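(* Let $(\mathcal{X},d)$ be a metric space on $n$ points accessed in the weak-strong oracle model, and let $z=\Theta(1)$. There exists an algorithm in the weak-strong oracle model that, with high probability, computes a $(k,\varepsilon)$-coreset for $(k,z)$-clustering of size $\tilde O(k^2/\varepsilon^3)$, using $\tilde O(k^2/\varepsilon^3)$ strong oracle point queries (or, alternatively, strong oracle distance queries), $\tilde O(nk)$ weak oracle queries, and $\tilde O(nk+k^2/\varepsilon^3)$ time.
   Context: Weak-strong oracle model: the metric $d$ on the $n$-point set $\mathcal{X}$ is not directly accessible. A weak oracle query $\mathrm{WO}(x,y)$ returns $d(x,y)$ exactly with probability $2/3$ and an arbitrary (possibly adversarial) value with probability $1/3$; this randomness is drawn exactly once per pair, so repeated queries give the same answer. A strong point query $\mathrm{SO}(x)$: once both $\mathrm{SO}(x)$ and $\mathrm{SO}(y)$ have been queried, $d(x,y)$ is revealed exactly. A strong distance query $\mathrm{SO}(x,y)$ reveals $d(x,y)$ exactly. Distances are integers and the aspect ratio is $\mathrm{poly}(n)$. $\tilde O(\cdot)$ hides $\mathrm{polylog}(n)$ factors and constants depending on $z$ (which may be $2^{O(z)}$); "with high probability" means with probability $1-1/\mathrm{poly}(n)$. For a weighted set $S$ with weights $w$ and centers $\mathcal{C}$, $\mathrm{cost}_z(\mathcal{C},S)=\sum_{x\in S}w(x)\min_{c\in\mathcal{C}}d(x,c)^z$ (unweighted means unit weights). A weighted subset $S\subseteq\mathcal{X}$ is a $(k,\varepsilon)$-coreset for $(k,z)$-clustering if $|\mathrm{cost}_z(\mathcal{C},S)-\mathrm{cost}_z(\mathcal{C},\mathcal{X})|\le\varepsilon\,\mathrm{cost}_z(\mathcal{C},\mathcal{X})$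 for all $\mathcal{C}\subseteq\mathcal{X}$ with $|\mathcal{C}|\le k$. *)

theory Defs
  imports "HOL-Probability.Probability"
begin

section \<open>Clustering cost and coresets\<close>

definition cost :: "('a \<Rightarrow> 'a \<Rightarrow> real) \<Rightarrow> real \<Rightarrow> 'a set \<Rightarrow> 'a set \<Rightarrow> ('a \<Rightarrow> real) \<Rightarrow> real" where
  "cost d z \<C> S w = (\<Sum>x\<in>S. w x * Min ((\<lambda>c. d x c powr z) ` \<C>))"

definition is_coreset ::
  "('a \<Rightarrow> 'a \<Rightarrow> real) \<Rightarrow> real \<Rightarrow> 'a set \<Rightarrow> nat \<Rightarrow> real \<Rightarrow> 'a set \<Rightarrow> ('a \<Rightarrow> real) \<Rightarrow> bool" where
  "is_coreset d z X k \<epsilon> S w \<longleftrightarrow>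
     S \<subseteq> X \<and> (\<forall>x\<in>S. 0 \<le> w x) \<and>
     (\<forall>\<C>. \<C> \<subseteq> X \<and> \<C> \<noteq> {} \<and> card \<C> \<le> k \<longrightarrow>
        \<bar>cost d z \<C> S w - cost d z \<C> X (\<lambda>_. 1)\<bar> \<le> \<epsilon> * cost d z \<C> X (\<lambda>_. 1))"

definition distances :: "('a \<Rightarrow> 'a \<Rightarrow> real) \<Rightarrow> 'a set \<Rightarrow> real set" where
  "distances d X = {d x y | x y. x \<in> X \<and> y \<in> X \<and> x \<noteq> y}"

definition aspect_ratio :: "('a \<Rightarrow> 'a \<Rightarrow> real) \<Rightarrow> 'a set \<Rightarrow> real" where
  "aspect_ratio d X = Max (distances d X) / Min (distances d X)"

section \<open>A randomized RAM with weak and strong oracles\<close>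

text \<open>
  Points are named by the numbers below \<open>n\<close>. The machine has a word memory, used for point names,
  counters and addresses, and a memory for real numbers, used for distances and weights; every
  instruction takes one unit of time. Real numbers support exact arithmetic and comparison, but
  there is no rounding instruction. Words must stay below a bound polynomial in \<open>n + k\<close>
  (that is, they have logarithmically many bits); exceeding it is a fault.
\<close>

datatype arith = Plus | Minus | Times | Divide

text \<open>
  Operands are memory locations. \<open>Reveal\<close> reads a distance between two points on which a strong point
  query has been made; it is not itself a query. \<open>RPow\<close> raises a number to the exponent \<open>z\<close> of the
  clustering problem. \<open>Rand a b\<close> draws uniformly from the numbers below the content of \<open>b\<close>.
  \<open>Emit a b\<close> outputs a point with a weight.
\<close>

datatype instr =
    WConst nat nat
  | WOp arith nat nat nat
  | WLoad nat nat
  | WStore nat nat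
  | WJumpLess nat nat nat
  | ROfWord nat nat
  | ROp arith nat nat nat
  | RPow nat nat
  | RLoad nat nat
  | RStore nat nat
  | RJumpLess nat nat nat
  | Rand nat nat
  | Weak nat nat nat
  | StrongPoint nat
  | Reveal nat nat nat
  | StrongDist nat nat nat
  | Emit nat nat
  | Halt

datatype event = WeakEv nat nat real | PointEv nat | DistEv nat nat

record config =
  pc :: nat
  wmem :: "nat \<Rightarrow> nat"
  rmem :: "nat \<Rightarrow> real"
  transcript :: "event list"
  emitted :: "(nat \<times> real) list"

fun nat_arith :: "arith \<Rightarrow> nat \<Rightarrow> nat \<Rightarrow> nat" where
  "nat_arith Plus x y = x + y"
| "nat_arith Minus x y = x - y"
| "nat_arith Times x y = x * y"
| "nat_arith Divide x y = x div y"

fun real_arith :: "arith \<Rightarrow> real \<Rightarrow> real \<Rightarrow> real" where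
  "real_arith Plus x y = x + y"
| "real_arith Minus x y = x - y"
| "real_arith Times x y = x * y"
| "real_arith Divide x y = x / y"

definition next_pc :: "config \<Rightarrow> config" where
  "next_pc s = s\<lparr>pc := Suc (pc s)\<rparr>"

definition jump_if :: "bool \<Rightarrow> nat \<Rightarrow> config \<Rightarrow> config" where
  "jump_if c l s = (if c then s\<lparr>pc := l\<rparr> else next_pc s)"

definition put_word :: "nat \<Rightarrow> nat \<Rightarrow> nat \<Rightarrow> config \<Rightarrow> config option" where
  "put_word W a v s = (if v < W then Some (next_pc (s\<lparr>wmem := (wmem s)(a := v)\<rparr>)) else None)"

definition put_real :: "nat \<Rightarrow> real \<Rightarrow> config \<Rightarrow> config" where
  "put_real a v s = next_pc (s\<lparr>rmem := (rmem s)(a := v)\<rparr>)"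

definition record_event :: "event \<Rightarrow> config \<Rightarrow> config" where
  "record_event e s = s\<lparr>transcript := transcript s @ [e]\<rparr>"

fun weak_answer :: "event list \<Rightarrow> nat \<Rightarrow> nat \<Rightarrow> real option" where
  "weak_answer [] x y = None"
| "weak_answer (WeakEv u v r # es) x y = (if {u, v} = {x, y} then Some r else weak_answer es x y)"
| "weak_answer (_ # es) x y = weak_answer es x y"

text \<open>
  The adversary picks the answer to a corrupted weak query knowing the transcript so far (and, since
  it may be chosen after the metric, all true distances). The coin of an unordered pair is tossed
  when the pair is first queried; later queries repeat the recorded answer.
\<close>

type_synonym adversary = "event list \<Rightarrow> nat \<Rightarrow> nat \<Rightarrow> real"

definition weak_oracle ::
  "(nat \<Rightarrow> nat \<Rightarrow> real) \<Rightarrow> adversary \<Rightarrow> event list \<Rightarrow> nat \<Rightarrow> nat \<Rightarrow> real pmf" where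
  "weak_oracle d adv es x y =
     (case weak_answer es x y of
        Some r \<Rightarrow> return_pmf r
      | None \<Rightarrow> map_pmf (\<lambda>exact. if exact then d x y else adv es x y) (bernoulli_pmf (2/3)))"

text \<open>The result \<open>None\<close> is a fault.\<close>

fun exec ::
  "nat \<Rightarrow> real \<Rightarrow> nat \<Rightarrow> (nat \<Rightarrow> nat \<Rightarrow> real) \<Rightarrow> adversary \<Rightarrow> config \<Rightarrow> instr \<Rightarrow> config option pmf"
where
  "exec W z n d adv s (WConst a v) = return_pmf (put_word W a v s)"
| "exec W z n d adv s (WOp f a b c) =
     return_pmf (put_word W a (nat_arith f (wmem s b) (wmem s c)) s)"
| "exec W z n d adv s (WLoad a b) = return_pmf (put_word W a (wmem s (wmem s b)) s)"
| "exec W z n d adv s (WStore a b) = return_pmf (put_word W (wmem s a) (wmem s b) s)"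
| "exec W z n d adv s (WJumpLess a b l) = return_pmf (Some (jump_if (wmem s a < wmem s b) l s))"
| "exec W z n d adv s (ROfWord a b) = return_pmf (Some (put_real a (real (wmem s b)) s))"
| "exec W z n d adv s (ROp f a b c) =
     return_pmf (Some (put_real a (real_arith f (rmem s b) (rmem s c)) s))"
| "exec W z n d adv s (RPow a b) = return_pmf (Some (put_real a (rmem s b powr z) s))"
| "exec W z n d adv s (RLoad a b) = return_pmf (Some (put_real a (rmem s (wmem s b)) s))"
| "exec W z n d adv s (RStore a b) = return_pmf (Some (put_real (wmem s a) (rmem s b) s))"
| "exec W z n d adv s (RJumpLess a b l) = return_pmf (Some (jump_if (rmem s a < rmem s b) l s))"
| "exec W z n d adv s (Rand a b) =
     (if wmem s b = 0 then return_pmf None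
      else map_pmf (\<lambda>v. put_word W a v s) (pmf_of_set {..<wmem s b}))"
| "exec W z n d adv s (Weak a b c) =
     (let x = wmem s b; y = wmem s c in
      if x < n \<and> y < n
      then map_pmf (\<lambda>r. Some (put_real a r (record_event (WeakEv x y r) s)))
             (weak_oracle d adv (transcript s) x y)
      else return_pmf None)"
| "exec W z n d adv s (StrongPoint a) =
     (let x = wmem s a in
      return_pmf (if x < n then Some (next_pc (record_event (PointEv x) s)) else None))"
| "exec W z n d adv s (Reveal a b c) =
     (let x = wmem s b; y = wmem s c in
      return_pmf (if PointEv x \<in> set (transcript s) \<and> PointEv y \<in> set (transcript s)
                  then Some (put_real a (d x y) s) else None))"
| "exec W z n d adv s (StrongDist a b c) =
     (let x = wmem s b; y = wmem s c in
      return_pmf (if x < n \<and> y < n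
                  then Some (put_real a (d x y) (record_event (DistEv x y) s)) else None))"
| "exec W z n d adv s (Emit a b) =
     return_pmf (Some (next_pc (s\<lparr>emitted := emitted s @ [(wmem s a, rmem s b)]\<rparr>)))"
| "exec W z n d adv s Halt = return_pmf (Some s)"

definition step ::
  "instr list \<Rightarrow> nat \<Rightarrow> real \<Rightarrow> nat \<Rightarrow> (nat \<Rightarrow> nat \<Rightarrow> real) \<Rightarrow> adversary \<Rightarrow> config \<Rightarrow> config option pmf"
where
  "step P W z n d adv s =
     (if pc s < length P then exec W z n d adv s (P ! pc s) else return_pmf None)"

definition init_config :: "nat \<Rightarrow> nat \<Rightarrow> real \<Rightarrow> config" where
  "init_config n k \<epsilon> =
     \<lparr>pc = 0, wmem = (\<lambda>_. 0)(0 := n, 1 := k), rmem = (\<lambda>_. 0)(0 := \<epsilon>), transcript = [], emitted = []\<rparr>"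

text \<open>
  The distribution of the outcome of \<open>t\<close> steps of program \<open>P\<close>. Words are bounded by
  \<open>(n + k + 1) ^ b\<close>, where the constant \<open>b\<close> belongs to the program.
\<close>

primrec run ::
  "instr list \<Rightarrow> nat \<Rightarrow> real \<Rightarrow> nat \<Rightarrow> nat \<Rightarrow> real \<Rightarrow> (nat \<Rightarrow> nat \<Rightarrow> real) \<Rightarrow> adversary \<Rightarrow> nat
     \<Rightarrow> config option pmf"
where
  "run P b z n k \<epsilon> d adv 0 = return_pmf (Some (init_config n k \<epsilon>))"
| "run P b z n k \<epsilon> d adv (Suc t) =
     bind_pmf (run P b z n k \<epsilon> d adv t)
       (\<lambda>r. case r of None \<Rightarrow> return_pmf None
                    | Some s \<Rightarrow> step P ((n + k + 1) ^ b) z n d adv s)"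

definition halted :: "instr list \<Rightarrow> config \<Rightarrow> bool" where
  "halted P s \<longleftrightarrow> pc s < length P \<and> P ! pc s = Halt"

definition weak_queries :: "config \<Rightarrow> nat" where
  "weak_queries s = length (filter (\<lambda>e. \<exists>x y r. e = WeakEv x y r) (transcript s))"

definition point_queries :: "config \<Rightarrow> nat" where
  "point_queries s = length (filter (\<lambda>e. \<exists>x. e = PointEv x) (transcript s))"

definition distance_queries :: "config \<Rightarrow> nat" where
  "distance_queries s = length (filter (\<lambda>e. \<exists>x y. e = DistEv x y) (transcript s))"

definition outputs_coreset ::
  "(nat \<Rightarrow> nat \<Rightarrow> real) \<Rightarrow> real \<Rightarrow> nat \<Rightarrow> nat \<Rightarrow> real \<Rightarrow> config \<Rightarrow> bool" where
  "outputs_coreset d z n k \<epsilon> s \<longleftrightarrow>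
     distinct (map fst (emitted s)) \<and>
     is_coreset d z {..<n} k \<epsilon> (fst ` set (emitted s)) (\<lambda>x. the (map_of (emitted s) x))"

text \<open>The strong queries an algorithm is allowed to make: only point or only distance queries.\<close>

datatype strong_kind = Point_Queries | Distance_Queries

fun strong_queries_within :: "strong_kind \<Rightarrow> real \<Rightarrow> config \<Rightarrow> bool" where
  "strong_queries_within Point_Queries q s \<longleftrightarrow>
     real (point_queries s) \<le> q \<and> distance_queries s = 0"
| "strong_queries_within Distance_Queries q s \<longleftrightarrow>
     real (distance_queries s) \<le> q \<and> point_queries s = 0"

text \<open>
  A quantity is soft-O of \<open>f\<close> if it is at most \<open>soft_bound C e n f\<close> for constants \<open>C\<close> and \<open>e\<close>.
  The shift by one keeps the logarithm positive for a single point.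
\<close>

definition soft_bound :: "real \<Rightarrow> nat \<Rightarrow> nat \<Rightarrow> real \<Rightarrow> real" where
  "soft_bound C e n f = C * f * log 2 (real n + 1) ^ e"

end

theory Submission
  imports Defs
begin

text \<open>
  The algorithm works in rounds on the set of points not yet clustered. Each round samples \<open>\<approx> k\<close> points
  uniformly, learns all distances inside the sample with strong queries, and assigns to every sample point
  the block of its nearest sample points. A majority vote over the weak answers from a point to a block
  estimates the distance of that point to the sample. The closer half of the remaining points is removed,
  every point joining the group of a nearby sample point; the other half continues, so there are
  logarithmically many rounds. In an optimal solution most of the remaining points belong to large
  clusters, which the sample hits often, and lie within a radius \<open>\<rho>\<close> determined by their average cost; so
  the closer half lies within \<open>O(\<rho>)\<close> of the sample and every group has diameter \<open>O(\<rho>)\<close>. As the average cost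
  of these points times the size of a group is at most the optimal cost, a point of a group \<open>G\<close> contributes at
  most an \<open>O(1 / card G)\<close> fraction of the cost of any \<open>k\<close> centers. Hence \<open>G\<close> can be sampled independently, each
  point with probability \<open>min 1 (m / card G)\<close> and inverse weight. An exponential moment bound for the cost of
  one set of centers and a union bound over all \<open>\<le> n ^ k\<close> sets give the coreset.

  The algorithm is written in a small language with arrays and bounded loops and compiled to the oracle
  machine; the loop bounds determine running time and query counts syntactically.
\<close>

section \<open>A structured language over the oracle machine\<close>

text \<open>The weak oracle tosses one coin per pair, so repeating a query cannot reduce its error.
  Instead, a sample point is replaced by \<open>ell\<close> sample points near it, whose answers
  vote. This is why the sample must hit every large cluster \<open>ell\<close> times and not just
  once: the block of a sample point in such a cluster then has radius at most twice the cluster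
  radius, and voting costs only a constant factor. The coins must also be fresh: a round asks about
  pairs of a remaining point and a new sample point, and sample points are never live again, so no
  pair recurs. The adversary is adaptive, so answers are not independent. Every tail bound is
  therefore a potential on stores whose expectation does not grow along a loop, which also composes
  with the program semantics. With a rate m of order k log n / \<epsilon>^2 and about k log n groups
  in each of about log n rounds, the output has about k^2 log^3 n / \<epsilon>^2 points, within the
  claimed size. The aspect ratio enters only through the number of halvings used to find the
  splitting radius.\<close>

datatype wexp = Const nat | Cell nat wexp | Arith arith wexp wexp
datatype rexp = RCell nat wexp | OfWord wexp | RArith arith rexp rexp
datatype guard = WLess wexp wexp | RLess rexp rexp

datatype com =
    Skip
  | WSet nat wexp wexp
  | RSet nat wexp rexp
  | Draw nat wexp
  | AskWeak nat wexp wexp wexp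
  | AskStrong nat wexp wexp wexp
  | Output wexp rexp
  | Seq com com (infixr ";;" 60)
  | Cond guard com com
  | For nat nat com

text \<open>Every variable is an array; the entry at index \<open>0\<close> serves as a scalar variable.\<close>

record store =
  words :: "nat \<Rightarrow> nat \<Rightarrow> nat"
  reals :: "nat \<Rightarrow> nat \<Rightarrow> real"
  events :: "event list"
  outs :: "(nat \<times> real) list"

abbreviation Var :: "nat \<Rightarrow> wexp" where "Var x \<equiv> Cell x (Const 0)"
abbreviation RVar :: "nat \<Rightarrow> rexp" where "RVar x \<equiv> RCell x (Const 0)"
abbreviation assign :: "nat \<Rightarrow> wexp \<Rightarrow> com" (infix "::=" 61) where "x ::= e \<equiv> WSet x (Const 0) e"
abbreviation rassign :: "nat \<Rightarrow> rexp \<Rightarrow> com" (infix "::=R" 61) where "x ::=R e \<equiv> RSet x (Const 0) e"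

primrec wval :: "store \<Rightarrow> wexp \<Rightarrow> nat" where
  "wval s (Const v) = v"
| "wval s (Cell x e) = words s x (wval s e)"
| "wval s (Arith f a b) = nat_arith f (wval s a) (wval s b)"

primrec rval :: "store \<Rightarrow> rexp \<Rightarrow> real" where
  "rval s (RCell x e) = reals s x (wval s e)"
| "rval s (OfWord e) = real (wval s e)"
| "rval s (RArith f a b) = real_arith f (rval s a) (rval s b)"

primrec gval :: "store \<Rightarrow> guard \<Rightarrow> bool" where
  "gval s (WLess a b) \<longleftrightarrow> wval s a < wval s b"
| "gval s (RLess a b) \<longleftrightarrow> rval s a < rval s b"

definition setw :: "nat \<Rightarrow> nat \<Rightarrow> nat \<Rightarrow> store \<Rightarrow> store" where
  "setw x i v s = s\<lparr>words := (words s)(x := (words s x)(i := v))\<rparr>"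

definition setr :: "nat \<Rightarrow> nat \<Rightarrow> real \<Rightarrow> store \<Rightarrow> store" where
  "setr x i v s = s\<lparr>reals := (reals s)(x := (reals s x)(i := v))\<rparr>"

definition log_events :: "event list \<Rightarrow> store \<Rightarrow> store" where
  "log_events es s = s\<lparr>events := events s @ es\<rparr>"

definition add_out :: "nat \<times> real \<Rightarrow> store \<Rightarrow> store" where
  "add_out p s = s\<lparr>outs := outs s @ [p]\<rparr>"

lemma store_updates [simp]:
  "words (setw x i v s) = (words s)(x := (words s x)(i := v))" "reals (setw x i v s) = reals s"
  "events (setw x i v s) = events s" "outs (setw x i v s) = outs s"
  "words (setr x i t s) = words s" "reals (setr x i t s) = (reals s)(x := (reals s x)(i := t))"
  "events (setr x i t s) = events s" "outs (setr x i t s) = outs s"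
  "words (log_events es s) = words s" "reals (log_events es s) = reals s"
  "events (log_events es s) = events s @ es" "outs (log_events es s) = outs s"
  "words (add_out p s) = words s" "reals (add_out p s) = reals s"
  "events (add_out p s) = events s" "outs (add_out p s) = outs s @ [p]"
  by (simp_all add: setw_def setr_def log_events_def add_out_def)

lemma setw_setw [simp]: "setw x i v (setw x i u s) = setw x i v s"
  by (simp add: setw_def)

lemma setw_same: "words s x i = v \<Longrightarrow> setw x i v s = s"
  by (auto simp: setw_def)

fun strong_events :: "strong_kind \<Rightarrow> nat \<Rightarrow> nat \<Rightarrow> event list" where
  "strong_events Point_Queries x y = [PointEv x, PointEv y]"
| "strong_events Distance_Queries x y = [DistEv x y]"

section \<open>Partial probabilistic computations\<close>

definition obind :: "'a option pmf \<Rightarrow> ('a \<Rightarrow> 'b option pmf) \<Rightarrow> 'b option pmf" where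
  "obind p f = bind_pmf p (\<lambda>r. case r of None \<Rightarrow> return_pmf None | Some s \<Rightarrow> f s)"

text \<open>A fault is charged infinity, so a finite upper bound on an expectation certifies at the
  same time that faults have probability zero.\<close>

definition oexp :: "'a option pmf \<Rightarrow> ('a \<Rightarrow> ennreal) \<Rightarrow> ennreal" where
  "oexp p Q = (\<integral>\<^sup>+r. (case r of None \<Rightarrow> \<infinity> | Some s \<Rightarrow> Q s) \<partial>measure_pmf p)"

definition osure :: "'a option pmf \<Rightarrow> ('a \<Rightarrow> bool) \<Rightarrow> bool" where
  "osure p Q \<longleftrightarrow> (\<forall>r\<in>set_pmf p. \<exists>s. r = Some s \<and> Q s)"

lemma oexp_return [simp]: "oexp (return_pmf (Some s)) Q = Q s" "oexp (return_pmf None) Q = \<infinity>"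
  by (simp_all add: oexp_def)

lemma osure_return [simp]: "osure (return_pmf (Some s)) Q \<longleftrightarrow> Q s" "\<not> osure (return_pmf None) Q"
  by (simp_all add: osure_def)

lemma obind_return [simp]: "obind (return_pmf (Some s)) f = f s" "obind (return_pmf None) f = return_pmf None"
  by (simp_all add: obind_def bind_return_pmf)

lemma oexp_obind: "oexp (obind p f) Q = oexp p (\<lambda>s. oexp (f s) Q)"
  unfolding oexp_def obind_def measure_pmf_bind
  by (subst nn_integral_bind[where B="count_space UNIV"])
     (auto intro!: nn_integral_cong simp: space_subprob_algebra measure_pmf.subprob_space_axioms oexp_def split: option.split)

lemma osure_obind: "osure (obind p f) Q \<longleftrightarrow> osure p (\<lambda>s. osure (f s) Q)"
proof -
  have "(\<exists>s. r = Some s \<and> (\<forall>q\<in>set_pmf (f s). \<exists>t. q = Some t \<and> Q t)) \<longleftrightarrow>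
     (\<forall>q\<in>set_pmf (case r of None \<Rightarrow> return_pmf None | Some s \<Rightarrow> f s). \<exists>t. q = Some t \<and> Q t)" for r
    by (cases r) auto
  then show ?thesis by (simp add: osure_def obind_def)
qed

lemma oexp_map: "oexp (map_pmf (\<lambda>x. Some (g x)) p) Q = (\<integral>\<^sup>+x. Q (g x) \<partial>measure_pmf p)"
  by (simp add: oexp_def)

lemma osure_map: "osure (map_pmf (\<lambda>x. Some (g x)) p) Q \<longleftrightarrow> (\<forall>x\<in>set_pmf p. Q (g x))"
  by (auto simp: osure_def)

lemma osure_mono: "osure p Q \<Longrightarrow> (\<And>s. Q s \<Longrightarrow> R s) \<Longrightarrow> osure p R"
  by (auto simp: osure_def)

lemma oexp_mono: "(\<And>s. Q s \<le> R s) \<Longrightarrow> oexp p Q \<le> oexp p R"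
  unfolding oexp_def by (intro nn_integral_mono) (auto split: option.split)

lemma oexp_mono_on: "osure p I \<Longrightarrow> (\<And>s. I s \<Longrightarrow> Q s \<le> R s) \<Longrightarrow> oexp p Q \<le> oexp p R"
  unfolding oexp_def osure_def
  by (intro nn_integral_mono_AE) (auto simp: AE_measure_pmf_iff split: option.split)

lemma oexp_cong_set:
  "(\<And>s. Some s \<in> set_pmf p \<Longrightarrow> Q s = R s) \<Longrightarrow> oexp p Q = oexp p R"
  unfolding oexp_def
  by (intro nn_integral_cong_AE) (auto simp: AE_measure_pmf_iff split: option.split)

lemma oexp_const: "osure p (\<lambda>_. True) \<Longrightarrow> oexp p (\<lambda>_. c) = c"
proof -
  assume "osure p (\<lambda>_. True)"
  then have "oexp p (\<lambda>_. c) = (\<integral>\<^sup>+r. c \<partial>measure_pmf p)"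
    unfolding oexp_def osure_def
    by (intro nn_integral_cong_AE) (auto simp: AE_measure_pmf_iff split: option.split)
  then show ?thesis by simp
qed

text \<open>Fault-freedom matters for the empty sum, where a fault would be worth infinity on the
  left and 0 on the right.\<close>

lemma oexp_sum: 
  assumes "finite T" "osure p (\<lambda>_. True)" shows "oexp p (\<lambda>s. \<Sum>t\<in>T. Q t s) = (\<Sum>t\<in>T. oexp p (Q t))"
proof -
  have "oexp p (\<lambda>s. \<Sum>t\<in>T. Q t s) = (\<integral>\<^sup>+r. (\<Sum>t\<in>T. case r of None \<Rightarrow> \<infinity> | Some s \<Rightarrow> Q t s) \<partial>measure_pmf p)"
    using assms(2) unfolding oexp_def osure_def
    by (intro nn_integral_cong_AE) (auto simp: AE_measure_pmf_iff split: option.split)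
  also have "\<dots> = (\<Sum>t\<in>T. oexp p (Q t))" by (simp add: nn_integral_sum oexp_def)
  finally show ?thesis .
qed

lemma oexp_add:
  assumes "osure p (\<lambda>_. True)" shows "oexp p (\<lambda>s. Q s + R s) = oexp p Q + oexp p R"
proof -
  have "oexp p (\<lambda>s. Q s + R s) = (\<integral>\<^sup>+r. (case r of None \<Rightarrow> \<infinity> | Some s \<Rightarrow> Q s) + (case r of None \<Rightarrow> \<infinity> | Some s \<Rightarrow> R s) \<partial>measure_pmf p)"
    using assms unfolding oexp_def osure_def
    by (intro nn_integral_cong_AE) (auto simp: AE_measure_pmf_iff split: option.split)
  also have "\<dots> = oexp p Q + oexp p R" by (simp add: nn_integral_add oexp_def)
  finally show ?thesis .
qed

lemma set_pmf_lessThan: "0 < v \<Longrightarrow> set_pmf (pmf_of_set {..<v::nat}) = {..<v}"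
  by (intro set_pmf_of_set) (auto simp: lessThan_empty_iff)

text \<open>The final assignment mirrors the machine, which leaves a loop only after incrementing
  the loop variable up to the bound.\<close>

primrec for_loop :: "(store \<Rightarrow> store option pmf) \<Rightarrow> nat \<Rightarrow> nat \<Rightarrow> nat \<Rightarrow> store \<Rightarrow> store option pmf" where
  "for_loop f x j 0 s = return_pmf (Some (setw x 0 j s))"
| "for_loop f x j (Suc m) s = obind (f (setw x 0 j s)) (for_loop f x (Suc j) m)"

text \<open>
  Assigned words are checked against \<open>B\<close>, and the number of iterations of a loop with bound
  variable \<open>y\<close> against \<open>env y\<close>; the latter makes running times and query counts syntactic.
\<close>

locale oracle_lang =
  fixes kind :: strong_kind and B :: nat and env :: "nat \<Rightarrow> nat"
    and n :: nat and d :: "nat \<Rightarrow> nat \<Rightarrow> real" and adv :: adversary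
begin

primrec sem :: "com \<Rightarrow> store \<Rightarrow> store option pmf" where
  "sem Skip s = return_pmf (Some s)"
| "sem (WSet x i e) s = return_pmf (if wval s e \<le> B then Some (setw x (wval s i) (wval s e) s) else None)"
| "sem (RSet x i e) s = return_pmf (Some (setr x (wval s i) (rval s e) s))"
| "sem (Draw x e) s =
     (if 0 < wval s e \<and> wval s e \<le> B
      then map_pmf (\<lambda>v. Some (setw x 0 v s)) (pmf_of_set {..<wval s e}) else return_pmf None)"
| "sem (AskWeak x i a b) s =
     (if wval s a < n \<and> wval s b < n
      then map_pmf (\<lambda>r. Some (setr x (wval s i) r (log_events [WeakEv (wval s a) (wval s b) r] s)))
             (weak_oracle d adv (events s) (wval s a) (wval s b))
      else return_pmf None)"
| "sem (AskStrong x i a b) s =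
     return_pmf (if wval s a < n \<and> wval s b < n
      then Some (setr x (wval s i) (d (wval s a) (wval s b))
              (log_events (strong_events kind (wval s a) (wval s b)) s))
      else None)"
| "sem (Output e r) s = return_pmf (Some (add_out (wval s e, rval s r) s))"
| "sem (Seq a b) s = obind (sem a s) (sem b)"
| "sem (Cond g a b) s = (if gval s g then sem a s else sem b s)"
| "sem (For x y c) s =
     (if words s y 0 \<le> env y then for_loop (sem c) x 0 (words s y 0) s else return_pmf None)"

definition expect :: "com \<Rightarrow> store \<Rightarrow> (store \<Rightarrow> ennreal) \<Rightarrow> ennreal" where
  "expect c s Q = oexp (sem c s) Q"

definition sure :: "com \<Rightarrow> store \<Rightarrow> (store \<Rightarrow> bool) \<Rightarrow> bool" where
  "sure c s Q \<longleftrightarrow> osure (sem c s) Q"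

lemma sure_simps [simp]:
  "sure Skip s Q \<longleftrightarrow> Q s"
  "sure (WSet x i e) s Q \<longleftrightarrow> wval s e \<le> B \<and> Q (setw x (wval s i) (wval s e) s)"
  "sure (RSet x i r) s Q \<longleftrightarrow> Q (setr x (wval s i) (rval s r) s)"
  "sure (Draw x e) s Q \<longleftrightarrow> 0 < wval s e \<and> wval s e \<le> B \<and> (\<forall>v<wval s e. Q (setw x 0 v s))"
  "sure (AskWeak x i e f) s Q \<longleftrightarrow> wval s e < n \<and> wval s f < n \<and>
     (\<forall>r\<in>set_pmf (weak_oracle d adv (events s) (wval s e) (wval s f)).
        Q (setr x (wval s i) r (log_events [WeakEv (wval s e) (wval s f) r] s)))"
  "sure (AskStrong x i e f) s Q \<longleftrightarrow> wval s e < n \<and> wval s f < n \<and>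
      Q (setr x (wval s i) (d (wval s e) (wval s f))
              (log_events (strong_events kind (wval s e) (wval s f)) s))"
  "sure (Output e r) s Q \<longleftrightarrow> Q (add_out (wval s e, rval s r) s)"
  "sure (Seq a b) s Q \<longleftrightarrow> sure a s (\<lambda>s'. sure b s' Q)"
  "sure (Cond g a b) s Q \<longleftrightarrow> (if gval s g then sure a s Q else sure b s Q)"
  by (auto simp: sure_def osure_obind osure_map set_pmf_lessThan)

lemma expect_simps [simp]:
  "expect Skip s Q = Q s"
  "expect (WSet x i e) s Q = (if wval s e \<le> B then Q (setw x (wval s i) (wval s e) s) else \<infinity>)"
  "expect (RSet x i r) s Q = Q (setr x (wval s i) (rval s r) s)"
  "expect (Draw x e) s Q = (if 0 < wval s e \<and> wval s e \<le> B
      then (\<integral>\<^sup>+v. Q (setw x 0 v s) \<partial>measure_pmf (pmf_of_set {..<wval s e})) else \<infinity>)"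
  "expect (AskWeak x i e f) s Q = (if wval s e < n \<and> wval s f < n then
     (\<integral>\<^sup>+r. Q (setr x (wval s i) r (log_events [WeakEv (wval s e) (wval s f) r] s))
       \<partial>measure_pmf (weak_oracle d adv (events s) (wval s e) (wval s f))) else \<infinity>)"
  "expect (AskStrong x i e f) s Q = (if wval s e < n \<and> wval s f < n then
      Q (setr x (wval s i) (d (wval s e) (wval s f))
              (log_events (strong_events kind (wval s e) (wval s f)) s)) else \<infinity>)"
  "expect (Output e r) s Q = Q (add_out (wval s e, rval s r) s)"
  "expect (Seq a b) s Q = expect a s (\<lambda>s'. expect b s' Q)"
  "expect (Cond g a b) s Q = (if gval s g then expect a s Q else expect b s Q)"
  by (auto simp: expect_def oexp_obind oexp_map)

lemma sure_mono: "sure c s Q \<Longrightarrow> (\<And>s'. Q s' \<Longrightarrow> R s') \<Longrightarrow> sure c s R"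
  unfolding sure_def by (rule osure_mono)

lemma expect_mono_on: "sure c s I \<Longrightarrow> (\<And>s'. I s' \<Longrightarrow> Q s' \<le> R s') \<Longrightarrow> expect c s Q \<le> expect c s R"
  unfolding sure_def expect_def by (rule oexp_mono_on)

text \<open>The invariant speaks of the store after the loop variable has been advanced, so one
  predicate serves at the head of the next iteration and at the exit.\<close>

lemma for_loop_sure:
  assumes "I j (setw x 0 j s)"
    and "\<And>i s. I i s \<Longrightarrow> j \<le> i \<Longrightarrow> i < j + m \<Longrightarrow> words s x 0 = i \<Longrightarrow> osure (f s) (\<lambda>s'. I (Suc i) (setw x 0 (Suc i) s'))"
    and "\<And>s. I (j + m) s \<Longrightarrow> words s x 0 = j + m \<Longrightarrow> Q s"
  shows "osure (for_loop f x j m s) Q"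
  using assms
proof (induction m arbitrary: j s)
  case 0 then show ?case by simp
next
  case (Suc m)
  have "osure (f (setw x 0 j s)) (\<lambda>s'. I (Suc j) (setw x 0 (Suc j) s'))"
    using Suc.prems(1) by (intro Suc.prems(2)) auto
  then show ?case
    by (auto simp: osure_obind intro!: Suc.IH Suc.prems elim!: osure_mono)
qed

lemma sure_For:
  assumes "words s y 0 = N" "N \<le> env y" "I 0 (setw x 0 0 s)"
    and "\<And>i s. I i s \<Longrightarrow> i < N \<Longrightarrow> words s x 0 = i \<Longrightarrow> sure c s (\<lambda>s'. I (Suc i) (setw x 0 (Suc i) s'))"
    and "\<And>s. I N s \<Longrightarrow> words s x 0 = N \<Longrightarrow> Q s"
  shows "sure (For x y c) s Q"
  using assms unfolding sure_def
  by (auto intro!: for_loop_sure[where I=I])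

text \<open>A supermartingale argument: the potential \<open>\<Phi>\<close> gains at most
  \<open>\<delta>\<close> in expectation per iteration. With \<open>\<delta> = 0\<close> it yields
  the exponential tail bounds, with a 0/1-valued \<open>\<Phi>\<close> a union bound over the
  iterations. The sure invariant \<open>I\<close> restricts the estimate for one iteration to stores
  that can occur.\<close>

lemma for_loop_expect:
  assumes "I j (setw x 0 j s)"
    and "\<And>i s. I i s \<Longrightarrow> j \<le> i \<Longrightarrow> i < j + m \<Longrightarrow> words s x 0 = i \<Longrightarrow> osure (f s) (\<lambda>s'. I (Suc i) (setw x 0 (Suc i) s'))"
    and "\<And>i s. I i s \<Longrightarrow> j \<le> i \<Longrightarrow> i < j + m \<Longrightarrow> words s x 0 = i \<Longrightarrow>
           oexp (f s) (\<lambda>s'. \<Phi> (Suc i) (setw x 0 (Suc i) s')) \<le> \<Phi> i s + \<delta>"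
    and "\<And>s. I (j + m) s \<Longrightarrow> words s x 0 = j + m \<Longrightarrow> Q s \<le> \<Phi> (j + m) s"
  shows "oexp (for_loop f x j m s) Q \<le> \<Phi> j (setw x 0 j s) + of_nat m * \<delta>"
  using assms
proof (induction m arbitrary: j s)
  case 0 then show ?case by simp
next
  case (Suc m)
  let ?s = "setw x 0 j s"
  have *: "osure (f ?s) (\<lambda>s'. I (Suc j) (setw x 0 (Suc j) s'))"
    using Suc.prems(1) by (intro Suc.prems(2)) auto
  then have T: "osure (f ?s) (\<lambda>_. True)" by (rule osure_mono) auto
  have "oexp (for_loop f x j (Suc m) s) Q = oexp (f ?s) (\<lambda>s'. oexp (for_loop f x (Suc j) m s') Q)"
    by (simp add: oexp_obind)
  also have "\<dots> \<le> oexp (f ?s) (\<lambda>s'. \<Phi> (Suc j) (setw x 0 (Suc j) s') + of_nat m * \<delta>)"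
    using * by (rule oexp_mono_on) (rule Suc.IH, auto intro: Suc.prems(2,3) Suc.prems(4)[simplified])
  also have "\<dots> = oexp (f ?s) (\<lambda>s'. \<Phi> (Suc j) (setw x 0 (Suc j) s')) + of_nat m * \<delta>"
    using T by (simp add: oexp_add oexp_const)
  also have "\<dots> \<le> (\<Phi> j ?s + \<delta>) + of_nat m * \<delta>"
    using Suc.prems(1) by (intro add_right_mono Suc.prems(3)) auto
  also have "\<dots> = \<Phi> j ?s + of_nat (Suc m) * \<delta>" by (simp add: algebra_simps)
  finally show ?case .
qed

lemma expect_For:
  assumes "words s y 0 = N" "N \<le> env y" "I 0 (setw x 0 0 s)"
    and "\<And>i s. I i s \<Longrightarrow> i < N \<Longrightarrow> words s x 0 = i \<Longrightarrow> sure c s (\<lambda>s'. I (Suc i) (setw x 0 (Suc i) s'))"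
    and "\<And>i s. I i s \<Longrightarrow> i < N \<Longrightarrow> words s x 0 = i \<Longrightarrow>
           expect c s (\<lambda>s'. \<Phi> (Suc i) (setw x 0 (Suc i) s')) \<le> \<Phi> i s + \<delta>"
    and "\<And>s. I N s \<Longrightarrow> words s x 0 = N \<Longrightarrow> Q s \<le> \<Phi> N s"
  shows "expect (For x y c) s Q \<le> \<Phi> 0 (setw x 0 0 s) + of_nat N * \<delta>"
  using assms for_loop_expect[where I=I and \<Phi>=\<Phi> and j=0 and m=N and f="sem c" and Q=Q and x=x and s=s and \<delta>=\<delta>]
  unfolding sure_def expect_def by simp

section \<open>Frame conditions\<close>

primrec wmods :: "com \<Rightarrow> nat set" where
  "wmods Skip = {}"
| "wmods (WSet x i e) = {x}"
| "wmods (RSet x i e) = {}"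
| "wmods (Draw x e) = {x}"
| "wmods (AskWeak x i a b) = {}"
| "wmods (AskStrong x i a b) = {}"
| "wmods (Output e r) = {}"
| "wmods (Seq a b) = wmods a \<union> wmods b"
| "wmods (Cond g a b) = wmods a \<union> wmods b"
| "wmods (For x y c) = insert x (wmods c)"

primrec rmods :: "com \<Rightarrow> nat set" where
  "rmods Skip = {}"
| "rmods (WSet x i e) = {}"
| "rmods (RSet x i e) = {x}"
| "rmods (Draw x e) = {}"
| "rmods (AskWeak x i a b) = {x}"
| "rmods (AskStrong x i a b) = {x}"
| "rmods (Output e r) = {}"
| "rmods (Seq a b) = rmods a \<union> rmods b"
| "rmods (Cond g a b) = rmods a \<union> rmods b"
| "rmods (For x y c) = rmods c"

definition frame :: "nat set \<Rightarrow> nat set \<Rightarrow> store \<Rightarrow> store \<Rightarrow> bool" where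
  "frame X Y s s' \<longleftrightarrow> (\<forall>x. x \<notin> X \<longrightarrow> words s' x = words s x) \<and> (\<forall>y. y \<notin> Y \<longrightarrow> reals s' y = reals s y)"

lemma frame_trans: "frame X Y s s' \<Longrightarrow> frame X Y s' s'' \<Longrightarrow> frame X Y s s''"
  by (simp add: frame_def)

lemma frame_mono: "frame X Y s s' \<Longrightarrow> X \<subseteq> X' \<Longrightarrow> Y \<subseteq> Y' \<Longrightarrow> frame X' Y' s s'"
  by (auto simp: frame_def)

lemma frame_for_loop:
  assumes "\<And>s s'. Some s' \<in> set_pmf (f s) \<Longrightarrow> frame X Y s s'" "x \<in> X"
  shows "Some s' \<in> set_pmf (for_loop f x j m s) \<Longrightarrow> frame X Y s s'"
proof (induction m arbitrary: j s)
  case 0 then show ?case using assms(2) by (auto simp: frame_def)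
next
  case (Suc m)
  then obtain t where "Some t \<in> set_pmf (f (setw x 0 j s))" "Some s' \<in> set_pmf (for_loop f x (Suc j) m t)"
    by (auto simp: obind_def split: option.splits)
  then have "frame X Y (setw x 0 j s) t" "frame X Y t s'"
    using assms Suc.IH by auto
  moreover have "frame X Y s (setw x 0 j s)" using assms(2) by (auto simp: frame_def)
  ultimately show ?case by (meson frame_trans)
qed

lemma sem_frame: "Some s' \<in> set_pmf (sem c s) \<Longrightarrow> frame (wmods c) (rmods c) s s'"
proof (induction c arbitrary: s s')
  case (Seq a b)
  then obtain t where "Some t \<in> set_pmf (sem a s)" "Some s' \<in> set_pmf (sem b t)"
    by (auto simp: obind_def split: option.splits)
  then show ?case using Seq.IH
    by (metis frame_mono frame_trans rmods.simps(8) sup.cobounded1 sup.cobounded2 wmods.simps(8))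
next
  case (Cond g a b)
  then have "frame (wmods a) (rmods a) s s' \<or> frame (wmods b) (rmods b) s s'"
    by (cases "gval s g") auto
  then show ?case by (auto simp: frame_def)
next
  case (For x y c)
  have "frame (insert x (wmods c)) (rmods c) s s'" if "Some s' \<in> set_pmf (sem c s)" for s s'
    using For.IH that by (auto intro: frame_mono)
  then show ?case using For.prems
    by (auto split: if_splits intro: frame_for_loop[where f="sem c"])
qed (auto simp: frame_def split: if_splits)

lemma sure_frame: "sure c s Q \<Longrightarrow> sure c s (\<lambda>s'. Q s' \<and> frame (wmods c) (rmods c) s s')"
  unfolding sure_def osure_def by (auto dest!: sem_frame bspec)

section \<open>Syntactic query counts\<close>

primrec weak_cost :: "com \<Rightarrow> nat" where
  "weak_cost Skip = 0"
| "weak_cost (WSet x i e) = 0"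
| "weak_cost (RSet x i e) = 0"
| "weak_cost (Draw x e) = 0"
| "weak_cost (AskWeak x i a b) = 1"
| "weak_cost (AskStrong x i a b) = 0"
| "weak_cost (Output e r) = 0"
| "weak_cost (Seq a b) = weak_cost a + weak_cost b"
| "weak_cost (Cond g a b) = weak_cost a + weak_cost b"
| "weak_cost (For x y c) = env y * weak_cost c"

text \<open>The charge of 2 covers both kinds of strong query: a distance costs two point queries or
  one distance query.\<close>

primrec strong_cost :: "com \<Rightarrow> nat" where
  "strong_cost Skip = 0"
| "strong_cost (WSet x i e) = 0"
| "strong_cost (RSet x i e) = 0"
| "strong_cost (Draw x e) = 0"
| "strong_cost (AskWeak x i a b) = 0"
| "strong_cost (AskStrong x i a b) = 2"
| "strong_cost (Output e r) = 0"
| "strong_cost (Seq a b) = strong_cost a + strong_cost b"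
| "strong_cost (Cond g a b) = strong_cost a + strong_cost b"
| "strong_cost (For x y c) = env y * strong_cost c"

definition weak_count :: "event list \<Rightarrow> nat" where
  "weak_count es = length (filter (\<lambda>e. \<exists>x y r. e = WeakEv x y r) es)"

definition point_count :: "event list \<Rightarrow> nat" where
  "point_count es = length (filter (\<lambda>e. \<exists>x. e = PointEv x) es)"

definition dist_count :: "event list \<Rightarrow> nat" where
  "dist_count es = length (filter (\<lambda>e. \<exists>x y. e = DistEv x y) es)"

text \<open>The count of the other kind must stay exactly the same, since the theorem forbids mixing
  the two kinds.\<close>

fun strong_within :: "strong_kind \<Rightarrow> nat \<Rightarrow> event list \<Rightarrow> event list \<Rightarrow> bool" where
  "strong_within Point_Queries q es es' \<longleftrightarrow> point_count es' \<le> point_count es + q \<and> dist_count es' = dist_count es"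
| "strong_within Distance_Queries q es es' \<longleftrightarrow> dist_count es' \<le> dist_count es + q \<and> point_count es' = point_count es"

definition queries_within :: "nat \<Rightarrow> nat \<Rightarrow> store \<Rightarrow> store \<Rightarrow> bool" where
  "queries_within p q s s' \<longleftrightarrow> weak_count (events s') \<le> weak_count (events s) + p \<and> strong_within kind q (events s) (events s')"

lemma queries_within_refl: "events s' = events s \<Longrightarrow> queries_within p q s s'"
  unfolding queries_within_def by (cases kind) auto

lemma queries_within_trans:
  "queries_within p q s s' \<Longrightarrow> queries_within p' q' s' s'' \<Longrightarrow> queries_within (p + p') (q + q') s s''"
  unfolding queries_within_def by (cases kind) auto

lemma queries_within_mono:
  "queries_within p q s s' \<Longrightarrow> p \<le> p' \<Longrightarrow> q \<le> q' \<Longrightarrow> queries_within p' q' s s'"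
  unfolding queries_within_def by (cases kind) auto

lemma queries_for_loop:
  assumes "\<And>s s'. Some s' \<in> set_pmf (f s) \<Longrightarrow> queries_within p q s s'"
  shows "Some s' \<in> set_pmf (for_loop f x j m s) \<Longrightarrow> queries_within (m * p) (m * q) s s'"
proof (induction m arbitrary: j s)
  case 0 then show ?case by (auto intro: queries_within_refl)
next
  case (Suc m)
  then obtain t where t: "Some t \<in> set_pmf (f (setw x 0 j s))" "Some s' \<in> set_pmf (for_loop f x (Suc j) m t)"
    by (auto simp: obind_def split: option.splits)
  have "queries_within 0 0 s (setw x 0 j s)" by (rule queries_within_refl) simp
  from queries_within_trans[OF this queries_within_trans[OF assms[OF t(1)] Suc.IH[OF t(2)]]]
  show ?case by (simp add: algebra_simps)
qed

lemma sem_queries: "Some s' \<in> set_pmf (sem c s) \<Longrightarrow> queries_within (weak_cost c) (strong_cost c) s s'"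
proof (induction c arbitrary: s s')
  case (Seq a b)
  then obtain t where "Some t \<in> set_pmf (sem a s)" "Some s' \<in> set_pmf (sem b t)"
    by (auto simp: obind_def split: option.splits)
  then show ?case using queries_within_trans[OF Seq.IH(1) Seq.IH(2)] by simp
next
  case (Cond g a b)
  then have "queries_within (weak_cost a) (strong_cost a) s s' \<or> queries_within (weak_cost b) (strong_cost b) s s'"
    by (cases "gval s g") auto
  then show ?case by (auto elim!: queries_within_mono)
next
  case (For x y c)
  have le: "words s y 0 \<le> env y" and "Some s' \<in> set_pmf (for_loop (sem c) x 0 (words s y 0) s)"
    using For.prems by (auto split: if_splits)
  then have "queries_within (words s y 0 * weak_cost c) (words s y 0 * strong_cost c) s s'"
    by (intro queries_for_loop[where f="sem c", OF For.IH])
  then show ?case using le by (auto elim!: queries_within_mono)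
next
  case (AskWeak x i a b)
  then obtain r where "events s' = events s @ [WeakEv (wval s a) (wval s b) r]"
    by (auto split: if_splits)
  then show ?case unfolding queries_within_def
    by (cases kind) (simp_all add: weak_count_def point_count_def dist_count_def)
next
  case (AskStrong x i a b)
  then have "events s' = events s @ strong_events kind (wval s a) (wval s b)"
    by (auto split: if_splits)
  then show ?case unfolding queries_within_def
    by (cases kind) (simp_all add: weak_count_def point_count_def dist_count_def)
qed (rule queries_within_refl, force split: if_splits)+

end

section \<open>Compilation to the machine\<close>

text \<open>
  Entry \<open>i\<close> of variable \<open>x < 40\<close> lives at address \<open>64 * i + x\<close>; the addresses from \<open>40\<close> to \<open>63\<close> hold
  the intermediate results of expressions.
\<close>

definition address :: "nat \<Rightarrow> nat \<Rightarrow> instr list" where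
  "address p x = [WConst (41 + p) 64, WOp Times (40 + p) (40 + p) (41 + p),
     WConst (41 + p) x, WOp Plus (40 + p) (40 + p) (41 + p)]"

text \<open>Registers form a stack: code at level \<open>p\<close> leaves its value at
  \<open>40 + p\<close> and never touches lower levels, so a left operand survives the evaluation of
  the right one.\<close>

primrec wcomp :: "nat \<Rightarrow> wexp \<Rightarrow> instr list" where
  "wcomp p (Const v) = [WConst (40 + p) v]"
| "wcomp p (Cell x e) = wcomp p e @ address p x @ [WLoad (40 + p) (40 + p)]"
| "wcomp p (Arith f a b) = wcomp p a @ wcomp (Suc p) b @ [WOp f (40 + p) (40 + p) (41 + p)]"

text \<open>Words and reals live in separate memories, so embedded word code may restart at level 0
  while the real stack stands at level \<open>p\<close>.\<close>

primrec rcomp :: "nat \<Rightarrow> rexp \<Rightarrow> instr list" where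
  "rcomp p (RCell x e) = wcomp 0 e @ address 0 x @ [RLoad (40 + p) 40]"
| "rcomp p (OfWord e) = wcomp 0 e @ [ROfWord (40 + p) 40]"
| "rcomp p (RArith f a b) = rcomp p a @ rcomp (Suc p) b @ [ROp f (40 + p) (40 + p) (41 + p)]"

primrec gcomp :: "guard \<Rightarrow> nat \<Rightarrow> instr list" where
  "gcomp (WLess a b) l = wcomp 0 a @ wcomp 1 b @ [WJumpLess 40 41 l]"
| "gcomp (RLess a b) l = rcomp 0 a @ rcomp 1 b @ [RJumpLess 40 41 l]"

definition goto :: "nat \<Rightarrow> instr list" where
  "goto l = [WConst 40 0, WConst 41 1, WJumpLess 40 41 l]"

fun strong_code :: "strong_kind \<Rightarrow> instr list" where
  "strong_code Point_Queries = [StrongPoint 40, StrongPoint 41, Reveal 40 40 41]"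
| "strong_code Distance_Queries = [StrongDist 40 40 41]"

definition set_code :: "nat \<Rightarrow> wexp \<Rightarrow> wexp \<Rightarrow> instr list" where
  "set_code x i e = wcomp 0 e @ wcomp 1 i @ address 1 x @ [WStore 41 40]"

definition rstore_code :: "nat \<Rightarrow> wexp \<Rightarrow> instr list" where
  "rstore_code x i = wcomp 0 i @ address 0 x @ [RStore 40 40]"

definition incr_code :: "nat \<Rightarrow> instr list" where
  "incr_code x = set_code x (Const 0) (Arith Plus (Var x) (Const 1))"

definition glen :: "guard \<Rightarrow> nat" where
  "glen g = length (gcomp g 0)"

lemma length_gcomp [simp]: "length (gcomp g l) = glen g"
  by (cases g) (simp_all add: glen_def)

text \<open>Lengths are defined apart from \<open>compile\<close>, because \<open>compile\<close>
  itself needs them to compute forward jump targets.\<close>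

primrec clen :: "strong_kind \<Rightarrow> com \<Rightarrow> nat" where
  "clen knd Skip = 0"
| "clen knd (WSet x i e) = length (set_code x i e)"
| "clen knd (RSet x i e) = length (rcomp 0 e @ rstore_code x i)"
| "clen knd (Draw x e) = length (wcomp 0 e @ [Rand 40 40] @ wcomp 1 (Const 0) @ address 1 x @ [WStore 41 40])"
| "clen knd (AskWeak x i a b) = length (wcomp 0 a @ wcomp 1 b @ [Weak 40 40 41] @ rstore_code x i)"
| "clen knd (AskStrong x i a b) = length (wcomp 0 a @ wcomp 1 b @ strong_code knd @ rstore_code x i)"
| "clen knd (Output e r) = length (rcomp 0 r @ wcomp 0 e @ [Emit 40 40])"
| "clen knd (Seq a b) = clen knd a + clen knd b"
| "clen knd (Cond g a b) = glen g + clen knd b + 3 + clen knd a"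
| "clen knd (For x y c) = length (set_code x (Const 0) (Const 0)) + glen (WLess (Var x) (Var y)) + 3 +
     clen knd c + length (incr_code x) + 3"

primrec compile :: "strong_kind \<Rightarrow> nat \<Rightarrow> com \<Rightarrow> instr list" where
  "compile knd l Skip = []"
| "compile knd l (WSet x i e) = set_code x i e"
| "compile knd l (RSet x i e) = rcomp 0 e @ rstore_code x i"
| "compile knd l (Draw x e) = wcomp 0 e @ [Rand 40 40] @ wcomp 1 (Const 0) @ address 1 x @ [WStore 41 40]"
| "compile knd l (AskWeak x i a b) = wcomp 0 a @ wcomp 1 b @ [Weak 40 40 41] @ rstore_code x i"
| "compile knd l (AskStrong x i a b) = wcomp 0 a @ wcomp 1 b @ strong_code knd @ rstore_code x i"
| "compile knd l (Output e r) = rcomp 0 r @ wcomp 0 e @ [Emit 40 40]"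
| "compile knd l (Seq a b) = compile knd l a @ compile knd (l + clen knd a) b"
| "compile knd l (Cond g a b) = 
     gcomp g (l + glen g + clen knd b + 3) @ compile knd (l + glen g) b @
     goto (l + glen g + clen knd b + 3 + clen knd a) @ compile knd (l + glen g + clen knd b + 3) a"
| "compile knd l (For x y c) =
     (let l1 = l + length (set_code x (Const 0) (Const 0));
          l2 = l1 + glen (WLess (Var x) (Var y)) + 3;
          l3 = l2 + clen knd c + length (incr_code x) + 3
      in set_code x (Const 0) (Const 0) @ gcomp (WLess (Var x) (Var y)) l2 @ goto l3 @
         compile knd l2 c @ incr_code x @ goto l1)"

lemma length_address [simp]: "length (address p x) = 4"
  by (simp add: address_def)

lemma length_goto [simp]: "length (goto l) = 3"
  by (simp add: goto_def)

lemma length_compile [simp]: "length (compile knd l c) = clen knd c"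
  by (induction c arbitrary: l) (simp_all add: Let_def del: gcomp.simps)

definition code_at :: "instr list \<Rightarrow> nat \<Rightarrow> instr list \<Rightarrow> bool" where
  "code_at P l is \<longleftrightarrow> (\<exists>pre post. P = pre @ is @ post \<and> length pre = l)"

lemma code_at_append: "code_at P l (a @ b) \<Longrightarrow> code_at P l a \<and> code_at P (l + length a) b"
  unfolding code_at_def by (metis append.assoc length_append)

lemma code_at_Cons: "code_at P l (i # is) \<Longrightarrow> l < length P \<and> P ! l = i \<and> code_at P (Suc l) is"
proof -
  assume *: "code_at P l (i # is)"
  then have "code_at P (l + length [i]) is" using code_at_append[of P l "[i]" "is"] by simp
  then show ?thesis using * by (auto simp: code_at_def)
qed

text \<open>Stored words are at most \<open>B\<close>, but intermediate results need not be. An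
  expression of degree i stays below \<open>B ^ i\<close>; an array access has degree 1 whatever its
  index, because its content was checked when it was stored.\<close>

primrec degree_bound :: "wexp \<Rightarrow> nat" where
  "degree_bound (Const v) = 1"
| "degree_bound (Cell x e) = 1"
| "degree_bound (Arith f a b) = degree_bound a + degree_bound b"

lemma degree_bound_pos: "1 \<le> degree_bound e"
  by (induction e) auto

definition abs_store :: "config \<Rightarrow> store" where
  "abs_store s = \<lparr>words = (\<lambda>x i. if x < 40 then wmem s (64 * i + x) else 0),
     reals = (\<lambda>x i. if x < 40 then rmem s (64 * i + x) else 0),
     events = transcript s, outs = emitted s\<rparr>"

definition same_mem :: "nat \<Rightarrow> config \<Rightarrow> config \<Rightarrow> bool" where
  "same_mem p s s' \<longleftrightarrow> (\<forall>a. a \<notin> {40 + p..<64} \<longrightarrow> wmem s' a = wmem s a) \<and> rmem s' = rmem s \<and>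
     transcript s' = transcript s \<and> emitted s' = emitted s"

text \<open>Real expressions restart word evaluation at level 0, so all word registers may change,
  whereas real registers below level \<open>p\<close> persist.\<close>

definition same_rmem :: "nat \<Rightarrow> config \<Rightarrow> config \<Rightarrow> bool" where
  "same_rmem p s s' \<longleftrightarrow> (\<forall>a. a \<notin> {40..<64} \<longrightarrow> wmem s' a = wmem s a) \<and>
     (\<forall>a. a \<notin> {40 + p..<64} \<longrightarrow> rmem s' a = rmem s a) \<and>
     transcript s' = transcript s \<and> emitted s' = emitted s"

lemma variable_address: "x < 40 \<Longrightarrow> 64 * i + x \<notin> {40 + p..<64::nat}"
  by (cases i) auto

lemma same_mem_trans: "same_mem p s s' \<Longrightarrow> same_mem p' s' s'' \<Longrightarrow> p \<le> p' \<Longrightarrow> same_mem p s s''"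
  by (auto simp: same_mem_def)

lemma same_rmem_trans: "same_rmem p s s' \<Longrightarrow> same_rmem p' s' s'' \<Longrightarrow> p \<le> p' \<Longrightarrow> same_rmem p s s''"
  by (auto simp: same_rmem_def)

lemma same_mem_rmem: "same_mem p s s' \<Longrightarrow> same_rmem p' s s'"
  by (auto simp: same_mem_def same_rmem_def)

lemma abs_same_rmem: "same_rmem p s s' \<Longrightarrow> abs_store s' = abs_store s"
proof -
  assume *: "same_rmem p s s'"
  have "wmem s' (64 * i + x) = wmem s (64 * i + x)" "rmem s' (64 * i + x) = rmem s (64 * i + x)"
    if "x < 40" for x i
    using * variable_address[OF that, of i 0] variable_address[OF that, of i p]
    unfolding same_rmem_def by simp_all
  then show ?thesis using * by (auto simp: abs_store_def same_rmem_def intro!: ext)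
qed

lemma abs_same_mem: "same_mem p s s' \<Longrightarrow> abs_store s' = abs_store s"
  using abs_same_rmem same_mem_rmem by blast

lemma variable_address_inj:
  assumes "x < 40" "y < 40" shows "64 * j + y = 64 * i + x \<longleftrightarrow> j = i \<and> y = (x::nat)"
proof
  assume eq: "64 * j + y = 64 * i + x"
  have "j = (64 * j + y) div 64" using assms by simp
  also have "\<dots> = i" using eq assms by simp
  finally show "j = i \<and> y = x" using eq by simp
qed simp

lemma abs_setw:
  assumes "x < 40" "wmem s' = (wmem s)(64 * i + x := v)" "rmem s' = rmem s"
    "transcript s' = transcript s" "emitted s' = emitted s"
  shows "abs_store s' = setw x i v (abs_store s)"
  using assms variable_address_inj[OF assms(1)]
  by (auto simp: abs_store_def setw_def fun_eq_iff)

lemma abs_setr: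
  assumes "x < 40" "rmem s' = (rmem s)(64 * i + x := v)" "wmem s' = wmem s"
    "transcript s' = transcript s" "emitted s' = emitted s"
  shows "abs_store s' = setr x i v (abs_store s)"
  using assms variable_address_inj[OF assms(1)]
  by (auto simp: abs_store_def setr_def fun_eq_iff)

section \<open>Machine runs and their values under free stopping\<close>

primrec nsteps :: "(config \<Rightarrow> config option pmf) \<Rightarrow> nat \<Rightarrow> config \<Rightarrow> config option pmf" where
  "nsteps f 0 s = return_pmf (Some s)"
| "nsteps f (Suc t) s = obind (f s) (nsteps f t)"

lemma obind_assoc: "obind (obind p f) g = obind p (\<lambda>s. obind (f s) g)"
  unfolding obind_def bind_assoc_pmf
  by (rule bind_pmf_cong) (auto simp: bind_return_pmf split: option.split)

lemma obind_some:
  fixes p :: "'a option pmf"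
  shows "obind p (\<lambda>s. return_pmf (Some s)) = p"
proof -
  have "(\<lambda>r. case r of None \<Rightarrow> return_pmf None | Some s \<Rightarrow> return_pmf (Some s)) = (return_pmf :: 'a option \<Rightarrow> _)"
    by (auto split: option.split)
  then show ?thesis by (simp add: obind_def bind_return_pmf')
qed

text \<open>\<open>run\<close> adds steps at the end, whereas compiler correctness peels them off at
  the front.\<close>

lemma nsteps_Suc_right: "nsteps f (Suc t) s = obind (nsteps f t s) f"
proof (induction t arbitrary: s)
  case 0
  have "nsteps f 0 = (\<lambda>s. return_pmf (Some s))" by auto
  then show ?case by (simp add: obind_some)
next
  case (Suc t)
  have "nsteps f (Suc (Suc t)) s = obind (f s) (nsteps f (Suc t))" by (rule nsteps.simps)
  also have "nsteps f (Suc t) = (\<lambda>s. obind (nsteps f t s) f)" using Suc.IH by blast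
  finally show ?case by (simp add: obind_assoc)
qed

lemma run_nsteps:
  "run P b z n k \<epsilon> d adv t = nsteps (step P ((n + k + 1) ^ b) z n d adv) t (init_config n k \<epsilon>)"
proof (induction t)
  case (Suc t) then show ?case
    by (simp only: nsteps_Suc_right run.simps obind_def)
qed simp

lemma sum_le_prod_nat: "2 \<le> (x::nat) \<Longrightarrow> 2 \<le> y \<Longrightarrow> x + y \<le> x * y"
proof -
  assume "2 \<le> x" "2 \<le> y"
  then obtain a b where "x = 2 + a" "y = 2 + b" by (metis le_Suc_ex)
  then show ?thesis by (simp add: algebra_simps)
qed

locale oracle_compiler = oracle_lang +
  fixes P :: "instr list" and W :: nat and z :: real
  assumes B_ge: "64 \<le> B" and W_gt: "B ^ 10 < W" and env_le: "\<And>y. env y \<le> B"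
begin

abbreviation "mstep \<equiv> step P W z n d adv"

text \<open>
  The least expected value of \<open>Q\<close> that can be attained by stopping the machine after at most \<open>t\<close> steps;
  a fault counts as \<open>\<infinity>\<close>. Stopping freely absorbs the different lengths of the execution paths.
\<close>

primrec stopval :: "nat \<Rightarrow> (config \<Rightarrow> ennreal) \<Rightarrow> config \<Rightarrow> ennreal" where
  "stopval 0 Q s = Q s"
| "stopval (Suc t) Q s = min (Q s) (oexp (mstep s) (stopval t Q))"

lemma stopval_mono: "(\<And>s. Q s \<le> Q' s) \<Longrightarrow> stopval t Q s \<le> stopval t Q' s"
proof (induction t arbitrary: s)
  case (Suc t)
  show ?case unfolding stopval.simps by (intro min.mono oexp_mono Suc.IH Suc.prems)
qed simp

lemma stopval_Suc_le: "stopval (Suc t) Q s \<le> stopval t Q s"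
proof (induction t arbitrary: s)
  case (Suc t)
  have "min (Q s) (oexp (mstep s) (stopval (Suc t) Q)) \<le> min (Q s) (oexp (mstep s) (stopval t Q))"
    by (intro min.mono oexp_mono Suc.IH order_refl)
  then show ?case by simp
qed simp

lemma stopval_antimono: "t \<le> t' \<Longrightarrow> stopval t' Q s \<le> stopval t Q s"
  using lift_Suc_antimono_le[of "\<lambda>t. stopval t Q s"] stopval_Suc_le by blast

text \<open>Stopping after a first phase and again after a second is one particular way of stopping
  within the total time. This is the rule for sequential composition in the compiler proof.\<close>

lemma stopval_add: "stopval (a + b) Q s \<le> stopval a (stopval b Q) s"
proof (induction a arbitrary: s)
  case (Suc a)
  have "stopval (Suc a + b) Q s \<le> oexp (mstep s) (stopval a (stopval b Q))"
    using oexp_mono[of "stopval (a + b) Q" "stopval a (stopval b Q)"] Suc.IH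
    by (simp add: min.coboundedI2)
  moreover have "stopval (Suc a + b) Q s \<le> stopval b Q s" by (rule stopval_antimono) simp
  ultimately show ?case by simp
qed simp

lemma stopval_step: "stopval (Suc t) Q s \<le> oexp (mstep s) (stopval t Q)"
  by simp

text \<open>A deterministic run from \<open>s\<close> to \<open>s'\<close>, expressed through
  \<open>stopval\<close> so that deterministic and random code compose in one calculus.\<close>

definition det :: "nat \<Rightarrow> config \<Rightarrow> config \<Rightarrow> bool" where
  "det t s s' \<longleftrightarrow> (\<forall>Q. stopval t Q s \<le> Q s')"

lemma det_stopval: "det t s s' \<Longrightarrow> stopval (t + b) Q s \<le> stopval b Q s'"
  using stopval_add order_trans unfolding det_def by blast

lemma det_trans: "det t s s' \<Longrightarrow> det t' s' s'' \<Longrightarrow> det (t + t') s s''"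
  using det_stopval order_trans unfolding det_def by blast

lemma det_instr:
  assumes "code_at P (pc s) [i]" "exec W z n d adv s i = return_pmf (Some s')"
  shows "det (Suc 0) s s'"
  unfolding det_def
proof
  fix Q
  have "mstep s = return_pmf (Some s')"
    using assms(2) code_at_Cons[OF assms(1)] by (simp add: step_def)
  then show "stopval (Suc 0) Q s \<le> Q s'" by simp
qed

section \<open>Correctness of compiled expressions\<close>

definition small :: "store \<Rightarrow> bool" where
  "small s \<longleftrightarrow> (\<forall>x i. words s x i \<le> B)"

text \<open>The depth limit 23 keeps the registers \<open>40 + p\<close> and \<open>41 + p\<close>
  inside the scratch area. Indices have degree at most 8, so that the address
  \<open>64 * v + x\<close> still has degree 10.\<close>

primrec wfx :: "nat \<Rightarrow> wexp \<Rightarrow> bool" where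
  "wfx p (Const v) \<longleftrightarrow> p < 23 \<and> v \<le> B"
| "wfx p (Cell x e) \<longleftrightarrow> x < 40 \<and> wfx p e \<and> degree_bound e \<le> 8"
| "wfx p (Arith f a b) \<longleftrightarrow> wfx p a \<and> wfx (Suc p) b \<and> degree_bound a + degree_bound b \<le> 10"

primrec wfr :: "nat \<Rightarrow> rexp \<Rightarrow> bool" where
  "wfr p (RCell x e) \<longleftrightarrow> p < 23 \<and> x < 40 \<and> wfx 0 e \<and> degree_bound e \<le> 8"
| "wfr p (OfWord e) \<longleftrightarrow> p < 23 \<and> wfx 0 e"
| "wfr p (RArith f a b) \<longleftrightarrow> wfr p a \<and> wfr (Suc p) b"

primrec wfg :: "guard \<Rightarrow> bool" where
  "wfg (WLess a b) \<longleftrightarrow> wfx 0 a \<and> wfx 1 b"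
| "wfg (RLess a b) \<longleftrightarrow> wfr 0 a \<and> wfr 1 b"

primrec wfc :: "com \<Rightarrow> bool" where
  "wfc Skip \<longleftrightarrow> True"
| "wfc (WSet x i e) \<longleftrightarrow> x < 40 \<and> wfx 0 e \<and> wfx 1 i \<and> degree_bound i \<le> 8"
| "wfc (RSet x i e) \<longleftrightarrow> x < 40 \<and> wfr 0 e \<and> wfx 0 i \<and> degree_bound i \<le> 8"
| "wfc (Draw x e) \<longleftrightarrow> x < 40 \<and> wfx 0 e"
| "wfc (AskWeak x i a b) \<longleftrightarrow> x < 40 \<and> wfx 0 a \<and> wfx 1 b \<and> wfx 0 i \<and> degree_bound i \<le> 8"
| "wfc (AskStrong x i a b) \<longleftrightarrow> x < 40 \<and> wfx 0 a \<and> wfx 1 b \<and> wfx 0 i \<and> degree_bound i \<le> 8"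
| "wfc (Output e r) \<longleftrightarrow> wfx 0 e \<and> wfr 0 r"
| "wfc (Seq a b) \<longleftrightarrow> wfc a \<and> wfc b"
| "wfc (Cond g a b) \<longleftrightarrow> wfg g \<and> wfc a \<and> wfc b"
| "wfc (For x y c) \<longleftrightarrow> x < 40 \<and> y < 40 \<and> x \<noteq> y \<and> x \<notin> wmods c \<and> y \<notin> wmods c \<and> wfc c"

lemma wfx_depth: "wfx p e \<Longrightarrow> p < 23"
  by (induction e arbitrary: p) auto

lemma wfr_depth: "wfr p e \<Longrightarrow> p < 23"
  by (induction e arbitrary: p) auto

lemma wfx_degree: "wfx p e \<Longrightarrow> degree_bound e \<le> 10"
  by (cases e) auto

text \<open>Both bounds are at least 2, so a sum is dominated by the product and a single degree
  count serves all four operations.\<close>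

lemma wval_bound: "wfx p e \<Longrightarrow> small s \<Longrightarrow> wval s e \<le> B ^ degree_bound e"
proof (induction e arbitrary: p)
  case (Arith f a b)
  let ?x = "B ^ degree_bound a" and ?y = "B ^ degree_bound b"
  have ge: "2 \<le> B ^ degree_bound e" for e
    using B_ge self_le_power[of B "degree_bound e"] degree_bound_pos[of e] by simp
  have a: "wval s a \<le> ?x" and b: "wval s b \<le> ?y" using Arith by auto
  have "nat_arith f (wval s a) (wval s b) \<le> ?x * ?y"
  proof (cases f)
    case Plus then show ?thesis using a b sum_le_prod_nat[OF ge ge, of a b] by simp
  next
    case Minus
    have "wval s a - wval s b \<le> ?x" using a by simp
    also have "\<dots> \<le> ?x * ?y" using ge[of b] by simp
    finally show ?thesis using Minus by simp
  next
    case Times then show ?thesis using a b by (simp add: mult_le_mono)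
  next
    case Divide
    have "wval s a div wval s b \<le> ?x" using a div_le_dividend le_trans by blast
    also have "\<dots> \<le> ?x * ?y" using ge[of b] by simp
    finally show ?thesis using Divide by simp
  qed
  then show ?case by (simp add: power_add)
qed (auto simp: small_def)

lemma power_less_W: "x \<le> B ^ i \<Longrightarrow> i \<le> 10 \<Longrightarrow> x < W"
  using W_gt power_increasing[of i 10 B] B_ge by (meson le_less_trans le_trans numeral_le_iff one_le_numeral)

lemma less_W: "x \<le> B \<Longrightarrow> x < W"
  using power_less_W[of x 1] by simp

lemma wval_less_W: "wfx p e \<Longrightarrow> small s \<Longrightarrow> wval s e < W"
  using wval_bound wfx_degree power_less_W by blast

text \<open>Since 64 and \<open>x\<close> are at most \<open>B\<close>, forming the address costs
  two degrees.\<close>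

lemma address_less_W:
  assumes "v \<le> B ^ g" "g \<le> 8" "x < 64" shows "64 * v + x < W" "v * 64 < W"
proof -
  have "64 * v + x \<le> B * B ^ g + B" using assms B_ge by (intro add_mono mult_mono) auto
  also have "\<dots> \<le> B ^ Suc g * B"
  proof -
    have "2 \<le> B ^ Suc g" using B_ge self_le_power[of B "Suc g"] by linarith
    then show ?thesis using sum_le_prod_nat[of "B ^ Suc g" B] B_ge by simp
  qed
  also have "\<dots> = B ^ (g + 2)" by simp
  finally show "64 * v + x < W" using assms(2) by (intro power_less_W[of _ "g + 2"]) auto
  then show "v * 64 < W" by simp
qed

lemma address_correct:
  assumes code: "code_at P (pc s) (address p x)" and "p < 23" "x < 64"
    and v: "64 * wmem s (40 + p) + x < W"
  shows "\<exists>s'. det 4 s s' \<and> pc s' = pc s + 4 \<and> wmem s' (40 + p) = 64 * wmem s (40 + p) + x \<and> same_mem p s s'"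
proof -
  have c1: "code_at P (pc s) [WConst (41 + p) 64]" "code_at P (Suc (pc s)) [WOp Times (40 + p) (40 + p) (41 + p)]"
    "code_at P (Suc (Suc (pc s))) [WConst (41 + p) x]" "code_at P (Suc (Suc (Suc (pc s)))) [WOp Plus (40 + p) (40 + p) (41 + p)]"
    using code code_at_append[of P "pc s" "[WConst (41 + p) 64]" "[WOp Times (40 + p) (40 + p) (41 + p), WConst (41 + p) x, WOp Plus (40 + p) (40 + p) (41 + p)]"]
      code_at_append[of P "Suc (pc s)" "[WOp Times (40 + p) (40 + p) (41 + p)]" "[WConst (41 + p) x, WOp Plus (40 + p) (40 + p) (41 + p)]"]
      code_at_append[of P "Suc (Suc (pc s))" "[WConst (41 + p) x]" "[WOp Plus (40 + p) (40 + p) (41 + p)]"]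
    by (auto simp: address_def)
  let ?v = "wmem s (40 + p)"
  define s1 where "s1 = next_pc (s\<lparr>wmem := (wmem s)(41 + p := 64)\<rparr>)"
  define s2 where "s2 = next_pc (s1\<lparr>wmem := (wmem s1)(40 + p := ?v * 64)\<rparr>)"
  define s3 where "s3 = next_pc (s2\<lparr>wmem := (wmem s2)(41 + p := x)\<rparr>)"
  define s4 where "s4 = next_pc (s3\<lparr>wmem := (wmem s3)(40 + p := ?v * 64 + x)\<rparr>)"
  note defs = s1_def s2_def s3_def s4_def next_pc_def
  have W: "64 < W" "x < W" using less_W[of 64] B_ge assms(3) by auto
  have "det (Suc 0) s s1" using c1(1) W by (intro det_instr) (auto simp: put_word_def defs)
  moreover have "det (Suc 0) s1 s2" using c1(2) v by (intro det_instr) (auto simp: put_word_def defs)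
  moreover have "det (Suc 0) s2 s3" using c1(3) W by (intro det_instr) (auto simp: put_word_def defs)
  moreover have "det (Suc 0) s3 s4" using c1(4) v by (intro det_instr) (auto simp: put_word_def defs)
  ultimately have "det (Suc 0 + Suc 0 + Suc 0 + Suc 0) s s4" using det_trans by blast
  then have "det 4 s s4" by (simp add: eval_nat_numeral)
  then show ?thesis using assms(2)
    by (intro exI[of _ s4]) (auto simp: defs same_mem_def)
qed

lemma wcomp_correct:
  assumes "code_at P (pc s) (wcomp p e)" "wfx p e" "small (abs_store s)"
  shows "\<exists>s'. det (length (wcomp p e)) s s' \<and> pc s' = pc s + length (wcomp p e) \<and>
     wmem s' (40 + p) = wval (abs_store s) e \<and> same_mem p s s'"
  using assms
proof (induction e arbitrary: p s)
  case (Const v)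
  define s1 where "s1 = next_pc (s\<lparr>wmem := (wmem s)(40 + p := v)\<rparr>)"
  have "det (Suc 0) s s1" using Const less_W[of v] 
    by (intro det_instr) (auto simp: put_word_def s1_def)
  then show ?case using Const
    by (intro exI[of _ s1]) (auto simp: s1_def next_pc_def same_mem_def)
next
  case (Cell x e)
  let ?v = "wval (abs_store s) e"
  have c: "code_at P (pc s) (wcomp p e)" "code_at P (pc s + length (wcomp p e)) (address p x)"
    "code_at P (pc s + length (wcomp p e) + 4) [WLoad (40 + p) (40 + p)]"
    using Cell.prems(1) code_at_append[of P "pc s" "wcomp p e"] code_at_append[of P "pc s + length (wcomp p e)" "address p x"]
    by auto
  have p: "p < 23" using Cell.prems wfx_depth by auto
  obtain s1 where s1: "det (length (wcomp p e)) s s1" "pc s1 = pc s + length (wcomp p e)"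
     "wmem s1 (40 + p) = ?v" "same_mem p s s1"
    using Cell.IH[of s p] c Cell.prems by auto
  have "64 * ?v + x < W"
    using address_less_W[OF wval_bound] Cell.prems by auto
  then obtain s2 where s2: "det 4 s1 s2" "pc s2 = pc s1 + 4" "wmem s2 (40 + p) = 64 * ?v + x" "same_mem p s1 s2"
    using address_correct[of s1 p x] s1 c p Cell.prems by auto
  have mem: "wmem s2 (64 * ?v + x) = words (abs_store s) x ?v"
    using s1(4) s2(4) variable_address[of x ?v p] Cell.prems(2) by (auto simp: same_mem_def abs_store_def)
  have lt: "words (abs_store s) x ?v < W" using Cell.prems(3) less_W by (auto simp: small_def)
  define s3 where "s3 = next_pc (s2\<lparr>wmem := (wmem s2)(40 + p := words (abs_store s) x ?v)\<rparr>)"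
  have "det (Suc 0) s2 s3" using c(3) s1(2) s2 lt mem
    by (intro det_instr) (auto simp: put_word_def s3_def)
  then have "det (length (wcomp p e) + 4 + Suc 0) s s3" using s1(1) s2(1) det_trans by blast
  moreover have "same_mem p s2 s3" using p by (auto simp: s3_def same_mem_def next_pc_def)
  ultimately show ?case using s1 s2 same_mem_trans[OF s1(4) s2(4)] same_mem_trans[of p s s2 p s3]
    by (intro exI[of _ s3]) (auto simp: s3_def next_pc_def ac_simps)
next
  case (Arith f a b)
  have c: "code_at P (pc s) (wcomp p a)" "code_at P (pc s + length (wcomp p a)) (wcomp (Suc p) b)"
    "code_at P (pc s + length (wcomp p a) + length (wcomp (Suc p) b)) [WOp f (40 + p) (40 + p) (41 + p)]"
    using Arith.prems(1) code_at_append[of P "pc s" "wcomp p a"] code_at_append[of P "pc s + length (wcomp p a)" "wcomp (Suc p) b"]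
    by auto
  obtain s1 where s1: "det (length (wcomp p a)) s s1" "pc s1 = pc s + length (wcomp p a)"
     "wmem s1 (40 + p) = wval (abs_store s) a" "same_mem p s s1"
    using Arith.IH(1)[of s p] c Arith.prems by auto
  have abs: "abs_store s1 = abs_store s" using abs_same_mem s1(4) by blast
  obtain s2 where s2: "det (length (wcomp (Suc p) b)) s1 s2" "pc s2 = pc s1 + length (wcomp (Suc p) b)"
     "wmem s2 (41 + p) = wval (abs_store s) b" "same_mem (Suc p) s1 s2"
    using Arith.IH(2)[of s1 "Suc p"] c s1 abs Arith.prems by auto
  have m: "wmem s2 (40 + p) = wval (abs_store s) a" using s1 s2 by (auto simp: same_mem_def)
  let ?v = "wval (abs_store s) (Arith f a b)"
  have lt: "?v < W" using Arith.prems by (intro wval_less_W)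
  define s3 where "s3 = next_pc (s2\<lparr>wmem := (wmem s2)(40 + p := ?v)\<rparr>)"
  have "det (Suc 0) s2 s3" using c(3) s1(2) s2 lt m
    by (intro det_instr) (auto simp: put_word_def s3_def)
  then have "det (length (wcomp p a) + length (wcomp (Suc p) b) + Suc 0) s s3" using s1(1) s2(1) det_trans by blast
  moreover have "same_mem p s2 s3" using wfx_depth Arith.prems(2) by (fastforce simp: s3_def same_mem_def next_pc_def)
  moreover have "same_mem p s s2" using same_mem_trans[OF s1(4) s2(4)] by simp
  ultimately show ?case using s1 s2 same_mem_trans[of p s s2 p s3]
    by (intro exI[of _ s3]) (auto simp: s3_def next_pc_def ac_simps)
qed

lemma wcomp_address_correct:
  assumes "code_at P (pc s) (wcomp p e @ address p x)" "wfx p e" "small (abs_store s)" "x < 64" "degree_bound e \<le> 8"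
  shows "\<exists>s'. det (length (wcomp p e @ address p x)) s s' \<and> pc s' = pc s + length (wcomp p e @ address p x) \<and>
     wmem s' (40 + p) = 64 * wval (abs_store s) e + x \<and> same_mem p s s'"
proof -
  have c: "code_at P (pc s) (wcomp p e)" "code_at P (pc s + length (wcomp p e)) (address p x)"
    using assms(1) code_at_append[of P "pc s" "wcomp p e"] by auto
  obtain s1 where s1: "det (length (wcomp p e)) s s1" "pc s1 = pc s + length (wcomp p e)"
     "wmem s1 (40 + p) = wval (abs_store s) e" "same_mem p s s1"
    using wcomp_correct[of s p e] c assms by auto
  have "64 * wval (abs_store s) e + x < W"
    using address_less_W[OF wval_bound] assms by auto
  then obtain s2 where s2: "det 4 s1 s2" "pc s2 = pc s1 + 4" "wmem s2 (40 + p) = 64 * wval (abs_store s) e + x" "same_mem p s1 s2"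
    using address_correct[of s1 p x] s1 c wfx_depth assms by auto
  show ?thesis using s1 s2 det_trans[OF s1(1) s2(1)] same_mem_trans[OF s1(4) s2(4)]
    by (intro exI[of _ s2]) auto
qed

lemma rcomp_correct:
  assumes "code_at P (pc s) (rcomp p e)" "wfr p e" "small (abs_store s)"
  shows "\<exists>s'. det (length (rcomp p e)) s s' \<and> pc s' = pc s + length (rcomp p e) \<and>
     rmem s' (40 + p) = rval (abs_store s) e \<and> same_rmem p s s'"
  using assms
proof (induction e arbitrary: p s)
  case (RCell x e)
  let ?c = "wcomp 0 e @ address 0 x" and ?v = "wval (abs_store s) e"
  have c: "code_at P (pc s) ?c" "code_at P (pc s + length ?c) [RLoad (40 + p) 40]"
    using RCell.prems(1) code_at_append[of P "pc s" ?c] by auto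
  obtain s1 where s1: "det (length ?c) s s1" "pc s1 = pc s + length ?c"
     "wmem s1 (40 + 0) = 64 * ?v + x" "same_mem 0 s s1"
    using wcomp_address_correct[of s 0 e x] c RCell.prems by auto
  have mem: "rmem s1 (64 * ?v + x) = reals (abs_store s) x ?v"
    using s1(4) RCell.prems(2) by (auto simp: same_mem_def abs_store_def)
  define s2 where "s2 = put_real (40 + p) (reals (abs_store s) x ?v) s1"
  have "det (Suc 0) s1 s2" using c(2) s1 mem by (intro det_instr) (auto simp: s2_def)
  then have "det (length ?c + Suc 0) s s2" using s1(1) det_trans by blast
  moreover have "same_rmem p s1 s2" using RCell.prems by (auto simp: s2_def same_rmem_def next_pc_def put_real_def)
  ultimately show ?case using s1 same_rmem_trans[OF same_mem_rmem[OF s1(4)], of p s2]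
    by (intro exI[of _ s2]) (auto simp: s2_def next_pc_def put_real_def ac_simps)
next
  case (OfWord e)
  have c: "code_at P (pc s) (wcomp 0 e)" "code_at P (pc s + length (wcomp 0 e)) [ROfWord (40 + p) 40]"
    using OfWord.prems(1) code_at_append[of P "pc s" "wcomp 0 e"] by auto
  obtain s1 where s1: "det (length (wcomp 0 e)) s s1" "pc s1 = pc s + length (wcomp 0 e)"
     "wmem s1 (40 + 0) = wval (abs_store s) e" "same_mem 0 s s1"
    using wcomp_correct[of s 0 e] c OfWord.prems by auto
  define s2 where "s2 = put_real (40 + p) (real (wval (abs_store s) e)) s1"
  have "det (Suc 0) s1 s2" using c(2) s1 by (intro det_instr) (auto simp: s2_def)
  then have "det (length (wcomp 0 e) + Suc 0) s s2" using s1(1) det_trans by blast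
  moreover have "same_rmem p s1 s2" using OfWord.prems by (auto simp: s2_def same_rmem_def next_pc_def put_real_def)
  ultimately show ?case using s1 same_rmem_trans[OF same_mem_rmem[OF s1(4)], of p s2]
    by (intro exI[of _ s2]) (auto simp: s2_def next_pc_def put_real_def ac_simps)
next
  case (RArith f a b)
  have c: "code_at P (pc s) (rcomp p a)" "code_at P (pc s + length (rcomp p a)) (rcomp (Suc p) b)"
    "code_at P (pc s + length (rcomp p a) + length (rcomp (Suc p) b)) [ROp f (40 + p) (40 + p) (41 + p)]"
    using RArith.prems(1) code_at_append[of P "pc s" "rcomp p a"] code_at_append[of P "pc s + length (rcomp p a)" "rcomp (Suc p) b"]
    by auto
  obtain s1 where s1: "det (length (rcomp p a)) s s1" "pc s1 = pc s + length (rcomp p a)"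
     "rmem s1 (40 + p) = rval (abs_store s) a" "same_rmem p s s1"
    using RArith.IH(1)[of s p] c RArith.prems by auto
  have abs: "abs_store s1 = abs_store s" using abs_same_rmem s1(4) by blast
  obtain s2 where s2: "det (length (rcomp (Suc p) b)) s1 s2" "pc s2 = pc s1 + length (rcomp (Suc p) b)"
     "rmem s2 (41 + p) = rval (abs_store s) b" "same_rmem (Suc p) s1 s2"
    using RArith.IH(2)[of s1 "Suc p"] c s1 abs RArith.prems by auto
  have m: "rmem s2 (40 + p) = rval (abs_store s) a" using s1 s2 by (auto simp: same_rmem_def)
  define s3 where "s3 = put_real (40 + p) (rval (abs_store s) (RArith f a b)) s2"
  have "det (Suc 0) s2 s3" using c(3) s1(2) s2 m by (intro det_instr) (auto simp: s3_def)
  then have "det (length (rcomp p a) + length (rcomp (Suc p) b) + Suc 0) s s3" using s1(1) s2(1) det_trans by blast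
  moreover have "same_rmem p s2 s3" using wfr_depth RArith.prems(2)
    by (fastforce simp: s3_def same_rmem_def next_pc_def put_real_def)
  moreover have "same_rmem p s s2" using same_rmem_trans[OF s1(4) s2(4)] by simp
  ultimately show ?case using s1 s2 same_rmem_trans[of p s s2 p s3]
    by (intro exI[of _ s3]) (auto simp: s3_def next_pc_def put_real_def)
qed

lemma gcomp_correct:
  assumes "code_at P (pc s) (gcomp g l)" "wfg g" "small (abs_store s)"
  shows "\<exists>s'. det (glen g) s s' \<and> pc s' = (if gval (abs_store s) g then l else pc s + glen g) \<and> same_rmem 0 s s'"
proof (cases g)
  case (WLess a b)
  have c: "code_at P (pc s) (wcomp 0 a)" "code_at P (pc s + length (wcomp 0 a)) (wcomp 1 b)"
    "code_at P (pc s + length (wcomp 0 a) + length (wcomp 1 b)) [WJumpLess 40 41 l]"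
    using assms(1) WLess code_at_append[of P "pc s" "wcomp 0 a"] code_at_append[of P "pc s + length (wcomp 0 a)" "wcomp 1 b"]
    by auto
  obtain s1 where s1: "det (length (wcomp 0 a)) s s1" "pc s1 = pc s + length (wcomp 0 a)"
     "wmem s1 (40 + 0) = wval (abs_store s) a" "same_mem 0 s s1"
    using wcomp_correct[of s 0 a] c assms WLess by auto
  have abs: "abs_store s1 = abs_store s" using abs_same_mem s1(4) by blast
  obtain s2 where s2: "det (length (wcomp 1 b)) s1 s2" "pc s2 = pc s1 + length (wcomp 1 b)"
     "wmem s2 (40 + 1) = wval (abs_store s) b" "same_mem 1 s1 s2"
    using wcomp_correct[of s1 1 b] c s1 abs assms WLess by auto
  have m: "wmem s2 40 = wval (abs_store s) a" using s1 s2 by (auto simp: same_mem_def)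
  define s3 where "s3 = jump_if (gval (abs_store s) g) l s2"
  have "det (Suc 0) s2 s3" using c(3) s1(2) s2 m WLess by (intro det_instr) (auto simp: s3_def)
  then have "det (length (wcomp 0 a) + length (wcomp 1 b) + Suc 0) s s3" using s1(1) s2(1) det_trans by blast
  then have "det (glen g) s s3" by (simp add: glen_def WLess)
  moreover have "same_mem 0 s s2" using same_mem_trans[OF s1(4) s2(4)] by simp
  then have "same_rmem 0 s s3"
    by (auto simp: same_mem_def same_rmem_def s3_def jump_if_def next_pc_def)
  moreover have "pc s3 = (if gval (abs_store s) g then l else pc s + glen g)"
    using s1(2) s2(2) by (simp add: s3_def jump_if_def next_pc_def glen_def WLess)
  ultimately show ?thesis by blast
next
  case (RLess a b)
  have c: "code_at P (pc s) (rcomp 0 a)" "code_at P (pc s + length (rcomp 0 a)) (rcomp 1 b)"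
    "code_at P (pc s + length (rcomp 0 a) + length (rcomp 1 b)) [RJumpLess 40 41 l]"
    using assms(1) RLess code_at_append[of P "pc s" "rcomp 0 a"] code_at_append[of P "pc s + length (rcomp 0 a)" "rcomp 1 b"]
    by auto
  obtain s1 where s1: "det (length (rcomp 0 a)) s s1" "pc s1 = pc s + length (rcomp 0 a)"
     "rmem s1 (40 + 0) = rval (abs_store s) a" "same_rmem 0 s s1"
    using rcomp_correct[of s 0 a] c assms RLess by auto
  have abs: "abs_store s1 = abs_store s" using abs_same_rmem s1(4) by blast
  obtain s2 where s2: "det (length (rcomp 1 b)) s1 s2" "pc s2 = pc s1 + length (rcomp 1 b)"
     "rmem s2 (40 + 1) = rval (abs_store s) b" "same_rmem 1 s1 s2"
    using rcomp_correct[of s1 1 b] c s1 abs assms RLess by auto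
  have m: "rmem s2 40 = rval (abs_store s) a" using s1 s2 by (auto simp: same_rmem_def)
  define s3 where "s3 = jump_if (gval (abs_store s) g) l s2"
  have "det (Suc 0) s2 s3" using c(3) s1(2) s2 m RLess by (intro det_instr) (auto simp: s3_def)
  then have "det (length (rcomp 0 a) + length (rcomp 1 b) + Suc 0) s s3" using s1(1) s2(1) det_trans by blast
  then have "det (glen g) s s3" by (simp add: glen_def RLess)
  moreover have "same_rmem 0 s s2" using same_rmem_trans[OF s1(4) s2(4)] by simp
  then have "same_rmem 0 s s3"
    by (auto simp: same_mem_def same_rmem_def s3_def jump_if_def next_pc_def)
  moreover have "pc s3 = (if gval (abs_store s) g then l else pc s + glen g)"
    using s1(2) s2(2) by (simp add: s3_def jump_if_def next_pc_def glen_def RLess)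
  ultimately show ?thesis by blast
qed

lemma goto_correct:
  assumes "code_at P (pc s) (goto l)"
  shows "\<exists>s'. det 3 s s' \<and> pc s' = l \<and> same_mem 0 s s'"
proof -
  have c: "code_at P (pc s) [WConst 40 0]" "code_at P (Suc (pc s)) [WConst 41 1]" "code_at P (Suc (Suc (pc s))) [WJumpLess 40 41 l]"
    using assms code_at_append[of P "pc s" "[WConst 40 0]" "[WConst 41 1, WJumpLess 40 41 l]"]
      code_at_append[of P "Suc (pc s)" "[WConst 41 1]" "[WJumpLess 40 41 l]"]
    by (auto simp: goto_def)
  define s1 where "s1 = next_pc (s\<lparr>wmem := (wmem s)(40 := 0)\<rparr>)"
  define s2 where "s2 = next_pc (s1\<lparr>wmem := (wmem s1)(41 := 1)\<rparr>)"
  define s3 where "s3 = s2\<lparr>pc := l\<rparr>"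
  note defs = s1_def s2_def s3_def next_pc_def
  have W: "1 < W" using less_W[of 1] B_ge by simp
  have "det (Suc 0) s s1" using c(1) W by (intro det_instr) (auto simp: put_word_def defs)
  moreover have "det (Suc 0) s1 s2" using c(2) W by (intro det_instr) (auto simp: put_word_def defs)
  moreover have "det (Suc 0) s2 s3" using c(3) by (intro det_instr) (auto simp: jump_if_def defs)
  ultimately have "det (Suc 0 + Suc 0 + Suc 0) s s3" using det_trans by blast
  then show ?thesis
    by (intro exI[of _ s3]) (auto simp: defs same_mem_def eval_nat_numeral)
qed

end

lemma for_loop_setw: "for_loop f x j m (setw x 0 i s) = for_loop f x j m s"
  by (cases m) simp_all

lemma abs_put_real: "abs_store (put_real 40 r s) = abs_store s"
  by (rule abs_same_rmem[of 0]) (auto simp: put_real_def next_pc_def same_rmem_def)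

lemma abs_record_event: "abs_store (record_event e s) = log_events [e] (abs_store s)"
  by (auto simp: record_event_def abs_store_def log_events_def fun_eq_iff)

lemma abs_next_pc: "abs_store (next_pc s) = abs_store s"
  by (auto simp: next_pc_def abs_store_def fun_eq_iff)

lemma abs_emit: "abs_store (s\<lparr>emitted := emitted s @ [p]\<rparr>) = add_out p (abs_store s)"
  by (auto simp: abs_store_def add_out_def fun_eq_iff)

lemma log_events_append: "log_events es' (log_events es s) = log_events (es @ es') s"
  by (simp add: log_events_def)

section \<open>Correctness of compiled commands\<close>

context oracle_compiler
begin

text \<open>Stopping anywhere but at the exit \<open>l\<close> is worth infinity, so the freedom to
  stop early gives no advantage. Smallness is carried along because the code that follows relies on
  it.\<close>

definition post :: "nat \<Rightarrow> (store \<Rightarrow> ennreal) \<Rightarrow> config \<Rightarrow> ennreal" where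
  "post l Q s = (if pc s = l \<and> small (abs_store s) then Q (abs_store s) else \<infinity>)"

primrec time :: "com \<Rightarrow> nat" where
  "time Skip = 0"
| "time (WSet x i e) = clen kind (WSet x i e)"
| "time (RSet x i e) = clen kind (RSet x i e)"
| "time (Draw x e) = clen kind (Draw x e)"
| "time (AskWeak x i a b) = clen kind (AskWeak x i a b)"
| "time (AskStrong x i a b) = clen kind (AskStrong x i a b)"
| "time (Output e r) = clen kind (Output e r)"
| "time (Seq a b) = time a + time b"
| "time (Cond g a b) = glen g + time a + time b + 3"
| "time (For x y c) = length (set_code x (Const 0) (Const 0)) +
     (env y * (glen (WLess (Var x) (Var y)) + (time c + (length (incr_code x) + 3))) +
     (glen (WLess (Var x) (Var y)) + 3))"

lemma small_setw: "small s \<Longrightarrow> v \<le> B \<Longrightarrow> small (setw x i v s)"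
  by (auto simp: small_def)

lemma small_words [simp]:
  "small (setr x i t s) = small s" "small (log_events es s) = small s" "small (add_out p s) = small s"
  by (auto simp: small_def)

lemma store_code_correct:
  assumes code: "code_at P (pc s) (wcomp 1 i @ address 1 x @ [WStore 41 40])"
    and "wfx 1 i" "degree_bound i \<le> 8" "x < 40" "small (abs_store s)" "wmem s 40 < W"
  shows "\<exists>s'. det (length (wcomp 1 i @ address 1 x @ [WStore 41 40])) s s' \<and>
     pc s' = pc s + length (wcomp 1 i @ address 1 x @ [WStore 41 40]) \<and>
     abs_store s' = setw x (wval (abs_store s) i) (wmem s 40) (abs_store s)"
proof -
  let ?c = "wcomp 1 i @ address 1 x" and ?i = "wval (abs_store s) i"
  have c: "code_at P (pc s) ?c" "code_at P (pc s + length ?c) [WStore 41 40]"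
    using code code_at_append[of P "pc s" ?c] by auto
  obtain s1 where s1: "det (length ?c) s s1" "pc s1 = pc s + length ?c"
     "wmem s1 (40 + 1) = 64 * ?i + x" "same_mem 1 s s1"
    using wcomp_address_correct[of s 1 i x] c assms by auto
  have m: "wmem s1 40 = wmem s 40" using s1(4) by (auto simp: same_mem_def)
  define s2 where "s2 = next_pc (s1\<lparr>wmem := (wmem s1)(64 * ?i + x := wmem s 40)\<rparr>)"
  have "det (Suc 0) s1 s2" using c(2) s1 m assms(6) 
    by (intro det_instr) (auto simp: s2_def put_word_def)
  then have "det (length ?c + Suc 0) s s2" using s1(1) det_trans by blast
  moreover have "abs_store s2 = setw x ?i (wmem s 40) (abs_store s1)"
    using assms(4) by (intro abs_setw) (auto simp: s2_def next_pc_def)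
  moreover have "pc s2 = pc s + length ?c + 1" using s1(2) by (simp add: s2_def next_pc_def)
  ultimately show ?thesis using abs_same_mem[OF s1(4)] by (intro exI[of _ s2]) (auto simp: ac_simps)
qed

lemma set_code_correct:
  assumes code: "code_at P (pc s) (set_code x i e)"
    and "wfx 0 e" "wfx 1 i" "degree_bound i \<le> 8" "x < 40" "small (abs_store s)"
  shows "\<exists>s'. det (length (set_code x i e)) s s' \<and> pc s' = pc s + length (set_code x i e) \<and>
     abs_store s' = setw x (wval (abs_store s) i) (wval (abs_store s) e) (abs_store s)"
proof -
  let ?c = "wcomp 1 i @ address 1 x @ [WStore 41 40]"
  have c: "code_at P (pc s) (wcomp 0 e)" "code_at P (pc s + length (wcomp 0 e)) ?c"
    using code code_at_append[of P "pc s" "wcomp 0 e" ?c] by (auto simp: set_code_def)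
  obtain s1 where s1: "det (length (wcomp 0 e)) s s1" "pc s1 = pc s + length (wcomp 0 e)"
     "wmem s1 (40 + 0) = wval (abs_store s) e" "same_mem 0 s s1"
    using wcomp_correct[of s 0 e] c assms by auto
  have abs: "abs_store s1 = abs_store s" using abs_same_mem s1(4) by blast
  have "wval (abs_store s) e < W" using assms wval_less_W by blast
  then obtain s2 where "det (length ?c) s1 s2" "pc s2 = pc s1 + length ?c"
      "abs_store s2 = setw x (wval (abs_store s) i) (wval (abs_store s) e) (abs_store s)"
    using store_code_correct[of s1 i x] c s1 abs assms by auto
  then show ?thesis using det_trans[OF s1(1), of "length ?c" s2] s1(2)
    by (intro exI[of _ s2]) (auto simp: set_code_def)
qed

lemma rstore_code_correct:
  assumes code: "code_at P (pc s) (rstore_code x i)"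
    and "wfx 0 i" "degree_bound i \<le> 8" "x < 40" "small (abs_store s)"
  shows "\<exists>s'. det (length (rstore_code x i)) s s' \<and> pc s' = pc s + length (rstore_code x i) \<and>
     abs_store s' = setr x (wval (abs_store s) i) (rmem s 40) (abs_store s)"
proof -
  let ?c = "wcomp 0 i @ address 0 x" and ?i = "wval (abs_store s) i"
  have c: "code_at P (pc s) ?c" "code_at P (pc s + length ?c) [RStore 40 40]"
    using code code_at_append[of P "pc s" ?c] by (auto simp: rstore_code_def)
  obtain s1 where s1: "det (length ?c) s s1" "pc s1 = pc s + length ?c"
     "wmem s1 (40 + 0) = 64 * ?i + x" "same_mem 0 s s1"
    using wcomp_address_correct[of s 0 i x] c assms by auto
  have m: "rmem s1 40 = rmem s 40" using s1(4) by (auto simp: same_mem_def)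
  define s2 where "s2 = put_real (64 * ?i + x) (rmem s 40) s1"
  have "det (Suc 0) s1 s2" using c(2) s1 m by (intro det_instr) (auto simp: s2_def)
  then have "det (length ?c + Suc 0) s s2" using s1(1) det_trans by blast
  moreover have "abs_store s2 = setr x ?i (rmem s 40) (abs_store s1)"
    using assms(4) by (intro abs_setr) (auto simp: s2_def next_pc_def put_real_def)
  moreover have "pc s2 = pc s + length ?c + 1" using s1(2) by (simp add: s2_def next_pc_def put_real_def)
  ultimately show ?thesis using abs_same_mem[OF s1(4)]
    by (intro exI[of _ s2]) (auto simp: ac_simps rstore_code_def)
qed

lemma wcomp2_correct:
  assumes "code_at P (pc s) (wcomp 0 a @ wcomp 1 b)" "wfx 0 a" "wfx 1 b" "small (abs_store s)"
  shows "\<exists>s'. det (length (wcomp 0 a @ wcomp 1 b)) s s' \<and> pc s' = pc s + length (wcomp 0 a @ wcomp 1 b) \<and>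
     wmem s' 40 = wval (abs_store s) a \<and> wmem s' 41 = wval (abs_store s) b \<and> same_mem 0 s s'"
proof -
  have c: "code_at P (pc s) (wcomp 0 a)" "code_at P (pc s + length (wcomp 0 a)) (wcomp 1 b)"
    using assms(1) code_at_append[of P "pc s" "wcomp 0 a"] by auto
  obtain s1 where s1: "det (length (wcomp 0 a)) s s1" "pc s1 = pc s + length (wcomp 0 a)"
     "wmem s1 (40 + 0) = wval (abs_store s) a" "same_mem 0 s s1"
    using wcomp_correct[of s 0 a] c assms by auto
  have abs: "abs_store s1 = abs_store s" using abs_same_mem s1(4) by blast
  obtain s2 where s2: "det (length (wcomp 1 b)) s1 s2" "pc s2 = pc s1 + length (wcomp 1 b)"
     "wmem s2 (40 + 1) = wval (abs_store s) b" "same_mem 1 s1 s2"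
    using wcomp_correct[of s1 1 b] c s1 abs assms by auto
  have m: "wmem s2 40 = wval (abs_store s) a" using s1 s2 by (auto simp: same_mem_def)
  show ?thesis using s1 s2 m det_trans[OF s1(1) s2(1)] same_mem_trans[OF s1(4) s2(4)]
    by (intro exI[of _ s2]) auto
qed

lemma mstep_eq: "code_at P (pc s) [i] \<Longrightarrow> mstep s = exec W z n d adv s i"
  using code_at_Cons by (simp add: step_def)

lemma det_post:
  assumes "det t s s'" "pc s' = l" "small (abs_store s')"
  shows "stopval t (post l Q) s \<le> Q (abs_store s')"
  using assms unfolding det_def by (metis post_def)

lemma strong_code_correct:
  assumes "code_at P (pc s) (strong_code kind)" "wmem s 40 < n" "wmem s 41 < n"
  shows "\<exists>s'. det (length (strong_code kind)) s s' \<and> pc s' = pc s + length (strong_code kind) \<and>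
     abs_store s' = log_events (strong_events kind (wmem s 40) (wmem s 41)) (abs_store s) \<and>
     rmem s' 40 = d (wmem s 40) (wmem s 41)"
proof (cases "kind = Distance_Queries")
  case True
  define s1 where "s1 = put_real 40 (d (wmem s 40) (wmem s 41)) (record_event (DistEv (wmem s 40) (wmem s 41)) s)"
  have "det (Suc 0) s s1" using assms True by (intro det_instr) (auto simp: s1_def Let_def)
  moreover have "abs_store s1 = log_events [DistEv (wmem s 40) (wmem s 41)] (abs_store s)"
    unfolding s1_def abs_put_real abs_record_event ..
  ultimately show ?thesis using True
    by (intro exI[of _ s1]) (auto simp: s1_def put_real_def next_pc_def record_event_def)
next
  case False
  then have k: "kind = Point_Queries" by (cases kind) auto
  have c: "code_at P (pc s) [StrongPoint 40]" "code_at P (Suc (pc s)) [StrongPoint 41]" "code_at P (Suc (Suc (pc s))) [Reveal 40 40 41]"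
    using assms(1) k code_at_append[of P "pc s" "[StrongPoint 40]" "[StrongPoint 41, Reveal 40 40 41]"]
      code_at_append[of P "Suc (pc s)" "[StrongPoint 41]" "[Reveal 40 40 41]"]
    by auto
  define s1 where "s1 = next_pc (record_event (PointEv (wmem s 40)) s)"
  define s2 where "s2 = next_pc (record_event (PointEv (wmem s 41)) s1)"
  define s3 where "s3 = put_real 40 (d (wmem s 40) (wmem s 41)) s2"
  note defs = s1_def s2_def s3_def put_real_def next_pc_def record_event_def
  have "det (Suc 0) s s1" using c assms by (intro det_instr) (auto simp: defs)
  moreover have "det (Suc 0) s1 s2" using c assms by (intro det_instr) (auto simp: defs)
  moreover have "det (Suc 0) s2 s3" using c assms by (intro det_instr) (auto simp: defs Let_def)
  ultimately have "det (Suc 0 + Suc 0 + Suc 0) s s3" using det_trans by blast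
  moreover have "abs_store s3 = log_events [PointEv (wmem s 40), PointEv (wmem s 41)] (abs_store s)"
    by (simp add: s1_def s2_def s3_def abs_put_real abs_next_pc abs_record_event log_events_append)
  ultimately show ?thesis using k
    by (intro exI[of _ s3]) (auto simp: defs)
qed

text \<open>Induction on the number of remaining iterations. The machine re-reads the bound
  \<open>y\<close> at every test, whereas \<open>for_loop\<close> fixes it on entry; the two agree
  because the body modifies neither \<open>x\<close> nor \<open>y\<close>.\<close>

lemma for_correct:
  assumes code: "code_at P l1 (gcomp (WLess (Var x) (Var y)) l2 @ goto l3 @ body @ incr_code x @ goto l1)"
    and l2: "l2 = l1 + glen (WLess (Var x) (Var y)) + 3"
    and l3: "l3 = l2 + length body + length (incr_code x) + 3"
    and x: "x < 40" "y < 40" "x \<noteq> y" "x \<notin> wmods c" "y \<notin> wmods c"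
    and body: "\<And>Q s. pc s = l2 \<Longrightarrow> small (abs_store s) \<Longrightarrow> stopval tc (post (l2 + length body) Q) s \<le> expect c (abs_store s) Q"
    and s: "pc s = l1" "small (abs_store s)" "words (abs_store s) x 0 = j" "words (abs_store s) y 0 = j + m"
  shows "stopval (m * (glen (WLess (Var x) (Var y)) + (tc + (length (incr_code x) + 3))) +
      (glen (WLess (Var x) (Var y)) + 3)) (post l3 Q) s \<le> oexp (for_loop (sem c) x j m (abs_store s)) Q"
  using s
proof (induction m arbitrary: j s)
  let ?g = "WLess (Var x) (Var y)"
  have c1: "code_at P l1 (gcomp ?g l2)" "code_at P (l1 + glen ?g) (goto l3)"
    "code_at P l2 body" "code_at P (l2 + length body) (incr_code x)" "code_at P (l2 + length body + length (incr_code x)) (goto l1)"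
    using code code_at_append[of P l1 "gcomp ?g l2"] code_at_append[of P "l1 + glen ?g" "goto l3"]
      code_at_append[of P l2 body] code_at_append[of P "l2 + length body" "incr_code x"]
    unfolding l2 by (auto simp del: gcomp.simps)
  have wf: "wfg ?g" using x B_ge by simp
  {
    case 0
    obtain s1 where s1: "det (glen ?g) s s1" "pc s1 = l1 + glen ?g" "same_rmem 0 s s1"
      using gcomp_correct[of s ?g l2] c1 wf 0 by auto
    obtain s2 where s2: "det 3 s1 s2" "pc s2 = l3" "same_mem 0 s1 s2"
      using goto_correct[of s1 l3] c1 s1 by auto
    have "abs_store s2 = abs_store s" using s1 s2 abs_same_mem abs_same_rmem by metis
    moreover have "det (glen ?g + 3) s s2" using s1 s2 det_trans by blast
    ultimately show ?case using det_post[of "glen ?g + 3" s s2 l3 Q] s2 0 by (simp add: setw_same)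
  next
    case (Suc m)
    let ?tb = "glen ?g + (tc + (length (incr_code x) + 3))" and ?te = "glen ?g + 3"
    obtain s1 where s1: "det (glen ?g) s s1" "pc s1 = l2" "same_rmem 0 s s1"
      using gcomp_correct[of s ?g l2] c1 wf Suc.prems by auto
    have abs1: "abs_store s1 = abs_store s" using s1 abs_same_rmem by metis
    \<comment> \<open>\<open>G\<close> is infinite outside the frame of the body. Such stores have
      probability zero by \<open>sem_frame\<close>, so this costs nothing, and it lets
      \<open>after\<close> assume that \<open>x\<close> and \<open>y\<close> are unchanged.\<close>
    define G where "G t = (if frame (wmods c) (rmods c) (abs_store s) t then oexp (for_loop (sem c) x (Suc j) m t) Q else \<infinity>)" for t
    have after: "stopval (length (incr_code x) + 3 + (m * ?tb + ?te)) (post l3 Q) u \<le> post (l2 + length body) G u" for u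
    proof (cases "pc u = l2 + length body \<and> small (abs_store u) \<and> frame (wmods c) (rmods c) (abs_store s) (abs_store u)")
      case True
      then have w: "words (abs_store u) x 0 = j" "words (abs_store u) y 0 = j + Suc m"
        using Suc.prems x by (auto simp: frame_def)
      have "small (abs_store u)" using True by simp
      then have jm: "j + Suc m \<le> B" using w(2) unfolding small_def by metis
      obtain u1 where u1: "det (length (incr_code x)) u u1" "pc u1 = pc u + length (incr_code x)"
        "abs_store u1 = setw x 0 (Suc j) (abs_store u)"
        using set_code_correct[of u x "Const 0" "Arith Plus (Var x) (Const 1)"] c1(4) True x w B_ge
        by (auto simp: incr_code_def)
      obtain u2 where u2: "det 3 u1 u2" "pc u2 = l1" "same_mem 0 u1 u2"
        using goto_correct[of u1 l1] c1(5) u1 True by auto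
      have abs2: "abs_store u2 = setw x 0 (Suc j) (abs_store u)" using u1 u2 abs_same_mem by metis
      have sm: "small (abs_store u2)" using True jm unfolding abs2 by (intro small_setw) auto
      have "stopval (length (incr_code x) + 3 + (m * ?tb + ?te)) (post l3 Q) u \<le> stopval (m * ?tb + ?te) (post l3 Q) u2"
        using u1 u2 by (intro det_stopval det_trans)
      also have "\<dots> \<le> oexp (for_loop (sem c) x (Suc j) m (abs_store u2)) Q"
        using u2 sm w x by (intro Suc.IH) (auto simp: abs2)
      also have "\<dots> = post (l2 + length body) G u"
        using True by (simp add: abs2 for_loop_setw post_def G_def)
      finally show ?thesis .
    qed (auto simp: post_def G_def)
    have "stopval (Suc m * ?tb + ?te) (post l3 Q) s = stopval (glen ?g + (tc + (length (incr_code x) + 3 + (m * ?tb + ?te)))) (post l3 Q) s"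
      by (simp add: algebra_simps)
    also have "\<dots> \<le> stopval (tc + (length (incr_code x) + 3 + (m * ?tb + ?te))) (post l3 Q) s1"
      using s1(1) by (rule det_stopval)
    also have "\<dots> \<le> stopval tc (stopval (length (incr_code x) + 3 + (m * ?tb + ?te)) (post l3 Q)) s1"
      by (rule stopval_add)
    also have "\<dots> \<le> stopval tc (post (l2 + length body) G) s1"
      by (intro stopval_mono after)
    also have "\<dots> \<le> expect c (abs_store s) G"
      using body[of s1 G] s1 abs1 Suc.prems by simp
    also have "\<dots> = oexp (sem c (abs_store s)) (\<lambda>t. oexp (for_loop (sem c) x (Suc j) m t) Q)"
      unfolding expect_def by (intro oexp_cong_set) (auto simp: G_def dest: sem_frame)
    also have "\<dots> = oexp (for_loop (sem c) x j (Suc m) (abs_store s)) Q"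
      using Suc.prems by (simp add: oexp_obind setw_same)
    finally show ?case .
  }
qed

text \<open>The inequality is one-sided: the machine does at least as well as the source program.
  This suffices because everything required, including the absence of faults, is an upper bound on
  an expectation.\<close>

theorem compile_correct:
  assumes "code_at P l (compile kind l c)" "wfc c" "pc s = l" "small (abs_store s)"
  shows "stopval (time c) (post (l + clen kind c) Q) s \<le> expect c (abs_store s) Q"
  using assms
proof (induction c arbitrary: l s Q)
  case Skip then show ?case by (simp add: post_def)
next
  case (WSet x i e)
  show ?case
  proof (cases "wval (abs_store s) e \<le> B")
    case True
    obtain s' where "det (length (set_code x i e)) s s'" "pc s' = l + length (set_code x i e)"
     "abs_store s' = setw x (wval (abs_store s) i) (wval (abs_store s) e) (abs_store s)"
      using set_code_correct[of s x i e] WSet by auto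
    then show ?thesis using det_post[of "length (set_code x i e)" s s'] True WSet.prems by (simp add: small_setw)
  qed simp
next
  case (RSet x i e)
  have c: "code_at P l (rcomp 0 e)" "code_at P (l + length (rcomp 0 e)) (rstore_code x i)"
    using RSet.prems code_at_append[of P l "rcomp 0 e"] by auto
  obtain s1 where s1: "det (length (rcomp 0 e)) s s1" "pc s1 = l + length (rcomp 0 e)"
     "rmem s1 (40 + 0) = rval (abs_store s) e" "same_rmem 0 s s1"
    using rcomp_correct[of s 0 e] c RSet.prems by auto
  have abs: "abs_store s1 = abs_store s" using abs_same_rmem s1(4) by blast
  obtain s2 where s2: "det (length (rstore_code x i)) s1 s2" "pc s2 = pc s1 + length (rstore_code x i)"
     "abs_store s2 = setr x (wval (abs_store s) i) (rval (abs_store s) e) (abs_store s)"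
    using rstore_code_correct[of s1 x i] c s1 abs RSet.prems by auto
  show ?case using det_post[OF det_trans[OF s1(1) s2(1)], of "l + clen kind (RSet x i e)"] s1 s2 RSet.prems by simp
next
  case (Draw x e)
  let ?v = "wval (abs_store s) e" and ?c = "wcomp 1 (Const 0) @ address 1 x @ [WStore 41 40]"
  show ?case
  proof (cases "0 < ?v \<and> ?v \<le> B")
    case True
    have c: "code_at P l (wcomp 0 e)" "code_at P (l + length (wcomp 0 e)) [Rand 40 40]"
       "code_at P (l + length (wcomp 0 e) + 1) ?c"
      using Draw.prems code_at_append[of P l "wcomp 0 e" "[Rand 40 40] @ ?c"]
        code_at_append[of P "l + length (wcomp 0 e)" "[Rand 40 40]" ?c] by auto
    obtain s1 where s1: "det (length (wcomp 0 e)) s s1" "pc s1 = l + length (wcomp 0 e)"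
       "wmem s1 (40 + 0) = ?v" "same_mem 0 s s1"
      using wcomp_correct[of s 0 e] c Draw.prems by auto
    have abs: "abs_store s1 = abs_store s" using abs_same_mem s1(4) by blast
    \<comment> \<open>The drawn word is below the bound \<open>?v\<close> of the draw, which is at
      most \<open>B\<close>, so putting it into register 40 cannot fault.\<close>
    have after: "(case put_word W 40 v s1 of None \<Rightarrow> \<infinity> | Some t \<Rightarrow>
       stopval (length ?c) (post (l + clen kind (Draw x e)) Q) t) \<le> Q (setw x 0 v (abs_store s))" if "v < ?v" for v
    proof -
      define s2 where "s2 = next_pc (s1\<lparr>wmem := (wmem s1)(40 := v)\<rparr>)"
      have v: "v \<le> B" "v < W" using that True less_W[of v] by auto
      have "same_mem 0 s1 s2" by (auto simp: s2_def same_mem_def next_pc_def)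
      then have abs2: "abs_store s2 = abs_store s" using abs abs_same_mem by metis
      have "pc s2 = l + length (wcomp 0 e) + 1" "wmem s2 40 = v" using s1 by (auto simp: s2_def next_pc_def)
      then obtain s3 where "det (length ?c) s2 s3" "pc s3 = pc s2 + length ?c" "abs_store s3 = setw x 0 v (abs_store s)"
        using store_code_correct[of s2 "Const 0" x] c(3) Draw.prems v abs2 by auto
      then have "stopval (length ?c) (post (l + clen kind (Draw x e)) Q) s2 \<le> Q (abs_store s3)"
        using v Draw.prems \<open>pc s2 = _\<close> by (intro det_post) (auto simp: small_setw)
      then show ?thesis using v \<open>abs_store s3 = _\<close> by (simp add: put_word_def s2_def)
    qed
    have "stopval (time (Draw x e)) (post (l + clen kind (Draw x e)) Q) s =
        stopval (length (wcomp 0 e) + Suc (length ?c)) (post (l + clen kind (Draw x e)) Q) s" by simp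
    also have "\<dots> \<le> stopval (Suc (length ?c)) (post (l + clen kind (Draw x e)) Q) s1"
      using s1(1) by (rule det_stopval)
    also have "\<dots> \<le> oexp (mstep s1) (stopval (length ?c) (post (l + clen kind (Draw x e)) Q))" by (rule stopval_step)
    also have "mstep s1 = map_pmf (\<lambda>v. put_word W 40 v s1) (pmf_of_set {..<?v})"
      using mstep_eq[of s1 "Rand 40 40"] c s1 True by simp
    also have "oexp \<dots> (stopval (length ?c) (post (l + clen kind (Draw x e)) Q)) \<le> (\<integral>\<^sup>+v. Q (setw x 0 v (abs_store s)) \<partial>measure_pmf (pmf_of_set {..<?v}))"
      unfolding oexp_def nn_integral_map_pmf
      using after True by (intro nn_integral_mono_AE) (simp add: AE_measure_pmf_iff set_pmf_lessThan)
    also have "\<dots> = expect (Draw x e) (abs_store s) Q" using True by simp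
    finally show ?thesis .
  qed auto
next
  case (AskWeak x i a b)
  let ?a = "wval (abs_store s) a" and ?b = "wval (abs_store s) b" and ?c = "wcomp 0 a @ wcomp 1 b"
  show ?case
  proof (cases "?a < n \<and> ?b < n")
    case True
    have c: "code_at P l ?c" "code_at P (l + length ?c) [Weak 40 40 41]"
       "code_at P (l + length ?c + 1) (rstore_code x i)"
      using AskWeak.prems code_at_append[of P l ?c "[Weak 40 40 41] @ rstore_code x i"]
        code_at_append[of P "l + length ?c" "[Weak 40 40 41]" "rstore_code x i"] by auto
    obtain s1 where s1: "det (length ?c) s s1" "pc s1 = l + length ?c"
       "wmem s1 40 = ?a" "wmem s1 41 = ?b" "same_mem 0 s s1"
      using wcomp2_correct[of s a b] c AskWeak.prems by auto
    have abs: "abs_store s1 = abs_store s" using abs_same_mem s1(5) by blast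
    have tr: "transcript s1 = events (abs_store s)" using s1(5) by (simp add: same_mem_def abs_store_def)
    let ?s2 = "\<lambda>r. put_real 40 r (record_event (WeakEv ?a ?b r) s1)"
    have after: "stopval (length (rstore_code x i)) (post (l + clen kind (AskWeak x i a b)) Q) (?s2 r) \<le>
       Q (setr x (wval (abs_store s) i) r (log_events [WeakEv ?a ?b r] (abs_store s)))" for r
    proof -
      have abs2: "abs_store (?s2 r) = log_events [WeakEv ?a ?b r] (abs_store s)"
        unfolding abs_put_real abs_record_event abs ..
      have w: "wval (log_events es t) e = wval t e" for es t e by (induction e) auto
      have p: "pc (?s2 r) = l + length ?c + 1" "rmem (?s2 r) 40 = r" using s1 by (auto simp: put_real_def next_pc_def record_event_def)
      then obtain s3 where "det (length (rstore_code x i)) (?s2 r) s3" "pc s3 = pc (?s2 r) + length (rstore_code x i)"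
         "abs_store s3 = setr x (wval (abs_store s) i) r (log_events [WeakEv ?a ?b r] (abs_store s))"
        using rstore_code_correct[of "?s2 r" x i] c(3) AskWeak.prems abs2 by (auto simp: w)
      then show ?thesis
        using AskWeak.prems p det_post[of "length (rstore_code x i)" "?s2 r" s3] by auto
    qed
    have "stopval (time (AskWeak x i a b)) (post (l + clen kind (AskWeak x i a b)) Q) s =
        stopval (length ?c + Suc (length (rstore_code x i))) (post (l + clen kind (AskWeak x i a b)) Q) s" by (simp add: add.assoc)
    also have "\<dots> \<le> stopval (Suc (length (rstore_code x i))) (post (l + clen kind (AskWeak x i a b)) Q) s1"
      using s1(1) by (rule det_stopval)
    also have "\<dots> \<le> oexp (mstep s1) (stopval (length (rstore_code x i)) (post (l + clen kind (AskWeak x i a b)) Q))" by (rule stopval_step)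
    also have "mstep s1 = map_pmf (\<lambda>r. Some (?s2 r)) (weak_oracle d adv (events (abs_store s)) ?a ?b)"
      using mstep_eq[of s1 "Weak 40 40 41"] c s1 True tr by (simp add: Let_def)
    also have "oexp \<dots> (stopval (length (rstore_code x i)) (post (l + clen kind (AskWeak x i a b)) Q)) \<le>
       (\<integral>\<^sup>+r. Q (setr x (wval (abs_store s) i) r (log_events [WeakEv ?a ?b r] (abs_store s))) \<partial>measure_pmf (weak_oracle d adv (events (abs_store s)) ?a ?b))"
      unfolding oexp_map by (intro nn_integral_mono after)
    also have "\<dots> = expect (AskWeak x i a b) (abs_store s) Q" using True by simp
    finally show ?thesis .
  qed auto
next
  case (AskStrong x i a b)
  let ?a = "wval (abs_store s) a" and ?b = "wval (abs_store s) b" and ?c = "wcomp 0 a @ wcomp 1 b"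
  show ?case
  proof (cases "?a < n \<and> ?b < n")
    case True
    have c: "code_at P l ?c" "code_at P (l + length ?c) (strong_code kind)"
       "code_at P (l + length ?c + length (strong_code kind)) (rstore_code x i)"
      using AskStrong.prems code_at_append[of P l ?c "strong_code kind @ rstore_code x i"]
        code_at_append[of P "l + length ?c" "strong_code kind" "rstore_code x i"] by auto
    obtain s1 where s1: "det (length ?c) s s1" "pc s1 = l + length ?c"
       "wmem s1 40 = ?a" "wmem s1 41 = ?b" "same_mem 0 s s1"
      using wcomp2_correct[of s a b] c AskStrong.prems by auto
    have abs: "abs_store s1 = abs_store s" using abs_same_mem s1(5) by blast
    obtain s2 where s2: "det (length (strong_code kind)) s1 s2" "pc s2 = pc s1 + length (strong_code kind)"
      "abs_store s2 = log_events (strong_events kind ?a ?b) (abs_store s)" "rmem s2 40 = d ?a ?b"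
      using strong_code_correct[of s1] c s1 abs True by auto
    have w: "wval (log_events es t) e = wval t e" for es t e by (induction e) auto
    obtain s3 where s3: "det (length (rstore_code x i)) s2 s3" "pc s3 = pc s2 + length (rstore_code x i)"
       "abs_store s3 = setr x (wval (abs_store s) i) (d ?a ?b) (log_events (strong_events kind ?a ?b) (abs_store s))"
      using rstore_code_correct[of s2 x i] c(3) AskStrong.prems s1 s2 by (auto simp: w)
    show ?thesis using det_post[OF det_trans[OF det_trans[OF s1(1) s2(1)] s3(1)], of "l + clen kind (AskStrong x i a b)"]
       s1 s2 s3 AskStrong.prems True by (simp add: ac_simps)
  qed auto
next
  case (Output e r)
  have c: "code_at P l (rcomp 0 r)" "code_at P (l + length (rcomp 0 r)) (wcomp 0 e)"
    "code_at P (l + length (rcomp 0 r) + length (wcomp 0 e)) [Emit 40 40]"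
    using Output.prems code_at_append[of P l "rcomp 0 r"] code_at_append[of P "l + length (rcomp 0 r)" "wcomp 0 e"] by auto
  obtain s1 where s1: "det (length (rcomp 0 r)) s s1" "pc s1 = l + length (rcomp 0 r)"
     "rmem s1 (40 + 0) = rval (abs_store s) r" "same_rmem 0 s s1"
    using rcomp_correct[of s 0 r] c Output.prems by auto
  have abs: "abs_store s1 = abs_store s" using abs_same_rmem s1(4) by blast
  obtain s2 where s2: "det (length (wcomp 0 e)) s1 s2" "pc s2 = pc s1 + length (wcomp 0 e)"
     "wmem s2 (40 + 0) = wval (abs_store s) e" "same_mem 0 s1 s2"
    using wcomp_correct[of s1 0 e] c s1 abs Output.prems by auto
  have abs2: "abs_store s2 = abs_store s" using abs abs_same_mem s2(4) by metis
  have m: "rmem s2 40 = rval (abs_store s) r" using s1 s2 by (simp add: same_mem_def)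
  define s3 where "s3 = next_pc (s2\<lparr>emitted := emitted s2 @ [(wmem s2 40, rmem s2 40)]\<rparr>)"
  have "det (Suc 0) s2 s3" using c(3) s1 s2 by (intro det_instr) (auto simp: s3_def)
  then have dt: "det (length (rcomp 0 r) + length (wcomp 0 e) + Suc 0) s s3" using s1 s2 det_trans by blast
  have "abs_store s3 = add_out (wval (abs_store s) e, rval (abs_store s) r) (abs_store s2)"
    using s2(3) m unfolding s3_def abs_next_pc abs_emit by simp
  then show ?case using det_post[OF dt, of "l + clen kind (Output e r)"] s1 s2 abs2 Output.prems
    by (simp add: s3_def next_pc_def)
next
  case (Seq a b)
  have c: "code_at P l (compile kind l a)" "code_at P (l + clen kind a) (compile kind (l + clen kind a) b)"
    using Seq.prems code_at_append[of P l "compile kind l a"] by auto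
  have b: "stopval (time b) (post (l + clen kind (Seq a b)) Q) u \<le> post (l + clen kind a) (\<lambda>t. expect b t Q) u" for u
    using Seq.IH(2)[OF c(2), of u Q] Seq.prems by (simp add: post_def[of _ _ u] add.assoc)
  have "stopval (time (Seq a b)) (post (l + clen kind (Seq a b)) Q) s \<le> stopval (time a) (stopval (time b) (post (l + clen kind (Seq a b)) Q)) s"
    using stopval_add by simp
  also have "\<dots> \<le> stopval (time a) (post (l + clen kind a) (\<lambda>t. expect b t Q)) s" by (intro stopval_mono b)
  also have "\<dots> \<le> expect a (abs_store s) (\<lambda>t. expect b t Q)"
    using Seq.prems by (intro Seq.IH(1) c) auto
  finally show ?case by simp
next
  case (Cond g a b)
  let ?l1 = "l + glen g" and ?l2 = "l + glen g + clen kind b + 3" and ?e = "l + clen kind (Cond g a b)"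
  have c: "code_at P l (gcomp g ?l2)" "code_at P ?l1 (compile kind ?l1 b)"
    "code_at P (?l1 + clen kind b) (goto ?e)" "code_at P ?l2 (compile kind ?l2 a)"
    using Cond.prems(1) code_at_append[of P l "gcomp g ?l2"] code_at_append[of P ?l1 "compile kind ?l1 b"]
      code_at_append[of P "?l1 + clen kind b" "goto ?e" "compile kind ?l2 a"] by (auto simp: add.assoc)
  obtain s1 where s1: "det (glen g) s s1" "pc s1 = (if gval (abs_store s) g then ?l2 else ?l1)" "same_rmem 0 s s1"
    using gcomp_correct[of s g ?l2] c Cond.prems by auto
  have abs: "abs_store s1 = abs_store s" using abs_same_rmem s1(3) by blast
  have "stopval (time (Cond g a b)) (post ?e Q) s = stopval (glen g + (time a + time b + 3)) (post ?e Q) s"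
    by (simp add: ac_simps)
  also have "\<dots> \<le> stopval (time a + time b + 3) (post ?e Q) s1" using s1(1) by (rule det_stopval)
  also have "\<dots> \<le> expect (Cond g a b) (abs_store s) Q"
  proof (cases "gval (abs_store s) g")
    case True
    have "stopval (time a + time b + 3) (post ?e Q) s1 \<le> stopval (time a) (post ?e Q) s1"
      by (rule stopval_antimono) simp
    also have "\<dots> = stopval (time a) (post (?l2 + clen kind a) Q) s1" by (simp add: add.assoc)
    also have "\<dots> \<le> expect a (abs_store s1) Q" using Cond.prems s1 abs True by (intro Cond.IH(1) c) auto
    finally show ?thesis using True abs by simp
  next
    case False
    \<comment> \<open>The else branch comes first in the code and has to jump over the then branch,
      which falls through to the exit.\<close>
    have after: "stopval 3 (post ?e Q) u \<le> post (?l1 + clen kind b) Q u" for u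
    proof (cases "pc u = ?l1 + clen kind b \<and> small (abs_store u)")
      case True
      obtain u' where u': "det 3 u u'" "pc u' = ?e" "same_mem 0 u u'" using goto_correct[of u ?e] c True by auto
      then have "abs_store u' = abs_store u" using abs_same_mem by blast
      then show ?thesis using det_post[OF u'(1,2), of Q] True by (simp add: post_def)
    qed (auto simp: post_def)
    have "stopval (time a + time b + 3) (post ?e Q) s1 \<le> stopval (time b + 3) (post ?e Q) s1"
      by (rule stopval_antimono) simp
    also have "\<dots> \<le> stopval (time b) (stopval 3 (post ?e Q)) s1" by (rule stopval_add)
    also have "\<dots> \<le> stopval (time b) (post (?l1 + clen kind b) Q) s1" by (intro stopval_mono after)
    also have "\<dots> \<le> expect b (abs_store s1) Q" using Cond.prems s1 abs False by (intro Cond.IH(2) c) auto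
    finally show ?thesis using False abs by simp
  qed
  finally show ?case .
next
  case (For x y c)
  let ?g = "WLess (Var x) (Var y)" and ?i = "set_code x (Const 0) (Const 0)"
  let ?l1 = "l + length ?i" let ?l2 = "?l1 + glen ?g + 3" let ?l3 = "?l2 + clen kind c + length (incr_code x) + 3"
  let ?rest = "gcomp ?g ?l2 @ goto ?l3 @ compile kind ?l2 c @ incr_code x @ goto ?l1"
  have e: "?l3 = l + clen kind (For x y c)" by simp
  show ?case
  proof (cases "words (abs_store s) y 0 \<le> env y")
    case True
    let ?N = "words (abs_store s) y 0" and ?tb = "glen ?g + (time c + (length (incr_code x) + 3))" and ?te = "glen ?g + 3"
    have c: "code_at P l ?i" "code_at P ?l1 ?rest"
      using For.prems(1) code_at_append[of P l ?i ?rest] unfolding compile.simps Let_def by blast+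
    have c2: "code_at P ?l2 (compile kind ?l2 c)"
      using code_at_append[OF code_at_append[OF code_at_append[OF c(2), THEN conjunct2], THEN conjunct2], THEN conjunct1]
      by (simp only: length_gcomp length_goto)
    obtain s1 where s1: "det (length ?i) s s1" "pc s1 = ?l1" "abs_store s1 = setw x 0 0 (abs_store s)"
      using set_code_correct[of s x "Const 0" "Const 0"] c For.prems by auto
    have "stopval (time (For x y c)) (post ?l3 Q) s \<le> stopval (env y * ?tb + ?te) (post ?l3 Q) s1"
      using s1(1) by (simp only: time.simps) (rule det_stopval)
    also have "\<dots> \<le> stopval (?N * ?tb + ?te) (post ?l3 Q) s1"
      using True by (intro stopval_antimono add_right_mono mult_right_mono) auto
    also have "\<dots> \<le> oexp (for_loop (sem c) x 0 ?N (abs_store s1)) Q"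
    proof (rule for_correct[OF c(2) refl])
      show "stopval (time c) (post (?l2 + length (compile kind ?l2 c)) Q) u \<le> expect c (abs_store u) Q"
        if "pc u = ?l2" "small (abs_store u)" for Q u
        using For.IH[OF c2, of u Q] For.prems that by simp
    qed (use For.prems s1 in \<open>auto simp: small_setw\<close>)
    also have "\<dots> = expect (For x y c) (abs_store s) Q"
      using True by (simp add: expect_def s1(3) for_loop_setw)
    finally show ?thesis unfolding e .
  qed (auto simp: expect_def)
qed

text \<open>\<open>Halt\<close> repeats the configuration, so waiting until time \<open>t\<close>
  after halting loses nothing; stopping at any other configuration is worth infinity. Hence no
  stopping rule beats running for all \<open>t\<close> steps.\<close>

lemma halting_value:
  "oexp (nsteps mstep t s) (\<lambda>s. if halted P s then Q s else \<infinity>) \<le> stopval t (\<lambda>s. if halted P s then Q s else \<infinity>) s"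
proof (induction t arbitrary: s)
  case (Suc t)
  let ?Q = "\<lambda>s. if halted P s then Q s else \<infinity>"
  have "oexp (nsteps mstep (Suc t) s) ?Q \<le> oexp (mstep s) (stopval t ?Q)"
    by (auto simp: oexp_obind intro!: oexp_mono Suc.IH)
  moreover have "oexp (nsteps mstep (Suc t) s) ?Q \<le> ?Q s"
  proof (cases "halted P s")
    case True
    then have "mstep s = return_pmf (Some s)" by (simp add: halted_def step_def)
    then have "nsteps mstep t s = return_pmf (Some s)" for t by (induction t) auto
    then show ?thesis by (simp only: oexp_return)
  qed simp
  ultimately show ?case by simp
qed simp

theorem machine_bound:
  assumes P: "P = compile kind 0 c @ [Halt]" and "wfc c" "pc s = 0" "small (abs_store s)"
  shows "oexp (nsteps mstep (time c) s) (\<lambda>s. if halted P s then Q (abs_store s) else \<infinity>) \<le> expect c (abs_store s) Q"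
proof -
  have "oexp (nsteps mstep (time c) s) (\<lambda>s. if halted P s then Q (abs_store s) else \<infinity>) \<le>
      stopval (time c) (\<lambda>s. if halted P s then Q (abs_store s) else \<infinity>) s" by (rule halting_value)
  also have "\<dots> \<le> stopval (time c) (post (0 + clen kind c) Q) s"
    by (rule stopval_mono) (auto simp: post_def halted_def P nth_append)
  also have "\<dots> \<le> expect c (abs_store s) Q"
    using assms by (intro compile_correct) (auto simp: code_at_def)
  finally show ?thesis .
qed

end

section \<open>The coreset program\<close>

abbreviation (input) "vN \<equiv> 0 :: nat"
abbreviation (input) "vK \<equiv> 1 :: nat"
abbreviation (input) "vL \<equiv> 2 :: nat"
abbreviation (input) "vP \<equiv> 3 :: nat"
abbreviation (input) "vEll \<equiv> 4 :: nat"
abbreviation (input) "vS \<equiv> 5 :: nat"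
abbreviation (input) "vJ \<equiv> 6 :: nat"
abbreviation (input) "vM \<equiv> 7 :: nat"
abbreviation (input) "vTot \<equiv> 8 :: nat"
abbreviation (input) "vU \<equiv> 9 :: nat"
abbreviation (input) "vCnt \<equiv> 10 :: nat"
abbreviation (input) "vI \<equiv> 11 :: nat"
abbreviation (input) "vE \<equiv> 12 :: nat"
abbreviation (input) "vQ \<equiv> 13 :: nat"
abbreviation (input) "vV \<equiv> 14 :: nat"
abbreviation (input) "vSmp \<equiv> 15 :: nat"
abbreviation (input) "vBt \<equiv> 16 :: nat"
abbreviation (input) "vUsed \<equiv> 17 :: nat"
abbreviation (input) "vBest \<equiv> 18 :: nat"
abbreviation (input) "vOwn \<equiv> 19 :: nat"
abbreviation (input) "vC \<equiv> 20 :: nat"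
abbreviation (input) "vFlag \<equiv> 21 :: nat"
abbreviation (input) "vGc \<equiv> 22 :: nat"
abbreviation (input) "vG \<equiv> 23 :: nat"
abbreviation (input) "vU2 \<equiv> 24 :: nat"
abbreviation (input) "vT \<equiv> 25 :: nat"
abbreviation (input) "vX \<equiv> 26 :: nat"
abbreviation (input) "vB1 \<equiv> 27 :: nat"
abbreviation (input) "yE \<equiv> 0 :: nat"
abbreviation (input) "yD \<equiv> 9 :: nat"
abbreviation (input) "yRho \<equiv> 2 :: nat"
abbreviation (input) "yA \<equiv> 3 :: nat"
abbreviation (input) "yVal \<equiv> 4 :: nat"
abbreviation (input) "yV \<equiv> 5 :: nat"
abbreviation (input) "yMax \<equiv> 6 :: nat"
abbreviation (input) "yR \<equiv> 7 :: nat"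
abbreviation (input) "yTmp \<equiv> 8 :: nat"

abbreviation (input) Incr :: "nat \<Rightarrow> com" where "Incr x \<equiv> x ::= Arith Plus (Var x) (Const 1)"

text \<open>The language has only bounded loops. The exponent never exceeds \<open>n\<close>, so
  \<open>n\<close> iterations suffice, and linear time is within the budget.\<close>

definition prog_log :: com where
  "prog_log = vP ::= Const 1 ;;
     For vI vN (Cond (WLess (Var vP) (Arith Plus (Var vN) (Const 1)))
       (vP ::= Arith Times (Const 2) (Var vP) ;; Incr vL) Skip)"

text \<open>The factor 64 makes the sample size divided by \<open>32 * k\<close> equal to
  \<open>2 * ell\<close>, the exponent required when a cluster must be hit \<open>ell\<close>
  times.\<close>

definition prog_params :: "nat \<Rightarrow> nat \<Rightarrow> com" where
  "prog_params kap a = vEll ::= Arith Times (Const kap) (Var vL) ;;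
     vS ::= Arith Times (Const 64) (Arith Times (Var vK) (Var vEll)) ;;
     vTot ::= Arith Times (Var vS) (Var vEll) ;;
     vJ ::= Arith Times (Const (a + 2)) (Var vL)"

text \<open>Without a rounding instruction, the least sufficient rate is found by counting up. The
  count stops at \<open>n\<close>; in that case no group exceeds the rate and every point is
  kept.\<close>

definition prog_rate :: "nat \<Rightarrow> com" where
  "prog_rate mc = For vI vN
     (Cond (RLess (RArith Times (OfWord (Var vM)) (RArith Times (RVar yE) (RVar yE)))
                  (OfWord (Arith Times (Const mc) (Arith Times (Var vK) (Var vL)))))
        (Incr vM) Skip)"

definition prog_init :: com where
  "prog_init = For vI vN (WSet vU (Var vI) (Var vI)) ;; vCnt ::= Var vN"

text \<open>Sampling without replacement: moving the last entry into the gap keeps the live set a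
  prefix of the array. The sample has no duplicates, which the freshness of the weak queries relies
  on.\<close>

definition prog_sample :: com where
  "prog_sample = For vI vS (Draw vV (Var vCnt) ;; WSet vSmp (Var vI) (Cell vU (Var vV)) ;;
     vCnt ::= Arith Minus (Var vCnt) (Const 1) ;; WSet vU (Var vV) (Cell vU (Var vCnt)))"

definition prog_argmin :: com where
  "prog_argmin = vBest ::= Var vS ;;
     For vQ vS (Cond (WLess (Cell vUsed (Var vQ)) (Const 1))
       (Cond (WLess (Var vBest) (Var vS))
         (Cond (RLess (RCell yD (Var vQ)) (RCell yD (Var vBest))) (vBest ::= Var vQ) Skip)
         (vBest ::= Var vQ))
       Skip)"

definition prog_dists :: com where
  "prog_dists = For vQ vS (AskStrong yD (Var vQ) (Cell vSmp (Var vI)) (Cell vSmp (Var vQ)) ;;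
     WSet vUsed (Var vQ) (Const 0))"

text \<open>The picks come in order of distance, so the last value written to \<open>yRho\<close> is
  the radius of the block. Repeated minimum search is affordable since the sample has only about k
  points.\<close>

definition prog_pick :: com where
  "prog_pick = For vE vEll (prog_argmin ;; WSet vUsed (Var vBest) (Const 1) ;;
     WSet vBt (Arith Plus (Arith Times (Var vI) (Var vEll)) (Var vE)) (Var vBest) ;;
     RSet yRho (Var vI) (RCell yD (Var vBest)))"

definition prog_near :: com where
  "prog_near = For vI vS (prog_dists ;; prog_pick)"

definition prog_ask :: com where
  "prog_ask = For vI vS (AskWeak yA (Var vI) (Var vX) (Cell vSmp (Var vI)))"

text \<open>A substitute for computing a median: for each answer, count the answers of its block
  that do not exceed it. An answer that covers more than half of the block is an upper median or
  larger.\<close>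

definition prog_rank :: com where
  "prog_rank = vC ::= Const 0 ;;
     For vI vEll (Cond (RLess (RCell yA (Cell vBt (Var vE)))
         (RCell yA (Cell vBt (Arith Plus (Arith Times (Arith Divide (Var vE) (Var vEll)) (Var vEll)) (Var vI)))))
       Skip (Incr vC))"

definition prog_update :: com where
  "prog_update = yVal ::=R RVar yTmp ;; vB1 ::= Arith Divide (Var vE) (Var vEll) ;; vFlag ::= Const 1"

text \<open>Adding the block radius turns a distance to some member of the block into an upper bound
  on the distance to its sample point, so one minimum yields both a value and an owner.
  \<open>vFlag\<close> stands in for an initial value of infinity.\<close>

definition prog_select :: com where
  "prog_select = vFlag ::= Const 0 ;;
     For vE vTot (prog_rank ;;
       Cond (WLess (Var vEll) (Arith Times (Const 2) (Var vC)))
         (yTmp ::=R RArith Plus (RCell yA (Cell vBt (Var vE))) (RCell yRho (Arith Divide (Var vE) (Var vEll))) ;;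
          Cond (WLess (Const 0) (Var vFlag))
            (Cond (RLess (RVar yTmp) (RVar yVal)) prog_update Skip) prog_update)
         Skip)"

definition prog_values :: com where
  "prog_values = For vQ vCnt (vX ::= Cell vU (Var vQ) ;; prog_ask ;; prog_select ;;
     RSet yV (Var vQ) (RVar yVal) ;; WSet vOwn (Var vQ) (Var vB1) ;;
     Cond (WLess (Const 0) (Var vQ))
       (Cond (RLess (RVar yMax) (RVar yVal)) (yMax ::=R RVar yVal) Skip) (yMax ::=R RVar yVal))"

text \<open>Halving ends once half the radius would capture fewer than half of the points. Compared
  with an exact median this loses a factor of 2 and avoids sorting.\<close>

definition prog_radius :: com where
  "prog_radius = yR ::=R RVar yMax ;;
     For vI vJ (vC ::= Const 0 ;;
       For vQ vCnt (Cond (RLess (RArith Divide (RVar yR) (OfWord (Const 2))) (RCell yV (Var vQ))) Skip (Incr vC)) ;;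
       Cond (WLess (Arith Times (Const 2) (Var vC)) (Var vCnt)) Skip
         (yR ::=R RArith Divide (RVar yR) (OfWord (Const 2))))"

definition prog_groups :: com where
  "prog_groups = For vI vS (WSet vGc (Var vI) (Const 0)) ;;
     For vQ vCnt (Cond (RLess (RVar yR) (RCell yV (Var vQ))) Skip
       (WSet vGc (Cell vOwn (Var vQ)) (Arith Plus (Cell vGc (Cell vOwn (Var vQ))) (Const 1))))"

text \<open>\<open>vG\<close> stays 0 for sample points and for points that no round removes; the
  last stage outputs these with weight 1.\<close>

definition prog_remove :: com where
  "prog_remove = vU2 ::= Const 0 ;;
     For vQ vCnt (Cond (RLess (RVar yR) (RCell yV (Var vQ)))
       (WSet vU (Var vU2) (Cell vU (Var vQ)) ;; Incr vU2)
       (WSet vG (Cell vU (Var vQ)) (Cell vGc (Cell vOwn (Var vQ))))) ;;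
     vCnt ::= Var vU2"

definition prog_round :: com where
  "prog_round = Cond (WLess (Arith Times (Const 2) (Var vS)) (Var vCnt))
     (prog_sample ;; prog_near ;; prog_values ;; prog_radius ;; prog_groups ;; prog_remove) Skip"

text \<open>A uniform draw below the group size realizes the inclusion probability exactly, although
  the machine can only draw integers.\<close>

definition prog_out :: com where
  "prog_out = For vI vN
     (Cond (WLess (Var vM) (Cell vG (Var vI)))
       (Draw vV (Cell vG (Var vI)) ;;
        Cond (WLess (Var vV) (Var vM))
          (Output (Var vI) (RArith Divide (OfWord (Cell vG (Var vI))) (OfWord (Var vM)))) Skip)
       (Output (Var vI) (OfWord (Const 1))))"

definition prog_setup :: "nat \<Rightarrow> nat \<Rightarrow> nat \<Rightarrow> com" where
  "prog_setup kap a mc = prog_log ;; prog_params kap a ;; prog_rate mc ;; prog_init"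

definition prog_coreset :: "nat \<Rightarrow> nat \<Rightarrow> nat \<Rightarrow> com" where
  "prog_coreset kap a mc = prog_setup kap a mc ;; For vT vL prog_round ;; prog_out"

lemmas prog_defs = prog_log_def prog_params_def prog_rate_def prog_init_def prog_sample_def prog_argmin_def
  prog_dists_def prog_pick_def prog_near_def prog_ask_def prog_rank_def prog_update_def prog_select_def prog_values_def
  prog_radius_def prog_groups_def prog_remove_def prog_round_def prog_out_def prog_setup_def prog_coreset_def

text \<open>The strict inequality makes \<open>lg 1 = 1\<close>, and it ensures that nothing is left
  after halving \<open>n\<close> points \<open>lg n\<close> times.\<close>

definition lg :: "nat \<Rightarrow> nat" where
  "lg n = (LEAST l. n < 2 ^ l)"

lemma less_two_power_lg: "n < 2 ^ lg n"
  unfolding lg_def by (rule LeastI[of _ n]) simp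

lemma two_power_le: "l < lg n \<Longrightarrow> 2 ^ l \<le> n"
  unfolding lg_def using not_less_Least by (meson not_le)

lemma lg_le: "lg n \<le> n"
  unfolding lg_def by (rule Least_le) simp

lemma pair_index_inj:
  assumes "i < l" "i' < (l::nat)" shows "j * l + i = j' * l + i' \<longleftrightarrow> j = j' \<and> i = i'"
proof
  assume eq: "j * l + i = j' * l + i'"
  have "j = (j * l + i) div l" using assms by simp
  also have "\<dots> = j'" using eq assms by simp
  finally show "j = j' \<and> i = i'" using eq by simp
qed simp

lemma pair_index_less:
  assumes "j < s" "i < (l::nat)" shows "j * l + i < s * l"
proof -
  have "j * l + i < Suc j * l" using assms by simp
  also have "\<dots> \<le> s * l" using assms(1) by (intro mult_right_mono) auto
  finally show ?thesis .
qed

text \<open>If \<open>v\<close> is the last index, the update is vacuous and only the range shrinks.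
  Both cases are read through the index map that sends \<open>v\<close> to \<open>u\<close>.\<close>

lemma swap_remove:
  fixes f :: "nat \<Rightarrow> 'a"
  assumes "inj_on f {..<Suc u}" "v < Suc u"
  shows "inj_on (f(v := f u)) {..<u}" "(f(v := f u)) ` {..<u} = f ` {..<Suc u} - {f v}"
proof -
  show "inj_on (f(v := f u)) {..<u}"
  proof (rule inj_onI)
    fix x y assume xy: "x \<in> {..<u}" "y \<in> {..<u}" "(f(v := f u)) x = (f(v := f u)) y"
    then have "f (if x = v then u else x) = f (if y = v then u else y)" by auto
    then have "(if x = v then u else x) = (if y = v then u else y)"
      by (rule inj_onD[OF assms(1)]) (use xy in auto)
    then show "x = y" using xy by (auto split: if_splits)
  qed
  show "(f(v := f u)) ` {..<u} = f ` {..<Suc u} - {f v}"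
  proof (intro equalityI subsetI)
    fix y assume "y \<in> (f(v := f u)) ` {..<u}"
    then obtain i where "i < u" "y = (f(v := f u)) i" by auto
    then have "y = f (if i = v then u else i)" by auto
    moreover have "(if i = v then u else i) \<noteq> v" "(if i = v then u else i) < Suc u" using \<open>i < u\<close> by auto
    ultimately obtain i' where "y = f i'" "i' \<noteq> v" "i' < Suc u" by blast
    then show "y \<in> f ` {..<Suc u} - {f v}"
      using inj_onD[OF assms(1), of i' v] assms(2) by auto
  next
    fix y assume "y \<in> f ` {..<Suc u} - {f v}"
    then obtain i where i: "i < Suc u" "y = f i" "i \<noteq> v" by auto
    show "y \<in> (f(v := f u)) ` {..<u}"
    proof (cases "i = u")
      case True
      then have "v < u" using i assms by auto
      then show ?thesis using True i by (intro image_eqI[of _ _ v]) auto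
    next
      case False
      then show ?thesis using i by (intro image_eqI[of _ _ i]) auto
    qed
  qed
qed

section \<open>Sequencing with frames, recorded pairs and recorded output\<close>

context oracle_lang
begin

text \<open>Only the interesting effect of the first command has to be named; whatever it does not
  assign is passed on by the frame.\<close>

lemma sure_seqI:
  assumes "sure a s R" "\<And>s'. R s' \<Longrightarrow> frame (wmods a) (rmods a) s s' \<Longrightarrow> sure b s' Q"
  shows "sure (Seq a b) s Q"
  using sure_mono[OF sure_frame[OF assms(1)], of "\<lambda>s'. sure b s' Q"] assms(2) by simp

primrec asks :: "com \<Rightarrow> bool" where
  "asks Skip \<longleftrightarrow> False"
| "asks (WSet x i e) \<longleftrightarrow> False"
| "asks (RSet x i e) \<longleftrightarrow> False"
| "asks (Draw x e) \<longleftrightarrow> False"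
| "asks (AskWeak x i a b) \<longleftrightarrow> True"
| "asks (AskStrong x i a b) \<longleftrightarrow> False"
| "asks (Output e r) \<longleftrightarrow> False"
| "asks (Seq a b) \<longleftrightarrow> asks a \<or> asks b"
| "asks (Cond g a b) \<longleftrightarrow> asks a \<or> asks b"
| "asks (For x y c) \<longleftrightarrow> asks c"

primrec prints :: "com \<Rightarrow> bool" where
  "prints Skip \<longleftrightarrow> False"
| "prints (WSet x i e) \<longleftrightarrow> False"
| "prints (RSet x i e) \<longleftrightarrow> False"
| "prints (Draw x e) \<longleftrightarrow> False"
| "prints (AskWeak x i a b) \<longleftrightarrow> False"
| "prints (AskStrong x i a b) \<longleftrightarrow> False"
| "prints (Output e r) \<longleftrightarrow> True"
| "prints (Seq a b) \<longleftrightarrow> prints a \<or> prints b"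
| "prints (Cond g a b) \<longleftrightarrow> prints a \<or> prints b"
| "prints (For x y c) \<longleftrightarrow> prints c"

text \<open>Freshness depends on the queried pairs but not on the answers. The pairs stay ordered
  because the argument exploits that the second component is always a sample point.\<close>

definition weak_pairs :: "store \<Rightarrow> (nat \<times> nat) set" where
  "weak_pairs s = {(u, v). \<exists>r. WeakEv u v r \<in> set (events s)}"

lemma weak_pairs_simps [simp]:
  "weak_pairs (setw x i v s) = weak_pairs s" "weak_pairs (setr x i t s) = weak_pairs s"
  "weak_pairs (add_out p s) = weak_pairs s"
  "weak_pairs (log_events [WeakEv u v t] s) = insert (u, v) (weak_pairs s)"
  "weak_pairs (log_events (strong_events knd u v) s) = weak_pairs s"
  by (auto simp: weak_pairs_def) (cases knd; auto)+

lemma for_loop_invariant: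
  assumes "\<And>s s'. Some s' \<in> set_pmf (f s) \<Longrightarrow> h s' = h s" "\<And>i s. h (setw x 0 i s) = h s"
  shows "Some s' \<in> set_pmf (for_loop f x j m s) \<Longrightarrow> h s' = h s"
proof (induction m arbitrary: j s)
  case 0 then show ?case using assms(2) by auto
next
  case (Suc m)
  then obtain t where "Some t \<in> set_pmf (f (setw x 0 j s))" "Some s' \<in> set_pmf (for_loop f x (Suc j) m t)"
    by (auto simp: obind_def split: option.splits)
  then have "h t = h (setw x 0 j s)" "h s' = h t"
    using assms(1) Suc.IH by blast+
  then show ?case using assms(2) by simp
qed

lemma sem_weak_pairs: "Some s' \<in> set_pmf (sem c s) \<Longrightarrow> \<not> asks c \<Longrightarrow> weak_pairs s' = weak_pairs s"
proof (induction c arbitrary: s s')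
  case (Seq a b)
  then obtain t where "Some t \<in> set_pmf (sem a s)" "Some s' \<in> set_pmf (sem b t)"
    by (auto simp: obind_def split: option.splits)
  then show ?case using Seq by auto
next
  case (Cond g a b) then show ?case by (cases "gval s g") auto
next
  case (For x y c)
  then have "Some s' \<in> set_pmf (for_loop (sem c) x 0 (words s y 0) s)" by (auto split: if_splits)
  then show ?case
    by (rule for_loop_invariant[where f="sem c" and h=weak_pairs, rotated 2]) (use For in auto)
qed (auto split: if_splits)

lemma sem_outs: "Some s' \<in> set_pmf (sem c s) \<Longrightarrow> \<not> prints c \<Longrightarrow> outs s' = outs s"
proof (induction c arbitrary: s s')
  case (Seq a b)
  then obtain t where "Some t \<in> set_pmf (sem a s)" "Some s' \<in> set_pmf (sem b t)"
    by (auto simp: obind_def split: option.splits)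
  then show ?case using Seq by auto
next
  case (Cond g a b) then show ?case by (cases "gval s g") auto
next
  case (For x y c)
  then have "Some s' \<in> set_pmf (for_loop (sem c) x 0 (words s y 0) s)" by (auto split: if_splits)
  then show ?case
    by (rule for_loop_invariant[where f="sem c" and h=outs, rotated 2]) (use For in auto)
qed (auto split: if_splits)

lemma sure_weak_pairs: "sure c s Q \<Longrightarrow> \<not> asks c \<Longrightarrow> sure c s (\<lambda>s'. Q s' \<and> weak_pairs s' = weak_pairs s)"
  unfolding sure_def osure_def by (auto dest!: sem_weak_pairs bspec)

lemma sure_outs: "sure c s Q \<Longrightarrow> \<not> prints c \<Longrightarrow> sure c s (\<lambda>s'. Q s' \<and> outs s' = outs s)"
  unfolding sure_def osure_def by (auto dest!: sem_outs bspec)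

end

lemma sample_step:
  fixes f g :: "nat \<Rightarrow> nat"
  assumes "inj_on f {..<Suc w}" "inj_on g {..<j}" "g ` {..<j} \<union> f ` {..<Suc w} = U0"
    "g ` {..<j} \<inter> f ` {..<Suc w} = {}" "v < Suc w"
  shows "inj_on (f(v := f w)) {..<w}" "inj_on (g(j := f v)) {..<Suc j}"
    "(g(j := f v)) ` {..<Suc j} \<union> (f(v := f w)) ` {..<w} = U0"
    "(g(j := f v)) ` {..<Suc j} \<inter> (f(v := f w)) ` {..<w} = {}"
proof -
  note sr = swap_remove[OF assms(1,5)]
  have img: "(g(j := f v)) ` {..<Suc j} = insert (f v) (g ` {..<j})" by (auto simp: lessThan_Suc)
  have fv: "f v \<in> f ` {..<Suc w}" using assms(5) by auto
  show "inj_on (f(v := f w)) {..<w}" by (rule sr(1))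
  show "inj_on (g(j := f v)) {..<Suc j}"
  proof -
    have "inj_on (g(j := f v)) {..<j}" using assms(2) by (subst inj_on_cong[of _ _ g]) auto
    moreover have "(g(j := f v)) ` ({..<j} - {j}) = g ` {..<j}" by auto
    ultimately show ?thesis using assms(4) fv unfolding lessThan_Suc inj_on_insert by auto
  qed
  show "(g(j := f v)) ` {..<Suc j} \<union> (f(v := f w)) ` {..<w} = U0"
    unfolding img sr(2) using assms(3) fv by auto
  show "(g(j := f v)) ` {..<Suc j} \<inter> (f(v := f w)) ` {..<w} = {}"
    unfolding img sr(2) using assms(4) by auto
qed

section \<open>Parameters and specifications of the program parts\<close>

locale coreset_alg = oracle_lang kind B env n d adv
  for kind B env n d adv +
  fixes k kap mc aa :: nat and \<epsilon> :: real
  assumes n_pos: "1 \<le> n" and k_pos: "1 \<le> k" and kap_pos: "1 \<le> kap" and mc_pos: "1 \<le> mc"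
    and eps: "0 < \<epsilon>" "\<epsilon> < 1"
    and metric: "Metric_space {..<n} d"
    and env_eqs: "env vN = n" "env vCnt = n" "env vL = lg n" "env vEll = kap * lg n"
      "env vS = 64 * (k * (kap * lg n))" "env vTot = 64 * (k * (kap * lg n)) * (kap * lg n)"
      "env vJ = (aa + 2) * lg n"
    and B_large: "2 * n + 64 + 64 * (k * (kap * lg n)) * (kap * lg n) + (aa + 2) * lg n \<le> B"
begin

definition "L = lg n"
definition "ell = kap * L"
definition "sz = 64 * (k * ell)"
definition "halvings = (aa + 2) * L"
definition "rate = (LEAST i. i = n \<or> real (mc * (k * L)) \<le> real i * (\<epsilon> * \<epsilon>))"

lemma L_pos: "1 \<le> L"
  using n_pos less_two_power_lg[of n] by (cases "lg n") (auto simp: L_def)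

lemma ell_pos: "1 \<le> ell"
  using L_pos kap_pos by (simp add: ell_def Suc_le_eq)

lemma sz_ge: "64 * ell \<le> sz" "64 \<le> sz"
  using ell_pos k_pos by (auto simp: sz_def Suc_le_eq)

lemma env_simps: "env vN = n" "env vCnt = n" "env vL = L" "env vEll = ell" "env vS = sz"
  "env vTot = sz * ell" "env vJ = halvings"
  using env_eqs by (simp_all add: L_def ell_def sz_def halvings_def)

lemma bounds: "2 * n + 64 + sz * ell + halvings \<le> B"
  using B_large by (simp add: L_def ell_def sz_def halvings_def)

lemma sz_le: "sz \<le> sz * ell" "ell \<le> sz * ell"
  using ell_pos sz_ge by auto

lemma le_B: "x \<le> 2 * n \<Longrightarrow> x \<le> B" "x \<le> sz \<Longrightarrow> x \<le> B" "x \<le> ell \<Longrightarrow> x \<le> B" "x \<le> sz * ell \<Longrightarrow> x \<le> B"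
    "x \<le> halvings \<Longrightarrow> x \<le> B" "x \<le> 64 \<Longrightarrow> x \<le> B"
  using bounds sz_le by linarith+

lemma rate_le: "rate \<le> n"
  unfolding rate_def by (rule Least_le) simp

lemma rate_prop: "rate = n \<or> real (mc * (k * L)) \<le> real rate * (\<epsilon> * \<epsilon>)"
  unfolding rate_def by (rule LeastI[of _ n]) simp

lemma rate_less: "i < rate \<Longrightarrow> i \<noteq> n \<and> real i * (\<epsilon> * \<epsilon>) < real (mc * (k * L))"
  unfolding rate_def using not_less_Least by fastforce

lemma rate_pos: "1 \<le> rate"
proof (rule ccontr)
  assume "\<not> 1 \<le> rate"
  then have "rate = 0" by simp
  moreover have "0 < mc" "0 < k" "0 < L" using mc_pos k_pos L_pos by linarith+
  then have "0 < real (mc * (k * L))" by simp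
  ultimately show False using rate_prop n_pos by auto
qed

definition params :: "store \<Rightarrow> bool" where
  "params s \<longleftrightarrow> words s vN 0 = n \<and> words s vK 0 = k \<and> words s vL 0 = L \<and> words s vEll 0 = ell \<and>
     words s vS 0 = sz \<and> words s vTot 0 = sz * ell \<and> words s vJ 0 = halvings \<and> words s vM 0 = rate"

lemma params_frame:
  assumes "params s" "frame X Y s s'" "vN \<notin> X" "vK \<notin> X" "vL \<notin> X" "vEll \<notin> X" "vS \<notin> X" "vTot \<notin> X" "vJ \<notin> X" "vM \<notin> X"
  shows "params s'"
  using assms unfolding params_def frame_def by metis

lemma spec_log:
  assumes "words s vN 0 = n" "words s vL 0 = 0"
  shows "sure prog_log s (\<lambda>s'. words s' vL 0 = L)"
  unfolding prog_log_def
proof (simp only: sure_simps(2,8) wval.simps, intro conjI)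
  \<comment> \<open>The exponent grows in step with the loop counter until it reaches
    \<open>L\<close> and then stays, whence the implication in the last conjunct.\<close>
  let ?I = "\<lambda>i (t::store). words t vN 0 = n \<and> words t vP 0 = 2 ^ words t vL 0 \<and> words t vL 0 \<le> L \<and> (words t vL 0 < L \<longrightarrow> words t vL 0 = i)"
  show "1 \<le> B" by (rule le_B) simp
  show "sure (For vI vN (Cond (WLess (Var vP) (Arith Plus (Var vN) (Const 1)))
       (vP ::= Arith Times (Const 2) (Var vP) ;; Incr vL) Skip)) (setw vP 0 1 s) (\<lambda>s'. words s' vL 0 = L)"
  proof (rule sure_For[where N=n and I="?I"])
    fix i t assume I: "?I i t" "i < n" "words t vI 0 = i"
    show "sure (Cond (WLess (Var vP) (Arith Plus (Var vN) (Const 1)))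
       (vP ::= Arith Times (Const 2) (Var vP) ;; Incr vL) Skip) t (\<lambda>s'. ?I (Suc i) (setw vI 0 (Suc i) s'))"
    proof (cases "2 ^ words t vL 0 \<le> n")
      case True
      have "words t vL 0 < L"
      proof (rule ccontr)
        assume "\<not> words t vL 0 < L"
        then have "(2::nat) ^ L \<le> 2 ^ words t vL 0" by (intro power_increasing) auto
        then show False using True less_two_power_lg[of n] unfolding L_def by linarith
      qed
      moreover have "L \<le> n" using lg_le by (simp add: L_def)
      ultimately show ?thesis using I True le_B(1)[of "2 * 2 ^ words t vL 0"] le_B(1)[of "Suc (words t vL 0)"]
        by (auto simp: less_Suc_eq_le)
    next
      case False
      then have "words t vL 0 = L" using I two_power_le[of "words t vL 0" n] unfolding L_def by linarith
      then show ?thesis using I False by (auto simp: less_Suc_eq_le)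
    qed
  next
    fix t assume "?I n t" "words t vI 0 = n"
    then show "words t vL 0 = L" using lg_le[of n] by (auto simp: L_def)
  qed (use assms env_simps in auto)
qed

lemma spec_params:
  assumes "words s vL 0 = L" "words s vK 0 = k"
  shows "sure (prog_params kap aa) s (\<lambda>s'. words s' vEll 0 = ell \<and> words s' vS 0 = sz \<and> words s' vTot 0 = sz * ell \<and> words s' vJ 0 = halvings)"
  using assms le_B(2)[of sz] le_B(3)[of ell] le_B(4)[of "sz * ell"] le_B(5)[of halvings]
  by (auto simp: prog_params_def ell_def[symmetric] sz_def[symmetric] halvings_def)

lemma spec_rate:
  assumes "words s vN 0 = n" "words s vL 0 = L" "words s vK 0 = k" "words s vM 0 = 0" "reals s yE 0 = \<epsilon>"
  shows "sure (prog_rate mc) s (\<lambda>s'. words s' vM 0 = rate)"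
  unfolding prog_rate_def
proof (rule sure_For[where N=n and I="\<lambda>i t. words t vL 0 = L \<and> words t vK 0 = k \<and> reals t yE 0 = \<epsilon> \<and> words t vM 0 = min i rate"])
  fix i and t :: store assume I: "words t vL 0 = L \<and> words t vK 0 = k \<and> reals t yE 0 = \<epsilon> \<and> words t vM 0 = min i rate" "i < n"
  \<comment> \<open>By minimality of \<open>rate\<close> the test succeeds exactly for smaller
    counters; if \<open>rate = n\<close>, the loop ends before the test can fail.\<close>
  have "real (min i rate) * (\<epsilon> * \<epsilon>) < real (mc * (k * L)) \<longleftrightarrow> i < rate"
    using rate_less[of i] rate_prop I(2) by (cases "i = rate") (auto simp: min_def not_less)
  then show "sure (Cond (RLess (RArith Times (OfWord (Var vM)) (RArith Times (RVar yE) (RVar yE)))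
                  (OfWord (Arith Times (Const mc) (Arith Times (Var vK) (Var vL))))) (Incr vM) Skip) t
     (\<lambda>s'. words (setw vI 0 (Suc i) s') vL 0 = L \<and> words (setw vI 0 (Suc i) s') vK 0 = k \<and>
        reals (setw vI 0 (Suc i) s') yE 0 = \<epsilon> \<and> words (setw vI 0 (Suc i) s') vM 0 = min (Suc i) rate)"
    using I le_B(1)[of "Suc i"] by (auto simp: min_def not_less)
qed (use assms env_simps rate_le in auto)

lemma spec_init:
  assumes "words s vN 0 = n"
  shows "sure prog_init s (\<lambda>s'. (\<forall>i<n. words s' vU i = i) \<and> words s' vCnt 0 = n)"
  unfolding prog_init_def
proof (rule sure_seqI)
  show "sure (For vI vN (WSet vU (Var vI) (Var vI))) s (\<lambda>s'. words s' vN 0 = n \<and> (\<forall>i<n. words s' vU i = i))"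
    by (rule sure_For[where N=n and I="\<lambda>i t. words t vN 0 = n \<and> (\<forall>j<i. words t vU j = j)"])
       (use assms env_simps le_B(1) in \<open>auto simp: less_Suc_eq\<close>)
qed (use le_B(1)[of n] in auto)

lemma spec_setup:
  assumes "words s vN 0 = n" "words s vK 0 = k" "words s vL 0 = 0" "words s vM 0 = 0" "reals s yE 0 = \<epsilon>"
  shows "sure (prog_setup kap aa mc) s (\<lambda>s'. params s' \<and> (\<forall>i<n. words s' vU i = i) \<and> words s' vCnt 0 = n)"
  unfolding prog_setup_def
proof (rule sure_seqI[OF spec_log])
  fix s1 assume s1: "words s1 vL 0 = L" "frame (wmods prog_log) (rmods prog_log) s s1"
  have f1: "words s1 vN 0 = n" "words s1 vK 0 = k" "words s1 vM 0 = 0" "reals s1 yE 0 = \<epsilon>"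
    using s1(2) assms by (auto simp: frame_def prog_log_def)
  show "sure (prog_params kap aa ;; prog_rate mc ;; prog_init) s1 (\<lambda>s'. params s' \<and> (\<forall>i<n. words s' vU i = i) \<and> words s' vCnt 0 = n)"
  proof (rule sure_seqI[OF spec_params])
    fix s2 assume s2: "words s2 vEll 0 = ell \<and> words s2 vS 0 = sz \<and> words s2 vTot 0 = sz * ell \<and> words s2 vJ 0 = halvings"
      "frame (wmods (prog_params kap aa)) (rmods (prog_params kap aa)) s1 s2"
    have f2: "words s2 vN 0 = n" "words s2 vK 0 = k" "words s2 vL 0 = L" "words s2 vM 0 = 0" "reals s2 yE 0 = \<epsilon>"
      using s2(2) s1(1) f1 by (auto simp: frame_def prog_params_def)
    show "sure (prog_rate mc ;; prog_init) s2 (\<lambda>s'. params s' \<and> (\<forall>i<n. words s' vU i = i) \<and> words s' vCnt 0 = n)"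
    proof (rule sure_seqI[OF spec_rate])
      fix s3 assume s3: "words s3 vM 0 = rate" "frame (wmods (prog_rate mc)) (rmods (prog_rate mc)) s2 s3"
      have f3: "params s3" using s3 s2(1) f2 by (auto simp: frame_def prog_rate_def params_def)
      then have "words s3 vN 0 = n" by (simp add: params_def)
      from sure_frame[OF spec_init[OF this]]
      show "sure prog_init s3 (\<lambda>s'. params s' \<and> (\<forall>i<n. words s' vU i = i) \<and> words s' vCnt 0 = n)"
      proof (rule sure_mono)
        fix s' assume *: "((\<forall>i<n. words s' vU i = i) \<and> words s' vCnt 0 = n) \<and> frame (wmods prog_init) (rmods prog_init) s3 s'"
        then have "params s'" by (intro params_frame[OF f3]) (auto simp: prog_init_def)
        then show "params s' \<and> (\<forall>i<n. words s' vU i = i) \<and> words s' vCnt 0 = n" using * by simp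
      qed
    qed (use f2 in auto)
  qed (use f1 s1 in auto)
qed (use assms in auto)

text \<open>The set \<open>U0\<close> stays split into the drawn points and the prefix still
  available, so each draw is uniform on what remains.\<close>

definition sampling :: "nat \<Rightarrow> nat set \<Rightarrow> nat \<Rightarrow> store \<Rightarrow> bool" where
  "sampling u U0 j t \<longleftrightarrow> words t vCnt 0 = u - j \<and> inj_on (words t vU) {..<u - j} \<and> inj_on (words t vSmp) {..<j} \<and>
     words t vSmp ` {..<j} \<union> words t vU ` {..<u - j} = U0 \<and> words t vSmp ` {..<j} \<inter> words t vU ` {..<u - j} = {}"

definition sample_next :: "nat \<Rightarrow> nat \<Rightarrow> store \<Rightarrow> store" where
  "sample_next u v t = (let j = words t vI 0 in
     setw vU v (words t vU (u - Suc j)) (setw vCnt 0 (u - Suc j) (setw vSmp j (words t vU v) (setw vV 0 v t))))"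

lemma sampling_next:
  assumes "sampling u U0 j t" "j < u" "v < u - j" "words t vI 0 = j"
  shows "sampling u U0 (Suc j) (setw vI 0 (Suc j) (sample_next u v t))"
proof -
  obtain w where w: "u - j = Suc w" using assms(2) by (metis Suc_diff_Suc)
  then have w': "u - Suc j = w" by simp
  show ?thesis using sample_step[of "words t vU" w "words t vSmp" j U0 v] assms
    unfolding sampling_def by (simp add: sample_next_def Let_def w w' assms(4))
qed

definition sample_body :: com where
  "sample_body = Draw vV (Var vCnt) ;; WSet vSmp (Var vI) (Cell vU (Var vV)) ;;
     vCnt ::= Arith Minus (Var vCnt) (Const 1) ;; WSet vU (Var vV) (Cell vU (Var vCnt))"

lemma sampling_less:
  assumes "sampling u U0 j t" "U0 \<subseteq> {..<n}" "i < u - j" shows "words t vU i < n"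
proof -
  have "words t vU i \<in> U0" using assms(1,3) unfolding sampling_def by blast
  then show ?thesis using assms(2) by auto
qed

lemma sample_body_ok:
  assumes "sampling u U0 j t" "U0 \<subseteq> {..<n}" "j < u" "words t vI 0 = j" "u \<le> n" "v < u - j"
  shows "words t vU v \<le> B" "u - Suc j \<le> B" "((words t vU) (u - Suc j)) \<le> B"
proof -
  have "words t vU v < n" "words t vU (u - Suc j) < n"
    using sampling_less[OF assms(1,2)] assms(3,6) by (auto simp: diff_less_mono2)
  then show "words t vU v \<le> B" "u - Suc j \<le> B" "words t vU (u - Suc j) \<le> B"
    using assms(5) by (auto intro!: le_B(1))
qed

lemma sure_sample_body:
  assumes "sampling u U0 j t" "U0 \<subseteq> {..<n}" "j < u" "words t vI 0 = j" "u \<le> n"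
  shows "sure sample_body t Q \<longleftrightarrow> (\<forall>v<u - j. Q (sample_next u v t))"
proof -
  have c: "words t vCnt 0 = u - j" using assms(1) by (simp add: sampling_def)
  have "u - j \<le> B" using le_B(1)[of "u - j"] assms(5) by simp
  then show ?thesis using assms(3) sample_body_ok[OF assms] c assms(4)
    by (auto simp: sample_body_def sample_next_def Let_def Suc_diff_Suc)
qed

lemma expect_sample_body:
  assumes "sampling u U0 j t" "U0 \<subseteq> {..<n}" "j < u" "words t vI 0 = j" "u \<le> n"
  shows "expect sample_body t Q = (\<integral>\<^sup>+v. Q (sample_next u v t) \<partial>measure_pmf (pmf_of_set {..<u - j}))"
proof -
  have c: "words t vCnt 0 = u - j" using assms(1) by (simp add: sampling_def)
  have "u - j \<le> B" using le_B(1)[of "u - j"] assms(5) by simp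
  moreover have "expect (WSet vSmp (Var vI) (Cell vU (Var vV)) ;; vCnt ::= Arith Minus (Var vCnt) (Const 1) ;;
      WSet vU (Var vV) (Cell vU (Var vCnt))) (setw vV 0 v t) Q = Q (sample_next u v t)" if "v < u - j" for v
    using sample_body_ok[OF assms that] c assms(4) by (simp add: sample_next_def Let_def)
  ultimately show ?thesis
    unfolding sample_body_def expect_simps(8)[of "Draw vV (Var vCnt)"] expect_simps(4) using c assms(3)
    by (auto intro!: nn_integral_cong_AE simp: AE_measure_pmf_iff set_pmf_lessThan simp del: expect_simps)
qed

lemma spec_sample:
  assumes "words s vCnt 0 = u" "inj_on (words s vU) {..<u}" "words s vU ` {..<u} = U0" "U0 \<subseteq> {..<n}" "sz < u" "u \<le> n"
    and "words s vS 0 = sz"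
  shows "sure prog_sample s (sampling u U0 sz)"
  unfolding prog_sample_def sample_body_def[symmetric]
proof (rule sure_For[where N=sz and I="sampling u U0"])
  fix i t assume *: "sampling u U0 i t" "i < sz" "words t vI 0 = i"
  then show "sure sample_body t (\<lambda>s'. sampling u U0 (Suc i) (setw vI 0 (Suc i) s'))"
    using assms by (subst sure_sample_body[of u U0 i]) (auto intro!: sampling_next)
qed (use assms env_simps in \<open>auto simp: sampling_def\<close>)

text \<open>\<open>sz\<close> is not the index of a sample point and serves as the initial value
  meaning that no candidate has been found.\<close>

lemma spec_argmin:
  assumes "words s vS 0 = sz" "\<exists>q<sz. words s vUsed q = 0"
  shows "sure prog_argmin s (\<lambda>s'. words s' vBest 0 < sz \<and> words s vUsed (words s' vBest 0) = 0 \<and>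
     (\<forall>q<sz. words s vUsed q = 0 \<longrightarrow> reals s yD (words s' vBest 0) \<le> reals s yD q))"
  unfolding prog_argmin_def
proof (simp only: sure_simps(2,8) wval.simps assms(1), intro conjI)
  let ?u = "words s vUsed" and ?D = "reals s yD"
  let ?I = "\<lambda>i (t::store). words t vS 0 = sz \<and> words t vUsed = ?u \<and> reals t yD = ?D \<and>
     (words t vBest 0 = sz \<and> (\<forall>q<i. ?u q \<noteq> 0) \<or> words t vBest 0 < sz \<and> ?u (words t vBest 0) = 0 \<and>
        (\<forall>q<i. ?u q = 0 \<longrightarrow> ?D (words t vBest 0) \<le> ?D q))"
  show "sz \<le> B" by (rule le_B) simp
  show "sure (For vQ vS (Cond (WLess (Cell vUsed (Var vQ)) (Const 1))
       (Cond (WLess (Var vBest) (Var vS))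
         (Cond (RLess (RCell yD (Var vQ)) (RCell yD (Var vBest))) (vBest ::= Var vQ) Skip)
         (vBest ::= Var vQ))
       Skip)) (setw vBest 0 sz s) (\<lambda>s'. words s' vBest 0 < sz \<and> ?u (words s' vBest 0) = 0 \<and>
     (\<forall>q<sz. ?u q = 0 \<longrightarrow> ?D (words s' vBest 0) \<le> ?D q))"
  proof (rule sure_For[where N=sz and I="?I"])
    fix i t assume I: "?I i t" "i < sz" "words t vQ 0 = i"
    then have iB: "i \<le> B" using le_B(2)[of i] by simp
    let ?b = "words t vBest 0"
    have t: "words t vS 0 = sz" "words t vUsed = ?u" "reals t yD = ?D" using I(1) by simp_all
    show "sure (Cond (WLess (Cell vUsed (Var vQ)) (Const 1))
       (Cond (WLess (Var vBest) (Var vS))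
         (Cond (RLess (RCell yD (Var vQ)) (RCell yD (Var vBest))) (vBest ::= Var vQ) Skip)
         (vBest ::= Var vQ)) Skip) t (\<lambda>s'. ?I (Suc i) (setw vQ 0 (Suc i) s'))"
    proof (cases "?u i = 0")
      case False then show ?thesis using I by (simp add: less_Suc_eq_le le_less)
    next
      case used: True
      show ?thesis
      proof (cases "?b < sz")
        case True
        then have b: "?u ?b = 0" "\<And>q. q < i \<Longrightarrow> ?u q = 0 \<Longrightarrow> ?D ?b \<le> ?D q" using I by auto
        show ?thesis
        proof (cases "?D i < ?D ?b")
          case lt: True
          have "?D i \<le> ?D q" if "q < Suc i" "?u q = 0" for q
            using b(2)[of q] that lt by (cases "q = i") auto
          then show ?thesis using used True lt t iB I(2,3) by simp
        next
          case ge: False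
          have "?D ?b \<le> ?D q" if "q < Suc i" "?u q = 0" for q
            using b(2)[of q] that ge by (cases "q = i") auto
          then show ?thesis using used True ge t iB I(3) b(1) by simp
        qed
      next
        case False
        then have no: "?u q \<noteq> 0" if "q < i" for q using I(1) that by simp
        have "?D i \<le> ?D q" if "q < Suc i" "?u q = 0" for q
          using no[of q] that by (cases "q = i") auto
        then show ?thesis using used False t iB I(2,3) by simp
      qed
    qed
  qed (use assms env_simps in auto)
qed

end

lemma card_less_Suc_filter:
  "card {j. j < Suc i \<and> P j} = card {j. j < i \<and> P j} + (if P i then 1 else 0)"
proof -
  have "{j. j < Suc i \<and> P j} = (if P i then insert i {j. j < i \<and> P j} else {j. j < i \<and> P j})"
    by (auto simp: less_Suc_eq)
  then show ?thesis by simp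
qed

lemma card_less_filter_le: "card {j. j < i \<and> P j} \<le> (i::nat)"
  using card_mono[of "{..<i}" "{j. j < i \<and> P j}"] by auto

text \<open>Minima are extracted in nondecreasing order. The newest distance therefore dominates the
  earlier ones, and a strictly smaller distance can only belong to an earlier pick, of which there
  are \<open>i\<close>.\<close>

lemma pick_step:
  fixes bt :: "nat \<Rightarrow> nat" and D :: "nat \<Rightarrow> real"
  assumes "inj_on bt {..<i}" "b \<notin> bt ` {..<i}" "\<And>q. q < s \<Longrightarrow> q \<notin> bt ` {..<i} \<Longrightarrow> D b \<le> D q" "b < s"
    "\<And>i'. i' < i \<Longrightarrow> D (bt i') \<le> rho" "0 < i \<Longrightarrow> rho \<le> D b"
  shows "inj_on (bt(i := b)) {..<Suc i}" "\<And>i'. i' < Suc i \<Longrightarrow> D ((bt(i := b)) i') \<le> D b"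
    "card {q. q < s \<and> D q < D b} < Suc i"
proof -
  have "inj_on (bt(i := b)) {..<i}" using assms(1) by (subst inj_on_cong[of _ _ bt]) auto
  moreover have "(bt(i := b)) ` ({..<i} - {i}) = bt ` {..<i}" by auto
  ultimately show "inj_on (bt(i := b)) {..<Suc i}" using assms(2) unfolding lessThan_Suc inj_on_insert by auto
  show "D ((bt(i := b)) i') \<le> D b" if "i' < Suc i" for i'
  proof (cases "i' = i")
    case False
    then have "i' < i" using that by simp
    then have "D (bt i') \<le> rho" "rho \<le> D b" using assms by auto
    then show ?thesis using False by simp
  qed simp
  have "{q. q < s \<and> D q < D b} \<subseteq> bt ` {..<i}" using assms(3) by force
  then have "card {q. q < s \<and> D q < D b} \<le> card (bt ` {..<i})" by (intro card_mono) auto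
  also have "\<dots> \<le> i" using card_image_le[of "{..<i}" bt] by simp
  finally show "card {q. q < s \<and> D q < D b} < Suc i" by simp
qed

context coreset_alg
begin

lemma spec_dists:
  assumes "words s vS 0 = sz" "words s vI 0 = j" "j < sz" "\<And>q. q < sz \<Longrightarrow> words s vSmp q < n"
  shows "sure prog_dists s (\<lambda>s'. \<forall>q<sz. reals s' yD q = d (words s vSmp j) (words s vSmp q) \<and> words s' vUsed q = 0)"
  unfolding prog_dists_def
  by (rule sure_For[where N=sz and I="\<lambda>i t. words t vI 0 = j \<and> words t vSmp = words s vSmp \<and>
      (\<forall>q<i. reals t yD q = d (words s vSmp j) (words s vSmp q) \<and> words t vUsed q = 0)"])
     (use assms env_simps in \<open>auto simp: less_Suc_eq\<close>)

definition picked :: "nat \<Rightarrow> store \<Rightarrow> nat \<Rightarrow> nat" where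
  "picked j t i = words t vBt (j * ell + i)"

lemma spec_pick:
  assumes "words s vS 0 = sz" "words s vEll 0 = ell" "words s vI 0 = j" "\<And>q. q < sz \<Longrightarrow> words s vUsed q = 0"
    and D: "reals s yD = D"
  shows "sure prog_pick s (\<lambda>s'. (\<forall>i<ell. picked j s' i < sz \<and> D (picked j s' i) \<le> reals s' yRho j) \<and>
     inj_on (picked j s') {..<ell} \<and> card {q. q < sz \<and> D q < reals s' yRho j} < ell \<and>
     (\<forall>p. (\<forall>i<ell. p \<noteq> j * ell + i) \<longrightarrow> words s' vBt p = words s vBt p) \<and>
     (\<forall>j'. j' \<noteq> j \<longrightarrow> reals s' yRho j' = reals s yRho j'))"
  unfolding prog_pick_def
proof (rule sure_For[where N=ell and I="\<lambda>i t. words t vS 0 = sz \<and> words t vEll 0 = ell \<and> words t vI 0 = j \<and> reals t yD = D \<and>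
      (\<forall>q<sz. words t vUsed q = 0 \<longleftrightarrow> q \<notin> picked j t ` {..<i}) \<and> picked j t ` {..<i} \<subseteq> {..<sz} \<and>
      inj_on (picked j t) {..<i} \<and> (\<forall>i'<i. D (picked j t i') \<le> reals t yRho j) \<and>
      (0 < i \<longrightarrow> (\<forall>q<sz. q \<notin> picked j t ` {..<i} \<longrightarrow> reals t yRho j \<le> D q) \<and> card {q. q < sz \<and> D q < reals t yRho j} < i) \<and>
      (\<forall>p. (\<forall>i<ell. p \<noteq> j * ell + i) \<longrightarrow> words t vBt p = words s vBt p) \<and>
      (\<forall>j'. j' \<noteq> j \<longrightarrow> reals t yRho j' = reals s yRho j')"], goal_cases)
  case (4 i t)
  then have I: "words t vS 0 = sz" "words t vEll 0 = ell" "words t vI 0 = j" "reals t yD = D"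
      "\<And>q. q < sz \<Longrightarrow> words t vUsed q = 0 \<longleftrightarrow> q \<notin> picked j t ` {..<i}" "picked j t ` {..<i} \<subseteq> {..<sz}"
      "inj_on (picked j t) {..<i}" "\<And>i'. i' < i \<Longrightarrow> D (picked j t i') \<le> reals t yRho j"
      "\<And>q. 0 < i \<Longrightarrow> q < sz \<Longrightarrow> q \<notin> picked j t ` {..<i} \<Longrightarrow> reals t yRho j \<le> D q" 
      "\<And>p. (\<forall>i<ell. p \<noteq> j * ell + i) \<Longrightarrow> words t vBt p = words s vBt p"
      "\<And>j'. j' \<noteq> j \<Longrightarrow> reals t yRho j' = reals s yRho j'" "i < ell" "words t vE 0 = i" by blast+
  \<comment> \<open>Fewer than \<open>ell\<close> indices are in use and
    \<open>ell \<le> sz\<close>, so the minimum search has a candidate.\<close>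
  have "card (picked j t ` {..<i}) \<le> i" using card_image_le[of "{..<i}" "picked j t"] by simp
  also have "i < card {..<sz}" using I(12) sz_ge(1) by simp
  finally have "picked j t ` {..<i} \<subset> {..<sz}" using I(6) by auto
  then have ex: "\<exists>q<sz. words t vUsed q = 0" using I(5) by auto
  show ?case
  proof (rule sure_seqI[OF spec_argmin[OF I(1) ex]])
    fix t1 assume t1: "words t1 vBest 0 < sz \<and> words t vUsed (words t1 vBest 0) = 0 \<and>
       (\<forall>q<sz. words t vUsed q = 0 \<longrightarrow> reals t yD (words t1 vBest 0) \<le> reals t yD q)"
      "frame (wmods prog_argmin) (rmods prog_argmin) t t1"
    define b where "b = words t1 vBest 0"
    have b: "b < sz" "b \<notin> picked j t ` {..<i}" "\<And>q. q < sz \<Longrightarrow> q \<notin> picked j t ` {..<i} \<Longrightarrow> D b \<le> D q" "b \<le> B"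
      using t1(1) I(4,5) le_B(2)[of b] by (auto simp: b_def)
    have f: "words t1 vS = words t vS" "words t1 vEll = words t vEll" "words t1 vI = words t vI" "reals t1 = reals t"
      "words t1 vUsed = words t vUsed" "words t1 vBt = words t vBt" "words t1 vE = words t vE"
      using t1(2) by (auto simp: frame_def prog_argmin_def)
    define t2 where "t2 = setr yRho j (D b) (setw vBt (j * ell + i) b (setw vUsed b 1 t1))"
    have pk: "picked j (setw vE 0 (Suc i) t2) = (picked j t)(i := b)"
      by (auto simp: picked_def t2_def f fun_eq_iff)
    note step = pick_step[OF I(7) b(2,3,1) I(8) I(9)[OF _ b(1,2)]]
    have img: "((picked j t)(i := b)) ` {..<Suc i} = insert b (picked j t ` {..<i})"
      by (auto simp: lessThan_Suc)
    have ne: "p \<noteq> j * ell + i" if "\<forall>i<ell. p \<noteq> j * ell + i" for p using that I(12) by auto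
    have "sure (WSet vUsed (Var vBest) (Const 1) ;;
       WSet vBt (Arith Plus (Arith Times (Var vI) (Var vEll)) (Var vE)) (Var vBest) ;;
       RSet yRho (Var vI) (RCell yD (Var vBest))) t1 (\<lambda>s'. s' = t2)"
      using b(4) le_B(6)[of 1] by (simp add: t2_def f I b_def[symmetric])
    then show "sure (WSet vUsed (Var vBest) (Const 1) ;;
       WSet vBt (Arith Plus (Arith Times (Var vI) (Var vEll)) (Var vE)) (Var vBest) ;;
       RSet yRho (Var vI) (RCell yD (Var vBest))) t1 (\<lambda>s'. words (setw vE 0 (Suc i) s') vS 0 = sz \<and>
      words (setw vE 0 (Suc i) s') vEll 0 = ell \<and> words (setw vE 0 (Suc i) s') vI 0 = j \<and> reals (setw vE 0 (Suc i) s') yD = D \<and>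
      (\<forall>q<sz. words (setw vE 0 (Suc i) s') vUsed q = 0 \<longleftrightarrow> q \<notin> picked j (setw vE 0 (Suc i) s') ` {..<Suc i}) \<and>
      picked j (setw vE 0 (Suc i) s') ` {..<Suc i} \<subseteq> {..<sz} \<and>
      inj_on (picked j (setw vE 0 (Suc i) s')) {..<Suc i} \<and>
      (\<forall>i'<Suc i. D (picked j (setw vE 0 (Suc i) s') i') \<le> reals (setw vE 0 (Suc i) s') yRho j) \<and>
      (0 < Suc i \<longrightarrow> (\<forall>q<sz. q \<notin> picked j (setw vE 0 (Suc i) s') ` {..<Suc i} \<longrightarrow> reals (setw vE 0 (Suc i) s') yRho j \<le> D q) \<and>
         card {q. q < sz \<and> D q < reals (setw vE 0 (Suc i) s') yRho j} < Suc i) \<and>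
      (\<forall>p. (\<forall>i<ell. p \<noteq> j * ell + i) \<longrightarrow> words (setw vE 0 (Suc i) s') vBt p = words s vBt p) \<and>
      (\<forall>j'. j' \<noteq> j \<longrightarrow> reals (setw vE 0 (Suc i) s') yRho j' = reals s yRho j'))"
    proof (rule sure_mono, goal_cases)
      case (1 s')
      then have s': "s' = t2" .
      show ?case unfolding s' pk img
      proof (intro conjI)
        show "\<forall>q<sz. words (setw vE 0 (Suc i) t2) vUsed q = 0 \<longleftrightarrow> q \<notin> insert b (picked j t ` {..<i})"
          using I(5) by (simp add: t2_def f)
        show "\<forall>i'<Suc i. D (((picked j t)(i := b)) i') \<le> reals (setw vE 0 (Suc i) t2) yRho j"
          using step(2) by (simp add: t2_def)
        show "0 < Suc i \<longrightarrow> (\<forall>q<sz. q \<notin> insert b (picked j t ` {..<i}) \<longrightarrow> reals (setw vE 0 (Suc i) t2) yRho j \<le> D q) \<and>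
           card {q. q < sz \<and> D q < reals (setw vE 0 (Suc i) t2) yRho j} < Suc i"
          using b(3) step(3) by (simp add: t2_def)
        show "\<forall>p. (\<forall>i<ell. p \<noteq> j * ell + i) \<longrightarrow> words (setw vE 0 (Suc i) t2) vBt p = words s vBt p"
          using I(10) ne by (simp add: t2_def f)
      qed (use I b step(1) in \<open>auto simp: t2_def f\<close>)
    qed
  qed
next
  case (5 t)
  then show ?case using ell_pos by auto
qed (use assms env_simps in \<open>auto simp: picked_def\<close>)

text \<open>The last conjunct says that the block radius does not exceed the distance of the
  \<open>ell\<close>-th nearest sample point. Together with \<open>ell\<close> hits in one cluster
  it bounds the block radius by the diameter of the cluster.\<close>

definition near_ok :: "(nat \<Rightarrow> nat) \<Rightarrow> nat \<Rightarrow> store \<Rightarrow> bool" where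
  "near_ok \<sigma> j t \<longleftrightarrow> (\<forall>i<ell. picked j t i < sz \<and> d (\<sigma> j) (\<sigma> (picked j t i)) \<le> reals t yRho j) \<and>
     inj_on (picked j t) {..<ell} \<and> card {q. q < sz \<and> d (\<sigma> j) (\<sigma> q) < reals t yRho j} < ell"

lemma spec_near:
  assumes "words s vS 0 = sz" "words s vEll 0 = ell" "\<And>q. q < sz \<Longrightarrow> words s vSmp q < n"
  shows "sure prog_near s (\<lambda>s'. \<forall>j<sz. near_ok (words s vSmp) j s')"
  unfolding prog_near_def
proof (rule sure_For[where N=sz and I="\<lambda>i t. words t vS 0 = sz \<and> words t vEll 0 = ell \<and> words t vSmp = words s vSmp \<and>
     (\<forall>j<i. near_ok (words s vSmp) j t)"], goal_cases)
  case (4 j t)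
  let ?\<sigma> = "words s vSmp"
  have t: "words t vS 0 = sz" "words t vEll 0 = ell" "words t vSmp = ?\<sigma>" "\<And>j'. j' < j \<Longrightarrow> near_ok ?\<sigma> j' t" "words t vI 0 = j"
    using 4 by auto
  show ?case
  proof (rule sure_seqI[OF spec_dists[where j=j and s=t]])
    fix t1 assume t1: "\<forall>q<sz. reals t1 yD q = d (words t vSmp j) (words t vSmp q) \<and> words t1 vUsed q = 0"
      "frame (wmods prog_dists) (rmods prog_dists) t t1"
    have f: "words t1 vS = words t vS" "words t1 vEll = words t vEll" "words t1 vI = words t vI" "words t1 vSmp = words t vSmp"
      "words t1 vBt = words t vBt" "reals t1 yRho = reals t yRho"
      using t1(2) by (auto simp: frame_def prog_dists_def)
    have D: "reals t1 yD q = d (?\<sigma> j) (?\<sigma> q)" if "q < sz" for q using t1(1) t that by simp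
    have "sure prog_pick t1 (\<lambda>s'. ((\<forall>i<ell. picked j s' i < sz \<and> reals t1 yD (picked j s' i) \<le> reals s' yRho j) \<and>
     inj_on (picked j s') {..<ell} \<and> card {q. q < sz \<and> reals t1 yD q < reals s' yRho j} < ell \<and>
     (\<forall>p. (\<forall>i<ell. p \<noteq> j * ell + i) \<longrightarrow> words s' vBt p = words t1 vBt p) \<and>
     (\<forall>j'. j' \<noteq> j \<longrightarrow> reals s' yRho j' = reals t1 yRho j')) \<and> frame (wmods prog_pick) (rmods prog_pick) t1 s')"
      by (intro sure_frame spec_pick) (use t f t1 in auto)
    then show "sure prog_pick t1 (\<lambda>s'. words (setw vI 0 (Suc j) s') vS 0 = sz \<and> words (setw vI 0 (Suc j) s') vEll 0 = ell \<and>
       words (setw vI 0 (Suc j) s') vSmp = ?\<sigma> \<and> (\<forall>j'<Suc j. near_ok ?\<sigma> j' (setw vI 0 (Suc j) s')))"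
    proof (rule sure_mono, goal_cases)
      case (1 s')
      then have fr: "frame (wmods prog_pick) (rmods prog_pick) t1 s'" by blast
      have f2: "words s' vS = words t1 vS" "words s' vEll = words t1 vEll" "words s' vSmp = words t1 vSmp"
        using fr by (auto simp: frame_def prog_pick_def prog_argmin_def)
      have "near_ok ?\<sigma> j' s'" if "j' < Suc j" for j'
      proof (cases "j' = j")
        case True
        have eq: "{q. q < sz \<and> reals t1 yD q < reals s' yRho j} = {q. q < sz \<and> d (?\<sigma> j) (?\<sigma> q) < reals s' yRho j}"
          using D by auto
        have "d (?\<sigma> j) (?\<sigma> (picked j s' i)) \<le> reals s' yRho j" if "i < ell" for i
        proof -
          have "picked j s' i < sz" "reals t1 yD (picked j s' i) \<le> reals s' yRho j" using 1 that by blast+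
          then show ?thesis using D by simp
        qed
        moreover have "card {q. q < sz \<and> d (?\<sigma> j) (?\<sigma> q) < reals s' yRho j} < ell"
          using 1 unfolding eq by blast
        ultimately show ?thesis using 1 True unfolding near_ok_def by auto
      next
        case False
        then have "near_ok ?\<sigma> j' t" using that t(4) by auto
        moreover have "words s' vBt (j' * ell + i) = words t vBt (j' * ell + i)" if "i < ell" for i
        proof -
          have "\<forall>i'<ell. j' * ell + i \<noteq> j * ell + i'" using pair_index_inj[OF that] False by blast
          then show ?thesis using 1 f(5) by simp
        qed
        moreover have "reals s' yRho j' = reals t yRho j'" using 1 False f(6) by simp
        ultimately show ?thesis unfolding near_ok_def inj_on_def picked_def by simp
      qed
      then show ?case using f f2 t by (auto simp: near_ok_def picked_def inj_on_def)
    qed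
  qed (use t 4 assms in auto)
qed (use assms env_simps in auto)

definition qual :: "(nat \<Rightarrow> real) \<Rightarrow> (nat \<Rightarrow> nat) \<Rightarrow> nat \<Rightarrow> bool" where
  "qual A bt e \<longleftrightarrow> ell < 2 * card {i. i < ell \<and> A (bt (e div ell * ell + i)) \<le> A (bt e)}"

lemma spec_rank:
  assumes "words s vEll 0 = ell" "words s vE 0 = e"
  shows "sure prog_rank s (\<lambda>s'. words s' vC 0 =
     card {i. i < ell \<and> reals s yA (words s vBt (e div ell * ell + i)) \<le> reals s yA (words s vBt e)})"
proof -
  let ?P = "\<lambda>i. reals s yA (words s vBt (e div ell * ell + i)) \<le> reals s yA (words s vBt e)"
  show ?thesis unfolding prog_rank_def
  proof (simp only: sure_simps(2,8) wval.simps, intro conjI, goal_cases)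
    case 2
    show ?case
    proof (rule sure_For[where N=ell and I="\<lambda>i t. words t vEll 0 = ell \<and> words t vE 0 = e \<and> words t vBt = words s vBt \<and>
       reals t yA = reals s yA \<and> words t vC 0 = card {j. j < i \<and> ?P j}"], goal_cases)
      case (4 i t)
      then have "words t vC 0 \<le> i" using card_less_filter_le by simp
      then have "Suc (words t vC 0) \<le> B" using 4 by (intro le_B(3)) auto
      then show ?case using 4 by (auto simp: card_less_Suc_filter not_less)
    qed (use assms env_simps in auto)
  qed simp
qed

text \<open>The largest answer of the first block is at least as large as all answers of that block,
  so the selection never comes back empty.\<close>

lemma exists_qual: "\<exists>e<sz * ell. qual A bt e"
proof -
  have "finite ((\<lambda>i. A (bt i)) ` {..<ell})" "(\<lambda>i. A (bt i)) ` {..<ell} \<noteq> {}"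
    using ell_pos by (auto simp: lessThan_empty_iff)
  from Max_in[OF this] obtain e where e: "e < ell" "A (bt e) = Max ((\<lambda>i. A (bt i)) ` {..<ell})" by auto
  have "A (bt i) \<le> A (bt e)" if "i < ell" for i unfolding e(2) using that by (intro Max_ge) auto
  then have "{i. i < ell \<and> A (bt (e div ell * ell + i)) \<le> A (bt e)} = {..<ell}" using e(1) by auto
  then have "qual A bt e" using ell_pos by (simp add: qual_def)
  moreover have "e < sz * ell" using e(1) sz_le(2) by linarith
  ultimately show ?thesis by blast
qed

definition chosen :: "(nat \<Rightarrow> real) \<Rightarrow> (nat \<Rightarrow> nat) \<Rightarrow> (nat \<Rightarrow> real) \<Rightarrow> nat \<Rightarrow> real \<Rightarrow> nat \<Rightarrow> bool" where
  "chosen A bt rho m v b \<longleftrightarrow> (\<exists>e<m. qual A bt e \<and> b = e div ell \<and> v = A (bt e) + rho (e div ell)) \<and>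
     (\<forall>e<m. qual A bt e \<longrightarrow> v \<le> A (bt e) + rho (e div ell))"

lemma spec_select:
  assumes "words s vEll 0 = ell" "words s vTot 0 = sz * ell"
  shows "sure prog_select s (\<lambda>s'. chosen (reals s yA) (words s vBt) (reals s yRho) (sz * ell) (reals s' yVal 0) (words s' vB1 0))"
  unfolding prog_select_def
proof (simp only: sure_simps(2,8) wval.simps, intro conjI, goal_cases)
  case 2
  let ?A = "reals s yA" and ?bt = "words s vBt" and ?rho = "reals s yRho"
  let ?I = "\<lambda>i t. words t vEll 0 = ell \<and> words t vBt = ?bt \<and> reals t yA = ?A \<and> reals t yRho = ?rho \<and>
     (words t vFlag 0 = 0 \<and> (\<forall>e<i. \<not> qual ?A ?bt e) \<or> words t vFlag 0 = 1 \<and> chosen ?A ?bt ?rho i (reals t yVal 0) (words t vB1 0))"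
  show ?case
  proof (rule sure_For[where N="sz * ell" and I="?I"], goal_cases)
    case (4 i t)
    show ?case
    proof (rule sure_seqI[OF spec_rank[where s=t and e=i]])
      fix t1 assume t1: "words t1 vC 0 = card {j. j < ell \<and> reals t yA (words t vBt (i div ell * ell + j)) \<le> reals t yA (words t vBt i)}"
        "frame (wmods prog_rank) (rmods prog_rank) t t1"
      have f: "words t1 vEll = words t vEll" "words t1 vBt = words t vBt" "words t1 vFlag = words t vFlag" "words t1 vB1 = words t vB1"
        "words t1 vE = words t vE" "reals t1 = reals t"
        using t1(2) by (auto simp: frame_def prog_rank_def)
      have q: "ell < 2 * words t1 vC 0 \<longleftrightarrow> qual ?A ?bt i" using t1(1) 4 by (simp add: qual_def)
      have "i div ell \<le> sz * ell" using div_le_dividend[of i ell] 4(2) by linarith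
      then have iB: "i div ell \<le> B" "1 \<le> B" by (auto intro: le_B)
      show "sure (Cond (WLess (Var vEll) (Arith Times (Const 2) (Var vC)))
         (yTmp ::=R RArith Plus (RCell yA (Cell vBt (Var vE))) (RCell yRho (Arith Divide (Var vE) (Var vEll))) ;;
          Cond (WLess (Const 0) (Var vFlag))
            (Cond (RLess (RVar yTmp) (RVar yVal)) prog_update Skip) prog_update)
         Skip) t1 (\<lambda>s'. ?I (Suc i) (setw vE 0 (Suc i) s'))"
      proof (cases "qual ?A ?bt i")
        case False
        then show ?thesis using 4 q by (auto simp: f chosen_def less_Suc_eq)
      next
        case True
        let ?v = "?A (?bt i) + ?rho (i div ell)"
        show ?thesis
        proof (cases "words t vFlag 0 = 0")
          case flag: True
          then have "chosen ?A ?bt ?rho (Suc i) ?v (i div ell)"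
            using 4 True by (auto simp: chosen_def less_Suc_eq)
          then show ?thesis using 4 q True flag iB by (auto simp: f prog_update_def)
        next
          case False
          then have c: "chosen ?A ?bt ?rho i (reals t yVal 0) (words t vB1 0)" "words t vFlag 0 = 1" using 4 by auto
          show ?thesis
          proof (cases "?v < reals t yVal 0")
            case lt: True
            then have "chosen ?A ?bt ?rho (Suc i) ?v (i div ell)"
              using c True by (fastforce simp: chosen_def less_Suc_eq)
            then show ?thesis using 4 q True c(2) lt iB by (auto simp: f prog_update_def)
          next
            case ge: False
            then have "chosen ?A ?bt ?rho (Suc i) (reals t yVal 0) (words t vB1 0)"
              using c True by (fastforce simp: chosen_def less_Suc_eq)
            then show ?thesis using 4 q True c(2) ge by (auto simp: f prog_update_def)
          qed
        qed
      qed
    qed (use 4 in auto)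
  next
    case (5 t) then show ?case using exists_qual[of ?A ?bt] by auto
  qed (use assms env_simps in auto)
qed simp

text \<open>Either one more halving would capture fewer than half of the points, or every iteration
  halved. The second possibility is ruled out later by the aspect ratio.\<close>

lemma spec_radius:
  assumes "words s vCnt 0 = u" "words s vJ 0 = halvings" "u \<le> n"
    "u \<le> 2 * card {q. q < u \<and> reals s yV q \<le> reals s yMax 0}"
  shows "sure prog_radius s (\<lambda>s'. u \<le> 2 * card {q. q < u \<and> reals s yV q \<le> reals s' yR 0} \<and>
     (reals s' yR 0 = reals s yMax 0 / 2 ^ halvings \<or> 2 * card {q. q < u \<and> reals s yV q \<le> reals s' yR 0 / 2} < u))"
  unfolding prog_radius_def
proof (simp only: sure_simps(3,8) wval.simps rval.simps, goal_cases)
  case 1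
  let ?V = "reals s yV" and ?M = "reals s yMax 0"
  let ?I = "\<lambda>i (t::store). words t vCnt 0 = u \<and> reals t yV = ?V \<and> u \<le> 2 * card {q. q < u \<and> ?V q \<le> reals t yR 0} \<and>
     (reals t yR 0 = ?M / 2 ^ i \<or> 2 * card {q. q < u \<and> ?V q \<le> reals t yR 0 / 2} < u)"
  show ?case
  proof (rule sure_For[where N=halvings and I="?I"], goal_cases)
    case (4 i t)
    show ?case
    proof (simp only: sure_simps(2,8) wval.simps, intro conjI, goal_cases)
      case 2
      let ?t = "setw vC 0 0 t"
      have "sure (For vQ vCnt (Cond (RLess (RArith Divide (RVar yR) (OfWord (Const 2))) (RCell yV (Var vQ))) Skip (Incr vC)))
         ?t (\<lambda>s'. (words s' vC 0 = card {q. q < u \<and> ?V q \<le> reals t yR 0 / 2} \<and> words s' vCnt 0 = u) \<and> reals s' = reals t)"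
      proof (rule sure_For[where N=u and I="\<lambda>i t'. words t' vCnt 0 = u \<and> reals t' = reals t \<and>
          words t' vC 0 = card {q. q < i \<and> ?V q \<le> reals t yR 0 / 2}"], goal_cases)
        case (4 j t')
        then have "words t' vC 0 \<le> j" using card_less_filter_le by simp
        then have "Suc (words t' vC 0) \<le> B" using 4(2) assms(3) by (intro le_B(1)) auto
        then show ?case using 4 \<open>?I i t\<close> by (auto simp: card_less_Suc_filter not_less)
      qed (use 4 assms env_simps in auto)
      then show ?case
      proof (rule sure_mono, goal_cases)
        case (1 s')
        then show ?case using \<open>?I i t\<close> by (auto simp: not_less field_simps)
      qed
    qed simp
  qed (use assms env_simps in auto)
qed

lemma spec_groups:
  assumes "words s vCnt 0 = u" "words s vS 0 = sz" "u \<le> n" "\<And>q. q < u \<Longrightarrow> words s vOwn q < sz"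
  shows "sure prog_groups s (\<lambda>s'. \<forall>j<sz. words s' vGc j = card {q. q < u \<and> reals s yV q \<le> reals s yR 0 \<and> words s vOwn q = j})"
  unfolding prog_groups_def
proof (rule sure_seqI)
  let ?P = "\<lambda>j q. reals s yV q \<le> reals s yR 0 \<and> words s vOwn q = j"
  show "sure (For vI vS (WSet vGc (Var vI) (Const 0))) s (\<lambda>s'. \<forall>j<sz. words s' vGc j = 0)"
    by (rule sure_For[where N=sz and I="\<lambda>i t. \<forall>j<i. words t vGc j = 0"]) (use assms env_simps in \<open>auto simp: less_Suc_eq\<close>)
  fix s1 assume s1: "\<forall>j<sz. words s1 vGc j = 0" "frame (wmods (For vI vS (WSet vGc (Var vI) (Const 0)))) (rmods (For vI vS (WSet vGc (Var vI) (Const 0)))) s s1"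
  have f: "words s1 vCnt = words s vCnt" "words s1 vOwn = words s vOwn" "reals s1 = reals s"
    using s1(2) by (auto simp: frame_def)
  show "sure (For vQ vCnt (Cond (RLess (RVar yR) (RCell yV (Var vQ))) Skip
       (WSet vGc (Cell vOwn (Var vQ)) (Arith Plus (Cell vGc (Cell vOwn (Var vQ))) (Const 1))))) s1
     (\<lambda>s'. \<forall>j<sz. words s' vGc j = card {q. q < u \<and> ?P j q})"
  proof (rule sure_For[where N=u and I="\<lambda>i t. words t vOwn = words s vOwn \<and> reals t = reals s \<and>
      (\<forall>j<sz. words t vGc j = card {q. q < i \<and> ?P j q})"], goal_cases)
    case (4 i t)
    then have "words t vGc (words s vOwn i) = card {q. q < i \<and> ?P (words s vOwn i) q}" using assms(4) by auto
    also have "\<dots> \<le> i" by (rule card_less_filter_le)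
    finally have "Suc (words t vGc (words s vOwn i)) \<le> B" using 4 assms(3) by (intro le_B(1)) auto
    then show ?case using 4 assms(4) by (auto simp: card_less_Suc_filter not_less)
  qed (use assms env_simps s1 f in auto)
qed

lemma spec_remove:
  assumes "words s vCnt 0 = u" "u \<le> n" "inj_on (words s vU) {..<u}" "\<And>q. q < u \<Longrightarrow> words s vU q < n"
    "\<And>q. q < u \<Longrightarrow> words s vGc (words s vOwn q) \<le> n"
  shows "sure prog_remove s (\<lambda>s'. words s' vCnt 0 = card {q. q < u \<and> reals s yR 0 < reals s yV q} \<and>
     inj_on (words s' vU) {..<words s' vCnt 0} \<and>
     words s' vU ` {..<words s' vCnt 0} = words s vU ` {q. q < u \<and> reals s yR 0 < reals s yV q} \<and>
     (\<forall>q<u. reals s yV q \<le> reals s yR 0 \<longrightarrow> words s' vG (words s vU q) = words s vGc (words s vOwn q)) \<and>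
     (\<forall>x. x \<notin> words s vU ` {q. q < u \<and> reals s yV q \<le> reals s yR 0} \<longrightarrow> words s' vG x = words s vG x))"
  unfolding prog_remove_def
proof (simp only: sure_simps(2,8) wval.simps, intro conjI, goal_cases)
  case 2
  let ?U = "words s vU" and ?P = "\<lambda>q. reals s yR 0 < reals s yV q"
  \<comment> \<open>The write position never overtakes the read position, so the entries from
    \<open>i\<close> on are still the original ones.\<close>
  let ?I = "\<lambda>i t. words t vOwn = words s vOwn \<and> words t vGc = words s vGc \<and> reals t = reals s \<and>
     words t vU2 0 = card {q. q < i \<and> ?P q} \<and> (\<forall>q. i \<le> q \<longrightarrow> words t vU q = ?U q) \<and>
     inj_on (words t vU) {..<words t vU2 0} \<and> words t vU ` {..<words t vU2 0} = ?U ` {q. q < i \<and> ?P q} \<and>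
     (\<forall>q<i. \<not> ?P q \<longrightarrow> words t vG (?U q) = words s vGc (words s vOwn q)) \<and>
     (\<forall>x. x \<notin> ?U ` {q. q < i \<and> \<not> ?P q} \<longrightarrow> words t vG x = words s vG x)"
  have "sure (For vQ vCnt (Cond (RLess (RVar yR) (RCell yV (Var vQ)))
       (WSet vU (Var vU2) (Cell vU (Var vQ)) ;; Incr vU2)
       (WSet vG (Cell vU (Var vQ)) (Cell vGc (Cell vOwn (Var vQ)))))) (setw vU2 0 0 s) (?I u)"
  proof (rule sure_For[where N=u and I="?I"], goal_cases)
    case (4 i t)
    have u2: "words t vU2 0 \<le> i" using 4 card_less_filter_le by simp
    then have B: "words t vU2 0 + 1 \<le> B" "?U i \<le> B" "words s vGc (words s vOwn i) \<le> B"
      using 4(2) assms(2) assms(4)[of i] assms(5)[of i] by (auto intro!: le_B(1))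
    have Ui: "words t vU i = ?U i" using 4 by auto
    have neq: "?U q \<noteq> ?U i" if "q < i" for q using inj_onD[OF assms(3), of q i] that 4(2) by auto
    show ?case
    proof (cases "?P i")
      case True
      let ?f = "(words t vU)(words t vU2 0 := ?U i)"
      have new: "?U i \<notin> ?U ` {q. q < i \<and> ?P q}"
        using neq by force
      have "inj_on ?f {..<words t vU2 0}" using 4 by (subst inj_on_cong[of _ _ "words t vU"]) auto
      moreover have "?f ` ({..<words t vU2 0} - {words t vU2 0}) = ?U ` {q. q < i \<and> ?P q}" using 4 by auto
      ultimately have inj: "inj_on ?f {..<Suc (words t vU2 0)}"
        using new unfolding lessThan_Suc inj_on_insert by auto
      have e1: "{q. q < Suc i \<and> ?P q} = insert i {q. q < i \<and> ?P q}" using True by (auto simp: less_Suc_eq)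
      have e2: "{q. q < Suc i \<and> \<not> ?P q} = {q. q < i \<and> \<not> ?P q}" using True by (auto simp: less_Suc_eq)
      have "?f ` {..<Suc (words t vU2 0)} = insert (?U i) (words t vU ` {..<words t vU2 0})"
        by (auto simp: lessThan_Suc)
      also have "words t vU ` {..<words t vU2 0} = ?U ` {q. q < i \<and> ?P q}" using 4 by blast
      finally have img: "?f ` {..<Suc (words t vU2 0)} = ?U ` {q. q < Suc i \<and> ?P q}" unfolding e1 image_insert .
      let ?t = "setw vQ 0 (Suc i) (setw vU2 0 (Suc (words t vU2 0)) (setw vU (words t vU2 0) (?U i) t))"
      have I': "?I (Suc i) ?t"
      proof (intro conjI)
        show "words ?t vU2 0 = card {q. q < Suc i \<and> ?P q}" using 4(1) True by (simp add: card_less_Suc_filter)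
        show "\<forall>q. Suc i \<le> q \<longrightarrow> words ?t vU q = ?U q" using 4(1) u2 by simp
        show "inj_on (words ?t vU) {..<words ?t vU2 0}" using inj by simp
        show "words ?t vU ` {..<words ?t vU2 0} = ?U ` {q. q < Suc i \<and> ?P q}" using img by simp
        show "\<forall>q<Suc i. \<not> ?P q \<longrightarrow> words ?t vG (?U q) = words s vGc (words s vOwn q)"
          using 4(1) True by (auto simp: less_Suc_eq)
        show "\<forall>x. x \<notin> ?U ` {q. q < Suc i \<and> \<not> ?P q} \<longrightarrow> words ?t vG x = words s vG x" using 4(1) unfolding e2 by simp
      qed (use 4(1) in simp_all)
      moreover have "?P i" "words t vQ 0 = i" "reals t = reals s" using 4 True by simp_all
      ultimately have S: "sure (Cond (RLess (RVar yR) (RCell yV (Var vQ)))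
       (WSet vU (Var vU2) (Cell vU (Var vQ)) ;; Incr vU2)
       (WSet vG (Cell vU (Var vQ)) (Cell vGc (Cell vOwn (Var vQ))))) t (\<lambda>s'. setw vQ 0 (Suc i) s' = ?t)"
        using B(1,2) Ui by simp
      show ?thesis
      proof (rule sure_mono[OF S])
        fix s' assume e: "setw vQ 0 (Suc i) s' = ?t"
        show "?I (Suc i) (setw vQ 0 (Suc i) s')" unfolding e by (rule I')
      qed
    next
      case False
      have e1: "{q. q < Suc i \<and> ?P q} = {q. q < i \<and> ?P q}" using False by (auto simp: less_Suc_eq)
      have e2: "{q. q < Suc i \<and> \<not> ?P q} = insert i {q. q < i \<and> \<not> ?P q}" using False by (auto simp: less_Suc_eq)
      let ?t = "setw vQ 0 (Suc i) (setw vG (?U i) (words s vGc (words s vOwn i)) t)"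
      have I': "?I (Suc i) ?t"
      proof (intro conjI)
        show "\<forall>q<Suc i. \<not> ?P q \<longrightarrow> words ?t vG (?U q) = words s vGc (words s vOwn q)"
          using 4(1) neq by (simp add: less_Suc_eq)
        show "\<forall>x. x \<notin> ?U ` {q. q < Suc i \<and> \<not> ?P q} \<longrightarrow> words ?t vG x = words s vG x" using 4(1) unfolding e2 by simp
        have "inj_on (words t vU) {..<words t vU2 0}" using 4(1) by blast
        then show "inj_on (words ?t vU) {..<words ?t vU2 0}" by simp
        have "words t vU ` {..<words t vU2 0} = ?U ` {q. q < i \<and> ?P q}" using 4(1) by blast
        then show "words ?t vU ` {..<words ?t vU2 0} = ?U ` {q. q < Suc i \<and> ?P q}" unfolding e1 by simp
      qed (use 4(1) e1 in simp_all)
      moreover have "\<not> ?P i" "words t vQ 0 = i" "reals t = reals s" "words t vGc = words s vGc" "words t vOwn = words s vOwn"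
        using 4 False by simp_all
      ultimately have S: "sure (Cond (RLess (RVar yR) (RCell yV (Var vQ)))
       (WSet vU (Var vU2) (Cell vU (Var vQ)) ;; Incr vU2)
       (WSet vG (Cell vU (Var vQ)) (Cell vGc (Cell vOwn (Var vQ))))) t (\<lambda>s'. setw vQ 0 (Suc i) s' = ?t)"
        using B(3) Ui by simp
      show ?thesis
      proof (rule sure_mono[OF S])
        fix s' assume e: "setw vQ 0 (Suc i) s' = ?t"
        show "?I (Suc i) (setw vQ 0 (Suc i) s')" unfolding e by (rule I')
      qed
    qed
  qed (use assms env_simps in auto)
  then show ?case
  proof (rule sure_mono, goal_cases)
    case (1 t)
    have "words t vU2 0 \<le> u" using 1 card_less_filter_le by simp
    then have "words t vU2 0 \<le> B" using assms(2) by (intro le_B(1)) auto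
    then show ?case using 1 by (auto simp: not_less)
  qed
qed simp

end

section \<open>Failure probabilities\<close>

lemma one_le_one_add: "1 \<le> 1 + (\<delta>::ennreal)"
  by (simp add: add_increasing2)

context oracle_lang
begin

text \<open>An expectation of an indicator rather than a probability, so that it composes through
  \<open>expect\<close>; possible faults make it infinite.\<close>

definition fails :: "com \<Rightarrow> store \<Rightarrow> (store \<Rightarrow> bool) \<Rightarrow> ennreal" where
  "fails c s G = expect c s (\<lambda>s'. if G s' then 0 else 1)"

lemma expect_const: "sure c s (\<lambda>_. True) \<Longrightarrow> expect c s (\<lambda>_. x) = x"
  unfolding sure_def expect_def by (rule oexp_const)

lemma expect_add: "sure c s (\<lambda>_. True) \<Longrightarrow> expect c s (\<lambda>s'. Q s' + R s') = expect c s Q + expect c s R"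
  unfolding sure_def expect_def by (rule oexp_add)

lemma expect_sum: "finite T \<Longrightarrow> sure c s (\<lambda>_. True) \<Longrightarrow> expect c s (\<lambda>s'. \<Sum>t\<in>T. Q t s') = (\<Sum>t\<in>T. expect c s (Q t))"
  unfolding sure_def expect_def by (rule oexp_sum)

lemma sure_True: "sure c s Q \<Longrightarrow> sure c s (\<lambda>_. True)"
  by (rule sure_mono) auto

lemma fails_le_one: "sure c s Q \<Longrightarrow> fails c s G \<le> 1"
  unfolding fails_def using expect_mono_on[OF sure_True, of c s Q "\<lambda>s'. if G s' then 0 else 1" "\<lambda>_. 1"] expect_const[OF sure_True]
  by (simp add: zero_le_one)

lemma fails_mono: "sure c s I \<Longrightarrow> (\<And>s'. I s' \<Longrightarrow> G s' \<Longrightarrow> G' s') \<Longrightarrow> fails c s G' \<le> fails c s G"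
  unfolding fails_def by (erule expect_mono_on) auto

lemma fails_sure: "sure c s G \<Longrightarrow> fails c s G = 0"
  using expect_mono_on[of c s G "\<lambda>s'. if G s' then 0 else 1" "\<lambda>_. 0"] expect_const[OF sure_True, of c s G 0]
  by (simp add: fails_def)

text \<open>Where \<open>G\<close> does not hold after the first command, the second is charged at
  most 1, and this has been paid for by the failure of the first.\<close>

lemma fails_seq:
  assumes "sure a s I" "fails a s G \<le> \<delta>" "\<And>s'. I s' \<Longrightarrow> G s' \<Longrightarrow> fails b s' G' \<le> \<delta>'" "\<And>s'. I s' \<Longrightarrow> sure b s' (\<lambda>_. True)"
  shows "fails (Seq a b) s G' \<le> \<delta> + \<delta>'"
proof -
  have "fails (Seq a b) s G' = expect a s (\<lambda>s'. fails b s' G')" by (simp add: fails_def)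
  also have "\<dots> \<le> expect a s (\<lambda>s'. (if G s' then 0 else 1) + \<delta>')"
    using assms(1)
  proof (rule expect_mono_on)
    fix s' assume "I s'"
    then show "fails b s' G' \<le> (if G s' then 0 else 1) + \<delta>'"
      using assms(3) order_trans[OF fails_le_one[OF assms(4)] one_le_one_add] by auto
  qed
  also have "\<dots> = fails a s G + \<delta>'"
    using sure_True[OF assms(1)] by (simp add: expect_add expect_const fails_def)
  also have "\<dots> \<le> \<delta> + \<delta>'" using assms(2) by (rule add_right_mono)
  finally show ?thesis .
qed

text \<open>The potential is the indicator that \<open>G\<close> is violated: once it is, the value
  1 bounds whatever follows.\<close>

lemma fails_For:
  assumes "words s y 0 = N" "N \<le> env y" "I 0 (setw x 0 0 s)" "G 0 (setw x 0 0 s)"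
    and sure: "\<And>i s. I i s \<Longrightarrow> i < N \<Longrightarrow> words s x 0 = i \<Longrightarrow> sure c s (\<lambda>s'. I (Suc i) (setw x 0 (Suc i) s'))"
    and fail: "\<And>i s. I i s \<Longrightarrow> G i s \<Longrightarrow> i < N \<Longrightarrow> words s x 0 = i \<Longrightarrow> fails c s (\<lambda>s'. G (Suc i) (setw x 0 (Suc i) s')) \<le> \<delta>"
    and "\<And>s. I N s \<Longrightarrow> G N s \<Longrightarrow> Q s"
  shows "fails (For x y c) s Q \<le> of_nat N * \<delta>"
proof -
  have "expect (For x y c) s (\<lambda>s. if Q s then 0 else 1) \<le> (if G 0 (setw x 0 0 s) then 0 else 1) + of_nat N * \<delta>"
  proof (rule expect_For[where I=I and \<Phi>="\<lambda>i s. if G i s then 0 else 1"])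
    fix i s assume *: "I i s" "i < N" "words s x 0 = i"
    show "expect c s (\<lambda>s'. if G (Suc i) (setw x 0 (Suc i) s') then 0 else 1) \<le> (if G i s then 0 else 1) + \<delta>"
      using fail[OF *(1) _ *(2,3)] order_trans[OF fails_le_one[OF sure[OF *], of "\<lambda>s'. G (Suc i) (setw x 0 (Suc i) s')"] one_le_one_add]
      unfolding fails_def by auto
  qed (use assms in auto)
  then show ?thesis using assms(4) by (simp add: fails_def)
qed

lemma fails_union:
  assumes "finite T" "sure c s I" "\<And>t. t \<in> T \<Longrightarrow> fails c s (G t) \<le> \<delta>"
  shows "fails c s (\<lambda>s'. \<forall>t\<in>T. G t s') \<le> of_nat (card T) * \<delta>"
proof -
  have "fails c s (\<lambda>s'. \<forall>t\<in>T. G t s') \<le> expect c s (\<lambda>s'. \<Sum>t\<in>T. if G t s' then 0 else 1)"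
    unfolding fails_def
  proof (rule expect_mono_on[OF assms(2)])
    fix s' 
    show "(if \<forall>t\<in>T. G t s' then 0 else 1) \<le> (\<Sum>t\<in>T. if G t s' then 0 else (1::ennreal))"
    proof (cases "\<forall>t\<in>T. G t s'")
      case False
      then obtain t where t: "t \<in> T" "\<not> G t s'" by blast
      then have "(if G t s' then 0 else (1::ennreal)) \<le> (\<Sum>t\<in>T. if G t s' then 0 else 1)"
        by (intro member_le_sum) (use assms(1) in auto)
      then show ?thesis using t False by simp
    qed simp
  qed
  also have "\<dots> = (\<Sum>t\<in>T. fails c s (G t))"
    using assms(1) sure_True[OF assms(2)] by (simp add: expect_sum fails_def)
  also have "\<dots> \<le> of_nat (card T) * \<delta>" using assms(3) by (rule sum_bounded_above)
  finally show ?thesis .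
qed

end

lemma weak_answer_None: "(\<And>u v r. WeakEv u v r \<in> set es \<Longrightarrow> {u, v} \<noteq> {x, y}) \<Longrightarrow> weak_answer es x y = None"
proof (induction es)
  case (Cons e es)
  have IH: "weak_answer es x y = None" using Cons.prems by (intro Cons.IH) (meson list.set_intros(2))
  show ?case
  proof (cases e)
    case (WeakEv u v r)
    then have "{u, v} \<noteq> {x, y}" using Cons.prems[of u v r] by simp
    then show ?thesis using WeakEv IH by simp
  qed (use IH in simp_all)
qed simp

text \<open>For a fresh pair the coin is independent of the transcript, although the corrupted
  answer may depend on it.\<close>

lemma expect_fresh_oracle:
  assumes "weak_answer es x y = None"
  shows "(\<integral>\<^sup>+r. Q r \<partial>measure_pmf (weak_oracle d adv es x y)) = Q (d x y) * ennreal (2/3) + Q (adv es x y) * ennreal (1/3)"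
  by (simp add: weak_oracle_def assms)

lemma nn_integral_uniform:
  assumes "0 < w" "\<And>v. v < w \<Longrightarrow> 0 \<le> f v"
  shows "(\<integral>\<^sup>+v. ennreal (f v) \<partial>measure_pmf (pmf_of_set {..<w::nat})) = ennreal ((\<Sum>v<w. f v) / real w)"
proof -
  have "(\<integral>\<^sup>+v. ennreal (f v) \<partial>measure_pmf (pmf_of_set {..<w})) = (\<Sum>v<w. ennreal (f v)) / of_nat w"
    using assms(1) by (subst nn_integral_pmf_of_set) (auto simp: lessThan_empty_iff)
  also have "(\<Sum>v<w. ennreal (f v)) = ennreal (\<Sum>v<w. f v)" using assms(2) by (intro sum_ennreal) auto
  also have "\<dots> / of_nat w = ennreal ((\<Sum>v<w. f v) / real w)"
    using assms by (subst ennreal_of_nat_eq_real_of_nat, subst divide_ennreal) (auto intro!: sum_nonneg)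
  finally show ?thesis .
qed

section \<open>The sample hits large clusters\<close>

context coreset_alg
begin

text \<open>The potential is 2 to the number of missing hits, times \<open>\<gamma>\<close> for each
  draw still to come. While fewer than \<open>ell\<close> points of \<open>C\<close> are drawn, at
  least half of \<open>C\<close> remains, so a draw hits with probability at least 1 / (16 k). A hit
  halves the potential, hence its expectation shrinks by \<open>\<gamma> = 1 - 1 / (32 * k)\<close>.
  The initial value \<open>2 ^ ell * \<gamma> ^ sz\<close> is at most
  \<open>2 ^ ell * exp (- 2) ^ ell\<close>, and \<open>exp (- 2) \<le> 1 / 4\<close>.\<close>

lemma sample_hits:
  assumes s: "words s vCnt 0 = u" "inj_on (words s vU) {..<u}" "words s vU ` {..<u} = U0" "U0 \<subseteq> {..<n}" "2 * sz < u" "u \<le> n"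
    "words s vS 0 = sz"
    and C: "C \<subseteq> U0" "u \<le> 8 * k * card C"
  shows "fails prog_sample s (\<lambda>s'. ell \<le> card (words s' vSmp ` {..<sz} \<inter> C)) \<le> ennreal ((1/2) ^ ell)"
proof -
  define \<gamma> :: real where "\<gamma> = 1 - 1 / (32 * real k)"
  define hits where "hits j t = card (words t vSmp ` {..<j} \<inter> C)" for j and t :: store
  define \<Psi> :: "nat \<Rightarrow> nat \<Rightarrow> real" where "\<Psi> j h = (if ell \<le> h then 0 else 2 ^ (ell - h) * \<gamma> ^ (sz - j))" for j h
  have k1: "1 \<le> real k" using k_pos by simp
  have \<gamma>: "0 \<le> \<gamma>" "\<gamma> \<le> 1" using k1 by (auto simp: \<gamma>_def field_simps)
  have \<Psi>0: "0 \<le> \<Psi> j h" for j h using \<gamma> by (simp add: \<Psi>_def)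
  have finC: "finite C" using finite_subset[OF subset_trans[OF C(1) s(4)]] by simp
  have "expect prog_sample s (\<lambda>s'. if ell \<le> card (words s' vSmp ` {..<sz} \<inter> C) then 0 else 1) \<le>
      ennreal (\<Psi> 0 (hits 0 (setw vI 0 0 s))) + of_nat sz * 0"
    unfolding prog_sample_def sample_body_def[symmetric]
  proof (rule expect_For[where I="sampling u U0" and \<Phi>="\<lambda>j t. ennreal (\<Psi> j (hits j t))"])
    fix j t assume *: "sampling u U0 j t" "j < sz" "words t vI 0 = j"
    have ju: "j < u" using *(2) s(5) by simp
    show "sure sample_body t (\<lambda>s'. sampling u U0 (Suc j) (setw vI 0 (Suc j) s'))"
      using *(1) s(4) ju *(3) s(6) by (subst sure_sample_body[of u U0 j]) (auto intro!: sampling_next *)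
    define w where "w = u - j"
    have w: "0 < w" using ju by (simp add: w_def)
    define h where "h = hits j t"
    define H where "H = {v. v < w \<and> words t vU v \<in> C}"
    have samp: "inj_on (words t vU) {..<w}" "words t vSmp ` {..<j} \<union> words t vU ` {..<w} = U0"
       "words t vSmp ` {..<j} \<inter> words t vU ` {..<w} = {}"
      using *(1) by (auto simp: sampling_def w_def)
    have hn: "hits (Suc j) (setw vI 0 (Suc j) (sample_next u v t)) = (if v \<in> H then Suc h else h)" if "v < w" for v
    proof -
      have "words (setw vI 0 (Suc j) (sample_next u v t)) vSmp ` {..<Suc j} = insert (words t vU v) (words t vSmp ` {..<j})"
        by (auto simp: sample_next_def Let_def *(3) lessThan_Suc)
      moreover have "words t vU v \<notin> words t vSmp ` {..<j}" using samp(3) that by blast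
      ultimately show ?thesis using that by (auto simp: hits_def h_def H_def Int_insert_left)
    qed
    have "expect sample_body t (\<lambda>s'. ennreal (\<Psi> (Suc j) (hits (Suc j) (setw vI 0 (Suc j) s')))) =
       (\<integral>\<^sup>+v. ennreal (\<Psi> (Suc j) (hits (Suc j) (setw vI 0 (Suc j) (sample_next u v t)))) \<partial>measure_pmf (pmf_of_set {..<w}))"
      using *(1) s(4) ju *(3) s(6) by (simp add: expect_sample_body[of u U0 j] w_def)
    also have "\<dots> = (\<integral>\<^sup>+v. ennreal (\<Psi> (Suc j) (if v \<in> H then Suc h else h)) \<partial>measure_pmf (pmf_of_set {..<w}))"
      using hn w by (intro nn_integral_cong_AE) (auto simp: AE_measure_pmf_iff set_pmf_lessThan)
    also have "\<dots> = ennreal ((\<Sum>v<w. \<Psi> (Suc j) (if v \<in> H then Suc h else h)) / real w)"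
      using w \<Psi>0 by (intro nn_integral_uniform) auto
    also have "\<dots> \<le> ennreal (\<Psi> j h)"
    proof (cases "ell \<le> h")
      case True
      then have "(\<Sum>v<w. \<Psi> (Suc j) (if v \<in> H then Suc h else h)) = 0" by (auto simp: \<Psi>_def intro!: sum.neutral)
      then show ?thesis by simp
    next
      case False
      define c where "c = 2 ^ (ell - h) * \<gamma> ^ (sz - Suc j)"
      have c0: "0 \<le> c" using \<gamma> by (simp add: c_def)
      \<comment> \<open>A hit halves the bound \<open>c\<close>. The hit that completes
        \<open>ell\<close> makes the potential 0, which is smaller still.\<close>
      have cH: "\<Psi> (Suc j) (if v \<in> H then Suc h else h) \<le> c - (if v \<in> H then c / 2 else 0)" for v
      proof (cases "v \<in> H \<and> \<not> ell \<le> Suc h")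
        case True
        then have "(2::real) ^ (ell - h) = 2 * 2 ^ (ell - Suc h)"
          by (metis Suc_diff_Suc False not_le power_Suc)
        then show ?thesis using True by (simp add: \<Psi>_def c_def)
      next
        case F: False
        then show ?thesis using False c0 \<gamma> by (auto simp: \<Psi>_def c_def)
      qed
      have Hsub: "H \<subseteq> {..<w}" by (auto simp: H_def)
      have finH: "finite H" by (simp add: H_def)
      have "C = (C \<inter> words t vSmp ` {..<j}) \<union> (C \<inter> words t vU ` {..<w})" using C(1) samp(2) by blast
      moreover have "card ((C \<inter> words t vSmp ` {..<j}) \<union> (C \<inter> words t vU ` {..<w})) =
          card (C \<inter> words t vSmp ` {..<j}) + card (C \<inter> words t vU ` {..<w})"
        using samp(3) finC by (intro card_Un_disjoint) blast+
      ultimately have "card C = card (C \<inter> words t vSmp ` {..<j}) + card (C \<inter> words t vU ` {..<w})" by simp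
      also have "C \<inter> words t vU ` {..<w} = words t vU ` H" by (auto simp: H_def)
      also have "card (words t vU ` H) = card H" using samp(1) Hsub by (intro card_image) (rule inj_on_subset)
      finally have cC: "card C = h + card H" by (simp add: h_def hits_def Int_commute)
      \<comment> \<open>The points already drawn account for at most half: \<open>h\<close> is below
        \<open>ell\<close>, and \<open>16 * (k * ell) \<le> u\<close> because the set is more than
        twice as large as the sample.\<close>
      have "u \<le> 16 * k * card H"
      proof -
        have "u \<le> 8 * (k * h) + 8 * (k * card H)" using C(2) cC by (simp add: algebra_simps)
        moreover have "k * h \<le> k * ell" using False by simp
        moreover have "16 * (k * ell) \<le> u" using s(5) by (simp add: sz_def)
        ultimately have "u \<le> 16 * (k * card H)" by linarith
        then show ?thesis by (simp add: mult.assoc)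
      qed
      moreover have "w \<le> u" by (simp add: w_def)
      ultimately have "w \<le> 16 * k * card H" by simp
      then have wH: "real w \<le> 16 * real k * real (card H)" by (metis of_nat_le_iff of_nat_mult of_nat_numeral)
      have "(\<Sum>v<w. \<Psi> (Suc j) (if v \<in> H then Suc h else h)) \<le> (\<Sum>v<w. c - (if v \<in> H then c / 2 else 0))"
        by (rule sum_mono) (rule cH)
      also have "\<dots> = real w * c - (\<Sum>v\<in>{..<w} \<inter> H. c / 2)"
        unfolding sum_subtractf sum.inter_restrict[OF finite_lessThan] by simp
      also have "{..<w} \<inter> H = H" using Hsub by blast
      also have "(\<Sum>v\<in>H. c / 2) = real (card H) * (c / 2)" by simp
      also have "real w * c - real (card H) * (c / 2) \<le> real w * (c * \<gamma>)"
      proof -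
        have "real w / (32 * real k) \<le> real (card H) / 2" using wH k1 by (simp add: field_simps)
        then have "c * (real w / (32 * real k)) \<le> c * (real (card H) / 2)" using c0 by (rule mult_left_mono)
        then show ?thesis by (simp add: \<gamma>_def algebra_simps)
      qed
      finally have "(\<Sum>v<w. \<Psi> (Suc j) (if v \<in> H then Suc h else h)) / real w \<le> c * \<gamma>"
        using w by (simp add: divide_le_eq mult.commute)
      also have "c * \<gamma> = \<Psi> j h" using False *(2) by (simp add: c_def \<Psi>_def Suc_diff_Suc[symmetric])
      finally show ?thesis by (rule ennreal_leI)
    qed
    finally show "expect sample_body t (\<lambda>s'. ennreal (\<Psi> (Suc j) (hits (Suc j) (setw vI 0 (Suc j) s')))) \<le> ennreal (\<Psi> j (hits j t)) + 0"
      by (simp add: h_def)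
  next
    fix t assume "sampling u U0 sz t"
    show "(if ell \<le> card (words t vSmp ` {..<sz} \<inter> C) then 0 else 1) \<le> ennreal (\<Psi> sz (hits sz t))"
      by (auto simp: \<Psi>_def hits_def)
  qed (use s env_simps in \<open>auto simp: sampling_def\<close>)
  also have "\<Psi> 0 (hits 0 (setw vI 0 0 s)) = 2 ^ ell * \<gamma> ^ sz" using ell_pos by (simp add: \<Psi>_def hits_def)
  also have "2 ^ ell * \<gamma> ^ sz \<le> (1/2) ^ ell"
  proof -
    have "\<gamma> \<le> exp (- (1 / (32 * real k)))" using exp_ge_add_one_self[of "- (1 / (32 * real k))"] by (simp add: \<gamma>_def)
    then have "\<gamma> ^ sz \<le> exp (- (1 / (32 * real k))) ^ sz" using \<gamma> by (intro power_mono)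
    also have "\<dots> = exp (- 2) ^ ell" using k1 by (simp add: exp_of_nat_mult[symmetric] sz_def field_simps)
    also have "\<dots> \<le> (1/4) ^ ell"
    proof (rule power_mono)
      have "(2::real) \<le> exp 1" using exp_ge_add_one_self[of 1] by simp
      then have "2 * 2 \<le> exp 1 * exp (1::real)" by (intro mult_mono) auto
      then have "4 \<le> exp (2::real)" by (simp add: exp_add[symmetric])
      then show "exp (- 2) \<le> (1/4::real)" by (simp add: exp_minus inverse_eq_divide field_simps)
    qed simp
    finally have "2 ^ ell * \<gamma> ^ sz \<le> 2 ^ ell * (1/4) ^ ell" by (intro mult_left_mono) auto
    also have "\<dots> = (1/2::real) ^ ell" by (simp add: power_mult_distrib[symmetric])
    finally show ?thesis .
  qed
  finally show ?thesis by (simp add: fails_def ennreal_leI)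
qed

section \<open>Majority votes of weak answers\<close>

definition fresh :: "nat \<Rightarrow> (nat \<Rightarrow> nat) \<Rightarrow> store \<Rightarrow> bool" where
  "fresh x \<sigma> s \<longleftrightarrow> (\<forall>q<sz. (x, \<sigma> q) \<notin> weak_pairs s \<and> (\<sigma> q, x) \<notin> weak_pairs s)"

definition ask_inv :: "store \<Rightarrow> nat \<Rightarrow> nat \<Rightarrow> store \<Rightarrow> bool" where
  "ask_inv s x i t \<longleftrightarrow> words t vX 0 = x \<and> words t vSmp = words s vSmp \<and>
     weak_pairs t = weak_pairs s \<union> (\<lambda>q. (x, words s vSmp q)) ` {..<i}"

lemma spec_ask:
  assumes "words s vS 0 = sz" "words s vX 0 = x" "x < n" "\<And>q. q < sz \<Longrightarrow> words s vSmp q < n"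
  shows "sure prog_ask s (ask_inv s x sz)"
  unfolding prog_ask_def
  by (rule sure_For[where N=sz and I="ask_inv s x"])
     (use assms env_simps in \<open>auto simp: ask_inv_def lessThan_Suc\<close>)

text \<open>A wrong answer multiplies the potential by 9/4, and a pending query contributes 17/12 =
  2/3 + 9/12, a bound on its expected factor. If at least half of the block is wrong, the wrong
  answers alone contribute (3/2)^ell. The quotient of 17/12 and 3/2 is 17/18. An adaptive adversary
  is harmless, because for a fresh pair only the coin decides whether its answer is used.\<close>

lemma ask_majority:
  assumes s: "words s vS 0 = sz" "words s vX 0 = x" "x < n" "\<And>q. q < sz \<Longrightarrow> words s vSmp q < n"
    and \<sigma>: "inj_on (words s vSmp) {..<sz}" "x \<notin> words s vSmp ` {..<sz}" "fresh x (words s vSmp) s"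
    and bt: "inj_on bt {..<ell}" "\<And>i. i < ell \<Longrightarrow> bt i < sz"
  shows "fails prog_ask s (\<lambda>s'. 2 * card {i. i < ell \<and> reals s' yA (bt i) \<noteq> d x (words s vSmp (bt i))} < ell) \<le> ennreal ((17/18) ^ ell)"
proof -
  let ?\<sigma> = "words s vSmp"
  define bad where "bad i A = card {p. p < ell \<and> bt p < i \<and> A (bt p) \<noteq> d x (?\<sigma> (bt p))}" for i and A :: "nat \<Rightarrow> real"
  define rem where "rem i = card {p. p < ell \<and> i \<le> bt p}" for i
  define \<Psi> :: "nat \<Rightarrow> nat \<Rightarrow> real" where "\<Psi> b r = (9/4) ^ b * (17/12) ^ r / (3/2) ^ ell" for b r
  have \<Psi>0: "0 \<le> \<Psi> b r" for b r by (simp add: \<Psi>_def)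
  have "expect prog_ask s (\<lambda>s'. if 2 * card {i. i < ell \<and> reals s' yA (bt i) \<noteq> d x (?\<sigma> (bt i))} < ell then 0 else 1) \<le>
      ennreal (\<Psi> (bad 0 (reals (setw vI 0 0 s) yA)) (rem 0)) + of_nat sz * 0"
    unfolding prog_ask_def
  proof (rule expect_For[where I="ask_inv s x" and \<Phi>="\<lambda>i t. ennreal (\<Psi> (bad i (reals t yA)) (rem i))"])
    fix i t assume *: "ask_inv s x i t" "i < sz" "words t vI 0 = i"
    have t: "words t vX 0 = x" "words t vSmp = ?\<sigma>" using *(1) by (auto simp: ask_inv_def)
    have lt: "x < n" "?\<sigma> i < n" using s *(2) by auto
    show "sure (AskWeak yA (Var vI) (Var vX) (Cell vSmp (Var vI))) t (\<lambda>s'. ask_inv s x (Suc i) (setw vI 0 (Suc i) s'))"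
      using * t lt by (auto simp: ask_inv_def lessThan_Suc)
    have None: "weak_answer (events t) x (?\<sigma> i) = None"
    proof (rule weak_answer_None)
      fix u v r assume "WeakEv u v r \<in> set (events t)"
      then have "(u, v) \<in> weak_pairs t" by (auto simp: weak_pairs_def)
      then consider "(u, v) \<in> weak_pairs s" | q where "q < i" "u = x" "v = ?\<sigma> q" using *(1) by (auto simp: ask_inv_def)
      then show "{u, v} \<noteq> {x, ?\<sigma> i}"
      proof cases
        case 1 then show ?thesis using \<sigma>(3) *(2) unfolding fresh_def by (auto simp: doubleton_eq_iff)
      next
        case 2
        then have "?\<sigma> q \<noteq> ?\<sigma> i" using inj_onD[OF \<sigma>(1), of q i] *(2) by auto
        then show ?thesis using 2 \<sigma>(2) *(2) by (auto simp: doubleton_eq_iff)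
      qed
    qed
    \<comment> \<open>Queries follow the order of the sample, whereas the block lists its members in
      its own order. \<open>P\<close> holds the position of sample point \<open>i\<close> in the
      block, if there is one.\<close>
    define P where "P = {p. p < ell \<and> bt p = i}"
    have finP: "finite P" by (simp add: P_def)
    have "p = p'" if "p \<in> P" "p' \<in> P" for p p' using inj_onD[OF bt(1), of p p'] that by (auto simp: P_def)
    then have cP: "card P \<le> 1" using card_le_Suc0_iff_eq[OF finP] by auto
    have r1: "rem i = rem (Suc i) + card P"
    proof -
      have "{p. p < ell \<and> i \<le> bt p} = {p. p < ell \<and> Suc i \<le> bt p} \<union> P" by (auto simp: P_def)
      moreover have "card ({p. p < ell \<and> Suc i \<le> bt p} \<union> P) = card {p. p < ell \<and> Suc i \<le> bt p} + card P"
        by (rule card_Un_disjoint) (auto simp: P_def)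
      ultimately show ?thesis by (simp add: rem_def)
    qed
    have b1: "bad (Suc i) ((reals t yA)(i := r)) = bad i (reals t yA) + (if r \<noteq> d x (?\<sigma> i) then card P else 0)" for r
    proof -
      let ?X = "{p. p < ell \<and> bt p < i \<and> reals t yA (bt p) \<noteq> d x (?\<sigma> (bt p))}"
      have "{p. p < ell \<and> bt p < Suc i \<and> ((reals t yA)(i := r)) (bt p) \<noteq> d x (?\<sigma> (bt p))} = ?X \<union> (if r \<noteq> d x (?\<sigma> i) then P else {})"
        by (auto simp: P_def less_Suc_eq)
      moreover have "card (?X \<union> (if r \<noteq> d x (?\<sigma> i) then P else {})) = card ?X + card (if r \<noteq> d x (?\<sigma> i) then P else {})"
        by (rule card_Un_disjoint) (auto simp: P_def)
      ultimately show ?thesis by (simp add: bad_def)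
    qed
    let ?b = "bad i (reals t yA)" and ?r = "rem (Suc i)"
    have e1: "ennreal (\<Psi> (?b + (if r \<noteq> d x (?\<sigma> i) then card P else 0)) ?r) \<le>
         ennreal (\<Psi> ?b ?r * (if r \<noteq> d x (?\<sigma> i) then (9/4) ^ card P else 1))" for r
      by (simp add: \<Psi>_def power_add field_simps)
    have "expect (AskWeak yA (Var vI) (Var vX) (Cell vSmp (Var vI))) t (\<lambda>s'. ennreal (\<Psi> (bad (Suc i) (reals (setw vI 0 (Suc i) s') yA)) (rem (Suc i)))) =
       (\<integral>\<^sup>+r. ennreal (\<Psi> (?b + (if r \<noteq> d x (?\<sigma> i) then card P else 0)) ?r) \<partial>measure_pmf (weak_oracle d adv (events t) x (?\<sigma> i)))"
      using lt by (simp add: t *(3) b1)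
    also have "\<dots> \<le> (\<integral>\<^sup>+r. ennreal (\<Psi> ?b ?r * (if r \<noteq> d x (?\<sigma> i) then (9/4) ^ card P else 1)) \<partial>measure_pmf (weak_oracle d adv (events t) x (?\<sigma> i)))"
      by (intro nn_integral_mono e1)
    also have "\<dots> = ennreal (\<Psi> ?b ?r) * ennreal (2/3) + ennreal (\<Psi> ?b ?r * (if adv (events t) x (?\<sigma> i) \<noteq> d x (?\<sigma> i) then (9/4) ^ card P else 1)) * ennreal (1/3)"
      by (subst expect_fresh_oracle[OF None]) simp
    also have "\<dots> \<le> ennreal (\<Psi> ?b ?r) * ennreal (2/3) + ennreal (\<Psi> ?b ?r * (9/4) ^ card P) * ennreal (1/3)"
    proof -
      have "1 \<le> (9/4::real) ^ card P" by (rule one_le_power) simp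
      then have "\<Psi> ?b ?r * (if adv (events t) x (?\<sigma> i) \<noteq> d x (?\<sigma> i) then (9/4) ^ card P else 1) \<le> \<Psi> ?b ?r * (9/4) ^ card P"
        using \<Psi>0[of ?b ?r] by (intro mult_left_mono) auto
      then show ?thesis by (intro add_left_mono mult_right_mono ennreal_leI) simp_all
    qed
    also have "\<dots> = ennreal (\<Psi> ?b ?r * (2/3 + (9/4) ^ card P / 3))"
      using \<Psi>0[of ?b ?r] by (simp add: ennreal_mult[symmetric] ennreal_plus[symmetric] algebra_simps del: ennreal_plus)
    also have "2/3 + (9/4) ^ card P / 3 = (17/12::real) ^ card P"
      using cP by (cases "card P") auto
    also have "\<Psi> ?b ?r * (17/12) ^ card P = \<Psi> ?b (rem i)" by (simp add: \<Psi>_def r1 power_add)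
    finally show "expect (AskWeak yA (Var vI) (Var vX) (Cell vSmp (Var vI))) t
       (\<lambda>s'. ennreal (\<Psi> (bad (Suc i) (reals (setw vI 0 (Suc i) s') yA)) (rem (Suc i)))) \<le> ennreal (\<Psi> ?b (rem i)) + 0" by simp
  next
    fix t assume "ask_inv s x sz t"
    let ?A = "reals t yA"
    have r0: "rem sz = 0" using bt(2) by (fastforce simp: rem_def)
    have b: "bad sz ?A = card {i. i < ell \<and> ?A (bt i) \<noteq> d x (?\<sigma> (bt i))}"
      unfolding bad_def using bt(2) by (intro arg_cong[where f=card]) auto
    show "(if 2 * card {i. i < ell \<and> ?A (bt i) \<noteq> d x (?\<sigma> (bt i))} < ell then 0 else 1) \<le> ennreal (\<Psi> (bad sz ?A) (rem sz))"
    proof (cases "2 * bad sz ?A < ell")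
      case False
      have "(9/4::real) ^ bad sz ?A = (3/2) ^ (2 * bad sz ?A)" by (simp add: power_mult power2_eq_square)
      moreover have "(3/2::real) ^ ell \<le> (3/2) ^ (2 * bad sz ?A)" using False by (intro power_increasing) auto
      ultimately have "(3/2::real) ^ ell \<le> (9/4) ^ bad sz ?A" by simp
      then have "1 \<le> (9/4::real) ^ bad sz ?A / (3/2) ^ ell" by (subst le_divide_eq_1_pos) simp_all
      then have "1 \<le> \<Psi> (bad sz ?A) (rem sz)" by (simp only: \<Psi>_def r0 power_0 mult_1_right)
      then have "1 \<le> ennreal (\<Psi> (bad sz ?A) (rem sz))" by (simp add: ennreal_ge_1)
      then show ?thesis by simp
    qed (simp add: b[symmetric])
  qed (use s env_simps in \<open>auto simp: ask_inv_def\<close>)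
  also have "bad 0 (reals (setw vI 0 0 s) yA) = 0" by (simp add: bad_def)
  also have "rem 0 = ell" by (simp add: rem_def)
  also have "\<Psi> 0 ell = (17/18) ^ ell" by (simp add: \<Psi>_def power_divide[symmetric])
  finally show ?thesis by (simp add: fails_def)
qed

end

lemma setr_same: "reals s x i = v \<Longrightarrow> setr x i v s = s"
  by (auto simp: setr_def)

context coreset_alg
begin

lemma dist_nonneg: "0 \<le> d x y"
  using metric by (rule Metric_space.nonneg)

lemma dist_commute: "d x y = d y x"
  using metric by (rule Metric_space.commute)

lemma dist_triangle: "x < n \<Longrightarrow> y < n \<Longrightarrow> w < n \<Longrightarrow> d x w \<le> d x y + d y w"
  using Metric_space.triangle[OF metric, of x y w] by simp

lemma dist_self: "x < n \<Longrightarrow> d x x = 0"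
  using Metric_space.zero[OF metric, of x x] by simp

lemma chosen_less: "chosen A bt rho (sz * ell) v b \<Longrightarrow> b < sz"
  unfolding chosen_def by (auto intro: less_mult_imp_div_less)

text \<open>
  More than half of the answers in each block are exact, so a block value attained by more than half
  of the answers is at least some exact distance, and the largest exact answer is such a value.
\<close>

lemma value_good:
  assumes near: "\<And>j. j < sz \<Longrightarrow> near_ok \<sigma> j t" and \<sigma>: "\<And>q. q < sz \<Longrightarrow> \<sigma> q < n" and x: "x < n"
    and maj: "\<And>j. j < sz \<Longrightarrow> 2 * card {i. i < ell \<and> A (picked j t i) \<noteq> d x (\<sigma> (picked j t i))} < ell"
    and ch: "chosen A (words t vBt) (reals t yRho) (sz * ell) v b"
  shows "d x (\<sigma> b) \<le> v" "\<And>j. j < sz \<Longrightarrow> v \<le> d x (\<sigma> j) + 2 * reals t yRho j"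
proof -
  have b: "b < sz" using ch by (rule chosen_less)
  have exact: "ell < 2 * card {i. i < ell \<and> A (picked j t i) = d x (\<sigma> (picked j t i))}" if "j < sz" for j
  proof -
    let ?E = "{i. i < ell \<and> A (picked j t i) = d x (\<sigma> (picked j t i))}" and ?N = "{i. i < ell \<and> A (picked j t i) \<noteq> d x (\<sigma> (picked j t i))}"
    have "?E \<union> ?N = {..<ell}" by auto
    moreover have "card (?E \<union> ?N) = card ?E + card ?N" by (rule card_Un_disjoint) auto
    ultimately have "card ?E + card ?N = ell" by simp
    then show ?thesis using maj[OF that] by linarith
  qed
  obtain e where e: "e < sz * ell" "qual A (words t vBt) e" "b = e div ell" "v = A (words t vBt e) + reals t yRho b"
    using ch unfolding chosen_def by auto
  let ?E = "{i. i < ell \<and> A (picked b t i) = d x (\<sigma> (picked b t i))}" and ?Q = "{i. i < ell \<and> A (picked b t i) \<le> A (words t vBt e)}"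
  have "ell < 2 * card ?Q" using e(2) by (simp add: qual_def picked_def e(3))
  moreover have "ell < 2 * card ?E" using exact[OF b] .
  moreover have "card (?E \<union> ?Q) \<le> ell" using card_mono[of "{..<ell}" "?E \<union> ?Q"] by auto
  moreover have "card (?E \<union> ?Q) + card (?E \<inter> ?Q) = card ?E + card ?Q" by (rule card_Un_Int[symmetric]) auto
  ultimately have "card (?E \<inter> ?Q) \<noteq> 0" by linarith
  then have "?E \<inter> ?Q \<noteq> {}" by (rule contrapos_nn) (simp only: card.empty)
  then obtain i where i: "i \<in> ?E \<inter> ?Q" by blast
  have p: "picked b t i < sz" "d (\<sigma> b) (\<sigma> (picked b t i)) \<le> reals t yRho b"
    using near[OF b] i by (auto simp: near_ok_def)
  have "d x (\<sigma> b) \<le> d x (\<sigma> (picked b t i)) + d (\<sigma> (picked b t i)) (\<sigma> b)"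
    using \<sigma> b p x by (intro dist_triangle) auto
  then show "d x (\<sigma> b) \<le> v" using i p(2) e(4) by (auto simp: dist_commute[of "\<sigma> b"])
  fix j assume j: "j < sz"
  let ?E = "{i. i < ell \<and> A (picked j t i) = d x (\<sigma> (picked j t i))}"
  have "card ?E \<noteq> 0" using exact[OF j] by linarith
  then have "?E \<noteq> {}" by (rule contrapos_nn) (simp only: card.empty)
  then have "finite ((\<lambda>i. A (picked j t i)) ` ?E)" "(\<lambda>i. A (picked j t i)) ` ?E \<noteq> {}" by simp_all
  from Max_in[OF this] obtain i where i: "i \<in> ?E" "A (picked j t i) = Max ((\<lambda>i. A (picked j t i)) ` ?E)" by auto
  have mx: "A (picked j t i') \<le> A (picked j t i)" if "i' \<in> ?E" for i'
    unfolding i(2) using that by (intro Max_ge) auto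
  let ?e = "j * ell + i"
  have dv: "?e div ell = j" using i(1) by auto
  have "card ?E \<le> card {i'. i' < ell \<and> A (picked j t i') \<le> A (picked j t i)}"
    using mx by (intro card_mono) auto
  then have "qual A (words t vBt) ?e" using exact[OF j] by (simp add: qual_def dv picked_def)
  moreover have "?e < sz * ell" using i(1) j by (intro pair_index_less) auto
  ultimately have "v \<le> A (picked j t i) + reals t yRho j"
    using ch dv unfolding chosen_def picked_def by metis
  also have "A (picked j t i) = d x (\<sigma> (picked j t i))" using i(1) by simp
  also have "\<dots> \<le> d x (\<sigma> j) + d (\<sigma> j) (\<sigma> (picked j t i))"
    using \<sigma> j x near[OF j] i(1) by (intro dist_triangle) (auto simp: near_ok_def)
  also have "d (\<sigma> j) (\<sigma> (picked j t i)) \<le> reals t yRho j" using near[OF j] i(1) by (auto simp: near_ok_def)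
  finally show "v \<le> d x (\<sigma> j) + 2 * reals t yRho j" by simp
qed

text \<open>In every pair recorded so far the second component is a sample point of an earlier round
  and therefore no longer live. This one-sided fact makes all pairs of the current round
  fresh.\<close>

definition values_pre :: "nat \<Rightarrow> store \<Rightarrow> bool" where
  "values_pre u s \<longleftrightarrow> words s vCnt 0 = u \<and> u \<le> n \<and> params s \<and> inj_on (words s vU) {..<u} \<and> words s vU ` {..<u} \<subseteq> {..<n} \<and>
     inj_on (words s vSmp) {..<sz} \<and> words s vSmp ` {..<sz} \<subseteq> {..<n} \<and> words s vSmp ` {..<sz} \<inter> words s vU ` {..<u} = {} \<and>
     (\<forall>j<sz. near_ok (words s vSmp) j s) \<and>
     (\<forall>(a, b) \<in> weak_pairs s. b \<notin> words s vU ` {..<u} \<union> words s vSmp ` {..<sz})"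

text \<open>The maximum \<open>yMax\<close> is required to be attained, because the aspect ratio can
  only be applied to the value of an actual point.\<close>

definition values_inv :: "store \<Rightarrow> nat \<Rightarrow> store \<Rightarrow> bool" where
  "values_inv s i t \<longleftrightarrow> frame {vQ, vX, vI, vFlag, vE, vC, vB1, vOwn} {yA, yTmp, yVal, yV, yMax} s t \<and>
     (\<forall>q<i. words t vOwn q < sz) \<and> (\<forall>q<i. reals t yV q \<le> reals t yMax 0) \<and>
     (0 < i \<longrightarrow> (\<exists>q<i. reals t yMax 0 = reals t yV q)) \<and>
     weak_pairs t = weak_pairs s \<union> {(words s vU q, words s vSmp j) | q j. q < i \<and> j < sz}"

text \<open>Kept apart from \<open>values_inv\<close>, which holds surely, since this property can
  fail with small probability.\<close>

definition values_good :: "store \<Rightarrow> nat \<Rightarrow> store \<Rightarrow> bool" where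
  "values_good s i t \<longleftrightarrow> (\<forall>q<i. d (words s vU q) (words s vSmp (words t vOwn q)) \<le> reals t yV q \<and>
     (\<forall>j<sz. reals t yV q \<le> d (words s vU q) (words s vSmp j) + 2 * reals s yRho j))"

definition value_store :: com where
  "value_store = prog_select ;; RSet yV (Var vQ) (RVar yVal) ;; WSet vOwn (Var vQ) (Var vB1) ;;
     Cond (WLess (Const 0) (Var vQ))
       (Cond (RLess (RVar yMax) (RVar yVal)) (yMax ::=R RVar yVal) Skip) (yMax ::=R RVar yVal)"

lemma spec_value_store:
  assumes pre: "values_pre u s" and inv: "values_inv s i t" and i: "i < u" "words t vQ 0 = i"
    and t1: "ask_inv (setw vX 0 (words s vU i) t) (words s vU i) sz t1"
      "frame (wmods prog_ask) (rmods prog_ask) (setw vX 0 (words s vU i) t) t1"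
  shows "sure value_store t1 (\<lambda>s'. values_inv s (Suc i) (setw vQ 0 (Suc i) s') \<and>
     chosen (reals t1 yA) (words s vBt) (reals s yRho) (sz * ell) (reals s' yV i) (words s' vOwn i) \<and>
     (\<forall>q<i. reals s' yV q = reals t yV q \<and> words s' vOwn q = words t vOwn q))"
proof -
  have fr: "frame {vQ, vX, vI, vFlag, vE, vC, vB1, vOwn} {yA, yTmp, yVal, yV, yMax} s t" using inv by (simp add: values_inv_def)
  have f1: "words t1 vOwn = words t vOwn" "reals t1 yV = reals t yV" "reals t1 yMax = reals t yMax" "words t1 vQ 0 = i"
    using t1(2) i(2) by (auto simp: frame_def prog_ask_def)
  have fr1: "frame {vQ, vX, vI, vFlag, vE, vC, vB1, vOwn} {yA, yTmp, yVal, yV, yMax} s t1"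
    using fr t1(2) by (auto simp: frame_def prog_ask_def)
  have c: "words t1 vEll 0 = ell" "words t1 vTot 0 = sz * ell" "words t1 vBt = words s vBt" "reals t1 yRho = reals s yRho"
    using fr1 pre by (auto simp: frame_def values_pre_def params_def)
  have sm: "words t vSmp = words s vSmp" using fr by (simp add: frame_def)
  have wp: "weak_pairs t1 = weak_pairs s \<union> {(words s vU q, words s vSmp j) | q j. q < Suc i \<and> j < sz}"
  proof -
    have "weak_pairs t1 = weak_pairs t \<union> (\<lambda>q. (words s vU i, words s vSmp q)) ` {..<sz}"
      using t1(1) sm by (simp add: ask_inv_def)
    also have "weak_pairs t = weak_pairs s \<union> {(words s vU q, words s vSmp j) | q j. q < i \<and> j < sz}"
      using inv by (simp add: values_inv_def)
    finally show ?thesis by (auto simp: less_Suc_eq)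
  qed
  show ?thesis unfolding value_store_def
  proof (rule sure_seqI[OF sure_weak_pairs[OF spec_select[OF c(1,2)]]], goal_cases)
    case 1 show ?case by (simp add: prog_select_def prog_rank_def prog_update_def)
  next
    case (2 t2)
    let ?v = "reals t2 yVal 0" and ?b = "words t2 vB1 0"
    have ch: "chosen (reals t1 yA) (words s vBt) (reals s yRho) (sz * ell) ?v ?b" and wp2: "weak_pairs t2 = weak_pairs t1"
      using 2(1) c by auto
    have b: "?b < sz" using ch by (rule chosen_less)
    then have bB: "?b \<le> B" using le_B(2)[of ?b] by simp
    have f2: "words t2 vOwn = words t vOwn" "reals t2 yV = reals t yV" "reals t2 yMax = reals t yMax" "words t2 vQ 0 = i"
      using 2(2) f1 by (auto simp: frame_def prog_select_def prog_rank_def prog_update_def)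
    have fr2: "frame {vQ, vX, vI, vFlag, vE, vC, vB1, vOwn} {yA, yTmp, yVal, yV, yMax} s t2"
      using fr1 2(2) by (auto simp: frame_def prog_select_def prog_rank_def prog_update_def)
    \<comment> \<open>The new running maximum; for the first point there is no earlier value to
      compare with.\<close>
    define m where "m = (if 0 < i \<and> \<not> reals t yMax 0 < ?v then reals t yMax 0 else ?v)"
    define t3 where "t3 = setr yMax 0 m (setw vOwn i ?b (setr yV i ?v t2))"
    have max_same: "setr yMax 0 (reals t yMax 0) (setw vOwn i ?b (setr yV i ?v t2)) = setw vOwn i ?b (setr yV i ?v t2)"
      by (rule setr_same) (simp add: f2)
    have S: "sure (RSet yV (Var vQ) (RVar yVal) ;; WSet vOwn (Var vQ) (Var vB1) ;;
       Cond (WLess (Const 0) (Var vQ))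
         (Cond (RLess (RVar yMax) (RVar yVal)) (yMax ::=R RVar yVal) Skip) (yMax ::=R RVar yVal)) t2 (\<lambda>s'. s' = t3)"
      using bB f2 max_same by (auto simp: t3_def m_def)
    have old: "\<forall>q<i. words t vOwn q < sz" "\<forall>q<i. reals t yV q \<le> reals t yMax 0"
        "0 < i \<Longrightarrow> \<exists>q<i. reals t yMax 0 = reals t yV q"
      using inv by (auto simp: values_inv_def)
    have m: "?v \<le> m" "0 < i \<Longrightarrow> reals t yMax 0 \<le> m" "m = ?v \<or> 0 < i \<and> m = reals t yMax 0" by (auto simp: m_def)
    have "values_inv s (Suc i) (setw vQ 0 (Suc i) t3)"
      unfolding values_inv_def
    proof (intro conjI)
      show "frame {vQ, vX, vI, vFlag, vE, vC, vB1, vOwn} {yA, yTmp, yVal, yV, yMax} s (setw vQ 0 (Suc i) t3)"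
        using fr2 by (auto simp: frame_def t3_def)
      show "\<forall>q<Suc i. words (setw vQ 0 (Suc i) t3) vOwn q < sz"
        using old(1) b by (auto simp: t3_def f2 less_Suc_eq)
      show "\<forall>q<Suc i. reals (setw vQ 0 (Suc i) t3) yV q \<le> reals (setw vQ 0 (Suc i) t3) yMax 0"
      proof (intro allI impI)
        fix q assume q: "q < Suc i"
        show "reals (setw vQ 0 (Suc i) t3) yV q \<le> reals (setw vQ 0 (Suc i) t3) yMax 0"
        proof (cases "q = i")
          case True then show ?thesis using m(1) by (simp add: t3_def)
        next
          case False
          then have "q < i" using q by simp
          then have "reals t yV q \<le> m" using old(2) m(2) by (meson le_less_trans order_trans zero_le)
          then show ?thesis using False by (simp add: t3_def f2)
        qed
      qed
      show "0 < Suc i \<longrightarrow> (\<exists>q<Suc i. reals (setw vQ 0 (Suc i) t3) yMax 0 = reals (setw vQ 0 (Suc i) t3) yV q)"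
        using m(3)
      proof
        assume "m = ?v" then show ?thesis by (auto simp: t3_def)
      next
        assume "0 < i \<and> m = reals t yMax 0"
        then obtain q where "q < i" "m = reals t yV q" using old(3) by auto
        then show ?thesis by (intro impI exI[of _ q]) (auto simp: t3_def f2)
      qed
      show "weak_pairs (setw vQ 0 (Suc i) t3) = weak_pairs s \<union> {(words s vU q, words s vSmp j) | q j. q < Suc i \<and> j < sz}"
        by (simp add: t3_def wp2 wp)
    qed
    moreover have "chosen (reals t1 yA) (words s vBt) (reals s yRho) (sz * ell) (reals t3 yV i) (words t3 vOwn i)"
      using ch by (simp add: t3_def)
    moreover have "\<forall>q<i. reals t3 yV q = reals t yV q \<and> words t3 vOwn q = words t vOwn q"
      by (simp add: t3_def f2)
    ultimately have fin: "values_inv s (Suc i) (setw vQ 0 (Suc i) t3) \<and>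
       chosen (reals t1 yA) (words s vBt) (reals s yRho) (sz * ell) (reals t3 yV i) (words t3 vOwn i) \<and>
       (\<forall>q<i. reals t3 yV q = reals t yV q \<and> words t3 vOwn q = words t vOwn q)" by simp
    show ?case
    proof (rule sure_mono[OF S], goal_cases)
      case (1 s') show ?case unfolding 1 by (rule fin)
    qed
  qed
qed

text \<open>A repeated pair could come from an earlier round, which the condition on second
  components excludes, or from this round, which is excluded because the points are distinct and
  disjoint from the sample.\<close>

lemma ask_ready:
  assumes pre: "values_pre u s" and inv: "values_inv s i t" and i: "i < u"
  defines "t0 \<equiv> setw vX 0 (words s vU i) t"
  shows "words s vU i < n" "words s vU i \<le> B" "words t vU i = words s vU i" "words t0 vS 0 = sz" "words t0 vX 0 = words s vU i" "words t0 vSmp = words s vSmp"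
    "\<And>q. q < sz \<Longrightarrow> words s vSmp q < n" "words s vU i \<notin> words s vSmp ` {..<sz}" "fresh (words s vU i) (words s vSmp) t0"
proof -
  have fr: "frame {vQ, vX, vI, vFlag, vE, vC, vB1, vOwn} {yA, yTmp, yVal, yV, yMax} s t" using inv by (simp add: values_inv_def)
  have P: "words s vU ` {..<u} \<subseteq> {..<n}" "words s vSmp ` {..<sz} \<subseteq> {..<n}" "words s vSmp ` {..<sz} \<inter> words s vU ` {..<u} = {}"
    "inj_on (words s vU) {..<u}" "params s"
    "\<And>a b. (a, b) \<in> weak_pairs s \<Longrightarrow> b \<notin> words s vU ` {..<u} \<union> words s vSmp ` {..<sz}"
    using pre by (auto simp: values_pre_def)
  show x: "words s vU i < n" using P(1) i by auto
  then show "words s vU i \<le> B" by (intro le_B(1)) simp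
  show "words t vU i = words s vU i" "words t0 vX 0 = words s vU i" "words t0 vSmp = words s vSmp" "words t0 vS 0 = sz"
    using fr P(5) by (auto simp: t0_def frame_def params_def)
  show "words s vSmp q < n" if "q < sz" for q using P(2) that by auto
  have xU: "words s vU i \<in> words s vU ` {..<u}" using i by blast
  then show "words s vU i \<notin> words s vSmp ` {..<sz}" using P(3) by blast
  have wp: "weak_pairs t0 = weak_pairs s \<union> {(words s vU q, words s vSmp j) | q j. q < i \<and> j < sz}"
    using inv by (simp add: values_inv_def t0_def)
  show "fresh (words s vU i) (words s vSmp) t0"
    unfolding fresh_def
  proof (intro allI impI conjI notI)
    fix q assume q: "q < sz"
    then have sq: "words s vSmp q \<in> words s vSmp ` {..<sz}" by blast
    {
      assume "(words s vU i, words s vSmp q) \<in> weak_pairs t0"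
      then consider "(words s vU i, words s vSmp q) \<in> weak_pairs s" | q' where "q' < i" "words s vU i = words s vU q'"
        unfolding wp by auto
      then show False
      proof cases
        case 1 then show ?thesis using P(6)[OF 1] sq by blast
      next
        case 2 then show ?thesis using inj_onD[OF P(4), of i q'] i by auto
      qed
    next
      assume "(words s vSmp q, words s vU i) \<in> weak_pairs t0"
      then consider "(words s vSmp q, words s vU i) \<in> weak_pairs s" | q' where "q' < i" "words s vSmp q = words s vU q'"
        unfolding wp by auto
      then show False
      proof cases
        case 1 then show ?thesis using P(6)[OF 1] xU by blast
      next
        case 2
        then have "words s vSmp q \<in> words s vU ` {..<u}" using i by auto
        then show ?thesis using sq P(3) by blast
      qed
    }
  qed
qed

definition value_body :: com where
  "value_body = vX ::= Cell vU (Var vQ) ;; prog_ask ;; value_store"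

lemma prog_values_alt: "prog_values = For vQ vCnt value_body"
  by (simp add: prog_values_def value_body_def value_store_def)

text \<open>Blocks overlap and share answers, so their majorities are combined by a union bound over
  the \<open>sz\<close> blocks.\<close>

lemma spec_value_body:
  assumes pre: "values_pre u s" and inv: "values_inv s i t" and i: "i < u" "words t vQ 0 = i"
  shows "sure value_body t (\<lambda>s'. values_inv s (Suc i) (setw vQ 0 (Suc i) s'))"
    "values_good s i t \<Longrightarrow> fails value_body t (\<lambda>s'. values_good s (Suc i) (setw vQ 0 (Suc i) s')) \<le> of_nat sz * ennreal ((17/18) ^ ell)"
proof -
  let ?x = "words s vU i" and ?\<sigma> = "words s vSmp"
  define t0 where "t0 = setw vX 0 ?x t"
  note R = ask_ready[OF pre inv i(1), folded t0_def]
  have ask: "sure prog_ask t0 (\<lambda>t1. ask_inv t0 ?x sz t1 \<and> frame (wmods prog_ask) (rmods prog_ask) t0 t1)"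
    using R by (intro sure_frame spec_ask) auto
  have store: "sure value_store t1 (\<lambda>s'. values_inv s (Suc i) (setw vQ 0 (Suc i) s') \<and>
     chosen (reals t1 yA) (words s vBt) (reals s yRho) (sz * ell) (reals s' yV i) (words s' vOwn i) \<and>
     (\<forall>q<i. reals s' yV q = reals t yV q \<and> words s' vOwn q = words t vOwn q))"
    if "ask_inv t0 ?x sz t1 \<and> frame (wmods prog_ask) (rmods prog_ask) t0 t1" for t1
    using spec_value_store[OF pre inv i] that unfolding t0_def by blast
  have S2: "sure (prog_ask ;; value_store) t0 (\<lambda>s'. values_inv s (Suc i) (setw vQ 0 (Suc i) s'))"
    unfolding sure_simps(8) by (rule sure_mono[OF ask]) (rule sure_mono[OF store], auto)
  then show "sure value_body t (\<lambda>s'. values_inv s (Suc i) (setw vQ 0 (Suc i) s'))"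
    using R i by (simp add: value_body_def t0_def)
  assume good: "values_good s i t"
  have near: "near_ok ?\<sigma> j s" if "j < sz" for j using pre that by (simp add: values_pre_def)
  have "fails prog_ask t0 (\<lambda>s'. \<forall>j\<in>{..<sz}. 2 * card {p. p < ell \<and> reals s' yA (picked j s p) \<noteq> d ?x (?\<sigma> (picked j s p))} < ell)
      \<le> of_nat (card {..<sz}) * ennreal ((17/18) ^ ell)"
  proof (rule fails_union)
    fix j assume "j \<in> {..<sz}"
    then have nj: "near_ok ?\<sigma> j s" using near by simp
    have "inj_on ?\<sigma> {..<sz}" using pre by (simp add: values_pre_def)
    then show "fails prog_ask t0 (\<lambda>s'. 2 * card {p. p < ell \<and> reals s' yA (picked j s p) \<noteq> d ?x (?\<sigma> (picked j s p))} < ell) \<le> ennreal ((17/18) ^ ell)"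
      using R nj ask_majority[of t0 ?x "picked j s"] by (auto simp: near_ok_def)
  qed (use ask in auto)
  then have F: "fails prog_ask t0 (\<lambda>s'. \<forall>j\<in>{..<sz}. 2 * card {p. p < ell \<and> reals s' yA (picked j s p) \<noteq> d ?x (?\<sigma> (picked j s p))} < ell)
      \<le> of_nat sz * ennreal ((17/18) ^ ell)" by simp
  have "fails (prog_ask ;; value_store) t0 (\<lambda>s'. values_good s (Suc i) (setw vQ 0 (Suc i) s')) \<le> of_nat sz * ennreal ((17/18) ^ ell) + 0"
  proof (rule fails_seq[OF ask F])
    fix t1 assume t1: "ask_inv t0 ?x sz t1 \<and> frame (wmods prog_ask) (rmods prog_ask) t0 t1"
      and maj: "\<forall>j\<in>{..<sz}. 2 * card {p. p < ell \<and> reals t1 yA (picked j s p) \<noteq> d ?x (?\<sigma> (picked j s p))} < ell"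
    have "sure value_store t1 (\<lambda>s'. values_good s (Suc i) (setw vQ 0 (Suc i) s'))"
    proof (rule sure_mono[OF store[OF t1]])
      fix s' assume s': "values_inv s (Suc i) (setw vQ 0 (Suc i) s') \<and>
         chosen (reals t1 yA) (words s vBt) (reals s yRho) (sz * ell) (reals s' yV i) (words s' vOwn i) \<and>
         (\<forall>q<i. reals s' yV q = reals t yV q \<and> words s' vOwn q = words t vOwn q)"
      have "d ?x (?\<sigma> (words s' vOwn i)) \<le> reals s' yV i" "\<And>j. j < sz \<Longrightarrow> reals s' yV i \<le> d ?x (?\<sigma> j) + 2 * reals s yRho j"
        using value_good[of ?\<sigma> s ?x "reals t1 yA" "reals s' yV i" "words s' vOwn i"] near R(1,7) maj s' by auto
      then show "values_good s (Suc i) (setw vQ 0 (Suc i) s')"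
        using good s' by (simp add: values_good_def less_Suc_eq)
    qed
    then show "fails value_store t1 (\<lambda>s'. values_good s (Suc i) (setw vQ 0 (Suc i) s')) \<le> 0" by (simp add: fails_sure)
  next
    fix t1 assume t1: "ask_inv t0 ?x sz t1 \<and> frame (wmods prog_ask) (rmods prog_ask) t0 t1"
    show "sure value_store t1 (\<lambda>_. True)" by (rule sure_True[OF store[OF t1]])
  qed
  then show "fails value_body t (\<lambda>s'. values_good s (Suc i) (setw vQ 0 (Suc i) s')) \<le> of_nat sz * ennreal ((17/18) ^ ell)"
    using R(2,3) i by (simp add: value_body_def t0_def fails_def)
qed

lemma spec_values:
  assumes pre: "values_pre u s"
  shows "sure prog_values s (values_inv s u)"
    "fails prog_values s (values_good s u) \<le> of_nat u * (of_nat sz * ennreal ((17/18) ^ ell))"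
proof -
  have u: "words s vCnt 0 = u" "u \<le> env vCnt" using pre env_simps by (auto simp: values_pre_def)
  have I0: "values_inv s 0 (setw vQ 0 0 s)" "values_good s 0 (setw vQ 0 0 s)"
    by (auto simp: values_inv_def values_good_def frame_def)
  show "sure prog_values s (values_inv s u)"
    unfolding prog_values_alt
    by (rule sure_For[where N=u and I="values_inv s"]) (use u I0 spec_value_body(1)[OF pre] in auto)
  show "fails prog_values s (values_good s u) \<le> of_nat u * (of_nat sz * ennreal ((17/18) ^ ell))"
    unfolding prog_values_alt
    by (rule fails_For[where N=u and I="values_inv s" and G="values_good s"])
       (use u I0 spec_value_body[OF pre] in auto)
qed

end

section \<open>Sensitivities of the groups formed in a round\<close>

text \<open>Bounding the sum by twice the maximum covers exponents below 1 as well as above.\<close>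

lemma powr_add_le:
  fixes a b z :: real
  assumes "0 \<le> a" "0 \<le> b" "0 < z"
  shows "(a + b) powr z \<le> 2 powr z * (a powr z + b powr z)"
proof -
  have "(a + b) powr z \<le> (2 * max a b) powr z" using assms by (intro powr_mono2) auto
  also have "\<dots> = 2 powr z * max a b powr z" by (rule powr_mult)
  also have "max a b powr z \<le> a powr z + b powr z" by (auto simp: max_def)
  finally show ?thesis by simp
qed

text \<open>A lower distance \<open>D\<close> replaces the ratio of extreme distances, so that the
  condition also makes sense for a single point.\<close>

locale coreset_analysis = coreset_alg +
  fixes z :: real
  assumes z_pos: "0 < z"
    and aspect: "\<exists>D>0. \<forall>x<n. \<forall>y<n. x \<noteq> y \<longrightarrow> D \<le> d x y \<and> d x y \<le> real n ^ aa * D"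
begin

definition ccost :: "nat set \<Rightarrow> nat \<Rightarrow> real" where
  "ccost C x = Min ((\<lambda>c. d x c powr z) ` C)"

definition total :: "nat set \<Rightarrow> real" where
  "total C = (\<Sum>x<n. ccost C x)"

definition centers :: "nat set set" where
  "centers = {C. C \<subseteq> {..<n} \<and> C \<noteq> {} \<and> card C \<le> k}"

text \<open>The sensitivity constant: a group has diameter at most \<open>24 * rad U0\<close>, the 8
  is the Markov factor inside \<open>rad\<close>, and \<open>2 powr z\<close> pays for the triangle
  inequality.\<close>

definition Kz :: real where
  "Kz = 2 powr z * (1 + 8 * 24 powr z)"

lemma finite_centers: "finite centers"
  unfolding centers_def by (rule finite_subset[of _ "Pow {..<n}"]) auto

lemma centersD: "C \<in> centers \<Longrightarrow> finite C" "C \<in> centers \<Longrightarrow> C \<noteq> {}" "C \<in> centers \<Longrightarrow> c \<in> C \<Longrightarrow> c < n" "C \<in> centers \<Longrightarrow> card C \<le> k"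
  unfolding centers_def by (auto intro: finite_subset)

lemma ccost_le: "C \<in> centers \<Longrightarrow> c \<in> C \<Longrightarrow> ccost C x \<le> d x c powr z"
  unfolding ccost_def by (intro Min_le) (auto dest: centersD)

lemma ccost_attained: "C \<in> centers \<Longrightarrow> \<exists>c\<in>C. ccost C x = d x c powr z"
proof -
  assume C: "C \<in> centers"
  have "ccost C x \<in> (\<lambda>c. d x c powr z) ` C"
    unfolding ccost_def using centersD(1,2)[OF C] by (intro Min_in) auto
  then show ?thesis by auto
qed

lemma ccost_nonneg: "C \<in> centers \<Longrightarrow> 0 \<le> ccost C x"
  using ccost_attained[of C x] by auto

lemma total_nonneg: "C \<in> centers \<Longrightarrow> 0 \<le> total C"
  unfolding total_def by (intro sum_nonneg ccost_nonneg)

lemma ccost_shift: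
  assumes C: "C \<in> centers" and "x < n" "y < n" "d x y \<le> R"
  shows "ccost C x \<le> 2 powr z * (ccost C y + R powr z)"
proof -
  obtain c where c: "c \<in> C" "ccost C y = d y c powr z" using ccost_attained[OF C] by blast
  have R: "0 \<le> R" using assms(4) dist_nonneg order_trans by blast
  have "d x c \<le> R + d y c" using dist_triangle[of x y c] assms centersD(3)[OF C c(1)] by linarith
  then have "d x c powr z \<le> (d y c + R) powr z" using dist_nonneg z_pos by (intro powr_mono2) auto
  also have "\<dots> \<le> 2 powr z * (d y c powr z + R powr z)" using dist_nonneg R z_pos by (intro powr_add_le)
  finally show ?thesis using ccost_le[OF C c(1), of x] c(2) by simp
qed

lemma exists_opt: "\<exists>C0\<in>centers. \<forall>C\<in>centers. total C0 \<le> total C"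
proof -
  have "{0} \<in> centers" using n_pos k_pos by (auto simp: centers_def)
  then have ne: "total ` centers \<noteq> {}" by blast
  have fin: "finite (total ` centers)" using finite_centers by simp
  obtain C0 where C0: "C0 \<in> centers" "total C0 = Min (total ` centers)" using Min_in[OF fin ne] by auto
  moreover have "Min (total ` centers) \<le> total C" if "C \<in> centers" for C using fin that by simp
  ultimately show ?thesis by metis
qed

definition Copt :: "nat set" where
  "Copt = (SOME C0. C0 \<in> centers \<and> (\<forall>C\<in>centers. total C0 \<le> total C))"

lemma Copt: "Copt \<in> centers" "C \<in> centers \<Longrightarrow> total Copt \<le> total C"
  using someI_ex[of "\<lambda>C0. C0 \<in> centers \<and> (\<forall>C\<in>centers. total C0 \<le> total C)"] exists_opt
  unfolding Copt_def by blast+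

definition ctr :: "nat \<Rightarrow> nat" where
  "ctr x = (SOME c. c \<in> Copt \<and> ccost Copt x = d x c powr z)"

lemma ctr: "ctr x \<in> Copt" "ccost Copt x = d x (ctr x) powr z"
  using someI_ex[of "\<lambda>c. c \<in> Copt \<and> ccost Copt x = d x c powr z"] ccost_attained[OF Copt(1), of x]
  unfolding ctr_def by blast+

definition mu :: "nat set \<Rightarrow> real" where
  "mu U0 = (\<Sum>x\<in>U0. ccost Copt x) / real (card U0)"

text \<open>The distance at which a point costs eight times the average optimal cost. By Markov's
  inequality at most an eighth of \<open>U0\<close> is farther from its optimal center.\<close>

definition rad :: "nat set \<Rightarrow> real" where
  "rad U0 = (8 * mu U0) powr (1 / z)"

definition Cl :: "nat set \<Rightarrow> nat \<Rightarrow> nat set" where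
  "Cl U0 c = {x \<in> U0. ccost Copt x \<le> 8 * mu U0 \<and> ctr x = c}"

definition big_points :: "nat set \<Rightarrow> nat set" where
  "big_points U0 = {x \<in> U0. ccost Copt x \<le> 8 * mu U0 \<and> card U0 \<le> 8 * k * card (Cl U0 (ctr x))}"

lemma mu_nonneg: "0 \<le> mu U0"
  unfolding mu_def by (intro divide_nonneg_nonneg sum_nonneg ccost_nonneg Copt(1)) simp

lemma rad_nonneg: "0 \<le> rad U0" by (simp add: rad_def)

lemma rad_powr: "(24 * rad U0) powr z = 24 powr z * (8 * mu U0)"
proof -
  have "rad U0 powr z = 8 * mu U0"
    using mu_nonneg[of U0] z_pos by (simp add: rad_def powr_powr)
  then show ?thesis using rad_nonneg by (simp add: powr_mult)
qed

lemma dist_ctr: "ccost Copt x \<le> 8 * mu U0 \<Longrightarrow> d x (ctr x) \<le> rad U0"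
proof -
  assume "ccost Copt x \<le> 8 * mu U0"
  then have "(d x (ctr x) powr z) powr (1 / z) \<le> rad U0"
    unfolding rad_def ctr(2) using z_pos by (intro powr_mono2) auto
  then show ?thesis using z_pos dist_nonneg[of x "ctr x"] by (simp add: powr_powr)
qed

lemma dist_Cl:
  assumes "U0 \<subseteq> {..<n}" "x \<in> Cl U0 c" "y \<in> Cl U0 c"
  shows "d x y \<le> 2 * rad U0"
proof -
  have "d x c \<le> rad U0" "d y c \<le> rad U0" using assms dist_ctr[of x U0] dist_ctr[of y U0] by (auto simp: Cl_def)
  moreover have "c < n" using assms(2) ctr(1)[of x] centersD(3)[OF Copt(1)] by (auto simp: Cl_def)
  moreover have "x < n" "y < n" using assms by (auto simp: Cl_def)
  ultimately show ?thesis using dist_triangle[of x c y] dist_commute[of c y] by linarith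
qed

text \<open>At most an eighth of the points costs more than eight times the average. The clusters
  whose cheap part is less than a \<open>1 / (8 * k)\<close> share of \<open>U0\<close> hold at most
  another eighth, as there are at most \<open>k\<close> of them.\<close>

lemma big_points_many:
  assumes "finite U0" "U0 \<noteq> {}"
  shows "4 * card (U0 - big_points U0) \<le> card U0"
proof -
  let ?u = "card U0"
  have u: "0 < ?u" using assms by (simp add: card_gt_0_iff)
  define X where "X = {x \<in> U0. 8 * mu U0 < ccost Copt x}"
  define Y where "Y = {x \<in> U0. ccost Copt x \<le> 8 * mu U0 \<and> \<not> ?u \<le> 8 * k * card (Cl U0 (ctr x))}"
  have finX: "finite X" "finite Y" using assms(1) by (auto simp: X_def Y_def)
  have sum: "(\<Sum>x\<in>U0. ccost Copt x) = mu U0 * real ?u" using u by (simp add: mu_def)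
  have "8 * card X \<le> ?u"
  proof (cases "mu U0 = 0")
    case True
    then have "\<forall>x\<in>U0. ccost Copt x = 0"
      using sum sum_nonneg_eq_0_iff[OF assms(1), of "ccost Copt"] ccost_nonneg[OF Copt(1)] by auto
    then have "X = {}" using True by (auto simp: X_def)
    then show ?thesis by simp
  next
    case False
    then have pos: "0 < mu U0" using mu_nonneg[of U0] by linarith
    have "real (card X) * (8 * mu U0) = (\<Sum>x\<in>X. 8 * mu U0)" by simp
    also have "\<dots> \<le> (\<Sum>x\<in>X. ccost Copt x)" by (intro sum_mono) (auto simp: X_def)
    also have "\<dots> \<le> (\<Sum>x\<in>U0. ccost Copt x)" using assms(1) ccost_nonneg[OF Copt(1)] by (intro sum_mono2) (auto simp: X_def)
    finally have "mu U0 * (8 * real (card X)) \<le> mu U0 * real ?u" unfolding sum by (simp add: algebra_simps)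
    then have "8 * real (card X) \<le> real ?u" using pos by simp
    then show ?thesis by linarith
  qed
  moreover have "8 * card Y \<le> ?u"
  proof -
    let ?S = "{c \<in> Copt. \<not> ?u \<le> 8 * k * card (Cl U0 c)}"
    have finC: "finite Copt" using centersD(1)[OF Copt(1)] .
    have "Y \<subseteq> (\<Union>c\<in>?S. Cl U0 c)" using ctr(1) by (auto simp: Y_def Cl_def)
    moreover have finU: "finite (\<Union>c\<in>?S. Cl U0 c)" using finC assms(1) by (auto simp: Cl_def)
    ultimately have "card Y \<le> card (\<Union>c\<in>?S. Cl U0 c)" by (intro card_mono)
    also have "\<dots> \<le> (\<Sum>c\<in>?S. card (Cl U0 c))" using finC by (intro card_UN_le) auto
    finally have "8 * k * card Y \<le> (\<Sum>c\<in>?S. 8 * k * card (Cl U0 c))" by (simp add: sum_distrib_left[symmetric])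
    also have "\<dots> \<le> (\<Sum>c\<in>?S. ?u)" by (intro sum_mono) auto
    also have "\<dots> = card ?S * ?u" by simp
    also have "card ?S \<le> card Copt" using finC by (intro card_mono) auto
    also have "card Copt \<le> k" using centersD(4)[OF Copt(1)] .
    finally have "k * (8 * card Y) \<le> k * ?u" by (simp add: mult_right_mono algebra_simps)
    then show ?thesis using k_pos by simp
  qed
  moreover have "U0 - big_points U0 \<subseteq> X \<union> Y" by (auto simp: big_points_def X_def Y_def not_le)
  then have "card (U0 - big_points U0) \<le> card (X \<union> Y)" using finX by (intro card_mono) auto
  then have "card (U0 - big_points U0) \<le> card X + card Y" using card_Un_le[of X Y] by linarith
  ultimately show ?thesis by linarith
qed

text \<open>The factor 4 leaves room for values that are bounded by three times the largest possible
  distance.\<close>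

lemma two_power_halvings: "4 * real n ^ aa \<le> 2 ^ halvings"
proof -
  have "n + 1 \<le> 2 ^ L" using less_two_power_lg[of n] by (simp add: L_def Suc_le_eq)
  then have "real (n + 1) \<le> 2 ^ L" by (metis of_nat_le_iff of_nat_numeral of_nat_power)
  then have "real (n + 1) ^ (aa + 2) \<le> (2 ^ L) ^ (aa + 2)" by (intro power_mono) auto
  also have "\<dots> = 2 ^ halvings" by (simp only: halvings_def power_mult[symmetric] mult.commute)
  finally have "real (n + 1) ^ aa * real (n + 1) ^ 2 \<le> 2 ^ halvings" by (simp only: power_add)
  moreover have "real n ^ aa * 4 \<le> real (n + 1) ^ aa * real (n + 1) ^ 2"
  proof (rule mult_mono)
    have "(2::real) ^ 2 \<le> real (n + 1) ^ 2" using n_pos by (intro power_mono) auto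
    then show "4 \<le> real (n + 1) ^ 2" by simp
  qed (auto intro: power_mono)
  ultimately show ?thesis by linarith
qed

text \<open>The geometric core. In a large cluster hit \<open>ell\<close> times the block radius is
  at most \<open>2 * rad U0\<close>, so its points get values at most \<open>6 * rad U0\<close>.
  These are more than half of the unsampled points, hence the splitting radius is at most
  \<open>12 * rad U0\<close> and a group has diameter at most \<open>24 * rad U0\<close>. Averaging
  \<open>ccost_shift\<close> over the group bounds the cost of one point by the average cost of the
  group plus a multiple of \<open>mu U0\<close>; the group size times \<open>mu U0\<close> is at
  most the optimal cost.\<close>

lemma round_sensitivity:
  assumes U0: "U0 \<subseteq> {..<n}" "card U0 = u" "2 * sz < u" "w = u - sz"
    and \<sigma>: "inj_on \<sigma> {..<sz}" and U: "inj_on U {..<w}" "\<sigma> ` {..<sz} \<union> U ` {..<w} = U0" "\<sigma> ` {..<sz} \<inter> U ` {..<w} = {}"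
    and near: "\<And>j. j < sz \<Longrightarrow> near_ok \<sigma> j t"
    and hits: "\<And>c. c \<in> Copt \<Longrightarrow> u \<le> 8 * k * card (Cl U0 c) \<Longrightarrow> ell \<le> card (\<sigma> ` {..<sz} \<inter> Cl U0 c)"
    and own: "\<And>q. q < w \<Longrightarrow> own q < sz"
    and val: "\<And>q. q < w \<Longrightarrow> d (U q) (\<sigma> (own q)) \<le> V q" "\<And>q j. q < w \<Longrightarrow> j < sz \<Longrightarrow> V q \<le> d (U q) (\<sigma> j) + 2 * reals t yRho j"
    and M: "\<exists>q<w. M = V q"
    and r: "w \<le> 2 * card {q. q < w \<and> V q \<le> r}" "r = M / 2 ^ halvings \<or> 2 * card {q. q < w \<and> V q \<le> r / 2} < w"
    and q: "q < w" "V q \<le> r" and C: "C \<in> centers"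
  shows "real (card {q'. q' < w \<and> V q' \<le> r \<and> own q' = own q}) * ccost C (U q) \<le> Kz * total C"
proof -
  let ?\<rho> = "rad U0"
  have finU0: "finite U0" by (rule finite_subset[OF U0(1)]) simp
  have w: "0 < w" "w + sz = u" using U0 by auto
  have Un: "U q < n" if "q < w" for q using U(2) U0(1) that by blast
  have \<sigma>n: "\<sigma> j < n" if "j < sz" for j using U(2) U0(1) that by blast
  have small: "V q \<le> 6 * ?\<rho>" if q: "q < w" "U q \<in> big_points U0" for q
  proof -
    define c where "c = ctr (U q)"
    have x: "U q \<in> Cl U0 c" and b: "u \<le> 8 * k * card (Cl U0 c)"
      using q(2) U0(2) by (auto simp: big_points_def Cl_def c_def)
    have h: "ell \<le> card (\<sigma> ` {..<sz} \<inter> Cl U0 c)" using hits[OF _ b] ctr(1) by (simp add: c_def)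
    then have "\<sigma> ` {..<sz} \<inter> Cl U0 c \<noteq> {}" using ell_pos by (intro notI) simp
    then obtain j where j: "j < sz" "\<sigma> j \<in> Cl U0 c" by blast
    \<comment> \<open>Otherwise the at least \<open>ell\<close> sample points in the cluster would
      all lie strictly within the block radius of \<open>\<sigma> j\<close>, contradicting
      \<open>near_ok\<close>.\<close>
    have "reals t yRho j \<le> 2 * ?\<rho>"
    proof (rule ccontr)
      assume "\<not> reals t yRho j \<le> 2 * ?\<rho>"
      then have "{i. i < sz \<and> \<sigma> i \<in> Cl U0 c} \<subseteq> {i. i < sz \<and> d (\<sigma> j) (\<sigma> i) < reals t yRho j}"
        using dist_Cl[OF U0(1) j(2)] by force
      then have "card {i. i < sz \<and> \<sigma> i \<in> Cl U0 c} \<le> card {i. i < sz \<and> d (\<sigma> j) (\<sigma> i) < reals t yRho j}"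
        by (intro card_mono) auto
      also have "\<dots> < ell" using near[OF j(1)] by (simp add: near_ok_def)
      finally have "card (\<sigma> ` {i. i < sz \<and> \<sigma> i \<in> Cl U0 c}) < ell"
        using card_image_le[of "{i. i < sz \<and> \<sigma> i \<in> Cl U0 c}" \<sigma>] by simp
      moreover have "\<sigma> ` {i. i < sz \<and> \<sigma> i \<in> Cl U0 c} = \<sigma> ` {..<sz} \<inter> Cl U0 c" by auto
      ultimately show False using h by simp
    qed
    moreover have "d (U q) (\<sigma> j) \<le> 2 * ?\<rho>" using dist_Cl[OF U0(1) x j(2)] .
    ultimately show ?thesis using val(2)[OF q(1) j(1)] by linarith
  qed
  \<comment> \<open>At most a quarter of \<open>U0\<close> is not big. Since more than half of
    \<open>U0\<close> is unsampled, that is less than half of the \<open>w\<close> unsampled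
    points.\<close>
  have many: "w \<le> 2 * card {q. q < w \<and> V q \<le> 6 * ?\<rho>}"
  proof -
    let ?B = "{q. q < w \<and> U q \<in> big_points U0}"
    have "U0 \<noteq> {}" using U0(2,3) by auto
    then have "4 * card (U0 - big_points U0) \<le> u" using big_points_many[OF finU0] U0(2) by simp
    moreover have "U ` {q. q < w \<and> U q \<notin> big_points U0} \<subseteq> U0 - big_points U0" using U(2) by auto
    then have "card (U ` {q. q < w \<and> U q \<notin> big_points U0}) \<le> card (U0 - big_points U0)" using finU0 by (intro card_mono) auto
    moreover have "card (U ` {q. q < w \<and> U q \<notin> big_points U0}) = card {q. q < w \<and> U q \<notin> big_points U0}"
      by (intro card_image inj_on_subset[OF U(1)]) auto
    moreover have "card ?B + card {q. q < w \<and> U q \<notin> big_points U0} = w"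
    proof -
      have "?B \<union> {q. q < w \<and> U q \<notin> big_points U0} = {..<w}" by auto
      moreover have "card (?B \<union> {q. q < w \<and> U q \<notin> big_points U0}) = card ?B + card {q. q < w \<and> U q \<notin> big_points U0}"
        by (rule card_Un_disjoint) auto
      ultimately show ?thesis by simp
    qed
    moreover have "card ?B \<le> card {q. q < w \<and> V q \<le> 6 * ?\<rho>}" using small by (intro card_mono) auto
    ultimately show ?thesis using w U0(3) by linarith
  qed
  have r12: "r \<le> 12 * ?\<rho>"
    using r(2)
  proof
    assume lt: "2 * card {q. q < w \<and> V q \<le> r / 2} < w"
    show ?thesis
    proof (rule ccontr)
      assume "\<not> r \<le> 12 * ?\<rho>"
      then have "card {q. q < w \<and> V q \<le> 6 * ?\<rho>} \<le> card {q. q < w \<and> V q \<le> r / 2}" by (intro card_mono) auto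
      then show False using lt many by linarith
    qed
  next
    \<comment> \<open>Halving in every iteration would push the radius below the smallest distance
      \<open>D\<close>. Yet some unsampled point has a value of at most \<open>r\<close>, and the
      value bounds its distance to its owner, a different point. This is impossible.\<close>
    assume eq: "r = M / 2 ^ halvings"
    obtain D where D: "0 < D" "\<And>x y. x < n \<Longrightarrow> y < n \<Longrightarrow> x \<noteq> y \<Longrightarrow> D \<le> d x y \<and> d x y \<le> real n ^ aa * D" using aspect by blast
    have dmax: "d x y \<le> real n ^ aa * D" if "x < n" "y < n" for x y
      using D that dist_self[of x] by (cases "x = y") auto
    have rho: "reals t yRho j \<le> real n ^ aa * D" if "j < sz" for j
    proof (rule ccontr)
      assume "\<not> reals t yRho j \<le> real n ^ aa * D"
      then have "d (\<sigma> j) (\<sigma> i) < reals t yRho j" if "i < sz" for i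
        using dmax[OF \<sigma>n[OF \<open>j < sz\<close>] \<sigma>n[OF that]] by linarith
      then have "{..<sz} \<subseteq> {i. i < sz \<and> d (\<sigma> j) (\<sigma> i) < reals t yRho j}" by auto
      then have "card {..<sz} \<le> card {i. i < sz \<and> d (\<sigma> j) (\<sigma> i) < reals t yRho j}" by (intro card_mono) auto
      then show False using near[OF that] sz_ge(1) by (simp add: near_ok_def)
    qed
    obtain q0 where q0: "q0 < w" "M = V q0" using M by blast
    have sz0: "0 < sz" using sz_ge(2) by simp
    have "V q0 \<le> d (U q0) (\<sigma> 0) + 2 * reals t yRho 0" using val(2) q0 sz0 by blast
    also have "\<dots> \<le> real n ^ aa * D + 2 * (real n ^ aa * D)"
      using dmax[OF Un[OF q0(1)] \<sigma>n[OF sz0]] rho[OF sz0] by linarith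
    also have "\<dots> < 4 * real n ^ aa * D" using n_pos D(1) by simp
    also have "\<dots> \<le> 2 ^ halvings * D" using two_power_halvings D(1) by (intro mult_right_mono) auto
    finally have "r < D" unfolding eq q0(2) by (simp add: field_simps)
    have "card {q. q < w \<and> V q \<le> r} \<noteq> 0" using r(1) w by linarith
    then have "{q. q < w \<and> V q \<le> r} \<noteq> {}" by (rule contrapos_nn) (simp only: card.empty)
    then obtain q1 where q1: "q1 < w" "V q1 \<le> r" by blast
    have "U q1 \<noteq> \<sigma> (own q1)" using U(3) q1 own[OF q1(1)] by blast
    then have "D \<le> d (U q1) (\<sigma> (own q1))" using D(2) Un[OF q1(1)] \<sigma>n[OF own[OF q1(1)]] by blast
    then show ?thesis using val(1)[OF q1(1)] q1(2) \<open>r < D\<close> by linarith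
  qed
  let ?G = "{q'. q' < w \<and> V q' \<le> r \<and> own q' = own q}"
  have near_G: "ccost C (U q) \<le> 2 powr z * (ccost C (U q') + 24 powr z * (8 * mu U0))" if "q' \<in> ?G" for q'
  proof -
    have "d (U q) (U q') \<le> d (U q) (\<sigma> (own q)) + d (\<sigma> (own q)) (U q')"
      using that q Un \<sigma>n own by (intro dist_triangle) auto
    also have "\<dots> \<le> r + r" using val(1)[of q] val(1)[of q'] q that by (simp add: dist_commute[of "\<sigma> (own q)"])
    finally have "d (U q) (U q') \<le> 24 * ?\<rho>" using r12 by linarith
    then show ?thesis using ccost_shift[OF C, of "U q" "U q'" "24 * ?\<rho>"] Un q that unfolding rad_powr by simp
  qed
  have finG: "finite ?G" by simp
  have "real (card ?G) * ccost C (U q) = (\<Sum>q'\<in>?G. ccost C (U q))" by simp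
  also have "\<dots> \<le> (\<Sum>q'\<in>?G. 2 powr z * (ccost C (U q') + 24 powr z * (8 * mu U0)))" by (intro sum_mono near_G)
  also have "\<dots> = 2 powr z * ((\<Sum>q'\<in>?G. ccost C (U q')) + 24 powr z * (8 * (real (card ?G) * mu U0)))"
    by (simp add: sum_distrib_left[symmetric] sum.distrib algebra_simps)
  also have "\<dots> \<le> 2 powr z * (total C + 24 powr z * (8 * total C))"
  proof (intro mult_left_mono add_mono)
    have "(\<Sum>q'\<in>?G. ccost C (U q')) = (\<Sum>x\<in>U ` ?G. ccost C x)"
      by (intro sum.reindex[symmetric, unfolded o_def] inj_on_subset[OF U(1)]) auto
    also have "\<dots> \<le> total C" unfolding total_def using Un ccost_nonneg[OF C] by (intro sum_mono2) auto
    finally show "(\<Sum>q'\<in>?G. ccost C (U q')) \<le> total C" .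
    have "card ?G \<le> card {..<w}" by (intro card_mono) auto
    then have "real (card ?G) \<le> real u" using w by simp
    then have "real (card ?G) * mu U0 \<le> real u * mu U0" using mu_nonneg by (rule mult_right_mono)
    also have "\<dots> = (\<Sum>x\<in>U0. ccost Copt x)" using U0(2,3) by (simp add: mu_def)
    also have "\<dots> \<le> total Copt" unfolding total_def using U0(1) ccost_nonneg[OF Copt(1)] by (intro sum_mono2) auto
    also have "\<dots> \<le> total C" using Copt(2)[OF C] .
    finally show "real (card ?G) * mu U0 \<le> total C" .
  qed auto
  also have "\<dots> = Kz * total C" by (simp add: Kz_def algebra_simps)
  finally show ?thesis .
qed

end

lemma Diff_split: "X = A \<union> (R \<union> K) \<Longrightarrow> A \<inter> K = {} \<Longrightarrow> R \<inter> K = {} \<Longrightarrow> X \<subseteq> N \<Longrightarrow> N - K = (N - X) \<union> (A \<union> R)"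
  by blast

context oracle_lang
begin

lemma fails_seq_sure:
  assumes "sure a s I" "\<And>s'. I s' \<Longrightarrow> fails b s' G \<le> \<delta>"
  shows "fails (Seq a b) s G \<le> \<delta>"
proof -
  have "fails (Seq a b) s G = expect a s (\<lambda>s'. fails b s' G)" by (simp add: fails_def)
  also have "\<dots> \<le> expect a s (\<lambda>s'. \<delta>)" using assms by (rule expect_mono_on)
  also have "\<dots> = \<delta>" using sure_True[OF assms(1)] by (rule expect_const)
  finally show ?thesis .
qed

end

section \<open>Invariant and failure probability of a round\<close>

context coreset_analysis
begin

text \<open>The probability with which the last stage outputs \<open>x\<close>; the sum over all
  points is the expected output size.\<close>

definition incl :: "store \<Rightarrow> nat \<Rightarrow> real" where
  "incl s x = (if words s vG x \<le> rate then 1 else real rate / real (words s vG x))"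

definition live :: "store \<Rightarrow> nat set" where
  "live s = words s vU ` {..<words s vCnt 0}"

text \<open>A round adds at most \<open>sz * rate\<close> to the sum for its groups and
  \<open>sz\<close> for its sample. The number of live points halves, until it is so small that
  rounds no longer do anything.\<close>

definition round_inv :: "nat \<Rightarrow> store \<Rightarrow> bool" where
  "round_inv i s \<longleftrightarrow> params s \<and> words s vCnt 0 \<le> n \<and> inj_on (words s vU) {..<words s vCnt 0} \<and> live s \<subseteq> {..<n} \<and>
     (\<forall>x. words s vG x \<le> n) \<and> (\<forall>x\<in>live s. words s vG x = 0) \<and>
     (\<Sum>x\<in>{..<n} - live s. incl s x) \<le> real i * (real sz * real rate + real sz) \<and>
     (words s vCnt 0 \<le> 2 * sz \<or> words s vCnt 0 * 2 ^ i \<le> n) \<and> (\<forall>(a, b)\<in>weak_pairs s. b \<notin> live s)"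

text \<open>Unlike \<open>round_inv\<close>, this holds only with high probability. Points with
  \<open>vG\<close> equal to 0 satisfy it trivially, which is harmless because they are output with
  certainty.\<close>

definition sens :: "store \<Rightarrow> bool" where
  "sens s \<longleftrightarrow> (\<forall>x<n. \<forall>C\<in>centers. real (words s vG x) * ccost C x \<le> Kz * total C)"

definition finish :: com where
  "finish = prog_radius ;; prog_groups ;; prog_remove"

text \<open>The radius is a parameter because later only its two characteristic properties matter,
  not the cell that held it.\<close>

definition finished :: "nat \<Rightarrow> store \<Rightarrow> real \<Rightarrow> store \<Rightarrow> bool" where
  "finished w t r s' \<longleftrightarrow> w \<le> 2 * card {q. q < w \<and> reals t yV q \<le> r} \<and>
     (r = reals t yMax 0 / 2 ^ halvings \<or> 2 * card {q. q < w \<and> reals t yV q \<le> r / 2} < w) \<and>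
     words s' vCnt 0 = card {q. q < w \<and> r < reals t yV q} \<and> inj_on (words s' vU) {..<words s' vCnt 0} \<and>
     live s' = words t vU ` {q. q < w \<and> r < reals t yV q} \<and>
     (\<forall>q<w. reals t yV q \<le> r \<longrightarrow> words s' vG (words t vU q) = card {q'. q' < w \<and> reals t yV q' \<le> r \<and> words t vOwn q' = words t vOwn q}) \<and>
     (\<forall>x. x \<notin> words t vU ` {q. q < w \<and> reals t yV q \<le> r} \<longrightarrow> words s' vG x = words t vG x) \<and>
     params s' \<and> weak_pairs s' = weak_pairs t"

lemma spec_finish:
  assumes pre: "values_pre w s2" and inv: "values_inv s2 w t"
  shows "sure finish t (\<lambda>s'. \<exists>r. finished w t r s')"
proof -
  have fr: "frame {vQ, vX, vI, vFlag, vE, vC, vB1, vOwn} {yA, yTmp, yVal, yV, yMax} s2 t" using inv by (simp add: values_inv_def)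
  have par: "params t" using pre by (intro params_frame[OF _ fr]) (auto simp: values_pre_def)
  have eqs: "words t vU = words s2 vU" "words t vCnt = words s2 vCnt" using fr by (auto simp: frame_def)
  have t: "words t vCnt 0 = w" "w \<le> n" "inj_on (words t vU) {..<w}" "words t vU ` {..<w} \<subseteq> {..<n}" "words t vJ 0 = halvings" "words t vS 0 = sz"
    using pre par by (auto simp: values_pre_def params_def eqs)
  have own: "words t vOwn q < sz" if "q < w" for q using inv that by (simp add: values_inv_def)
  have "{q. q < w \<and> reals t yV q \<le> reals t yMax 0} = {..<w}" using inv by (auto simp: values_inv_def)
  then have all: "w \<le> 2 * card {q. q < w \<and> reals t yV q \<le> reals t yMax 0}" by simp
  have "sure finish t (\<lambda>s'. \<exists>r. w \<le> 2 * card {q. q < w \<and> reals t yV q \<le> r} \<and>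
     (r = reals t yMax 0 / 2 ^ halvings \<or> 2 * card {q. q < w \<and> reals t yV q \<le> r / 2} < w) \<and>
     words s' vCnt 0 = card {q. q < w \<and> r < reals t yV q} \<and> inj_on (words s' vU) {..<words s' vCnt 0} \<and>
     live s' = words t vU ` {q. q < w \<and> r < reals t yV q} \<and>
     (\<forall>q<w. reals t yV q \<le> r \<longrightarrow> words s' vG (words t vU q) = card {q'. q' < w \<and> reals t yV q' \<le> r \<and> words t vOwn q' = words t vOwn q}) \<and>
     (\<forall>x. x \<notin> words t vU ` {q. q < w \<and> reals t yV q \<le> r} \<longrightarrow> words s' vG x = words t vG x))"
    unfolding finish_def
  proof (rule sure_seqI[OF spec_radius[OF t(1,5,2) all]], goal_cases)
    case (1 t1)
    define r where "r = reals t1 yR 0"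
    have f1: "words t1 vCnt = words t vCnt" "words t1 vS = words t vS" "words t1 vOwn = words t vOwn" "words t1 vU = words t vU"
      "words t1 vG = words t vG" "reals t1 yV = reals t yV"
      using 1(2) by (auto simp: frame_def prog_radius_def)
    have "sure prog_groups t1 (\<lambda>s'. \<forall>j<sz. words s' vGc j = card {q. q < w \<and> reals t1 yV q \<le> reals t1 yR 0 \<and> words t1 vOwn q = j})"
      by (rule spec_groups) (use t own f1 in auto)
    then show ?case
    proof (rule sure_seqI, goal_cases)
      case (1 t2)
      have f2: "words t2 vCnt = words t vCnt" "words t2 vOwn = words t vOwn" "words t2 vU = words t vU"
        "words t2 vG = words t vG" "reals t2 yV = reals t yV" "reals t2 yR 0 = r"
        using 1(2) f1 by (auto simp: frame_def prog_groups_def r_def)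
      have gc: "words t2 vGc j = card {q. q < w \<and> reals t yV q \<le> r \<and> words t vOwn q = j}" if "j < sz" for j
        using 1(1) that by (simp add: f1 r_def)
      have "words t2 vGc (words t2 vOwn q) \<le> n" if "q < w" for q
      proof -
        have "words t2 vGc (words t2 vOwn q) = card {q'. q' < w \<and> reals t yV q' \<le> r \<and> words t vOwn q' = words t vOwn q}"
          using gc[OF own[OF that]] by (simp add: f2)
        also have "\<dots> \<le> w" by (rule card_less_filter_le)
        finally show ?thesis using t(2) by simp
      qed
      then have "sure prog_remove t2 (\<lambda>s'. words s' vCnt 0 = card {q. q < w \<and> reals t2 yR 0 < reals t2 yV q} \<and>
         inj_on (words s' vU) {..<words s' vCnt 0} \<and>
         words s' vU ` {..<words s' vCnt 0} = words t2 vU ` {q. q < w \<and> reals t2 yR 0 < reals t2 yV q} \<and>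
         (\<forall>q<w. reals t2 yV q \<le> reals t2 yR 0 \<longrightarrow> words s' vG (words t2 vU q) = words t2 vGc (words t2 vOwn q)) \<and>
         (\<forall>x. x \<notin> words t2 vU ` {q. q < w \<and> reals t2 yV q \<le> reals t2 yR 0} \<longrightarrow> words s' vG x = words t2 vG x))"
        using t by (intro spec_remove) (auto simp: f2)
      then show ?case
      proof (rule sure_mono, goal_cases)
        case (1 s')
        show ?case
        proof (intro exI[of _ r] conjI)
          show "w \<le> 2 * card {q. q < w \<and> reals t yV q \<le> r}"
            "r = reals t yMax 0 / 2 ^ halvings \<or> 2 * card {q. q < w \<and> reals t yV q \<le> r / 2} < w"
            using \<open>w \<le> 2 * card {q. q < w \<and> reals t yV q \<le> reals t1 yR 0} \<and> _\<close> by (simp_all add: r_def)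
          show "\<forall>q<w. reals t yV q \<le> r \<longrightarrow> words s' vG (words t vU q) = card {q'. q' < w \<and> reals t yV q' \<le> r \<and> words t vOwn q' = words t vOwn q}"
            using 1 gc own by (simp add: f2)
          show "words s' vCnt 0 = card {q. q < w \<and> r < reals t yV q}" "inj_on (words s' vU) {..<words s' vCnt 0}"
            "live s' = words t vU ` {q. q < w \<and> r < reals t yV q}"
            "\<forall>x. x \<notin> words t vU ` {q. q < w \<and> reals t yV q \<le> r} \<longrightarrow> words s' vG x = words t vG x"
            using 1 unfolding f2 live_def by blast+
        qed
      qed
    qed
  qed
  then have S: "sure finish t (\<lambda>s'. \<exists>r. w \<le> 2 * card {q. q < w \<and> reals t yV q \<le> r} \<and>
     (r = reals t yMax 0 / 2 ^ halvings \<or> 2 * card {q. q < w \<and> reals t yV q \<le> r / 2} < w) \<and>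
     words s' vCnt 0 = card {q. q < w \<and> r < reals t yV q} \<and> inj_on (words s' vU) {..<words s' vCnt 0} \<and>
     live s' = words t vU ` {q. q < w \<and> r < reals t yV q} \<and>
     (\<forall>q<w. reals t yV q \<le> r \<longrightarrow> words s' vG (words t vU q) = card {q'. q' < w \<and> reals t yV q' \<le> r \<and> words t vOwn q' = words t vOwn q}) \<and>
     (\<forall>x. x \<notin> words t vU ` {q. q < w \<and> reals t yV q \<le> r} \<longrightarrow> words s' vG x = words t vG x))" .
  have "\<not> asks finish" by (simp add: finish_def prog_radius_def prog_groups_def prog_remove_def)
  from sure_frame[OF sure_weak_pairs[OF S this]]
  show ?thesis
  proof (rule sure_mono)
    fix s' assume *: "((\<exists>r. w \<le> 2 * card {q. q < w \<and> reals t yV q \<le> r} \<and>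
     (r = reals t yMax 0 / 2 ^ halvings \<or> 2 * card {q. q < w \<and> reals t yV q \<le> r / 2} < w) \<and>
     words s' vCnt 0 = card {q. q < w \<and> r < reals t yV q} \<and> inj_on (words s' vU) {..<words s' vCnt 0} \<and>
     live s' = words t vU ` {q. q < w \<and> r < reals t yV q} \<and>
     (\<forall>q<w. reals t yV q \<le> r \<longrightarrow> words s' vG (words t vU q) = card {q'. q' < w \<and> reals t yV q' \<le> r \<and> words t vOwn q' = words t vOwn q}) \<and>
     (\<forall>x. x \<notin> words t vU ` {q. q < w \<and> reals t yV q \<le> r} \<longrightarrow> words s' vG x = words t vG x)) \<and>
     weak_pairs s' = weak_pairs t) \<and> frame (wmods finish) (rmods finish) t s'"
    have "params s'" by (rule params_frame[OF par *[THEN conjunct2]])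
      (simp_all add: finish_def prog_radius_def prog_groups_def prog_remove_def)
    then show "\<exists>r. finished w t r s'" using * unfolding finished_def by blast
  qed
qed

definition sampled :: "store \<Rightarrow> store \<Rightarrow> bool" where
  "sampled s t \<longleftrightarrow> sampling (words s vCnt 0) (live s) sz t \<and> params t \<and> words t vG = words s vG \<and> weak_pairs t = weak_pairs s"

lemma spec_sampled:
  assumes inv: "round_inv i s" and u: "2 * sz < words s vCnt 0"
  shows "sure prog_sample s (sampled s)"
proof -
  have "sure prog_sample s (sampling (words s vCnt 0) (live s) sz)"
    using inv u by (intro spec_sample) (auto simp: round_inv_def live_def params_def)
  moreover have "\<not> asks prog_sample" by (simp add: prog_sample_def)
  ultimately have "sure prog_sample s (\<lambda>t. (sampling (words s vCnt 0) (live s) sz t \<and> weak_pairs t = weak_pairs s) \<and> frame (wmods prog_sample) (rmods prog_sample) s t)"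
    by (intro sure_frame sure_weak_pairs)
  then show ?thesis
  proof (rule sure_mono)
    fix t assume *: "(sampling (words s vCnt 0) (live s) sz t \<and> weak_pairs t = weak_pairs s) \<and> frame (wmods prog_sample) (rmods prog_sample) s t"
    have "params t" using inv by (intro params_frame[OF _ *[THEN conjunct2]]) (auto simp: prog_sample_def round_inv_def)
    then show "sampled s t" using * by (auto simp: sampled_def frame_def prog_sample_def)
  qed
qed

lemma spec_nearest:
  assumes inv: "round_inv i s" and u: "2 * sz < words s vCnt 0" and s1: "sampled s s1"
  shows "sure prog_near s1 (\<lambda>s2. sampled s s2 \<and> words s2 vSmp = words s1 vSmp \<and> values_pre (words s vCnt 0 - sz) s2)"
proof -
  let ?u = "words s vCnt 0"
  have lv: "live s \<subseteq> {..<n}" "?u \<le> n" "\<And>a b. (a, b) \<in> weak_pairs s \<Longrightarrow> b \<notin> live s" using inv by (auto simp: round_inv_def)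
  have sm: "sampling ?u (live s) sz s1" "params s1" using s1 by (auto simp: sampled_def)
  have \<sigma>: "words s1 vSmp q < n" if "q < sz" for q using sm(1) lv(1) that unfolding sampling_def by blast
  have "sure prog_near s1 (\<lambda>s'. \<forall>j<sz. near_ok (words s1 vSmp) j s')"
    using sm(2) \<sigma> by (intro spec_near) (auto simp: params_def)
  moreover have "\<not> asks prog_near" by (simp add: prog_near_def prog_dists_def prog_pick_def prog_argmin_def)
  ultimately have "sure prog_near s1 (\<lambda>s2. ((\<forall>j<sz. near_ok (words s1 vSmp) j s2) \<and> weak_pairs s2 = weak_pairs s1) \<and> frame (wmods prog_near) (rmods prog_near) s1 s2)"
    by (intro sure_frame sure_weak_pairs)
  then show ?thesis
  proof (rule sure_mono)
    fix s2 assume *: "((\<forall>j<sz. near_ok (words s1 vSmp) j s2) \<and> weak_pairs s2 = weak_pairs s1) \<and> frame (wmods prog_near) (rmods prog_near) s1 s2"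
    have par: "params s2" using sm(2) by (rule params_frame[OF _ *[THEN conjunct2]])
      (simp_all add: prog_near_def prog_dists_def prog_pick_def prog_argmin_def)
    have f: "words s2 vSmp = words s1 vSmp" "words s2 vU = words s1 vU" "words s2 vCnt = words s1 vCnt" "words s2 vG = words s1 vG"
      using * by (auto simp: frame_def prog_near_def prog_dists_def prog_pick_def prog_argmin_def)
    have "sampled s s2" using s1 par * f by (simp add: sampled_def sampling_def)
    moreover have "values_pre (?u - sz) s2"
    proof -
      have U: "words s1 vSmp ` {..<sz} \<union> words s1 vU ` {..<?u - sz} = live s" using sm(1) by (simp add: sampling_def)
      have W: "weak_pairs s2 = weak_pairs s" using * s1 by (simp add: sampled_def)
      have "\<forall>(a, b)\<in>weak_pairs s2. b \<notin> words s2 vU ` {..<?u - sz} \<union> words s2 vSmp ` {..<sz}"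
        using lv(3) U unfolding W f by blast
      moreover have "words s2 vU ` {..<?u - sz} \<subseteq> {..<n}" "words s2 vSmp ` {..<sz} \<subseteq> {..<n}"
        using U lv(1) unfolding f by blast+
      ultimately show ?thesis
        using sm(1) par * lv(2) unfolding values_pre_def sampling_def by (simp add: f)
    qed
    ultimately show "sampled s s2 \<and> words s2 vSmp = words s1 vSmp \<and> values_pre (?u - sz) s2" using f by simp
  qed
qed

text \<open>A group contributes at most \<open>rate\<close> to the sum of inclusion probabilities
  whatever its size, and there is at most one group per sample point. At least half of the unsampled
  points are removed, so at most half survive.\<close>

lemma round_end:
  assumes inv: "round_inv i s" and u: "2 * sz < words s vCnt 0" and s2: "sampled s s2" "values_pre (words s vCnt 0 - sz) s2"
    and t: "values_inv s2 (words s vCnt 0 - sz) t" and fin: "finished (words s vCnt 0 - sz) t r s'"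
  shows "round_inv (Suc i) s'"
proof -
  let ?u = "words s vCnt 0"
  define w where "w = ?u - sz"
  let ?U = "words t vU" and ?\<sigma> = "words t vSmp" and ?V = "reals t yV" and ?own = "words t vOwn"
  define R where "R = {q. q < w \<and> ?V q \<le> r}"
  define K where "K = {q. q < w \<and> r < ?V q}"
  have fr: "frame {vQ, vX, vI, vFlag, vE, vC, vB1, vOwn} {yA, yTmp, yVal, yV, yMax} s2 t" using t by (simp add: values_inv_def)
  have f: "words t vU = words s2 vU" "words t vSmp = words s2 vSmp" "words t vG = words s vG"
    using fr s2(1) by (auto simp: frame_def sampled_def)
  have sm: "inj_on ?U {..<w}" "inj_on ?\<sigma> {..<sz}" "?\<sigma> ` {..<sz} \<union> ?U ` {..<w} = live s" "?\<sigma> ` {..<sz} \<inter> ?U ` {..<w} = {}"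
    using s2(1) by (auto simp: sampled_def sampling_def f w_def)
  have old: "live s \<subseteq> {..<n}" "?u \<le> n" "\<And>x. words s vG x \<le> n" "\<And>x. x \<in> live s \<Longrightarrow> words s vG x = 0"
      "(\<Sum>x\<in>{..<n} - live s. incl s x) \<le> real i * (real sz * real rate + real sz)" "?u * 2 ^ i \<le> n"
      "\<And>a b. (a, b) \<in> weak_pairs s \<Longrightarrow> b \<notin> live s"
    using inv u by (auto simp: round_inv_def)
  have own: "?own q < sz" if "q < w" for q using t that by (simp add: values_inv_def w_def)
  note fin' = fin[unfolded finished_def, folded w_def]
  have F5: "words s' vG (?U q) = card {q' \<in> R. ?own q' = ?own q}" if "q \<in> R" for q
  proof -
    have "{q' \<in> R. ?own q' = ?own q} = {q'. q' < w \<and> ?V q' \<le> r \<and> ?own q' = ?own q}" by (auto simp: R_def)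
    then show ?thesis using fin' that unfolding R_def by simp
  qed
  have F: "w \<le> 2 * card R" "words s' vCnt 0 = card K" "inj_on (words s' vU) {..<words s' vCnt 0}" "live s' = ?U ` K"
     "\<And>x. x \<notin> ?U ` R \<Longrightarrow> words s' vG x = words t vG x" "params s'" "weak_pairs s' = weak_pairs t"
    using fin' unfolding R_def K_def by blast+
  have RK: "R \<union> K = {..<w}" "R \<inter> K = {}" "finite R" "finite K" by (auto simp: R_def K_def)
  have cRK: "card R + card K = w" using card_Un_disjoint[OF RK(3,4,2)] RK(1) by simp
  have Rw: "R \<subseteq> {..<w}" "K \<subseteq> {..<w}" using RK(1) by auto
  have live': "live s' \<subseteq> live s" using F(4) sm(3) Rw(2) by blast
  have dis: "?U ` R \<inter> ?U ` K = {}" using inj_on_image_Int[OF sm(1) Rw] RK(2) by simp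
  have wp: "weak_pairs s' = weak_pairs s \<union> {(?U q, ?\<sigma> j) | q j. q < w \<and> j < sz}"
    using F(7) t s2(1) by (simp add: values_inv_def sampled_def f w_def)
  have inclR: "(\<Sum>x\<in>?U ` R. incl s' x) \<le> real sz * real rate"
  proof -
    have "(\<Sum>x\<in>?U ` R. incl s' x) = (\<Sum>q\<in>R. incl s' (?U q))"
      using inj_on_subset[OF sm(1) Rw(1)] by (subst sum.reindex) auto
    also have "\<dots> = (\<Sum>j<sz. \<Sum>q\<in>{q \<in> R. ?own q = j}. incl s' (?U q))"
      using RK(3) own Rw(1) by (intro sum.group[symmetric]) auto
    also have "\<dots> \<le> (\<Sum>j<sz. real rate)"
    proof (rule sum_mono)
      fix j
      let ?g = "card {q \<in> R. ?own q = j}"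
      have "(\<Sum>q\<in>{q \<in> R. ?own q = j}. incl s' (?U q)) = (\<Sum>q\<in>{q \<in> R. ?own q = j}. if ?g \<le> rate then 1 else real rate / real ?g)"
        by (rule sum.cong) (auto simp: incl_def F5)
      also have "\<dots> = real ?g * (if ?g \<le> rate then 1 else real rate / real ?g)" by simp
      also have "\<dots> \<le> real rate" by auto
      finally show "(\<Sum>q\<in>{q \<in> R. ?own q = j}. incl s' (?U q)) \<le> real rate" .
    qed
    finally show ?thesis by simp
  qed
  have inclS: "(\<Sum>x\<in>?\<sigma> ` {..<sz}. incl s' x) \<le> real sz"
  proof -
    have "incl s' x = 1" if "x \<in> ?\<sigma> ` {..<sz}" for x
    proof -
      have "x \<in> live s" "x \<notin> ?U ` R" using that sm(3,4) Rw(1) by blast+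
      then show ?thesis using F(5) old(4) by (simp add: incl_def f)
    qed
    then have "(\<Sum>x\<in>?\<sigma> ` {..<sz}. incl s' x) = real (card (?\<sigma> ` {..<sz}))" by simp
    also have "card (?\<sigma> ` {..<sz}) \<le> sz" using card_image_le[of "{..<sz}" ?\<sigma>] by simp
    finally show ?thesis by simp
  qed
  have inclO: "(\<Sum>x\<in>{..<n} - live s. incl s' x) = (\<Sum>x\<in>{..<n} - live s. incl s x)"
  proof (rule sum.cong)
    fix x assume "x \<in> {..<n} - live s"
    then have "x \<notin> ?U ` R" using sm(3) Rw(1) by blast
    then show "incl s' x = incl s x" using F(5) by (simp add: incl_def f)
  qed simp
  have split: "{..<n} - live s' = ({..<n} - live s) \<union> (?\<sigma> ` {..<sz} \<union> ?U ` R)"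
  proof -
    have "?U ` {..<w} = ?U ` R \<union> ?U ` K" unfolding RK(1)[symmetric] by (rule image_Un)
    then have "live s = ?\<sigma> ` {..<sz} \<union> (?U ` R \<union> ?U ` K)" using sm(3) by simp
    moreover have "?\<sigma> ` {..<sz} \<inter> ?U ` K = {}" using sm(4) Rw(2) by blast
    ultimately show ?thesis unfolding F(4) using dis old(1) by (intro Diff_split)
  qed
  have "(\<Sum>x\<in>{..<n} - live s'. incl s' x) = (\<Sum>x\<in>{..<n} - live s. incl s' x) + ((\<Sum>x\<in>?\<sigma> ` {..<sz}. incl s' x) + (\<Sum>x\<in>?U ` R. incl s' x))"
  proof -
    have d1: "?\<sigma> ` {..<sz} \<inter> ?U ` R = {}" using sm(4) Rw(1) by blast
    have d2: "({..<n} - live s) \<inter> (?\<sigma> ` {..<sz} \<union> ?U ` R) = {}" using sm(3) Rw(1) by blast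
    show ?thesis unfolding split using RK(3) d1 d2 by (simp add: sum.union_disjoint)
  qed
  also have "\<dots> \<le> real i * (real sz * real rate + real sz) + (real sz + real sz * real rate)"
    using old(5) inclR inclS inclO by linarith
  also have "\<dots> = real (Suc i) * (real sz * real rate + real sz)" by (simp add: algebra_simps)
  finally have sum: "(\<Sum>x\<in>{..<n} - live s'. incl s' x) \<le> real (Suc i) * (real sz * real rate + real sz)" .
  have "2 * card K \<le> w" using F(1) cRK by linarith
  then have K2: "2 * card K \<le> ?u" by (simp add: w_def)
  have "words s' vCnt 0 * 2 ^ Suc i = 2 * card K * 2 ^ i" using F(2) by simp
  also have "\<dots> \<le> ?u * 2 ^ i" using K2 by (rule mult_le_mono1)
  also have "\<dots> \<le> n" by (rule old(6))
  finally have half: "words s' vCnt 0 * 2 ^ Suc i \<le> n" .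
  have G: "words s' vG x \<le> n" for x
  proof (cases "x \<in> ?U ` R")
    case True
    then obtain q where "q \<in> R" "x = ?U q" by blast
    then have "words s' vG x \<le> card R" using F5 RK(3) by (auto intro: card_mono)
    also have "\<dots> \<le> n" using cRK old(2) by (simp add: w_def)
    finally show ?thesis .
  next
    case False then show ?thesis using F(5) old(3) by (simp add: f)
  qed
  have G0: "words s' vG x = 0" if "x \<in> live s'" for x
  proof -
    have "x \<notin> ?U ` R" using that dis F(4) by blast
    then show ?thesis using F(5) old(4) that live' f by auto
  qed
  have W: "b \<notin> live s'" if "(a, b) \<in> weak_pairs s'" for a b
  proof -
    have "(a, b) \<in> weak_pairs s \<or> (\<exists>j<sz. b = ?\<sigma> j)" using that wp by blast
    then show ?thesis
    proof
      assume "(a, b) \<in> weak_pairs s" then show ?thesis using old(7) live' by blast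
    next
      assume "\<exists>j<sz. b = ?\<sigma> j"
      then have "b \<in> ?\<sigma> ` {..<sz}" by blast
      then show ?thesis using sm(4) F(4) Rw(2) by blast
    qed
  qed
  show ?thesis unfolding round_inv_def
    using F(2,3,6) sum half G G0 W live' old(1,2) K2 by auto
qed

text \<open>Group sizes recorded in earlier rounds are final, so only the new groups require
  \<open>round_sensitivity\<close>.\<close>

lemma round_end_sens:
  assumes inv: "round_inv i s" and u: "2 * sz < words s vCnt 0" and s2: "sampled s s2" "values_pre (words s vCnt 0 - sz) s2"
    and t: "values_inv s2 (words s vCnt 0 - sz) t" and fin: "finished (words s vCnt 0 - sz) t r s'"
    and sens: "sens s" and good: "values_good s2 (words s vCnt 0 - sz) t"
    and hits: "\<And>c. c \<in> Copt \<Longrightarrow> words s vCnt 0 \<le> 8 * k * card (Cl (live s) c) \<Longrightarrow> ell \<le> card (words s2 vSmp ` {..<sz} \<inter> Cl (live s) c)"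
  shows "sens s'"
  unfolding sens_def
proof (intro allI impI ballI)
  fix x C assume x: "x < n" and C: "C \<in> centers"
  let ?u = "words s vCnt 0"
  define w where "w = ?u - sz"
  let ?U = "words s2 vU" and ?\<sigma> = "words s2 vSmp" and ?V = "reals t yV" and ?own = "words t vOwn"
  have fr: "frame {vQ, vX, vI, vFlag, vE, vC, vB1, vOwn} {yA, yTmp, yVal, yV, yMax} s2 t" using t by (simp add: values_inv_def)
  have f: "words t vU = ?U" "words t vSmp = ?\<sigma>" "words t vG = words s vG" "reals t yRho = reals s2 yRho"
    using fr s2(1) by (auto simp: frame_def sampled_def)
  have sm: "inj_on ?U {..<w}" "inj_on ?\<sigma> {..<sz}" "?\<sigma> ` {..<sz} \<union> ?U ` {..<w} = live s" "?\<sigma> ` {..<sz} \<inter> ?U ` {..<w} = {}"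
    using s2(1) by (auto simp: sampled_def sampling_def f w_def)
  have near: "near_ok ?\<sigma> j s2" if "j < sz" for j using s2(2) that by (simp add: values_pre_def)
  have lv: "live s \<subseteq> {..<n}" "inj_on (words s vU) {..<?u}" using inv by (auto simp: round_inv_def)
  have card: "card (live s) = ?u" unfolding live_def using lv(2) by (simp add: card_image)
  have own: "?own q < sz" if "q < w" for q using t that by (simp add: values_inv_def w_def)
  have w0: "0 < w" using u by (simp add: w_def)
  have M: "\<exists>q<w. reals t yMax 0 = ?V q" using t w0 by (simp add: values_inv_def w_def)
  have val: "d (?U q) (?\<sigma> (?own q)) \<le> ?V q" "j < sz \<Longrightarrow> ?V q \<le> d (?U q) (?\<sigma> j) + 2 * reals s2 yRho j" if "q < w" for q j
    using good that by (auto simp: values_good_def w_def)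
  have F: "w \<le> 2 * card {q. q < w \<and> ?V q \<le> r}" "r = reals t yMax 0 / 2 ^ halvings \<or> 2 * card {q. q < w \<and> ?V q \<le> r / 2} < w"
     "\<And>q. q < w \<Longrightarrow> ?V q \<le> r \<Longrightarrow> words s' vG (?U q) = card {q'. q' < w \<and> ?V q' \<le> r \<and> ?own q' = ?own q}"
     "\<And>x. x \<notin> ?U ` {q. q < w \<and> ?V q \<le> r} \<Longrightarrow> words s' vG x = words s vG x"
    using fin unfolding finished_def w_def[symmetric] f by blast+
  show "real (words s' vG x) * ccost C x \<le> Kz * total C"
  proof (cases "x \<in> ?U ` {q. q < w \<and> ?V q \<le> r}")
    case True
    then obtain q where q: "q < w" "?V q \<le> r" "x = ?U q" by blast
    have "real (card {q'. q' < w \<and> ?V q' \<le> r \<and> ?own q' = ?own q}) * ccost C (?U q) \<le> Kz * total C"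
      by (rule round_sensitivity[OF lv(1) card u w_def sm(2,1,3,4) near hits own val(1) _ M F(1,2) q(1,2) C])
         (use val(2) in auto)
    then show ?thesis using F(3)[OF q(1,2)] q(3) by simp
  next
    case False
    then show ?thesis using F(4) sens x C by (simp add: sens_def)
  qed
qed

text \<open>The first term covers missing one of at most \<open>k\<close> large clusters, the second
  a wrong majority for one of at most \<open>n\<close> points in one of \<open>sz\<close>
  blocks.\<close>

definition round_failure :: ennreal where
  "round_failure = of_nat k * ennreal ((1/2) ^ ell) + of_nat n * (of_nat sz * ennreal ((17/18) ^ ell))"

lemma spec_round:
  assumes inv: "round_inv i s"
  shows "sure prog_round s (round_inv (Suc i))" "sens s \<Longrightarrow> fails prog_round s sens \<le> round_failure"
proof -
  let ?u = "words s vCnt 0"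
  have par: "words s vS 0 = sz" using inv by (simp add: round_inv_def params_def)
  have "sure prog_round s (round_inv (Suc i)) \<and> (sens s \<longrightarrow> fails prog_round s sens \<le> round_failure)"
  proof (cases "2 * sz < ?u")
    case False
    have "(\<Sum>x\<in>{..<n} - live s. incl s x) \<le> real i * (real sz * real rate + real sz)" using inv by (simp add: round_inv_def)
    also have "\<dots> \<le> real (Suc i) * (real sz * real rate + real sz)" by (intro mult_right_mono) auto
    finally have "round_inv (Suc i) s" using inv False by (simp add: round_inv_def)
    then show ?thesis using False par by (simp add: prog_round_def fails_def)
  next
    case u: True
    let ?w = "?u - sz"
    have near: "sure prog_near s1 (\<lambda>s2. sampled s s2 \<and> words s2 vSmp = words s1 vSmp \<and> values_pre ?w s2)" if "sampled s s1" for s1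
      by (rule spec_nearest[OF inv u that])
    have vals: "sure prog_values s2 (values_inv s2 ?w)" if "values_pre ?w s2" for s2 by (rule spec_values(1)[OF that])
    have fin: "sure finish t (\<lambda>s'. \<exists>r. finished ?w t r s')" if "values_pre ?w s2" "values_inv s2 ?w t" for s2 t
      by (rule spec_finish[OF that])
    have S4: "sure finish t (round_inv (Suc i))" if "sampled s s2" "values_pre ?w s2" "values_inv s2 ?w t" for s2 t
      by (rule sure_mono[OF fin[OF that(2,3)]]) (use round_end[OF inv u that] in blast)
    have S3: "sure (prog_values ;; finish) s2 (round_inv (Suc i))" if "sampled s s2" "values_pre ?w s2" for s2
      unfolding sure_simps(8) by (rule sure_mono[OF vals[OF that(2)]]) (rule S4[OF that])
    have S2: "sure (prog_near ;; prog_values ;; finish) s1 (round_inv (Suc i))" if "sampled s s1" for s1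
      unfolding sure_simps(8)[of prog_near] by (rule sure_mono[OF near[OF that]]) (use S3 in blast)
    have S1: "sure (prog_sample ;; prog_near ;; prog_values ;; finish) s (round_inv (Suc i))"
      unfolding sure_simps(8)[of prog_sample] by (rule sure_mono[OF spec_sampled[OF inv u]]) (rule S2)
    \<comment> \<open>The event that every sufficiently large optimal cluster is hit. It depends on
      the store only through \<open>vSmp\<close>, so it survives \<open>prog_near\<close>.\<close>
    define H where "H = (\<lambda>t::store. \<forall>c\<in>{c \<in> Copt. ?u \<le> 8 * k * card (Cl (live s) c)}. ell \<le> card (words t vSmp ` {..<sz} \<inter> Cl (live s) c))"
    have "fails (prog_sample ;; prog_near ;; prog_values ;; finish) s sens \<le> round_failure" if sens: "sens s"
    proof -
      have finC: "finite Copt" using centersD(1)[OF Copt(1)] .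
      have "fails prog_sample s H \<le> of_nat (card {c \<in> Copt. ?u \<le> 8 * k * card (Cl (live s) c)}) * ennreal ((1/2) ^ ell)"
        unfolding H_def
      proof (rule fails_union)
        fix c assume "c \<in> {c \<in> Copt. ?u \<le> 8 * k * card (Cl (live s) c)}"
        then show "fails prog_sample s (\<lambda>s'. ell \<le> card (words s' vSmp ` {..<sz} \<inter> Cl (live s) c)) \<le> ennreal ((1/2) ^ ell)"
          using inv u by (intro sample_hits[where u="?u" and ?U0.0="live s"]) (auto simp: round_inv_def live_def params_def Cl_def)
      qed (use finC spec_sampled[OF inv u] in auto)
      also have "\<dots> \<le> of_nat k * ennreal ((1/2) ^ ell)"
      proof (rule mult_right_mono)
        have "card {c \<in> Copt. ?u \<le> 8 * k * card (Cl (live s) c)} \<le> card Copt" using finC by (intro card_mono) auto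
        also have "\<dots> \<le> k" using centersD(4)[OF Copt(1)] .
        finally show "of_nat (card {c \<in> Copt. ?u \<le> 8 * k * card (Cl (live s) c)}) \<le> (of_nat k :: ennreal)" by simp
      qed simp
      finally have F1: "fails prog_sample s H \<le> of_nat k * ennreal ((1/2) ^ ell)" .
      have F4: "fails finish t sens \<le> 0" if "sampled s s2" "values_pre ?w s2" "H s2" "values_inv s2 ?w t" "values_good s2 ?w t" for s2 t
      proof -
        have "sure finish t sens"
          by (rule sure_mono[OF fin[OF that(2,4)]])
             (use round_end_sens[OF inv u that(1,2,4) _ sens that(5)] that(3) in \<open>auto simp: H_def\<close>)
        then show ?thesis by (simp add: fails_sure)
      qed
      have F3: "fails (prog_values ;; finish) s2 sens \<le> of_nat n * (of_nat sz * ennreal ((17/18) ^ ell))"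
        if s2: "sampled s s2" "values_pre ?w s2" "H s2" for s2
      proof -
        have "fails (prog_values ;; finish) s2 sens \<le> of_nat ?w * (of_nat sz * ennreal ((17/18) ^ ell)) + 0"
          by (rule fails_seq[OF vals[OF s2(2)] spec_values(2)[OF s2(2)]]) (use F4[OF s2] S4[OF s2(1,2)] sure_True in blast)+
        also have "\<dots> \<le> of_nat n * (of_nat sz * ennreal ((17/18) ^ ell))"
        proof -
          have "?u \<le> n" using inv by (simp add: round_inv_def)
          then have "?w \<le> n" by linarith
          then have "of_nat ?w \<le> (of_nat n :: ennreal)" by simp
          then show ?thesis by (simp add: mult_right_mono)
        qed
        finally show ?thesis .
      qed
      have F2: "fails (prog_near ;; prog_values ;; finish) s1 sens \<le> of_nat n * (of_nat sz * ennreal ((17/18) ^ ell))"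
        if s1: "sampled s s1" "H s1" for s1
        by (rule fails_seq_sure[OF near[OF s1(1)]]) (use F3 s1(2) in \<open>auto simp: H_def\<close>)
      show ?thesis unfolding round_failure_def
        by (rule fails_seq[OF spec_sampled[OF inv u] F1 F2]) (use S2 sure_True in blast)+
    qed
    then show ?thesis using S1 u par
      by (simp add: prog_round_def finish_def[symmetric] fails_def)
  qed
  then show "sure prog_round s (round_inv (Suc i))" "sens s \<Longrightarrow> fails prog_round s sens \<le> round_failure" by auto
qed

end

section \<open>The sampling stage\<close>

text \<open>For negative \<open>y\<close> pass to the reciprocal: with \<open>x = - y\<close> the
  claim is that 1 - x + x^2 times exp x is at least 1, and this already holds with exp x replaced by
  its quadratic Taylor polynomial.\<close>

lemma exp_le_quadratic:
  fixes y :: real assumes "y \<le> 1" shows "exp y \<le> 1 + y + y\<^sup>2"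
proof (cases "0 \<le> y")
  case True then show ?thesis using exp_bound[of y] assms by simp
next
  case False
  define x where "x = - y"
  have x: "0 \<le> x" using False by (simp add: x_def)
  have "1 \<le> (1 - x + x\<^sup>2) * (1 + x + x\<^sup>2 / 2)"
  proof -
    have "(1 - x + x\<^sup>2) * (1 + x + x\<^sup>2 / 2) = 1 + (x\<^sup>2 + x ^ 3 + x ^ 4) / 2"
      by (simp add: power2_eq_square power3_eq_cube power4_eq_xxxx field_simps)
    then show ?thesis using x by simp
  qed
  also have "\<dots> \<le> (1 - x + x\<^sup>2) * exp x"
  proof (rule mult_left_mono)
    show "1 + x + x\<^sup>2 / 2 \<le> exp x" using exp_lower_Taylor_quadratic[OF x] .
    have "1 - x + x\<^sup>2 = (1 - x / 2)\<^sup>2 + 3 / 4 * x\<^sup>2" by (simp add: power2_eq_square algebra_simps)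
    then show "0 \<le> 1 - x + x\<^sup>2" by simp
  qed
  finally have "1 / exp x \<le> 1 - x + x\<^sup>2" by (simp add: divide_le_eq)
  then show ?thesis by (simp add: x_def exp_minus inverse_eq_divide)
qed

text \<open>The increment has mean zero and second moment \<open>h * (h / p) * (1 - p)\<close>,
  which is at most \<open>\<beta> * h\<close>. As \<open>lam * \<beta> \<le> 1\<close>, the
  quadratic bound on the exponential applies to both outcomes. The sign \<open>\<sigma>\<close>
  treats both tails at once.\<close>

lemma importance_mgf:
  fixes p h \<beta> lam \<sigma> :: real
  assumes p: "0 < p" "p \<le> 1" and h: "0 \<le> h" "h / p \<le> \<beta>" and lam: "0 \<le> lam" "lam * \<beta> \<le> 1" and \<sigma>: "\<sigma> = 1 \<or> \<sigma> = -1"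
  shows "p * exp (\<sigma> * lam * (h / p - h)) + (1 - p) * exp (\<sigma> * lam * (- h)) \<le> exp (lam\<^sup>2 * \<beta> * h)"
proof -
  define y1 where "y1 = \<sigma> * lam * (h / p - h)"
  define y0 where "y0 = \<sigma> * lam * (- h)"
  have hp: "h \<le> h / p" using p h(1) by (simp add: le_divide_eq mult_left_le)
  have "lam * (h / p) \<le> 1" using mult_left_mono[OF h(2) lam(1)] lam(2) by linarith
  moreover have "lam * (h / p - h) \<le> lam * (h / p)" by (rule mult_left_mono) (use lam(1) h(1) in auto)
  moreover have "lam * h \<le> lam * (h / p)" using hp lam(1) by (rule mult_left_mono)
  moreover have "0 \<le> lam * (h / p - h)" "0 \<le> lam * h" using lam(1) h(1) hp by simp_all
  ultimately have y: "y1 \<le> 1" "y0 \<le> 1" using \<sigma> unfolding y1_def y0_def by auto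
  have s2: "\<sigma> * \<sigma> = 1" using \<sigma> by auto
  have "p * exp y1 + (1 - p) * exp y0 \<le> p * (1 + y1 + y1\<^sup>2) + (1 - p) * (1 + y0 + y0\<^sup>2)"
    using p y by (intro add_mono mult_left_mono exp_le_quadratic) auto
  also have "\<dots> = 1 + (p * y1 + (1 - p) * y0) + (p * y1\<^sup>2 + (1 - p) * y0\<^sup>2)" by (simp add: algebra_simps)
  also have "p * y1 + (1 - p) * y0 = 0" using p(1) by (simp add: y1_def y0_def field_simps)
  also have "p * y1\<^sup>2 + (1 - p) * y0\<^sup>2 = (\<sigma> * \<sigma>) * lam\<^sup>2 * h * (h / p) * (1 - p)"
    using p(1) by (simp add: y1_def y0_def power2_eq_square field_simps)
  also have "\<dots> = lam\<^sup>2 * h * ((h / p) * (1 - p))" by (simp add: s2 mult.assoc)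
  also have "\<dots> \<le> lam\<^sup>2 * h * (\<beta> * 1)"
    using p h hp by (intro mult_left_mono mult_mono) auto
  also have "1 + 0 + lam\<^sup>2 * h * (\<beta> * 1) \<le> exp (lam\<^sup>2 * \<beta> * h)"
    using exp_ge_add_one_self[of "lam\<^sup>2 * \<beta> * h"] by (simp add: algebra_simps)
  finally show ?thesis by (simp add: y1_def y0_def)
qed

lemma sum_map_of:
  fixes f :: "'a \<Rightarrow> real"
  assumes "distinct (map fst xs)"
  shows "(\<Sum>x\<in>fst ` set xs. the (map_of xs x) * f x) = (\<Sum>(x, w)\<leftarrow>xs. w * f x)"
  using assms
proof (induction xs)
  case (Cons a xs)
  obtain x w where a: "a = (x, w)" by fastforce
  have x: "x \<notin> fst ` set xs" using Cons.prems a by simp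
  have "(\<Sum>y\<in>fst ` set (a # xs). the (map_of (a # xs) y) * f y) = w * f x + (\<Sum>y\<in>fst ` set xs. the (map_of (a # xs) y) * f y)"
    using x by (simp add: a)
  also have "(\<Sum>y\<in>fst ` set xs. the (map_of (a # xs) y) * f y) = (\<Sum>y\<in>fst ` set xs. the (map_of xs y) * f y)"
    using x by (intro sum.cong) (auto simp: a)
  also have "\<dots> = (\<Sum>(x, w)\<leftarrow>xs. w * f x)" using Cons by simp
  finally show ?case by (simp add: a)
qed simp

context coreset_analysis
begin

definition out_body :: com where
  "out_body = Cond (WLess (Var vM) (Cell vG (Var vI)))
       (Draw vV (Cell vG (Var vI)) ;;
        Cond (WLess (Var vV) (Var vM))
          (Output (Var vI) (RArith Divide (OfWord (Cell vG (Var vI))) (OfWord (Var vM)))) Skip)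
       (Output (Var vI) (OfWord (Const 1)))"

definition out_inv :: "store \<Rightarrow> nat \<Rightarrow> store \<Rightarrow> bool" where
  "out_inv s i t \<longleftrightarrow> frame {vI, vV} {} s t \<and> distinct (map fst (outs t)) \<and> fst ` set (outs t) \<subseteq> {..<i} \<and> (\<forall>(x, w)\<in>set (outs t). 0 \<le> w)"

definition out_pre :: "store \<Rightarrow> bool" where
  "out_pre s \<longleftrightarrow> params s \<and> (\<forall>x. words s vG x \<le> n) \<and> outs s = []"

lemma out_words:
  assumes "out_pre s" "out_inv s i t"
  shows "words t vM 0 = rate" "words t vG = words s vG" "words s vG x \<le> B"
proof -
  have fr: "frame {vI, vV} {} s t" and par: "params s" and G: "words s vG x \<le> n"
    using assms by (auto simp: out_pre_def out_inv_def)
  show "words t vM 0 = rate" "words t vG = words s vG" using fr par by (simp_all add: frame_def params_def)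
  show "words s vG x \<le> B" using G by (intro le_B(1)) simp
qed

lemma sure_out_body:
  assumes "out_pre s" "out_inv s i t" "words t vI 0 = i"
  shows "sure out_body t (\<lambda>s'. out_inv s (Suc i) (setw vI 0 (Suc i) s'))"
proof -
  have inv: "frame {vI, vV} {} s t" "distinct (map fst (outs t))" "fst ` set (outs t) \<subseteq> {..<i}" "\<forall>(x, w)\<in>set (outs t). 0 \<le> w"
    using assms(2) by (auto simp: out_inv_def)
  have new: "i \<notin> fst ` set (outs t)" "fst ` set (outs t) \<subseteq> {..<Suc i}" using inv(3) by auto
  have fr: "frame {vI, vV} {} s (setw vI 0 v t)" "frame {vI, vV} {} s (setw vI 0 v (setw vV 0 v' t))"
    "frame {vI, vV} {} s (setw vI 0 v (add_out p t))" "frame {vI, vV} {} s (setw vI 0 v (add_out p (setw vV 0 v' t)))" for v v' p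
    using inv(1) by (auto simp: frame_def)
  show ?thesis
    unfolding out_body_def
    using out_words[OF assms(1,2)] inv(2,4) new assms(3) fr by (auto simp: out_inv_def)
qed

lemma expect_out_body:
  assumes "out_pre s" "out_inv s i t" "words t vI 0 = i" and F: "\<And>l. 0 \<le> F l"
  shows "expect out_body t (\<lambda>s'. ennreal (F (outs s'))) = ennreal (if words s vG i \<le> rate then F (outs t @ [(i, 1)])
     else real rate / real (words s vG i) * F (outs t @ [(i, real (words s vG i) / real rate)]) +
       (1 - real rate / real (words s vG i)) * F (outs t))"
proof (cases "words s vG i \<le> rate")
  case True
  then show ?thesis using out_words[OF assms(1,2)] assms(3) by (simp add: out_body_def)
next
  case False
  let ?g = "words s vG i"
  have g: "rate < ?g" "0 < ?g" using False by auto
  let ?e = "F (outs t @ [(i, real ?g / real rate)])" and ?k = "F (outs t)"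
  have "expect out_body t (\<lambda>s'. ennreal (F (outs s'))) = (\<integral>\<^sup>+v. ennreal (if v < rate then ?e else ?k) \<partial>measure_pmf (pmf_of_set {..<?g}))"
    using out_words[OF assms(1,2)] assms(3) g unfolding out_body_def by (simp cong: if_cong) (intro nn_integral_cong, auto)
  also have "\<dots> = ennreal ((\<Sum>v<?g. if v < rate then ?e else ?k) / real ?g)"
    using g F by (intro nn_integral_uniform) auto
  also have "(\<Sum>v<?g. if v < rate then ?e else ?k) = real rate * ?e + (real ?g - real rate) * ?k"
  proof -
    have U: "{..<rate} \<union> {rate..<?g} = {..<?g}" using g by auto
    have "(\<Sum>v\<in>{..<rate} \<union> {rate..<?g}. if v < rate then ?e else ?k) =
        (\<Sum>v<rate. if v < rate then ?e else ?k) + (\<Sum>v\<in>{rate..<?g}. if v < rate then ?e else ?k)"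
      by (rule sum.union_disjoint) auto
    then show ?thesis unfolding U using g by (simp add: of_nat_diff)
  qed
  also have "(real rate * ?e + (real ?g - real rate) * ?k) / real ?g = real rate / real ?g * ?e + (1 - real rate / real ?g) * ?k"
    using g by (simp add: field_simps)
  finally show ?thesis using False by simp
qed

lemma spec_out:
  assumes "out_pre s"
  shows "sure prog_out s (out_inv s n)"
  unfolding prog_out_def out_body_def[symmetric]
proof (rule sure_For[where N=n and I="out_inv s"])
  show "out_inv s 0 (setw vI 0 0 s)" using assms by (auto simp: out_inv_def out_pre_def frame_def)
qed (use assms env_simps sure_out_body[OF assms] in \<open>auto simp: out_pre_def params_def\<close>)

text \<open>The potential sees only the output list and the number of treated points, so the
  accuracy and the size of the output both reduce to inequalities between real numbers.\<close>

lemma out_potential: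
  assumes pre: "out_pre s" and F: "\<And>i l. 0 \<le> F i l"
    and step: "\<And>i l. i < n \<Longrightarrow> words s vG i \<le> rate \<Longrightarrow> F (Suc i) (l @ [(i, 1)]) \<le> F i l"
      "\<And>i l p. i < n \<Longrightarrow> rate < words s vG i \<Longrightarrow> p = real rate / real (words s vG i) \<Longrightarrow> 0 < p \<Longrightarrow> p \<le> 1 \<Longrightarrow>
         p * F (Suc i) (l @ [(i, 1 / p)]) + (1 - p) * F (Suc i) l \<le> F i l"
    and bad: "\<And>s'. out_inv s n s' \<Longrightarrow> \<not> G s' \<Longrightarrow> 1 \<le> F n (outs s')"
  shows "fails prog_out s G \<le> ennreal (F 0 [])"
proof -
  have "expect prog_out s (\<lambda>s'. if G s' then 0 else 1) \<le> ennreal (F 0 (outs (setw vI 0 0 s))) + of_nat n * 0"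
    unfolding prog_out_def out_body_def[symmetric]
  proof (rule expect_For[where I="out_inv s" and \<Phi>="\<lambda>i t. ennreal (F i (outs t))"])
    show "out_inv s 0 (setw vI 0 0 s)" using pre by (auto simp: out_inv_def out_pre_def frame_def)
    fix i t assume *: "out_inv s i t" "i < n" "words t vI 0 = i"
    show "sure out_body t (\<lambda>s'. out_inv s (Suc i) (setw vI 0 (Suc i) s'))" by (rule sure_out_body[OF pre *(1,3)])
    have "expect out_body t (\<lambda>s'. ennreal (F (Suc i) (outs s'))) \<le> ennreal (F i (outs t))"
      unfolding expect_out_body[where F="F (Suc i)", OF pre *(1,3) F]
    proof (rule ennreal_leI, cases "words s vG i \<le> rate")
      case True then show "(if words s vG i \<le> rate then F (Suc i) (outs t @ [(i, 1)])
         else real rate / real (words s vG i) * F (Suc i) (outs t @ [(i, real (words s vG i) / real rate)]) +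
           (1 - real rate / real (words s vG i)) * F (Suc i) (outs t)) \<le> F i (outs t)"
        using step(1)[OF *(2)] by simp
    next
      case False
      define p where "p = real rate / real (words s vG i)"
      have "0 < p" "p \<le> 1" using False rate_pos by (auto simp: p_def)
      moreover have "1 / p = real (words s vG i) / real rate" by (simp add: p_def)
      ultimately show "(if words s vG i \<le> rate then F (Suc i) (outs t @ [(i, 1)])
         else real rate / real (words s vG i) * F (Suc i) (outs t @ [(i, real (words s vG i) / real rate)]) +
           (1 - real rate / real (words s vG i)) * F (Suc i) (outs t)) \<le> F i (outs t)"
        using step(2)[OF *(2), of p "outs t"] False by (simp add: p_def)
    qed
    then show "expect out_body t (\<lambda>s'. ennreal (F (Suc i) (outs (setw vI 0 (Suc i) s')))) \<le> ennreal (F i (outs t)) + 0" by simp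
  next
    fix t assume "out_inv s n t"
    then show "(if G t then 0 else 1) \<le> ennreal (F n (outs t))" using bad[of t] by (auto simp: ennreal_ge_1)
  qed (use pre env_simps in \<open>auto simp: out_pre_def params_def\<close>)
  then show ?thesis using pre by (simp add: fails_def out_pre_def)
qed

definition estimate :: "nat set \<Rightarrow> (nat \<times> real) list \<Rightarrow> real" where
  "estimate C l = (\<Sum>(x, w)\<leftarrow>l. w * ccost C x)"

lemma estimate_append: "estimate C (l @ [(x, w)]) = estimate C l + w * ccost C x"
  by (simp add: estimate_def)

text \<open>Relative to the total cost, a sampled point contributes at most
  \<open>Kz / rate\<close>, hence at most \<open>\<beta>\<close>. The choice
  \<open>lam = \<epsilon> / (2 * \<beta>)\<close> minimizes the exponent lam^2 \<beta> - lam
  \<epsilon>. The minimum is - \<epsilon>^2 / (4 \<beta>) = - mc k L / (4 Kz), and \<open>K\<close>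
  makes it at most - c k L.\<close>

lemma estimate_fails:
  assumes pre: "out_pre s" and sens: "sens s" and C: "C \<in> centers" and K: "4 * Kz * real c \<le> real mc"
  shows "fails prog_out s (\<lambda>s'. \<bar>estimate C (outs s') - total C\<bar> \<le> \<epsilon> * total C) \<le> ennreal (2 * exp (- (real c * (real k * real L))))"
proof (cases "total C = 0")
  case True
  \<comment> \<open>With total cost zero every point that can be output costs nothing, so the
    estimate is exact.\<close>
  have "ccost C x = 0" if "x < n" for x
    using True sum_nonneg_eq_0_iff[of "{..<n}" "ccost C"] ccost_nonneg[OF C] that by (auto simp: total_def)
  then have "estimate C (outs s') = 0" if "out_inv s n s'" for s'
  proof -
    have "\<forall>p\<in>set (outs s'). fst p < n" using that by (auto simp: out_inv_def)
    then have 0: "map (\<lambda>(x, w). w * ccost C x) (outs s') = map (\<lambda>_. 0) (outs s')"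
      using \<open>\<And>x. x < n \<Longrightarrow> ccost C x = 0\<close> by (auto simp: case_prod_unfold)
    show ?thesis unfolding estimate_def 0 by (rule sum_list_0)
  qed
  then have "sure prog_out s (\<lambda>s'. \<bar>estimate C (outs s') - total C\<bar> \<le> \<epsilon> * total C)"
    by (intro sure_mono[OF spec_out[OF pre]]) (simp add: True)
  then show ?thesis by (simp add: fails_sure)
next
  case False
  then have tot: "0 < total C" using total_nonneg[OF C] by linarith
  have pos: "0 < real (mc * (k * L))" using mc_pos k_pos L_pos by simp
  have Kz: "0 < Kz" by (simp add: Kz_def add_pos_nonneg)
  define h where "h x = ccost C x / total C" for x
  define \<beta> where "\<beta> = Kz * (\<epsilon> * \<epsilon>) / real (mc * (k * L))"
  define lam where "lam = \<epsilon> / (2 * \<beta>)"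
  have \<beta>: "0 < \<beta>" using Kz eps pos by (simp add: \<beta>_def)
  have lam: "0 \<le> lam" "lam * \<beta> \<le> 1" "lam * \<beta> = \<epsilon> / 2" using \<beta> eps by (auto simp: lam_def)
  have h0: "0 \<le> h x" for x using ccost_nonneg[OF C] tot by (simp add: h_def)
  have hsum: "(\<Sum>x<n. h x) = 1" using tot by (simp add: h_def sum_divide_distrib[symmetric] total_def)
  have hp: "h x / p \<le> \<beta>" if "x < n" "rate < words s vG x" "p = real rate / real (words s vG x)" for x p
  proof -
    have "words s vG x \<le> n" using pre by (simp add: out_pre_def)
    \<comment> \<open>A group larger than the rate shows that the cap at \<open>n\<close> was not
      reached, so the rate satisfies its defining inequality.\<close>
    then have "rate \<noteq> n" using that(2) by simp
    then have r: "real (mc * (k * L)) \<le> real rate * (\<epsilon> * \<epsilon>)" using rate_prop by simp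
    have "real (words s vG x) * ccost C x \<le> Kz * total C" using sens that(1) C by (simp add: sens_def)
    then have g: "real (words s vG x) * h x \<le> Kz" using tot by (simp add: h_def field_simps)
    have rp: "0 < real rate" using rate_pos by simp
    have "h x / p = real (words s vG x) * h x / real rate" using that(3) by simp
    also have "\<dots> \<le> Kz / real rate" using g rp by (simp add: divide_right_mono)
    also have "\<dots> \<le> \<beta>" using r rp pos Kz by (simp add: \<beta>_def field_simps)
    finally show ?thesis .
  qed
  have side: "fails prog_out s (\<lambda>s'. \<sigma> * (estimate C (outs s') - total C) \<le> \<epsilon> * total C) \<le> ennreal (exp (- (real c * (real k * real L))))"
    if \<sigma>: "\<sigma> = 1 \<or> \<sigma> = -1" for \<sigma> :: real
  proof -
    \<comment> \<open>The middle summand reserves the growth that \<open>importance_mgf\<close>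
      allows for the points still to come; it is used up at \<open>i = n\<close>.\<close>
    define F where "F i l = exp (\<sigma> * lam * (estimate C l / total C - (\<Sum>x<i. h x)) + lam\<^sup>2 * \<beta> * (\<Sum>x\<in>{i..<n}. h x) - lam * \<epsilon>)" for i and l
    have tail: "(\<Sum>x\<in>{i..<n}. h x) = h i + (\<Sum>x\<in>{Suc i..<n}. h x)" if "i < n" for i
      using that by (simp add: sum.atLeast_Suc_lessThan)
    have "fails prog_out s (\<lambda>s'. \<sigma> * (estimate C (outs s') - total C) \<le> \<epsilon> * total C) \<le> ennreal (F 0 [])"
    proof (rule out_potential[OF pre])
      fix i l assume i: "i < n"
      {
        have E1: "estimate C (l @ [(i, 1)]) / total C - (\<Sum>x<Suc i. h x) = estimate C l / total C - (\<Sum>x<i. h x)"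
          by (simp add: estimate_append add_divide_distrib h_def)
        have E2: "lam\<^sup>2 * \<beta> * (\<Sum>x\<in>{Suc i..<n}. h x) \<le> lam\<^sup>2 * \<beta> * (\<Sum>x\<in>{i..<n}. h x)"
          using \<beta> h0 tail[OF i] by (intro mult_left_mono) auto
        show "F (Suc i) (l @ [(i, 1)]) \<le> F i l" unfolding F_def E1 using E2 by simp
      }
      fix p assume g: "rate < words s vG i" "p = real rate / real (words s vG i)" and p: "0 < p" "p \<le> 1"
      let ?A = "\<sigma> * lam * (estimate C l / total C - (\<Sum>x<i. h x)) + lam\<^sup>2 * \<beta> * (\<Sum>x\<in>{Suc i..<n}. h x) - lam * \<epsilon>"
      have e1: "F (Suc i) (l @ [(i, 1 / p)]) = exp ?A * exp (\<sigma> * lam * (h i / p - h i))"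
        by (simp add: F_def estimate_append add_divide_distrib exp_add[symmetric] h_def[of i] algebra_simps)
      have e0: "F (Suc i) l = exp ?A * exp (\<sigma> * lam * (- h i))"
        by (simp add: F_def exp_add[symmetric] algebra_simps)
      have eF: "F i l = exp ?A * exp (lam\<^sup>2 * \<beta> * h i)"
        by (simp add: F_def exp_add[symmetric] tail[OF i] algebra_simps)
      have "p * F (Suc i) (l @ [(i, 1 / p)]) + (1 - p) * F (Suc i) l =
          exp ?A * (p * exp (\<sigma> * lam * (h i / p - h i)) + (1 - p) * exp (\<sigma> * lam * (- h i)))"
        unfolding e1 e0 by (simp add: algebra_simps)
      also have "\<dots> \<le> exp ?A * exp (lam\<^sup>2 * \<beta> * h i)"
        using importance_mgf[OF p h0 hp[OF i g] lam(1,2) \<sigma>] by (intro mult_left_mono) auto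
      finally show "p * F (Suc i) (l @ [(i, 1 / p)]) + (1 - p) * F (Suc i) l \<le> F i l" unfolding eF .
    next
      fix s' assume "\<not> \<sigma> * (estimate C (outs s') - total C) \<le> \<epsilon> * total C"
      then have "\<epsilon> \<le> \<sigma> * (estimate C (outs s') - total C) / total C" using tot by (simp add: le_divide_eq)
      also have "\<dots> = \<sigma> * (estimate C (outs s') / total C - 1)" using tot by (simp add: field_simps)
      finally have "lam * \<epsilon> \<le> lam * (\<sigma> * (estimate C (outs s') / total C - 1))" using lam(1) by (rule mult_left_mono)
      then show "1 \<le> F n (outs s')" by (simp add: F_def hsum algebra_simps)
    qed (simp add: F_def)
    also have "F 0 [] = exp (lam\<^sup>2 * \<beta> - lam * \<epsilon>)" using hsum by (simp add: F_def estimate_def lessThan_atLeast0)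
    also have "lam\<^sup>2 * \<beta> - lam * \<epsilon> = - (real mc * (real k * real L)) / (4 * Kz)"
    proof -
      have "lam\<^sup>2 * \<beta> - lam * \<epsilon> = lam * (lam * \<beta>) - lam * \<epsilon>" by (simp add: power2_eq_square)
      also have "\<dots> = - (\<epsilon> * \<epsilon>) / (4 * \<beta>)" unfolding lam(3) using \<beta> by (simp add: lam_def field_simps)
      also have "\<dots> = - (real mc * (real k * real L)) / (4 * Kz)" using eps Kz pos by (simp add: \<beta>_def field_simps)
      finally show ?thesis .
    qed
    also have "\<dots> \<le> - (real c * (real k * real L))"
    proof -
      have "4 * Kz * real c * (real k * real L) \<le> real mc * (real k * real L)" using K by (intro mult_right_mono) auto
      then show ?thesis using Kz by (simp add: field_simps)
    qed
    finally show ?thesis by (simp add: ennreal_leI)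
  qed
  have "fails prog_out s (\<lambda>s'. \<bar>estimate C (outs s') - total C\<bar> \<le> \<epsilon> * total C) \<le>
     fails prog_out s (\<lambda>s'. \<forall>\<sigma>\<in>{1, -1::real}. \<sigma> * (estimate C (outs s') - total C) \<le> \<epsilon> * total C)"
    by (rule fails_mono[OF spec_out[OF pre]]) (auto simp: abs_le_iff)
  also have "\<dots> \<le> of_nat (card {1, -1::real}) * ennreal (exp (- (real c * (real k * real L))))"
    by (rule fails_union[OF _ spec_out[OF pre]]) (use side in auto)
  also have "\<dots> = ennreal (2 * exp (- (real c * (real k * real L))))" by (simp add: ennreal_mult)
  finally show ?thesis .
qed

text \<open>A point kept with probability \<open>p\<close> multiplies the expected exponential of
  the length by 1 + p (e - 1), at most exp (2 p) because e \<le> 3. The potential therefore starts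
  at no more than exp (2 M - 3 M).\<close>

lemma size_fails:
  assumes pre: "out_pre s" and M: "(\<Sum>x<n. incl s x) \<le> M"
  shows "fails prog_out s (\<lambda>s'. real (length (outs s')) \<le> 3 * M) \<le> ennreal (exp (- M))"
proof -
  define F where "F i l = exp (real (length l) + 2 * (\<Sum>x\<in>{i..<n}. incl s x) - 3 * M)" for i and l :: "(nat \<times> real) list"
  have tail: "(\<Sum>x\<in>{i..<n}. incl s x) = incl s i + (\<Sum>x\<in>{Suc i..<n}. incl s x)" if "i < n" for i
    using that by (simp add: sum.atLeast_Suc_lessThan)
  have "fails prog_out s (\<lambda>s'. real (length (outs s')) \<le> 3 * M) \<le> ennreal (F 0 [])"
  proof (rule out_potential[OF pre])
    fix i l assume i: "i < n"
    show "F (Suc i) (l @ [(i, 1)]) \<le> F i l" if "words s vG i \<le> rate"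
      using tail[OF i] that by (simp add: F_def incl_def)
    fix p assume g: "rate < words s vG i" "p = real rate / real (words s vG i)" and p: "0 < p" "p \<le> 1"
    let ?A = "real (length l) + 2 * (\<Sum>x\<in>{Suc i..<n}. incl s x) - 3 * M"
    have inc: "incl s i = p" using g by (simp add: incl_def)
    have "p * F (Suc i) (l @ [(i, 1 / p)]) + (1 - p) * F (Suc i) l = exp ?A * (1 + p * (exp 1 - 1))"
    proof -
      have "F (Suc i) (l @ [(i, 1 / p)]) = exp ?A * exp 1" by (simp add: F_def exp_add[symmetric] algebra_simps)
      moreover have "F (Suc i) l = exp ?A" by (simp add: F_def)
      ultimately show ?thesis by (simp add: algebra_simps)
    qed
    also have "\<dots> \<le> exp ?A * exp (2 * p)"
    proof (rule mult_left_mono)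
      have "p * (exp 1 - 1) \<le> p * 2" using exp_le p by (intro mult_left_mono) auto
      then show "1 + p * (exp 1 - 1) \<le> exp (2 * p)" using exp_ge_add_one_self[of "2 * p"] by linarith
    qed simp
    also have "\<dots> = F i l" using tail[OF i] inc by (simp add: F_def exp_add[symmetric] algebra_simps)
    finally show "p * F (Suc i) (l @ [(i, 1 / p)]) + (1 - p) * F (Suc i) l \<le> F i l" .
  next
    fix s' assume "\<not> real (length (outs s')) \<le> 3 * M"
    then show "1 \<le> F n (outs s')" by (simp add: F_def)
  qed (simp add: F_def)
  also have "F 0 [] \<le> exp (- M)" using M by (simp add: F_def lessThan_atLeast0)
  finally show ?thesis by (simp add: ennreal_leI)
qed

text \<open>A nonempty set of at most \<open>k\<close> points is the image of a map on
  \<open>k\<close> indices; surplus indices repeat the first point.\<close>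

lemma card_centers: "card centers \<le> n ^ k"
proof -
  have "centers \<subseteq> (\<lambda>f. f ` {..<k}) ` ({..<k} \<rightarrow>\<^sub>E {..<n})"
  proof
    fix C assume C: "C \<in> centers"
    note D = centersD(1,2,4)[OF C]
    obtain e where e: "bij_betw e {0..<card C} C" using ex_bij_betw_nat_finite[OF D(1)] by blast
    have c0: "0 < card C" using D by (simp add: card_gt_0_iff)
    define f where "f = restrict (\<lambda>i. if i < card C then e i else e 0) {..<k}"
    have eC: "e i \<in> C" if "i < card C" for i using e that by (auto simp: bij_betw_def)
    have "f ` {..<k} = C"
    proof
      show "f ` {..<k} \<subseteq> C" using eC c0 by (auto simp: f_def)
      show "C \<subseteq> f ` {..<k}"
      proof
        fix x assume "x \<in> C"
        then obtain i where "i < card C" "x = e i" using e unfolding bij_betw_def by (metis atLeastLessThan_iff imageE)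
        then show "x \<in> f ` {..<k}" using D(3) by (intro image_eqI[of _ _ i]) (auto simp: f_def)
      qed
    qed
    moreover have "f \<in> {..<k} \<rightarrow>\<^sub>E {..<n}" using eC c0 centersD(3)[OF C] by (auto simp: f_def)
    ultimately show "C \<in> (\<lambda>f. f ` {..<k}) ` ({..<k} \<rightarrow>\<^sub>E {..<n})" by blast
  qed
  moreover have fin: "finite ({..<k} \<rightarrow>\<^sub>E {..<n})" by (intro finite_PiE) auto
  ultimately have "card centers \<le> card ((\<lambda>f. f ` {..<k}) ` ({..<k} \<rightarrow>\<^sub>E {..<n}))" by (intro card_mono) auto
  also have "\<dots> \<le> card ({..<k} \<rightarrow>\<^sub>E {..<n})" using fin by (rule card_image_le)
  also have "\<dots> = n ^ k" by (simp add: card_PiE)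
  finally show ?thesis .
qed

lemma coreset_of_estimates:
  assumes "out_inv s n s'" "\<forall>C\<in>centers. \<bar>estimate C (outs s') - total C\<bar> \<le> \<epsilon> * total C"
  shows "is_coreset d z {..<n} k \<epsilon> (fst ` set (outs s')) (\<lambda>x. the (map_of (outs s') x))"
  unfolding is_coreset_def
proof (intro conjI allI impI ballI)
  have dis: "distinct (map fst (outs s'))" using assms(1) by (simp add: out_inv_def)
  show "fst ` set (outs s') \<subseteq> {..<n}" using assms(1) by (simp add: out_inv_def)
  show "0 \<le> the (map_of (outs s') x)" if x: "x \<in> fst ` set (outs s')" for x
  proof -
    obtain p where p: "x = fst p" "p \<in> set (outs s')" using x by (rule imageE)
    have "map_of (outs s') x = Some (snd p)" using dis p by (intro map_of_is_SomeI) simp_all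
    moreover have "\<forall>p\<in>set (outs s'). 0 \<le> snd p" using assms(1) by (simp add: out_inv_def case_prod_unfold)
    ultimately show ?thesis using p(2) by simp
  qed
  fix C assume "C \<subseteq> {..<n} \<and> C \<noteq> {} \<and> card C \<le> k"
  then have C: "C \<in> centers" by (simp add: centers_def)
  have "cost d z C (fst ` set (outs s')) (\<lambda>x. the (map_of (outs s') x)) = estimate C (outs s')"
    unfolding cost_def estimate_def ccost_def[symmetric] by (rule sum_map_of[OF dis])
  moreover have "cost d z C {..<n} (\<lambda>_. 1) = total C"
    by (simp add: cost_def total_def ccost_def)
  ultimately show "\<bar>cost d z C (fst ` set (outs s')) (\<lambda>x. the (map_of (outs s') x)) - cost d z C {..<n} (\<lambda>_. 1)\<bar> \<le> \<epsilon> * cost d z C {..<n} (\<lambda>_. 1)"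
    using assms(2) C by simp
qed

end

context oracle_lang
begin

lemma fails_conj:
  assumes "sure c s I"
  shows "fails c s (\<lambda>s'. G s' \<and> H s') \<le> fails c s G + fails c s H"
proof -
  have "fails c s (\<lambda>s'. G s' \<and> H s') \<le> expect c s (\<lambda>s'. (if G s' then 0 else 1) + (if H s' then 0 else 1))"
    unfolding fails_def by (rule expect_mono_on[OF assms]) auto
  also have "\<dots> = fails c s G + fails c s H"
    unfolding fails_def using sure_True[OF assms] by (rule expect_add)
  finally show ?thesis .
qed

end

section \<open>Failure probability of the whole program\<close>

context coreset_analysis
begin

text \<open>The last summand accounts for the at most \<open>2 * sz\<close> points that no round
  removes.\<close>

definition max_size :: real where
  "max_size = real L * (real sz * real rate + real sz) + 2 * real sz"

definition good_out :: "store \<Rightarrow> bool" where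
  "good_out s \<longleftrightarrow> distinct (map fst (outs s)) \<and>
     is_coreset d z {..<n} k \<epsilon> (fst ` set (outs s)) (\<lambda>x. the (map_of (outs s) x)) \<and>
     real (length (outs s)) \<le> 3 * max_size"

definition init_store :: "store \<Rightarrow> bool" where
  "init_store s \<longleftrightarrow> words s vN 0 = n \<and> words s vK 0 = k \<and> words s vL 0 = 0 \<and> words s vM 0 = 0 \<and> reals s yE 0 = \<epsilon> \<and>
     (\<forall>x. words s vG x = 0) \<and> events s = [] \<and> outs s = []"

text \<open>If \<open>n\<close> is at most twice the sample size, every round is skipped. Separating
  this case allows \<open>k\<close> and \<open>sz\<close> to be bounded by \<open>n\<close> in the
  other one.\<close>

lemma spec_rounds:
  assumes inv: "round_inv 0 s"
  shows "sure (For vT vL prog_round) s (round_inv L)"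
    "sens s \<Longrightarrow> fails (For vT vL prog_round) s sens \<le> of_nat L * (if 2 * sz < n then round_failure else 0)"
proof -
  have vT: "round_inv i (setw vT 0 v t) = round_inv i t" "sens (setw vT 0 v t) = sens t" for i v t
  proof -
    have "incl (setw vT 0 v t) = incl t" by (auto simp: incl_def fun_eq_iff)
    then show "round_inv i (setw vT 0 v t) = round_inv i t" "sens (setw vT 0 v t) = sens t"
      by (simp_all add: round_inv_def sens_def params_def live_def)
  qed
  have L: "words s vL 0 = L" "L \<le> env vL" using inv env_simps by (auto simp: round_inv_def params_def)
  show "sure (For vT vL prog_round) s (round_inv L)"
    by (rule sure_For[where N=L and I=round_inv]) (use L inv spec_round in \<open>auto simp: vT\<close>)
  have zero: "fails prog_round t sens = 0" if "round_inv i t" "sens t" "\<not> 2 * sz < n" for i t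
  proof -
    have "\<not> 2 * sz < words t vCnt 0" "words t vS 0 = sz" using that(1,3) by (auto simp: round_inv_def params_def)
    then show ?thesis using that(2) by (simp add: prog_round_def fails_def)
  qed
  show "fails (For vT vL prog_round) s sens \<le> of_nat L * (if 2 * sz < n then round_failure else 0)" if "sens s"
    by (rule fails_For[where N=L and I=round_inv and G="\<lambda>_. sens"])
       (use L inv spec_round zero that in \<open>auto simp: vT\<close>)
qed

text \<open>After \<open>L\<close> rounds of halving nothing could be left because
  \<open>n < 2 ^ L\<close>, so the live set must have fallen below the threshold.\<close>

lemma rounds_done:
  assumes inv: "round_inv L s" and "outs s = []"
  shows "out_pre s" "(\<Sum>x<n. incl s x) \<le> max_size"
proof -
  show "out_pre s" using assms by (simp add: out_pre_def round_inv_def)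
  let ?u = "words s vCnt 0"
  have u: "?u \<le> 2 * sz"
  proof (rule ccontr)
    assume "\<not> ?u \<le> 2 * sz"
    then have "?u * 2 ^ L \<le> n" "1 \<le> ?u" using inv by (auto simp: round_inv_def)
    moreover from this(2) have "1 * 2 ^ L \<le> ?u * 2 ^ L" by (rule mult_le_mono1)
    ultimately show False using less_two_power_lg[of n] unfolding L_def by linarith
  qed
  have lv: "live s \<subseteq> {..<n}" using inv by (simp add: round_inv_def)
  have "(\<Sum>x\<in>live s. incl s x) = real (card (live s))" using inv by (simp add: round_inv_def incl_def)
  also have "card (live s) \<le> ?u" unfolding live_def using card_image_le[of "{..<?u}" "words s vU"] by simp
  finally have "(\<Sum>x\<in>live s. incl s x) \<le> 2 * real sz" using u by linarith
  moreover have "(\<Sum>x\<in>{..<n} - live s. incl s x) \<le> real L * (real sz * real rate + real sz)" using inv by (simp add: round_inv_def)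
  moreover have "(\<Sum>x<n. incl s x) = (\<Sum>x\<in>{..<n} - live s. incl s x) + (\<Sum>x\<in>live s. incl s x)"
    using lv by (intro sum.subset_diff) auto
  ultimately show "(\<Sum>x<n. incl s x) \<le> max_size" by (simp add: max_size_def)
qed

lemma spec_start:
  assumes "init_store s"
  shows "sure (prog_setup kap aa mc) s (\<lambda>t. round_inv 0 t \<and> sens t)"
proof -
  have S: "sure (prog_setup kap aa mc) s (\<lambda>s'. params s' \<and> (\<forall>i<n. words s' vU i = i) \<and> words s' vCnt 0 = n)"
    using assms by (intro spec_setup) (auto simp: init_store_def)
  have "\<not> asks (prog_setup kap aa mc)"
    by (simp add: prog_setup_def prog_log_def prog_params_def prog_rate_def prog_init_def)
  from sure_frame[OF sure_weak_pairs[OF S this]]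
  show ?thesis
  proof (rule sure_mono)
    fix t assume *: "((params t \<and> (\<forall>i<n. words t vU i = i) \<and> words t vCnt 0 = n) \<and> weak_pairs t = weak_pairs s) \<and>
      frame (wmods (prog_setup kap aa mc)) (rmods (prog_setup kap aa mc)) s t"
    have G: "words t vG x = 0" for x
      using * assms by (auto simp: frame_def prog_setup_def prog_log_def prog_params_def prog_rate_def prog_init_def init_store_def)
    have W: "weak_pairs t = {}" using * assms by (auto simp: weak_pairs_def init_store_def)
    have U: "words t vCnt 0 = n" "\<And>i. i < n \<Longrightarrow> words t vU i = i" using * by auto
    have lv: "live t = {..<n}" using U by (auto simp: live_def)
    have "inj_on (words t vU) {..<n}" using U(2) by (auto simp: inj_on_def)
    then have "round_inv 0 t" using * G W U(1) lv by (simp add: round_inv_def)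
    moreover have "sens t" using G total_nonneg by (simp add: sens_def Kz_def)
    ultimately show "round_inv 0 t \<and> sens t" by blast
  qed
qed

lemma out_fails:
  assumes pre: "out_pre s" and sens: "sens s" and K: "4 * Kz * real c \<le> real mc" and M: "(\<Sum>x<n. incl s x) \<le> max_size"
  shows "fails prog_out s good_out \<le> ennreal (real n ^ k * (2 * exp (- (real c * (real k * real L)))) + exp (- max_size))"
proof -
  let ?E = "\<lambda>s'. \<forall>C\<in>centers. \<bar>estimate C (outs s') - total C\<bar> \<le> \<epsilon> * total C" and ?p = "2 * exp (- (real c * (real k * real L)))"
  have "fails prog_out s good_out \<le> fails prog_out s (\<lambda>s'. ?E s' \<and> real (length (outs s')) \<le> 3 * max_size)"
    by (rule fails_mono[OF spec_out[OF pre]])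
       (use coreset_of_estimates in \<open>auto simp: good_out_def out_inv_def\<close>)
  also have "\<dots> \<le> fails prog_out s ?E + fails prog_out s (\<lambda>s'. real (length (outs s')) \<le> 3 * max_size)"
    by (rule fails_conj[OF spec_out[OF pre]])
  also have "fails prog_out s ?E \<le> of_nat (card centers) * ennreal ?p"
    using finite_centers spec_out[OF pre] estimate_fails[OF pre sens _ K] by (rule fails_union)
  also have "of_nat (card centers) * ennreal ?p = ennreal (real (card centers) * ?p)"
    by (simp add: ennreal_mult ennreal_of_nat_eq_real_of_nat)
  also have "\<dots> \<le> ennreal (real n ^ k * ?p)"
  proof (intro ennreal_leI mult_right_mono)
    show "real (card centers) \<le> real n ^ k" using card_centers by (metis of_nat_le_iff of_nat_power)
  qed simp
  also have "fails prog_out s (\<lambda>s'. real (length (outs s')) \<le> 3 * max_size) \<le> ennreal (exp (- max_size))"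
    by (rule size_fails[OF pre M])
  also have "ennreal (real n ^ k * ?p) + ennreal (exp (- max_size)) = ennreal (real n ^ k * ?p + exp (- max_size))"
    by (rule ennreal_plus[symmetric]) simp_all
  finally show ?thesis by (simp add: add_mono)
qed

lemma half_power_le: "(1/2::real) ^ (m * L) \<le> 1 / real n ^ m"
proof -
  have "real n \<le> 2 ^ L" using less_two_power_lg[of n] unfolding L_def
    by (metis less_imp_le of_nat_le_iff of_nat_numeral of_nat_power)
  then have "real n ^ m \<le> (2 ^ L) ^ m" by (intro power_mono) auto
  then have "1 / (2 ^ L) ^ m \<le> 1 / real n ^ m" using n_pos by (intro divide_left_mono) auto
  also have "1 / (2 ^ L) ^ m = (1/2::real) ^ (m * L)" by (simp add: power_mult[symmetric] power_divide mult.commute)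
  finally show ?thesis .
qed

lemma exp_neg_le: "real j \<le> x \<Longrightarrow> exp (- x) \<le> (1/2) ^ j"
proof -
  assume "real j \<le> x"
  then have "exp (- x) \<le> exp (- real j)" by simp
  also have "\<dots> = exp (- 1) ^ j" by (simp add: exp_of_nat_mult[symmetric])
  also have "\<dots> \<le> (1/2) ^ j"
  proof (rule power_mono)
    have "(2::real) \<le> exp 1" using exp_ge_add_one_self[of 1] by simp
    then show "exp (- 1) \<le> (1/2::real)" by (simp add: exp_minus inverse_eq_divide field_simps)
  qed simp
  finally show ?thesis .
qed

text \<open>13 is the least exponent at which a power of 17/18 is at most one half, so each block of
  \<open>13 * L\<close> votes gains a factor of at least \<open>n\<close>.\<close>

lemma weak_power_le:
  assumes "kap = 13 * (c + 6)"
  shows "(17/18::real) ^ ell \<le> 1 / real n ^ (c + 6)"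
proof -
  have "(17/18::real) ^ 13 \<le> 1/2" by (simp add: power_divide)
  have "kap * L = 13 * ((c + 6) * L)" by (simp only: assms mult.assoc)
  then have e: "ell = 13 * ((c + 6) * L)" by (simp only: ell_def)
  have "(17/18::real) ^ ell = ((17/18) ^ 13) ^ ((c + 6) * L)" unfolding e power_mult ..
  also have "\<dots> \<le> (1/2) ^ ((c + 6) * L)" using \<open>(17/18::real) ^ 13 \<le> 1/2\<close> by (intro power_mono) auto
  also have "\<dots> \<le> 1 / real n ^ (c + 6)" by (rule half_power_le)
  finally show ?thesis .
qed

text \<open>Of the six extra powers of \<open>n\<close>, three pay for the union over rounds, points
  and blocks, each at most \<open>n\<close> in number. The other three are kept to absorb constants
  at the end.\<close>

lemma rounds_failure_le:
  assumes "kap = 13 * (c + 6)"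
  shows "of_nat L * (if 2 * sz < n then round_failure else 0) \<le> ennreal (2 / real n ^ (c + 3))"
proof (cases "2 * sz < n")
  case True
  let ?q = "1 / real n ^ (c + 6)"
  have q0: "0 \<le> ?q" by simp
  have q: "(17/18::real) ^ ell \<le> ?q" by (rule weak_power_le[OF assms])
  have h: "(1/2::real) ^ ell \<le> ?q"
    using power_mono[of "1/2" "17/18::real" ell] q by linarith
  have k: "k \<le> n"
  proof -
    have "k * 1 \<le> k * ell" using ell_pos by (intro mult_le_mono2)
    then show ?thesis using True unfolding sz_def by linarith
  qed
  have L: "real L \<le> real n" using lg_le by (simp add: L_def)
  have n1: "1 \<le> real n" using n_pos by simp
  have "of_nat L * round_failure = ennreal (real L * (real k * (1/2) ^ ell + real n * (real sz * (17/18) ^ ell)))"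
    by (simp add: round_failure_def ennreal_of_nat_eq_real_of_nat ennreal_mult ennreal_plus)
  also have "\<dots> \<le> ennreal (2 / real n ^ (c + 3))"
  proof (rule ennreal_leI)
    have "real L * (real k * (1/2) ^ ell + real n * (real sz * (17/18) ^ ell)) \<le> real n * (real n * ?q + real n * (real n * ?q))"
      using L k True q h q0 by (intro mult_mono add_mono) auto
    also have "\<dots> \<le> real n * (real n * (real n * ?q) + real n * (real n * ?q))"
    proof -
      have "1 * ?q \<le> real n * ?q" using n1 q0 by (rule mult_right_mono)
      then have "real n * ?q \<le> real n * (real n * ?q)" using mult_left_mono[of "1 * ?q" "real n * ?q" "real n"] by simp
      then have "real n * ?q + real n * (real n * ?q) \<le> real n * (real n * ?q) + real n * (real n * ?q)"
        by (rule add_right_mono)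
      then show ?thesis by (rule mult_left_mono) simp
    qed
    also have "\<dots> = 2 * (real n ^ 3 * ?q)" by (simp add: power3_eq_cube)
    also have "real n ^ 3 * ?q = 1 / real n ^ (c + 3)"
      using n_pos by (simp add: field_simps power_add eval_nat_numeral)
    finally show "real L * (real k * (1/2) ^ ell + real n * (real sz * (17/18) ^ ell)) \<le> 2 / real n ^ (c + 3)" by simp
  qed
  finally show ?thesis using True by simp
qed simp

text \<open>The union over \<open>n ^ k\<close> sets of centers is paid from the exponent: each set
  fails with probability at most 2 / n^((c + 4) k), which leaves 2 / n^((c + 3) k).\<close>

lemma out_failure_le:
  assumes "kap = 13 * (c + 6)"
  shows "real n ^ k * (2 * exp (- (real (c + 4) * (real k * real L)))) + exp (- max_size) \<le> 3 / real n ^ (c + 3)"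
proof -
  have n1: "1 \<le> real n" using n_pos by simp
  have "exp (- (real (c + 4) * (real k * real L))) \<le> (1/2) ^ (((c + 4) * k) * L)" by (rule exp_neg_le) simp
  also have "\<dots> \<le> 1 / real n ^ ((c + 4) * k)" by (rule half_power_le)
  finally have "real n ^ k * (2 * exp (- (real (c + 4) * (real k * real L)))) \<le> real n ^ k * (2 * (1 / real n ^ ((c + 4) * k)))"
    by (intro mult_left_mono) auto
  also have "\<dots> = 2 / real n ^ ((c + 3) * k)"
  proof -
    have "(c + 4) * k = (c + 3) * k + k" by (simp add: algebra_simps)
    then show ?thesis using n1 by (simp add: power_add)
  qed
  also have "\<dots> \<le> 2 / real n ^ (c + 3)"
  proof (rule divide_left_mono)
    have "(c + 3) * 1 \<le> (c + 3) * k" using k_pos by (intro mult_le_mono2)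
    then show "real n ^ (c + 3) \<le> real n ^ ((c + 3) * k)" using n1 by (intro power_increasing) auto
  qed (use n1 in auto)
  finally have A: "real n ^ k * (2 * exp (- (real (c + 4) * (real k * real L)))) \<le> 2 / real n ^ (c + 3)" .
  have "exp (- max_size) \<le> (1/2) ^ ((c + 3) * L)"
  proof (rule exp_neg_le)
    have "1 * (kap * 1) \<le> k * (kap * L)" using L_pos k_pos by (intro mult_le_mono order_refl)
    moreover have "c + 3 \<le> kap" by (simp add: assms)
    ultimately have "c + 3 \<le> sz" unfolding sz_def ell_def by linarith
    then have "(c + 3) * L \<le> sz * L" by (rule mult_le_mono1)
    then have "real ((c + 3) * L) \<le> real L * real sz" by (metis mult.commute of_nat_le_iff of_nat_mult)
    also have "\<dots> \<le> max_size" by (simp add: max_size_def algebra_simps)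
    finally show "real ((c + 3) * L) \<le> max_size" .
  qed
  also have "\<dots> \<le> 1 / real n ^ (c + 3)" by (rule half_power_le)
  finally show ?thesis using A by simp
qed

theorem program_correct:
  assumes init: "init_store s" and kap: "kap = 13 * (c + 6)" and K: "4 * Kz * real (c + 4) \<le> real mc"
  shows "sure (prog_coreset kap aa mc) s (\<lambda>_. True)"
    "fails (prog_coreset kap aa mc) s good_out \<le> ennreal (1 / real n ^ c)"
proof -
  have "\<not> prints (prog_setup kap aa mc ;; For vT vL prog_round)" by (simp add: prog_defs)
  then have np: "\<not> prints (prog_setup kap aa mc)" "\<not> prints (For vT vL prog_round)" by auto
  have start: "sure (prog_setup kap aa mc) s (\<lambda>t. (round_inv 0 t \<and> sens t) \<and> outs t = [])"
    using sure_outs[OF spec_start[OF init] np(1)] init by (simp add: init_store_def)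
  have rounds: "sure (For vT vL prog_round) t (\<lambda>t'. round_inv L t' \<and> outs t' = [])" if "round_inv 0 t" "outs t = []" for t
    using sure_outs[OF spec_rounds(1)[OF that(1)] np(2)] that(2) by simp
  have out: "sure prog_out t' (\<lambda>_. True)" if "round_inv L t' \<and> outs t' = []" for t'
    using that by (intro sure_True[OF spec_out[OF rounds_done(1)]]) auto
  have rest: "sure (For vT vL prog_round ;; prog_out) t (\<lambda>_. True)" if "(round_inv 0 t \<and> sens t) \<and> outs t = []" for t
    unfolding sure_simps(8) by (rule sure_mono[OF rounds]) (use that out in auto)
  show all: "sure (prog_coreset kap aa mc) s (\<lambda>_. True)"
    unfolding prog_coreset_def sure_simps(8)[of "prog_setup kap aa mc"] by (rule sure_mono[OF start]) (rule rest)
  show "fails (prog_coreset kap aa mc) s good_out \<le> ennreal (1 / real n ^ c)"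
  \<comment> \<open>For \<open>n = 1\<close> the claimed bound is 1. Otherwise the constants 2 and 3
    of the two stages sum to 5, which is less than \<open>n ^ 3\<close>.\<close>
  proof (cases "n = 1")
    case True then show ?thesis using fails_le_one[OF all] by simp
  next
    case False
    then have n2: "2 \<le> real n" using n_pos by simp
    have "fails (For vT vL prog_round ;; prog_out) t good_out \<le> ennreal (2 / real n ^ (c + 3)) + ennreal (3 / real n ^ (c + 3))"
      if t: "(round_inv 0 t \<and> sens t) \<and> outs t = []" for t
    proof (rule fails_seq[OF rounds])
      show "fails (For vT vL prog_round) t sens \<le> ennreal (2 / real n ^ (c + 3))"
        using spec_rounds(2)[of t] rounds_failure_le[OF kap] t by (meson order_trans)
      fix t' assume t': "round_inv L t' \<and> outs t' = []" "sens t'"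
      have "fails prog_out t' good_out \<le> ennreal (real n ^ k * (2 * exp (- (real (c + 4) * (real k * real L)))) + exp (- max_size))"
        using t' by (intro out_fails[OF rounds_done(1) _ K rounds_done(2)]) auto
      also have "\<dots> \<le> ennreal (3 / real n ^ (c + 3))" by (intro ennreal_leI out_failure_le[OF kap])
      finally show "fails prog_out t' good_out \<le> ennreal (3 / real n ^ (c + 3))" .
    qed (use t out in auto)
    then have "fails (prog_coreset kap aa mc) s good_out \<le> ennreal (2 / real n ^ (c + 3)) + ennreal (3 / real n ^ (c + 3))"
      unfolding prog_coreset_def by (intro fails_seq_sure[OF start]) blast
    also have "\<dots> = ennreal (5 / real n ^ (c + 3))" by (simp add: ennreal_plus[symmetric] add_divide_distrib[symmetric] del: ennreal_plus)
    also have "\<dots> \<le> ennreal (1 / real n ^ c)"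
    proof (rule ennreal_leI)
      have "2 ^ 3 \<le> real n ^ 3" using n2 by (intro power_mono) auto
      then have "5 \<le> real n ^ 3" by simp
      then have "5 / (real n ^ c * real n ^ 3) \<le> real n ^ 3 / (real n ^ c * real n ^ 3)" using n2 by (intro divide_right_mono) auto
      also have "\<dots> = 1 / real n ^ c" using n2 by simp
      finally show "5 / real n ^ (c + 3) \<le> 1 / real n ^ c" by (simp only: power_add)
    qed
    finally show ?thesis .
  qed
qed

end

section \<open>Running time\<close>

context oracle_compiler
begin

text \<open>The part of the running time that is determined by the program text and the kind of
  strong query, separated from the loop bounds.\<close>

primrec tconst :: "com \<Rightarrow> nat" where
  "tconst Skip = 0"
| "tconst (WSet x i e) = clen kind (WSet x i e)"
| "tconst (RSet x i e) = clen kind (RSet x i e)"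
| "tconst (Draw x e) = clen kind (Draw x e)"
| "tconst (AskWeak x i a b) = clen kind (AskWeak x i a b)"
| "tconst (AskStrong x i a b) = clen kind (AskStrong x i a b)"
| "tconst (Output e r) = clen kind (Output e r)"
| "tconst (Seq a b) = tconst a + tconst b"
| "tconst (Cond g a b) = glen g + tconst a + tconst b + 3"
| "tconst (For x y c) = length (set_code x (Const 0) (Const 0)) + glen (WLess (Var x) (Var y)) + tconst c + length (incr_code x) + 3"

text \<open>The largest product of loop bounds along a path of nested loops. Adding one to each
  bound keeps the product positive and absorbs the cost of initialization and of the final
  test.\<close>

primrec nest :: "com \<Rightarrow> nat" where
  "nest Skip = 1"
| "nest (WSet x i e) = 1"
| "nest (RSet x i e) = 1"
| "nest (Draw x e) = 1"
| "nest (AskWeak x i a b) = 1"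
| "nest (AskStrong x i a b) = 1"
| "nest (Output e r) = 1"
| "nest (Seq a b) = max (nest a) (nest b)"
| "nest (Cond g a b) = max (nest a) (nest b)"
| "nest (For x y c) = Suc (env y) * nest c"

lemma nest_pos: "1 \<le> nest c"
  by (induction c) (auto simp: max_def)

lemma time_le: "time c \<le> tconst c * nest c"
proof (induction c)
  case (Seq a b)
  have "time a \<le> tconst a * nest (Seq a b)" "time b \<le> tconst b * nest (Seq a b)"
    using Seq by (auto intro: order_trans mult_le_mono2)
  then show ?case by (simp add: distrib_right)
next
  case (Cond g a b)
  have "time a \<le> tconst a * nest (Cond g a b)" "time b \<le> tconst b * nest (Cond g a b)"
    using Cond by (auto intro: order_trans mult_le_mono2)
  moreover have "(glen g + 3) * 1 \<le> (glen g + 3) * nest (Cond g a b)" by (intro mult_le_mono2 nest_pos)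
  ultimately show ?case by (simp add: distrib_right)
next
  case (For x y c)
  let ?l = "length (set_code x (Const 0) (Const 0))" and ?g = "glen (WLess (Var x) (Var y))" and ?i = "length (incr_code x) + 3"
  have N: "1 \<le> nest c" by (rule nest_pos)
  then have i: "3 \<le> ?i * nest c" using mult_le_mono[of 3 ?i 1 "nest c"] by simp
  have "time (For x y c) \<le> ?l + (env y * (?g + (tconst c * nest c + ?i)) + (?g + 3))"
    using For by (simp add: mult_le_mono2)
  also have "\<dots> \<le> ?l * nest c + (env y * (?g * nest c + (tconst c * nest c + ?i * nest c)) + (?g * nest c + ?i * nest c))"
    using N i by (intro add_mono mult_le_mono2) auto
  also have "\<dots> \<le> (?l + ?g + tconst c + ?i) * (Suc (env y) * nest c)" by (simp add: algebra_simps)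
  finally show ?case by (simp add: ac_simps)
qed auto

lemma wfc_prog_coreset:
  assumes "kap \<le> B" "mc \<le> B" "a + 2 \<le> B"
  shows "wfc (prog_coreset kap a mc)"
  using assms B_ge by (simp add: prog_defs)

text \<open>Carries the product of enclosing loop bounds down to the leaves, so that a bound on a
  maximum splits into inequalities that can be discharged one path at a time.\<close>

primrec nested :: "nat \<Rightarrow> nat \<Rightarrow> com \<Rightarrow> bool" where
  "nested X m Skip \<longleftrightarrow> m \<le> X"
| "nested X m (WSet x i e) \<longleftrightarrow> m \<le> X"
| "nested X m (RSet x i e) \<longleftrightarrow> m \<le> X"
| "nested X m (Draw x e) \<longleftrightarrow> m \<le> X"
| "nested X m (AskWeak x i a b) \<longleftrightarrow> m \<le> X"
| "nested X m (AskStrong x i a b) \<longleftrightarrow> m \<le> X"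
| "nested X m (Output e r) \<longleftrightarrow> m \<le> X"
| "nested X m (Seq a b) \<longleftrightarrow> nested X m a \<and> nested X m b"
| "nested X m (Cond g a b) \<longleftrightarrow> nested X m a \<and> nested X m b"
| "nested X m (For x y c) \<longleftrightarrow> nested X (m * Suc (env y)) c"

lemma nested_le: "nested X m c \<Longrightarrow> m * nest c \<le> X"
proof (induction c arbitrary: m)
  case (For x y c)
  then show ?case by (simp only: nested.simps nest.simps mult.assoc[symmetric])
qed (auto simp: max_def)

text \<open>The five products belong to the deepest loop nests: picking nearest sample points,
  ranking answers, halving the radius, asking weak queries, and the single loops over all points.
  Every other nest is obtained from these by dropping factors.\<close>

lemma time_prog_coreset:
  assumes X: "Suc (env vL) * Suc (env vS) * Suc (env vEll) * Suc (env vS) \<le> X"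
    "Suc (env vL) * Suc (env vCnt) * Suc (env vTot) * Suc (env vEll) \<le> X"
    "Suc (env vL) * Suc (env vJ) * Suc (env vCnt) \<le> X"
    "Suc (env vL) * Suc (env vCnt) * Suc (env vS) \<le> X" "Suc (env vN) \<le> X"
  shows "time (prog_coreset kap a mc) \<le> tconst (prog_coreset kap a mc) * X"
proof -
  have drop: "x \<le> X" if "x * Suc y \<le> X" for x y using that by simp
  have "Suc (env vL) * Suc (env vS) * 1 * Suc (env vS) \<le> Suc (env vL) * Suc (env vS) * Suc (env vEll) * Suc (env vS)"
    by (intro mult_le_mono) auto
  then have ss: "Suc (env vL) * Suc (env vS) * Suc (env vS) \<le> X" using X(1) by (simp only: mult_1_right)
  note facts = X ss drop[OF X(1)] drop[OF ss] drop[OF drop[OF ss]] drop[OF X(2)] drop[OF X(4)] drop[OF X(3)]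
  have one: "1 \<le> X" using X(5) by simp
  have "nested X 1 (prog_coreset kap a mc)"
    unfolding prog_defs nested.simps mult_1 by (intro conjI facts one)
  from nested_le[OF this] have "nest (prog_coreset kap a mc) \<le> X" by simp
  then have "tconst (prog_coreset kap a mc) * nest (prog_coreset kap a mc) \<le> tconst (prog_coreset kap a mc) * X"
    by (rule mult_le_mono2)
  then show ?thesis using time_le order_trans by blast
qed

lemma cost_prog_coreset:
  "strong_cost (prog_coreset kap a mc) = env vL * (env vS * (env vS * 2))"
  "weak_cost (prog_coreset kap a mc) = env vL * (env vCnt * env vS)"
  by (simp_all add: prog_defs)

end

section \<open>The theorem\<close>

text \<open>Applied to a function with values 0 and infinity, this turns an expectation bound into a
  statement about every outcome. In this way the sure query counts reach the machine.\<close>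

lemma oexp_zeroD: "oexp p Q = 0 \<Longrightarrow> \<forall>r\<in>set_pmf p. \<exists>s. r = Some s \<and> Q s = 0"
proof
  fix r assume "oexp p Q = 0" and r: "r \<in> set_pmf p"
  then have "(case r of None \<Rightarrow> \<infinity> | Some s \<Rightarrow> Q s) = 0"
    unfolding oexp_def by (subst (asm) nn_integral_0_iff_AE) (auto simp: AE_measure_pmf_iff)
  then show "\<exists>s. r = Some s \<and> Q s = 0" by (cases r) auto
qed

lemma prob_ge_of_oexp:
  assumes "oexp p Q \<le> ennreal \<delta>" "0 \<le> \<delta>" "\<And>s. Some s \<notin> S \<Longrightarrow> 1 \<le> Q s"
  shows "1 - \<delta> \<le> measure_pmf.prob p S"
proof -
  have "emeasure (measure_pmf p) (- S) = (\<integral>\<^sup>+r. indicator (- S) r \<partial>measure_pmf p)" by simp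
  also have "\<dots> \<le> oexp p Q"
    unfolding oexp_def
  proof (rule nn_integral_mono)
    fix r show "indicator (- S) r \<le> (case r of None \<Rightarrow> \<infinity> | Some s \<Rightarrow> Q s)"
      using assms(3) by (cases r) (auto simp: indicator_def)
  qed
  finally have "measure_pmf.prob p (- S) \<le> \<delta>"
    using assms(1,2) by (simp add: measure_pmf.emeasure_eq_measure) (metis ennreal_le_iff order_trans)
  then show ?thesis using measure_pmf.prob_compl[of S p] by (simp add: Compl_eq_Diff_UNIV)
qed

text \<open>\<open>lg n\<close> exceeds the logarithm by at most one, and the factor 2 absorbs this
  because the shifted logarithm is at least 1.\<close>

lemma lg_le_log:
  assumes "1 \<le> n" shows "real (lg n) \<le> 2 * log 2 (real n + 1)" "1 \<le> log 2 (real n + 1)"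
proof -
  show one: "1 \<le> log 2 (real n + 1)" using assms by (simp add: le_log_iff)
  show "real (lg n) \<le> 2 * log 2 (real n + 1)"
  proof (cases "lg n")
    case (Suc l)
    then have "2 ^ l \<le> n" using two_power_le[of l n] by simp
    then have "(2::real) ^ l \<le> real n + 1" by (metis add_increasing2 of_nat_le_iff of_nat_numeral of_nat_power zero_le_one)
    then have "real l \<le> log 2 (real n + 1)" using assms by (simp add: le_log_iff powr_realpow)
    moreover have "real (lg n) = real l + 1" using Suc by simp
    ultimately show ?thesis using one by linarith
  qed (use one in simp)
qed

text \<open>No estimate uses more than the fifth power, so a single exponent serves all of them; 32
  is 2^5.\<close>

lemma powers_le:
  fixes l :: real assumes "1 \<le> real L" "real L \<le> 2 * l" "i \<le> 5" shows "real L ^ i \<le> 32 * l ^ 5"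
proof -
  have "real L ^ i \<le> real L ^ 5" using assms by (intro power_increasing) auto
  also have "\<dots> \<le> (2 * l) ^ 5" using assms by (intro power_mono) auto
  also have "\<dots> = 32 * l ^ 5" by (simp add: power_mult_distrib)
  finally show ?thesis .
qed

definition coreset_env :: "nat \<Rightarrow> nat \<Rightarrow> nat \<Rightarrow> nat \<Rightarrow> nat \<Rightarrow> nat" where
  "coreset_env n k kap a y = (if y = vN \<or> y = vCnt then n else if y = vL then lg n
     else if y = vEll then kap * lg n else if y = vS then 64 * (k * (kap * lg n))
     else if y = vTot then 64 * (k * (kap * lg n)) * (kap * lg n)
     else if y = vJ then (a + 2) * lg n else 0)"

text \<open>With N = n + k + 1, the cube N^3 dominates k lg n lg n and the linear terms, while the
  constants collected in \<open>Q\<close> are absorbed by Q \<le> 2^Q \<le> N^Q. The resulting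
  exponent depends only on the program.\<close>

lemma word_bound:
  assumes "1 \<le> n" "1 \<le> k" "Q = 64 * kap * kap + a + mc + 70"
  shows "2 * n + 64 + 64 * (k * (kap * lg n)) * (kap * lg n) + (a + 2) * lg n \<le> (n + k + 1) ^ (Q + 3)"
    "Q \<le> (n + k + 1) ^ (Q + 3)" "k \<le> (n + k + 1) ^ (Q + 3)"
proof -
  let ?N = "n + k + 1"
  have lN: "lg n \<le> ?N" "n \<le> ?N" "k \<le> ?N" "1 \<le> ?N" using lg_le[of n] by auto
  have N3: "x \<le> ?N ^ 3" if "x \<le> ?N" for x
    using that self_le_power[of ?N 3] lN(4) by linarith
  have "k * lg n * lg n \<le> ?N * ?N * ?N" using lN by (intro mult_le_mono)
  also have "\<dots> = ?N ^ 3" by (simp add: power3_eq_cube)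
  finally have "64 * kap * kap * (k * lg n * lg n) \<le> 64 * kap * kap * ?N ^ 3" by (rule mult_le_mono2)
  moreover have "64 * (k * (kap * lg n)) * (kap * lg n) = 64 * kap * kap * (k * lg n * lg n)" by (simp add: algebra_simps)
  moreover have "(a + 2) * lg n \<le> (a + 2) * ?N ^ 3" using N3[OF lN(1)] by (rule mult_le_mono2)
  moreover have "2 * n \<le> 2 * ?N ^ 3" using N3[OF lN(2)] by simp
  moreover have "64 * 1 \<le> 64 * ?N ^ 3" by (intro mult_le_mono2) simp
  ultimately have "2 * n + 64 + 64 * (k * (kap * lg n)) * (kap * lg n) + (a + 2) * lg n \<le>
      2 * ?N ^ 3 + 64 * ?N ^ 3 + 64 * kap * kap * ?N ^ 3 + (a + 2) * ?N ^ 3" by linarith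
  also have "\<dots> = (68 + a + 64 * kap * kap) * ?N ^ 3" by (simp add: algebra_simps)
  also have "\<dots> \<le> Q * ?N ^ 3" using assms(3) by (intro mult_le_mono1) simp
  also have Q: "Q \<le> ?N ^ Q"
  proof -
    have "Q \<le> 2 ^ Q" by (rule less_imp_le[OF less_exp])
    also have "\<dots> \<le> ?N ^ Q" using assms by (intro power_mono) auto
    finally show ?thesis .
  qed
  then have "Q * ?N ^ 3 \<le> ?N ^ Q * ?N ^ 3" by (rule mult_le_mono1)
  also have "\<dots> = ?N ^ (Q + 3)" by (simp only: power_add)
  finally show "2 * n + 64 + 64 * (k * (kap * lg n)) * (kap * lg n) + (a + 2) * lg n \<le> ?N ^ (Q + 3)" .
  have "?N ^ Q \<le> ?N ^ (Q + 3)" by (intro power_increasing) auto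
  then show "Q \<le> ?N ^ (Q + 3)" using Q by linarith
  have "?N \<le> ?N ^ (Q + 3)" using self_le_power[of ?N "Q + 3"] by simp
  then show "k \<le> ?N ^ (Q + 3)" by simp
qed

text \<open>A single point has no distances and any positive \<open>D\<close> works; otherwise
  \<open>D\<close> is the smallest distance.\<close>

lemma aspect_bound:
  fixes d :: "nat \<Rightarrow> nat \<Rightarrow> real"
  assumes "Metric_space {..<n} d" "2 \<le> n \<longrightarrow> aspect_ratio d {..<n} \<le> real n ^ a"
  shows "\<exists>D>0. \<forall>x<n. \<forall>y<n. x \<noteq> y \<longrightarrow> D \<le> d x y \<and> d x y \<le> real n ^ a * D"
proof (cases "2 \<le> n")
  case False
  then have "x = y" if "x < n" "y < n" for x y using that by simp
  then show ?thesis by (intro exI[of _ 1]) auto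
next
  case True
  let ?S = "distances d {..<n}"
  have "?S \<subseteq> (\<lambda>(x, y). d x y) ` ({..<n} \<times> {..<n})" by (auto simp: distances_def)
  then have fin: "finite ?S" by (rule finite_subset) auto
  have "d 0 1 \<in> ?S" unfolding distances_def using True by (intro CollectI exI[of _ 0] exI[of _ 1]) auto
  then have ne: "?S \<noteq> {}" by blast
  have "0 < r" if r: "r \<in> ?S" for r
  proof -
    obtain x y where "r = d x y" "x < n" "y < n" "x \<noteq> y" using r unfolding distances_def by blast
    then show ?thesis using Metric_space.zero[OF assms(1), of x y] Metric_space.nonneg[OF assms(1), of x y] by fastforce
  qed
  then have pos: "0 < Min ?S" using Min_in[OF fin ne] by blast
  have "Max ?S \<le> real n ^ a * Min ?S" using assms(2) True pos by (simp add: aspect_ratio_def divide_le_eq)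
  moreover have "Min ?S \<le> d x y \<and> d x y \<le> Max ?S" if "x < n" "y < n" "x \<noteq> y" for x y
  proof -
    have "d x y \<in> ?S" using that by (auto simp: distances_def)
    then show ?thesis using fin by simp
  qed
  ultimately show ?thesis using pos by (intro exI[of _ "Min ?S"]) force
qed

context coreset_analysis
begin

text \<open>By minimality, \<open>rate - 1\<close> is below the real threshold \<open>v\<close>.
  Rounding up costs at most a factor 2, because \<open>v\<close> is at least 1.\<close>

lemma rate_upper: "real rate \<le> 2 * (real mc * (real k * real L)) / \<epsilon>\<^sup>2"
proof -
  define v where "v = real (mc * (k * L)) / \<epsilon>\<^sup>2"
  have e2: "0 < \<epsilon>\<^sup>2" "\<epsilon>\<^sup>2 \<le> 1" using eps by (auto simp: power_le_one)
  have "rate - 1 < rate" using rate_pos by simp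
  from rate_less[OF this] have "real (rate - 1) * \<epsilon>\<^sup>2 < real (mc * (k * L))" by (simp add: power2_eq_square)
  then have "real rate - 1 < v" using e2 rate_pos by (simp add: v_def less_divide_eq of_nat_diff)
  moreover have "1 \<le> v"
  proof -
    have "1 \<le> mc * (k * L)" using mc_pos k_pos L_pos by (simp add: Suc_le_eq)
    then have "1 \<le> real (mc * (k * L))" by (metis of_nat_1 of_nat_le_iff)
    then show ?thesis using e2 by (simp add: v_def le_divide_eq)
  qed
  ultimately have "real rate \<le> 2 * v" by linarith
  then show ?thesis by (simp add: v_def)
qed

lemma sz_real: "real sz = 64 * real kap * (real k * real L)"
  by (simp add: sz_def ell_def)

lemma max_size_le: "3 * max_size \<le> (1536 * real kap * real mc) * (real k ^ 2 / \<epsilon> ^ 3) * real L ^ 3"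
proof -
  have L1: "1 \<le> real L" and r1: "1 \<le> real rate" using L_pos rate_pos by simp_all
  have Lr: "1 * 1 \<le> real L * real rate" using L1 r1 by (intro mult_mono) auto
  have "real L * real sz * 1 \<le> real L * real sz * real rate" using r1 by (intro mult_left_mono) auto
  moreover have "real sz * 1 \<le> real sz * (real L * real rate)" using Lr by (intro mult_left_mono) auto
  ultimately have "max_size \<le> 4 * (real L * real sz * real rate)" by (simp add: max_size_def algebra_simps)
  also have "\<dots> \<le> 4 * (real L * real sz * (2 * (real mc * (real k * real L)) / \<epsilon>\<^sup>2))"
    by (intro mult_left_mono rate_upper) auto
  also have "\<dots> = (512 * real kap * real mc) * (real k ^ 2 / \<epsilon>\<^sup>2) * real L ^ 3"
    by (simp add: sz_real power2_eq_square power3_eq_cube)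
  \<comment> \<open>Up to here the estimate has the square of \<epsilon> in the denominator; as
    \<epsilon> < 1, it may be relaxed to the cube.\<close>
  also have "\<dots> \<le> (512 * real kap * real mc) * (real k ^ 2 / \<epsilon> ^ 3) * real L ^ 3"
  proof (intro mult_right_mono mult_left_mono divide_left_mono)
    show "\<epsilon> ^ 3 \<le> \<epsilon>\<^sup>2" using eps by (intro power_decreasing) auto
  qed (use eps in auto)
  finally show ?thesis by simp
qed

end

theorem theorem1p4:
  shows "\<exists>e::nat. \<forall>(z::real)>0. \<forall>(a::nat) (c::nat) (kind::strong_kind).
    \<exists>(P::instr list) (b::nat) (C::real).
      \<forall>(n::nat) (k::nat) (\<epsilon>::real) (d::nat \<Rightarrow> nat \<Rightarrow> real) (adv::adversary).
        1 \<le> n \<and> 1 \<le> k \<and> 0 < \<epsilon> \<and> \<epsilon> < 1 \<and>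
        Metric_space {..<n} d \<and> (\<forall>x<n. \<forall>y<n. d x y \<in> \<int>) \<and>
        (2 \<le> n \<longrightarrow> aspect_ratio d {..<n} \<le> real n ^ a) \<longrightarrow>
        (\<exists>T::nat.
           real T \<le> soft_bound C e n (real n * real k + real k ^ 2 / \<epsilon> ^ 3) \<and>
           (\<forall>r \<in> set_pmf (run P b z n k \<epsilon> d adv T). \<exists>s. r = Some s \<and> halted P s \<and>
              strong_queries_within kind (soft_bound C e n (real k ^ 2 / \<epsilon> ^ 3)) s \<and>
              real (weak_queries s) \<le> soft_bound C e n (real n * real k)) \<and>
           measure_pmf.prob (run P b z n k \<epsilon> d adv T)
             {r. \<exists>s. r = Some s \<and> outputs_coreset d z n k \<epsilon> s \<and>
                   real (length (emitted s)) \<le> soft_bound C e n (real k ^ 2 / \<epsilon> ^ 3)}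
             \<ge> 1 - 1 / real n ^ c)"
proof (intro exI[of _ 5] allI impI)
  fix z :: real and a c :: nat and kind :: strong_kind
  assume z: "0 < z"
  define kap where "kap = 13 * (c + 6)"
  \<comment> \<open>Chosen above \<open>4 * Kz * (c + 4)\<close>, as the tail bound demands. The
    constant \<open>Kz\<close> is written out because the locale that defines it depends on data not
    yet fixed.\<close>
  define mc where "mc = Suc (nat \<lceil>4 * (2 powr z * (1 + 8 * 24 powr z)) * real (c + 4)\<rceil>)"
  define prog where "prog = prog_coreset kap a mc"
  define P where "P = compile kind 0 prog @ [Halt]"
  define Q where "Q = 64 * kap * kap + a + mc + 70"
  \<comment> \<open>Stored words are bounded by \<open>(n + k + 1) ^ (Q + 3)\<close> and
    intermediate ones by the tenth power of that; the additional 1 makes the word bound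
    strict.\<close>
  define b where "b = (Q + 3) * 10 + 1"
  \<comment> \<open>Taken from outside any interpretation, so that \<open>C\<close> can be chosen
    before \<open>n\<close>, \<open>k\<close>, \<open>\<epsilon>\<close> and the metric are
    given.\<close>
  define K0 where "K0 = oracle_compiler.tconst kind prog"
  define A where "A = real kap ^ 3 * real (a + 2) * real mc"
  \<comment> \<open>The factor \<open>2 ^ 22\<close> exceeds 32 * 67584, where 67584 is the largest
    numerical coefficient below and 32 comes from \<open>powers_le\<close>.\<close>
  define C where "C = 2 ^ 22 * (real K0 + 1) * A"
  have kap1: "1 \<le> kap" "1 \<le> mc" by (simp_all add: kap_def mc_def)
  have A: "real kap ^ 3 * real (a + 2) \<le> A" "real kap ^ 3 \<le> A" "real kap ^ 2 \<le> A" "real kap \<le> A" "real kap * real mc \<le> A" "1 \<le> A"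
  proof -
    have k1: "1 \<le> real kap" "1 \<le> real mc" "1 \<le> real (a + 2)" using kap1 by auto
    have k3: "real kap \<le> real kap ^ 3" "real kap ^ 2 \<le> real kap ^ 3" using k1(1) power_increasing[of 1 3 "real kap"] power_increasing[of 2 3 "real kap"] by auto
    have "real kap ^ 3 * real (a + 2) * 1 \<le> A" unfolding A_def using k1 by (intro mult_left_mono) auto
    then show a1: "real kap ^ 3 * real (a + 2) \<le> A" by simp
    have "real kap ^ 3 * 1 \<le> real kap ^ 3 * real (a + 2)" using k1 by (intro mult_left_mono) auto
    then show a2: "real kap ^ 3 \<le> A" using a1 by linarith
    show "real kap ^ 2 \<le> A" "real kap \<le> A" "1 \<le> A" using a2 k3 k1 by linarith+
    have "real kap * 1 * real mc \<le> real kap ^ 3 * real (a + 2) * real mc" using k3 k1 by (intro mult_mono) auto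
    then show "real kap * real mc \<le> A" by (simp add: A_def)
  qed
  show "\<exists>(P::instr list) (b::nat) (C::real).
      \<forall>(n::nat) (k::nat) (\<epsilon>::real) (d::nat \<Rightarrow> nat \<Rightarrow> real) (adv::adversary).
        1 \<le> n \<and> 1 \<le> k \<and> 0 < \<epsilon> \<and> \<epsilon> < 1 \<and>
        Metric_space {..<n} d \<and> (\<forall>x<n. \<forall>y<n. d x y \<in> \<int>) \<and>
        (2 \<le> n \<longrightarrow> aspect_ratio d {..<n} \<le> real n ^ a) \<longrightarrow>
        (\<exists>T::nat.
           real T \<le> soft_bound C 5 n (real n * real k + real k ^ 2 / \<epsilon> ^ 3) \<and>
           (\<forall>r \<in> set_pmf (run P b z n k \<epsilon> d adv T). \<exists>s. r = Some s \<and> halted P s \<and>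
              strong_queries_within kind (soft_bound C 5 n (real k ^ 2 / \<epsilon> ^ 3)) s \<and>
              real (weak_queries s) \<le> soft_bound C 5 n (real n * real k)) \<and>
           measure_pmf.prob (run P b z n k \<epsilon> d adv T)
             {r. \<exists>s. r = Some s \<and> outputs_coreset d z n k \<epsilon> s \<and>
                   real (length (emitted s)) \<le> soft_bound C 5 n (real k ^ 2 / \<epsilon> ^ 3)}
             \<ge> 1 - 1 / real n ^ c)"
  proof (rule exI[of _ P], rule exI[of _ b], rule exI[of _ C], intro allI impI)
    fix n k :: nat and \<epsilon> :: real and d :: "nat \<Rightarrow> nat \<Rightarrow> real" and adv :: adversary
    assume H: "1 \<le> n \<and> 1 \<le> k \<and> 0 < \<epsilon> \<and> \<epsilon> < 1 \<and> Metric_space {..<n} d \<and> (\<forall>x<n. \<forall>y<n. d x y \<in> \<int>) \<and>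
        (2 \<le> n \<longrightarrow> aspect_ratio d {..<n} \<le> real n ^ a)"
    define B where "B = (n + k + 1) ^ (Q + 3)"
    define W where "W = (n + k + 1) ^ b"
    define env where "env = coreset_env n k kap a"
    note wb = word_bound[of n k Q kap a mc, OF _ _ Q_def, folded B_def]
    have QB: "Q \<le> B" "k \<le> B" "2 * n + 64 + 64 * (k * (kap * lg n)) * (kap * lg n) + (a + 2) * lg n \<le> B" using wb H by auto
    have kapQ: "kap \<le> Q"
    proof -
      have "kap * 1 \<le> kap * (64 * kap)" using kap1 by (intro mult_le_mono2) simp
      moreover have "64 * kap * kap = kap * (64 * kap)" by simp
      ultimately show ?thesis unfolding Q_def by linarith
    qed
    have cB: "64 \<le> B" "kap \<le> B" "mc \<le> B" "a + 2 \<le> B" using QB(1) kapQ by (auto simp: Q_def)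
    interpret an: coreset_analysis kind B env n d adv k kap mc a \<epsilon> z
    proof (intro coreset_analysis.intro coreset_alg.intro coreset_analysis_axioms.intro)
      show "2 * n + 64 + 64 * (k * (kap * lg n)) * (kap * lg n) + (a + 2) * lg n \<le> B" by (rule QB(3))
      show "\<exists>D>0. \<forall>x<n. \<forall>y<n. x \<noteq> y \<longrightarrow> D \<le> d x y \<and> d x y \<le> real n ^ a * D" using H by (intro aspect_bound) auto
    qed (use H kap1 z in \<open>auto simp: env_def coreset_env_def\<close>)
    interpret m: oracle_compiler kind B env n d adv P W z
    proof
      show "64 \<le> B" by (rule cB)
      have "B ^ 10 * 1 < B ^ 10 * (n + k + 1)" using cB H by (intro mult_strict_left_mono) auto
      also have "\<dots> = W" by (simp only: W_def b_def B_def power_add[of _ "(Q + 3) * 10" 1] power_mult power_one_right)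
      finally show "B ^ 10 < W" by simp
      have "an.ell \<le> B" "an.sz \<le> B" "an.sz * an.ell \<le> B" "an.halvings \<le> B" by (auto intro: an.le_B)
      moreover have "n \<le> B" "lg n \<le> B" using lg_le[of n] by (auto intro!: an.le_B(1))
      ultimately show "env y \<le> B" for y
        unfolding env_def coreset_env_def an.sz_def an.ell_def an.L_def an.halvings_def by simp
    qed
    define T where "T = m.time prog"
    let ?s0 = "init_config n k \<epsilon>"
    let ?run = "run P b z n k \<epsilon> d adv T"
    let ?l = "log 2 (real n + 1)"
    have L1: "1 \<le> real an.L" using an.L_pos by simp
    have Ll: "real an.L \<le> 2 * ?l" "1 \<le> ?l" using lg_le_log[of n] H by (auto simp: an.L_def)
    have pow: "real an.L ^ i \<le> 32 * ?l ^ 5" if "i \<le> 5" for i using powers_le[OF L1 Ll(1) that] .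
    have e3: "0 < \<epsilon> ^ 3" "\<epsilon> ^ 3 \<le> 1" using H by (auto simp: power_le_one)
    have k2: "real k ^ 2 \<le> real k ^ 2 / \<epsilon> ^ 3" using e3 by (simp add: le_divide_eq mult_left_le)
    have soft: "x \<le> soft_bound C 5 n f" if "x \<le> (cc * A) * f * real an.L ^ i" "i \<le> 5" "0 \<le> f" "0 \<le> cc" "32 * cc \<le> 2 ^ 22 * (real K0 + 1)" for x cc f i
    proof -
      have "x \<le> (cc * A) * f * (32 * ?l ^ 5)"
        using that(1) mult_left_mono[OF pow[OF that(2)], of "(cc * A) * f"] that(3,4) A(6) by auto
      also have "\<dots> = (32 * cc) * (A * f * ?l ^ 5)" by simp
      also have "\<dots> \<le> (2 ^ 22 * (real K0 + 1)) * (A * f * ?l ^ 5)" using that A(6) Ll(2) by (intro mult_right_mono) auto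
      also have "\<dots> = soft_bound C 5 n f" by (simp add: soft_bound_def C_def)
      finally show ?thesis .
    qed
    have wf: "m.wfc prog" unfolding prog_def using cB by (intro m.wfc_prog_coreset)
    have abs0: "abs_store ?s0 = \<lparr>words = (\<lambda>x i. if x = 0 \<and> i = 0 then n else if x = 1 \<and> i = 0 then k else 0),
       reals = (\<lambda>x i. if x = 0 \<and> i = 0 then \<epsilon> else 0), events = [], outs = []\<rparr>"
      by (auto simp: abs_store_def init_config_def fun_eq_iff)
    have small: "m.small (abs_store ?s0)" using QB by (auto simp: m.small_def abs0)
    have init: "an.init_store (abs_store ?s0)" by (simp add: an.init_store_def abs0)
    have K: "4 * an.Kz * real (c + 4) \<le> real mc"
      unfolding an.Kz_def mc_def by linarith
    note pc = an.program_correct[OF init kap_def K, folded prog_def]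
    have mb: "oexp ?run (\<lambda>s. if halted P s then R (abs_store s) else \<infinity>) \<le> an.expect prog (abs_store ?s0) R" for R
      using m.machine_bound[OF P_def wf _ small, of R] by (simp add: run_nsteps W_def T_def init_config_def)
    have qs: "an.sure prog (abs_store ?s0) (an.queries_within (an.weak_cost prog) (an.strong_cost prog) (abs_store ?s0))"
      using pc(1) unfolding an.sure_def osure_def by (auto dest!: an.sem_queries bspec)
    let ?R = "\<lambda>s. if an.queries_within (an.weak_cost prog) (an.strong_cost prog) (abs_store ?s0) s then 0 else (\<infinity>::ennreal)"
    have "an.expect prog (abs_store ?s0) ?R \<le> an.expect prog (abs_store ?s0) (\<lambda>_. 0)"
      by (rule an.expect_mono_on[OF qs]) simp
    also have "\<dots> = 0" by (rule an.expect_const[OF pc(1)])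
    finally have "oexp ?run (\<lambda>s. if halted P s then ?R (abs_store s) else \<infinity>) = 0" using mb[of ?R] by simp
    note all = oexp_zeroD[OF this]
    have szr: "real an.sz ^ 2 = 4096 * real kap ^ 2 * real k ^ 2 * real an.L ^ 2"
      by (simp add: an.sz_real power2_eq_square)
    have strong: "real (an.strong_cost prog) \<le> soft_bound C 5 n (real k ^ 2 / \<epsilon> ^ 3)"
    proof (rule soft[where cc = 8192 and i = 3])
      have "real (an.strong_cost prog) = 2 * (real an.L * real an.sz ^ 2)"
        by (simp add: prog_def m.cost_prog_coreset an.env_simps power2_eq_square)
      also have "\<dots> = 8192 * real kap ^ 2 * real k ^ 2 * real an.L ^ 3" unfolding szr by (simp add: power3_eq_cube power2_eq_square)
      also have "\<dots> \<le> 8192 * A * (real k ^ 2 / \<epsilon> ^ 3) * real an.L ^ 3"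
        using A k2 e3 by (intro mult_mono) auto
      finally show "real (an.strong_cost prog) \<le> 8192 * A * (real k ^ 2 / \<epsilon> ^ 3) * real an.L ^ 3" .
    qed (use e3 in auto)
    have weak: "real (an.weak_cost prog) \<le> soft_bound C 5 n (real n * real k)"
    proof (rule soft[where cc = 64 and i = 2])
      have "real (an.weak_cost prog) = 64 * real kap * (real n * real k) * real an.L ^ 2"
        by (simp add: prog_def m.cost_prog_coreset an.env_simps an.sz_real power2_eq_square)
      also have "\<dots> \<le> 64 * A * (real n * real k) * real an.L ^ 2" using A by (intro mult_mono) auto
      finally show "real (an.weak_cost prog) \<le> 64 * A * (real n * real k) * real an.L ^ 2" .
    qed auto
    have size: "3 * an.max_size \<le> soft_bound C 5 n (real k ^ 2 / \<epsilon> ^ 3)"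
    proof (rule soft[where cc = 1536 and i = 3])
      have "3 * an.max_size \<le> (1536 * (real kap * real mc)) * (real k ^ 2 / \<epsilon> ^ 3) * real an.L ^ 3"
        using an.max_size_le by (simp only: mult.assoc)
      also have "\<dots> \<le> 1536 * A * (real k ^ 2 / \<epsilon> ^ 3) * real an.L ^ 3" using A e3 by (intro mult_mono) auto
      finally show "3 * an.max_size \<le> 1536 * A * (real k ^ 2 / \<epsilon> ^ 3) * real an.L ^ 3" .
    qed (use e3 in auto)
    have time: "real T \<le> soft_bound C 5 n (real n * real k + real k ^ 2 / \<epsilon> ^ 3)"
    proof (rule soft[where cc = "67584 * (real K0 + 1)" and i = 5])
      let ?a = "Suc (env vL)" and ?s = "Suc (env vS)" and ?e = "Suc (env vEll)" and ?t = "Suc (env vTot)" and ?b = "Suc (env vCnt)" and ?h = "Suc (env vJ)"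
      \<comment> \<open>Two products majorize all five loop nests: the first is of order k^2, the
        second of order n k up to logarithms. The factor for the halvings joins the second so that
        it also covers the radius loop.\<close>
      define X where "X = ?a * ?s * ?e * ?s + ?a * ?b * ?t * ?e * ?h"
      have N: "env vN = env vCnt" by (simp add: an.env_simps)
      have st: "env vS \<le> env vTot" using an.sz_le an.env_simps by simp
      have "T \<le> K0 * X" unfolding T_def prog_def K0_def
      proof (rule m.time_prog_coreset)
        have p: "?a * ?b * ?t * ?e \<le> ?a * ?b * ?t * ?e * ?h" by simp
        show "?a * ?s * ?e * ?s \<le> X" "?a * ?b * ?t * ?e \<le> X" using p by (auto simp: X_def)
        have "?a * ?b * 1 * 1 * ?h \<le> ?a * ?b * ?t * ?e * ?h" by (intro mult_le_mono) auto
        then have "?a * ?h * ?b \<le> ?a * ?b * ?t * ?e * ?h" by (simp only: mult_1_right ac_simps)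
        then show "?a * ?h * ?b \<le> X" unfolding X_def by (rule trans_le_add2)
        have "?a * ?b * ?s * 1 * 1 \<le> ?a * ?b * ?t * ?e * ?h" using st by (intro mult_le_mono) auto
        then show "?a * ?b * ?s \<le> X" unfolding X_def mult_1_right by (rule trans_le_add2)
        have "1 * ?b * 1 * 1 * 1 \<le> ?a * ?b * ?t * ?e * ?h" by (intro mult_le_mono) auto
        then show "Suc (env vN) \<le> X" unfolding X_def N mult_1_right mult_1 by (rule trans_le_add2)
      qed
      then have "real T \<le> real K0 * real X" by (metis of_nat_le_iff of_nat_mult)
      also have "\<dots> \<le> (real K0 + 1) * real X" by (intro mult_right_mono) auto
      finally have TX: "real T \<le> (real K0 + 1) * real X" .
      have "real X \<le> 67584 * A * (real n * real k + real k ^ 2 / \<epsilon> ^ 3) * real an.L ^ 5"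
      proof -
        have two: "real (Suc v) \<le> 2 * real v" if "1 \<le> v" for v using that by simp
        have "1 \<le> an.sz" using an.sz_ge by simp
        moreover from this have "1 \<le> an.sz * an.ell" using an.ell_pos by (simp add: Suc_le_eq)
        moreover have "1 \<le> an.halvings" using an.L_pos by (simp add: an.halvings_def)
        ultimately have v: "real ?a \<le> 2 * real an.L" "real ?s \<le> 2 * real an.sz" "real ?e \<le> 2 * real an.ell"
          "real ?t \<le> 2 * (real an.sz * real an.ell)" "real ?b \<le> 2 * real n" "real ?h \<le> 2 * real an.halvings"
          using two[of an.L] two[of an.sz] two[of an.ell] two[of "an.sz * an.ell"] two[of n] two[of an.halvings]
            an.L_pos an.ell_pos H unfolding an.env_simps of_nat_mult by blast+
        have ell: "real an.ell = real kap * real an.L" and halv: "real an.halvings = real (a + 2) * real an.L"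
          unfolding an.ell_def an.halvings_def by (simp_all only: of_nat_mult)
        have "real (?a * ?s * ?e * ?s) = real ?a * real ?s * real ?e * real ?s" by (simp only: of_nat_mult)
        also have "\<dots> \<le> (2 * real an.L) * (2 * real an.sz) * (2 * real an.ell) * (2 * real an.sz)"
          using v by (intro mult_mono) auto
        also have "\<dots> = 65536 * real kap ^ 3 * real k ^ 2 * real an.L ^ 4"
          by (simp add: an.sz_real ell power2_eq_square power3_eq_cube power4_eq_xxxx)
        also have "\<dots> \<le> 65536 * A * (real k ^ 2 / \<epsilon> ^ 3) * real an.L ^ 5"
          using A k2 e3 L1 by (intro mult_mono power_increasing) auto
        finally have x1: "real (?a * ?s * ?e * ?s) \<le> 65536 * A * (real k ^ 2 / \<epsilon> ^ 3) * real an.L ^ 5" .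
        have "real (?a * ?b * ?t * ?e * ?h) = real ?a * real ?b * real ?t * real ?e * real ?h" by (simp only: of_nat_mult)
        also have "\<dots> \<le> (2 * real an.L) * (2 * real n) * (2 * (real an.sz * real an.ell)) * (2 * real an.ell) * (2 * real an.halvings)"
          using v by (intro mult_mono) auto
        also have "\<dots> = 2048 * (real kap ^ 3 * real (a + 2)) * (real n * real k) * real an.L ^ 5"
          unfolding an.sz_real ell halv by (simp add: power3_eq_cube eval_nat_numeral)
        also have "\<dots> \<le> 2048 * A * (real n * real k) * real an.L ^ 5" using A by (intro mult_mono) auto
        finally have x2: "real (?a * ?b * ?t * ?e * ?h) \<le> 2048 * A * (real n * real k) * real an.L ^ 5" .
        have "65536 * A * (real k ^ 2 / \<epsilon> ^ 3) * real an.L ^ 5 \<le> 67584 * A * (real k ^ 2 / \<epsilon> ^ 3) * real an.L ^ 5"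
          "2048 * A * (real n * real k) * real an.L ^ 5 \<le> 67584 * A * (real n * real k) * real an.L ^ 5"
          using A e3 by (intro mult_right_mono; simp)+
        then have "real X \<le> 67584 * A * (real k ^ 2 / \<epsilon> ^ 3) * real an.L ^ 5 + 67584 * A * (real n * real k) * real an.L ^ 5"
          using x1 x2 unfolding X_def of_nat_add by linarith
        also have "\<dots> = 67584 * A * (real n * real k + real k ^ 2 / \<epsilon> ^ 3) * real an.L ^ 5"
          by (simp only: distrib_left distrib_right add.commute)
        finally show ?thesis .
      qed
      then have "(real K0 + 1) * real X \<le> (real K0 + 1) * (67584 * A * (real n * real k + real k ^ 2 / \<epsilon> ^ 3) * real an.L ^ 5)"
        by (rule mult_left_mono) simp
      also have "\<dots> = 67584 * (real K0 + 1) * A * (real n * real k + real k ^ 2 / \<epsilon> ^ 3) * real an.L ^ 5"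
        by (simp only: ac_simps)
      finally show "real T \<le> 67584 * (real K0 + 1) * A * (real n * real k + real k ^ 2 / \<epsilon> ^ 3) * real an.L ^ 5"
        using TX by linarith
    qed (use e3 in auto)
    have queries: "\<exists>s. r = Some s \<and> halted P s \<and> strong_queries_within kind (soft_bound C 5 n (real k ^ 2 / \<epsilon> ^ 3)) s \<and>
              real (weak_queries s) \<le> soft_bound C 5 n (real n * real k)" if rr: "r \<in> set_pmf ?run" for r
    proof -
      obtain s where s: "r = Some s" "(if halted P s then ?R (abs_store s) else \<infinity>) = 0" using bspec[OF all rr] by blast
      then have h: "halted P s" and q: "an.queries_within (an.weak_cost prog) (an.strong_cost prog) (abs_store ?s0) (abs_store s)"
        by (auto split: if_splits)
      have ev: "events (abs_store s) = transcript s" "events (abs_store ?s0) = []" by (simp_all add: abs_store_def abs0[unfolded abs_store_def])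
      have "weak_queries s \<le> an.weak_cost prog"
        using q by (simp add: an.queries_within_def ev an.weak_count_def weak_queries_def)
      then have "real (weak_queries s) \<le> soft_bound C 5 n (real n * real k)" using weak by linarith
      moreover have "an.strong_within kind (an.strong_cost prog) [] (transcript s)" using q by (simp add: an.queries_within_def ev)
      then have "strong_queries_within kind (soft_bound C 5 n (real k ^ 2 / \<epsilon> ^ 3)) s"
        using strong by (cases kind) (auto simp: an.point_count_def an.dist_count_def point_queries_def distance_queries_def)
      ultimately show ?thesis using s(1) h by blast
    qed
    have prob: "1 - 1 / real n ^ c \<le> measure_pmf.prob ?run
             {r. \<exists>s. r = Some s \<and> outputs_coreset d z n k \<epsilon> s \<and> real (length (emitted s)) \<le> soft_bound C 5 n (real k ^ 2 / \<epsilon> ^ 3)}"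
    proof (rule prob_ge_of_oexp)
      show "oexp ?run (\<lambda>s. if halted P s then (if an.good_out (abs_store s) then 0 else 1) else \<infinity>) \<le> ennreal (1 / real n ^ c)"
        using mb[of "\<lambda>s. if an.good_out s then 0 else 1"] pc(2) unfolding an.fails_def by (rule order_trans)
      fix s assume "Some s \<notin> {r. \<exists>s. r = Some s \<and> outputs_coreset d z n k \<epsilon> s \<and> real (length (emitted s)) \<le> soft_bound C 5 n (real k ^ 2 / \<epsilon> ^ 3)}"
      then have "\<not> an.good_out (abs_store s)"
        using size by (auto simp: an.good_out_def outputs_coreset_def abs_store_def)
      then show "1 \<le> (if halted P s then (if an.good_out (abs_store s) then 0 else 1) else (\<infinity>::ennreal))" by simp
    qed simp
    show "\<exists>T::nat.
           real T \<le> soft_bound C 5 n (real n * real k + real k ^ 2 / \<epsilon> ^ 3) \<and>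
           (\<forall>r \<in> set_pmf (run P b z n k \<epsilon> d adv T). \<exists>s. r = Some s \<and> halted P s \<and>
              strong_queries_within kind (soft_bound C 5 n (real k ^ 2 / \<epsilon> ^ 3)) s \<and>
              real (weak_queries s) \<le> soft_bound C 5 n (real n * real k)) \<and>
           measure_pmf.prob (run P b z n k \<epsilon> d adv T)
             {r. \<exists>s. r = Some s \<and> outputs_coreset d z n k \<epsilon> s \<and>
                   real (length (emitted s)) \<le> soft_bound C 5 n (real k ^ 2 / \<epsilon> ^ 3)}
             \<ge> 1 - 1 / real n ^ c"
      using time queries prob by (intro exI[of _ T]) blast
  qed
qed

end
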